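(* Let $A$ and $B$ be $C^*$-algebras, and suppose that the Banach $^*$-algebra $A\widehat{\otimes}B$ has spectral synthesis. Then $A\widehat{\otimes}B$ satisfies property $(F)$.
   Context: All $^*$-representations are by bounded operators on Hilbert spaces; "closed ideal" means closed two-sided ideal. Operator space projective tensor product: for $u$ in the algebraic tensor product $A\otimes B$, $\|u\|_\wedge=\inf\{\|\alpha\|\|x\|\|y\|\|\beta\|: u=\alpha(x\otimes y)\beta\}$, where $\alpha\in M_{1,pq}$, $\beta\in M_{pq,1}$, $x\in M_p(A)$, $y\in M_q(B)$, $p,q\in\mathbb{N}$, and $x\otimes y=(x_{ij}\otimes y_{kl})_{(i,k),(j,l)}\in M_{pq}(A\otimes B)$. $A\widehat{\otimes}B$ is the completion of $A\otimes B$ in this norm; it is a Banach $^*$-algebra with the natural involution $(a\otimes b)^*=a^*\otimes b^*$. For a Banach $^*$-algebra $D$, $Prim^*(D)$ is the set of kernels of (nonzero) topologically irreducible $^*$-representations of $D$. For $E\subseteq Prim^*(D)$ let $k(E)=\bigcap\{P:P\in E\}$ (with $k(\emptyset)=D$), and for $J\subseteq D$ let $h^*(J)=\{P\in Prim^*(D):P\supseteq J\}$ (the hull of $J$). $Prim^*(D)$ carries the hull-kernel topology, $\overline{E}=h^*(k(E))$. A closed set $E\subseteq Prim^*(D)$ is spectral if $k(E)$ is the only closed ideal of $D$ with hull equal to $E$; $D$ has spectral synthesis if every closed subset of $Prim^*(D)$ is spectral. $A\widehat{\otimes}B$ satisfies property $(F)$ if the set of all product states $\phi\widehat{\otimes}\psi$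 (the continuous functional on $A\widehat\otimes B$ with $a\otimes b\mapsto\phi(a)\psi(b)$), where $\phi$ and $\psi$ are pure states of $A$ and $B$ respectively, separates the closed ideals of $A\widehat{\otimes}B$, i.e. for any two distinct closed ideals some such product state vanishes on one of them but not on the other. *)

theory Defs
  imports "HOL-Analysis.Analysis" "Jordan_Normal_Form.Matrix"
begin

section \<open>Complex vector spaces, Banach *-algebras and C*-algebras\<close>

class complex_vector = ab_group_add +
  fixes scaleC :: "complex \<Rightarrow> 'a \<Rightarrow> 'a"  (infixr \<open>*\<^sub>C\<close> 75)
  assumes scaleC_add_right: "c *\<^sub>C (x + y) = c *\<^sub>C x + c *\<^sub>C y"
    and scaleC_add_left: "(c + d) *\<^sub>C x = c *\<^sub>C x + d *\<^sub>C x"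
    and scaleC_scaleC: "c *\<^sub>C d *\<^sub>C x = (c * d) *\<^sub>C x"
    and scaleC_one: "1 *\<^sub>C x = x"

global_interpretation complex_vector:
  vector_space "scaleC :: complex \<Rightarrow> 'a::complex_vector \<Rightarrow> 'a"
  by unfold_locales
    (rule scaleC_add_right scaleC_add_left scaleC_scaleC scaleC_one)+

text \<open>Algebras are not assumed to have a unit, and the zero algebra is allowed.\<close>

class banach_star_algebra = real_normed_algebra + banach + complex_vector +
  fixes star :: "'a \<Rightarrow> 'a"
  assumes scaleC_of_real: "complex_of_real r *\<^sub>C x = r *\<^sub>R x"
    and norm_scaleC: "norm (c *\<^sub>C x) = cmod c * norm x"
    and mult_scaleC_left: "(c *\<^sub>C x) * y = c *\<^sub>C (x * y)"
    and mult_scaleC_right: "x * (c *\<^sub>C y) = c *\<^sub>C (x * y)"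
    and star_star: "star (star x) = x"
    and star_add: "star (x + y) = star x + star y"
    and star_scaleC: "star (c *\<^sub>C x) = cnj c *\<^sub>C star x"
    and star_mult: "star (x * y) = star y * star x"
    and norm_star: "norm (star x) = norm x"

class cstar_algebra = banach_star_algebra +
  assumes cstar_identity: "norm (star x * x) = (norm x)\<^sup>2"

definition bounded_clinear_functional :: "('a::banach_star_algebra \<Rightarrow> complex) \<Rightarrow> bool" where
  "bounded_clinear_functional f \<longleftrightarrow> bounded_linear f \<and> (\<forall>c x. f (c *\<^sub>C x) = c * f x)"

definition state :: "('a::cstar_algebra \<Rightarrow> complex) \<Rightarrow> bool" where
  "state \<phi> \<longleftrightarrow> bounded_clinear_functional \<phi> \<and>
     (\<forall>a. \<phi> (star a * a) \<in> nonneg_Reals) \<and> onorm \<phi> = 1"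

text \<open>Pure states are the extreme points of the convex set of states.\<close>

definition pure_state :: "('a::cstar_algebra \<Rightarrow> complex) \<Rightarrow> bool" where
  "pure_state \<phi> \<longleftrightarrow> state \<phi> \<and>
     (\<forall>\<phi>\<^sub>1 \<phi>\<^sub>2 t. state \<phi>\<^sub>1 \<and> state \<phi>\<^sub>2 \<and> 0 < t \<and> t < 1 \<and>
        (\<forall>a. \<phi> a = complex_of_real t * \<phi>\<^sub>1 a + complex_of_real (1 - t) * \<phi>\<^sub>2 a)
        \<longrightarrow> \<phi>\<^sub>1 = \<phi> \<and> \<phi>\<^sub>2 = \<phi>)"

definition closed_ideal :: "'d::banach_star_algebra set \<Rightarrow> bool" where
  "closed_ideal I \<longleftrightarrow> closed I \<and> 0 \<in> I \<and> (\<forall>x\<in>I. \<forall>y\<in>I. x + y \<in> I) \<and>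
     (\<forall>c. \<forall>x\<in>I. c *\<^sub>C x \<in> I) \<and> (\<forall>a. \<forall>x\<in>I. a * x \<in> I \<and> x * a \<in> I)"


section \<open>The algebraic tensor product\<close>

text \<open>A list stands for the formal sum of the elementary tensors of its entries; two formal sums
  are identified by the congruence generated by the bilinearity relations.\<close>

inductive tensor_eq ::
  "('a::complex_vector \<times> 'b::complex_vector) list \<Rightarrow> ('a \<times> 'b) list \<Rightarrow> bool" where
  tensor_eq_refl: "tensor_eq s s"
| tensor_eq_sym: "tensor_eq s t \<Longrightarrow> tensor_eq t s"
| tensor_eq_trans: "tensor_eq r s \<Longrightarrow> tensor_eq s t \<Longrightarrow> tensor_eq r t"
| tensor_eq_append: "tensor_eq s s' \<Longrightarrow> tensor_eq t t' \<Longrightarrow> tensor_eq (s @ t) (s' @ t')"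
| tensor_eq_commute: "tensor_eq (s @ t) (t @ s)"
| tensor_eq_zero: "tensor_eq [(0, b)] []"
| tensor_eq_add_left: "tensor_eq [(a + a', b)] [(a, b), (a', b)]"
| tensor_eq_add_right: "tensor_eq [(a, b + b')] [(a, b), (a, b')]"
| tensor_eq_scale: "tensor_eq [(c *\<^sub>C a, b)] [(a, c *\<^sub>C b)]"

lemma equivp_tensor_eq: "equivp tensor_eq"
  by (rule equivpI)
    (auto simp: reflp_def symp_def transp_def
      intro: tensor_eq_refl tensor_eq_sym tensor_eq_trans)

lemma tensor_eq_map_scale:
  assumes "tensor_eq s t"
  shows "tensor_eq (map (\<lambda>(a, b). (c *\<^sub>C a, b)) s) (map (\<lambda>(a, b). (c *\<^sub>C a, b)) t)"
  using assms
proof induction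
  case (tensor_eq_scale d a b)
  have "tensor_eq [(d *\<^sub>C c *\<^sub>C a, b)] [(c *\<^sub>C a, d *\<^sub>C b)]"
    by (rule tensor_eq.tensor_eq_scale)
  then show ?case by (simp add: scaleC_scaleC mult.commute)
qed (auto simp: scaleC_add_right intro: tensor_eq.intros)

quotient_type (overloaded) ('a, 'b) alg_tensor =
  "('a::complex_vector \<times> 'b::complex_vector) list" / tensor_eq
  by (rule equivp_tensor_eq)

lift_definition tensor :: "'a::complex_vector \<Rightarrow> 'b::complex_vector \<Rightarrow> ('a, 'b) alg_tensor"
  (infixr \<open>\<otimes>\<^sub>a\<close> 70) is "\<lambda>a b. [(a, b)]" .

instantiation alg_tensor :: (complex_vector, complex_vector) complex_vector
begin

lift_definition zero_alg_tensor :: "('a, 'b) alg_tensor" is "[]" .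

lift_definition plus_alg_tensor ::
  "('a, 'b) alg_tensor \<Rightarrow> ('a, 'b) alg_tensor \<Rightarrow> ('a, 'b) alg_tensor" is append
  by (rule tensor_eq_append)

lift_definition scaleC_alg_tensor ::
  "complex \<Rightarrow> ('a, 'b) alg_tensor \<Rightarrow> ('a, 'b) alg_tensor"
  is "\<lambda>c. map (\<lambda>(a, b). (c *\<^sub>C a, b))"
  by (rule tensor_eq_map_scale)

definition uminus_alg_tensor :: "('a, 'b) alg_tensor \<Rightarrow> ('a, 'b) alg_tensor" where
  "- u = (- 1) *\<^sub>C (u :: ('a, 'b) alg_tensor)"

definition minus_alg_tensor ::
  "('a, 'b) alg_tensor \<Rightarrow> ('a, 'b) alg_tensor \<Rightarrow> ('a, 'b) alg_tensor" where
  "u - v = (u :: ('a, 'b) alg_tensor) + - (v :: ('a, 'b) alg_tensor)"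

instance
proof
  fix u v w :: "('a, 'b) alg_tensor" and c d :: complex
  show "u + v + w = u + (v + w)"
    by transfer (simp add: tensor_eq_refl)
  show comm: "u + v = v + u" for u v :: "('a, 'b) alg_tensor"
    by transfer (rule tensor_eq_commute)
  show zero: "0 + u = u" for u :: "('a, 'b) alg_tensor"
    by transfer (simp add: tensor_eq_refl)
  show "c *\<^sub>C (u + v) = c *\<^sub>C u + c *\<^sub>C v"
    by transfer (simp add: tensor_eq_refl)
  show add: "(c + d) *\<^sub>C u = c *\<^sub>C u + d *\<^sub>C u" for c d and u :: "('a, 'b) alg_tensor"
  proof (transfer fixing: c d)
    fix s :: "('a \<times> 'b) list"
    show "tensor_eq (map (\<lambda>(a, b). ((c + d) *\<^sub>C a, b)) s)
        (map (\<lambda>(a, b). (c *\<^sub>C a, b)) s @ map (\<lambda>(a, b). (d *\<^sub>C a, b)) s)"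
    proof (induction s)
      case Nil
      show ?case by (simp add: tensor_eq_refl)
    next
      case (Cons p s)
      obtain a b where p: "p = (a, b)" by (cases p)
      let ?f = "\<lambda>c. map (\<lambda>(a::'a, b::'b). (c *\<^sub>C a, b))"
      have "tensor_eq ([((c + d) *\<^sub>C a, b)] @ ?f (c + d) s)
          ([(c *\<^sub>C a, b), (d *\<^sub>C a, b)] @ (?f c s @ ?f d s))"
        using Cons.IH by (intro tensor_eq_append) (auto simp: scaleC_add_left intro: tensor_eq.intros)
      moreover have "tensor_eq ([(c *\<^sub>C a, b)] @ (([(d *\<^sub>C a, b)] @ ?f c s) @ ?f d s))
          ([(c *\<^sub>C a, b)] @ ((?f c s @ [(d *\<^sub>C a, b)]) @ ?f d s))"
        by (intro tensor_eq_append tensor_eq_refl tensor_eq_commute)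
      ultimately show ?case
        unfolding p by (auto intro: tensor_eq_trans)
    qed
  qed
  show "c *\<^sub>C d *\<^sub>C u = (c * d) *\<^sub>C u"
    by transfer (simp add: tensor_eq_refl scaleC_scaleC case_prod_unfold comp_def)
  show one: "1 *\<^sub>C u = u" for u :: "('a, 'b) alg_tensor"
    by transfer (simp add: tensor_eq_refl scaleC_one)
  have null: "0 *\<^sub>C u = 0" for u :: "('a, 'b) alg_tensor"
  proof transfer
    fix s :: "('a \<times> 'b) list"
    show "tensor_eq (map (\<lambda>(a, b). (0 *\<^sub>C a, b)) s) []"
    proof (induction s)
      case Nil
      show ?case by (simp add: tensor_eq_refl)
    next
      case (Cons p s)
      have "tensor_eq ([(0, snd p)] @ map (\<lambda>(a, b). (0 *\<^sub>C a, b)) s) ([] @ [])"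
        by (intro tensor_eq_append tensor_eq_zero Cons.IH)
      then show ?case by (simp add: case_prod_unfold)
    qed
  qed
  show "- u + u = 0"
    using add[of "- 1" 1 u] by (simp add: uminus_alg_tensor_def null one)
  show "u - v = u + - v"
    by (rule minus_alg_tensor_def)
qed

end

lemma tensor_add_left: "(a + a') \<otimes>\<^sub>a b = a \<otimes>\<^sub>a b + a' \<otimes>\<^sub>a b"
  by transfer (simp add: tensor_eq_add_left)

lemma tensor_add_right: "a \<otimes>\<^sub>a (b + b') = a \<otimes>\<^sub>a b + a \<otimes>\<^sub>a b'"
  by transfer (simp add: tensor_eq_add_right)

lemma tensor_scaleC_left: "(c *\<^sub>C a) \<otimes>\<^sub>a b = c *\<^sub>C (a \<otimes>\<^sub>a b)"
  by transfer (simp add: tensor_eq_refl)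

lemma tensor_scaleC_right: "a \<otimes>\<^sub>a (c *\<^sub>C b) = c *\<^sub>C (a \<otimes>\<^sub>a b)"
  by transfer (auto intro: tensor_eq.intros)


section \<open>The operator space projective tensor product\<close>

definition mat_star :: "'a::banach_star_algebra mat \<Rightarrow> 'a mat" where
  "mat_star x = map_mat star (transpose_mat x)"

definition cstar_norm_on_matrices :: "nat \<Rightarrow> ('a::cstar_algebra mat \<Rightarrow> real) \<Rightarrow> bool" where
  "cstar_norm_on_matrices p N \<longleftrightarrow>
     (\<forall>x\<in>carrier_mat p p. N x \<ge> 0 \<and> (N x = 0 \<longleftrightarrow> x = 0\<^sub>m p p) \<and>
        (\<forall>c. N (map_mat (scaleC c) x) = cmod c * N x) \<and>
        N (mat_star x * x) = (N x)\<^sup>2 \<and>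
        (\<forall>y\<in>carrier_mat p p. N (x + y) \<le> N x + N y \<and> N (x * y) \<le> N x * N y))"

text \<open>The operator space structure of a C*-algebra: the norm of a matrix \<open>x\<close> in \<open>M\<^sub>p(A)\<close> is
  its value under the unique C*-norm of the *-algebra \<open>M\<^sub>p(A)\<close>. That norm is complete, so
  completeness need not be required in order to single it out.\<close>

definition mat_norm :: "'a::cstar_algebra mat \<Rightarrow> real" where
  "mat_norm x = (THE r. \<exists>N. cstar_norm_on_matrices (dim_row x) N \<and> r = N x)"

text \<open>The product \<open>\<alpha>(x \<otimes> y)\<beta>\<close>, where rows and columns of \<open>x \<otimes> y\<close> are indexed by pairs.\<close>

definition sandwich ::
  "(nat \<times> nat \<Rightarrow> complex) \<Rightarrow> 'a::cstar_algebra mat \<Rightarrow> 'b::cstar_algebra mat \<Rightarrow>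
   (nat \<times> nat \<Rightarrow> complex) \<Rightarrow> ('a, 'b) alg_tensor" where
  "sandwich \<alpha> x y \<beta> =
     (\<Sum>(i, k) \<in> {..<dim_row x} \<times> {..<dim_row y}. \<Sum>(j, l) \<in> {..<dim_col x} \<times> {..<dim_col y}.
        (\<alpha> (i, k) * \<beta> (j, l)) *\<^sub>C (x $$ (i, j) \<otimes>\<^sub>a y $$ (k, l)))"

text \<open>The norm of a scalar row or column matrix is its Euclidean norm.\<close>

definition op_proj_norm :: "('a::cstar_algebra, 'b::cstar_algebra) alg_tensor \<Rightarrow> real" where
  "op_proj_norm u = Inf {L2_set (\<lambda>r. cmod (\<alpha> r)) ({..<p} \<times> {..<q}) * mat_norm x * mat_norm y *
       L2_set (\<lambda>r. cmod (\<beta> r)) ({..<p} \<times> {..<q}) | \<alpha> \<beta> x y p q.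
       0 < p \<and> 0 < q \<and> x \<in> carrier_mat p p \<and> y \<in> carrier_mat q q \<and> u = sandwich \<alpha> x y \<beta>}"

text \<open>A Banach *-algebra \<open>D\<close> together with \<open>emb\<close> is the operator space projective tensor product
  when \<open>emb\<close> exhibits \<open>D\<close> as a completion of the normed *-algebra \<open>A \<otimes> B\<close>. The product and the
  involution of \<open>A \<otimes> B\<close> are given by their values on elementary tensors. Completions are unique
  up to isometric *-isomorphism.\<close>

locale op_proj_tensor_product =
  fixes emb :: "('a::cstar_algebra, 'b::cstar_algebra) alg_tensor \<Rightarrow> 'd::banach_star_algebra"
  assumes emb_add: "emb (u + v) = emb u + emb v"
    and emb_scaleC: "emb (c *\<^sub>C u) = c *\<^sub>C emb u"
    and emb_mult: "emb (a \<otimes>\<^sub>a b) * emb (a' \<otimes>\<^sub>a b') = emb ((a * a') \<otimes>\<^sub>a (b * b'))"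
    and emb_star: "star (emb (a \<otimes>\<^sub>a b)) = emb (star a \<otimes>\<^sub>a star b)"
    and norm_emb: "norm (emb u) = op_proj_norm u"
    and dense_range_emb: "closure (range emb) = UNIV"

definition product_functional ::
  "(('a::cstar_algebra, 'b::cstar_algebra) alg_tensor \<Rightarrow> 'd::banach_star_algebra) \<Rightarrow>
   ('a \<Rightarrow> complex) \<Rightarrow> ('b \<Rightarrow> complex) \<Rightarrow> ('d \<Rightarrow> complex) \<Rightarrow> bool" where
  "product_functional emb \<phi> \<psi> f \<longleftrightarrow>
     bounded_clinear_functional f \<and> (\<forall>a b. f (emb (a \<otimes>\<^sub>a b)) = \<phi> a * \<psi> b)"

definition property_F ::
  "(('a::cstar_algebra, 'b::cstar_algebra) alg_tensor \<Rightarrow> 'd::banach_star_algebra) \<Rightarrow> bool" where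
  "property_F emb \<longleftrightarrow>
     (\<forall>I J. closed_ideal I \<and> closed_ideal J \<and> I \<noteq> J \<longrightarrow>
        (\<exists>\<phi> \<psi> f. pure_state \<phi> \<and> pure_state \<psi> \<and> product_functional emb \<phi> \<psi> f \<and>
           ((\<forall>x\<in>I. f x = 0) \<and> \<not> (\<forall>x\<in>J. f x = 0) \<or>
            \<not> (\<forall>x\<in>I. f x = 0) \<and> (\<forall>x\<in>J. f x = 0))))"


section \<open>Hilbert spaces and *-representations\<close>

text \<open>Hilbert spaces are structures on a carrier set rather than on a type, since the definition
  of \<open>Prim\<^sup>*\<close> quantifies over them.\<close>

record 'h pre_hilbert =
  hcarrier :: "'h set"
  hzero :: 'h
  hadd :: "'h \<Rightarrow> 'h \<Rightarrow> 'h"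
  hscale :: "complex \<Rightarrow> 'h \<Rightarrow> 'h"
  hinner :: "'h \<Rightarrow> 'h \<Rightarrow> complex"

definition hnorm :: "'h pre_hilbert \<Rightarrow> 'h \<Rightarrow> real" where
  "hnorm H v = sqrt (Re (hinner H v v))"

definition hdist :: "'h pre_hilbert \<Rightarrow> 'h \<Rightarrow> 'h \<Rightarrow> real" where
  "hdist H v w = hnorm H (hadd H v (hscale H (- 1) w))"

locale hilbert_space =
  fixes H :: "'h pre_hilbert"
  assumes zero_closed: "hzero H \<in> hcarrier H"
    and add_closed: "v \<in> hcarrier H \<Longrightarrow> w \<in> hcarrier H \<Longrightarrow> hadd H v w \<in> hcarrier H"
    and scale_closed: "v \<in> hcarrier H \<Longrightarrow> hscale H c v \<in> hcarrier H"
    and add_assoc: "u \<in> hcarrier H \<Longrightarrow> v \<in> hcarrier H \<Longrightarrow> w \<in> hcarrier H \<Longrightarrow>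
      hadd H (hadd H u v) w = hadd H u (hadd H v w)"
    and add_commute: "v \<in> hcarrier H \<Longrightarrow> w \<in> hcarrier H \<Longrightarrow> hadd H v w = hadd H w v"
    and add_zero: "v \<in> hcarrier H \<Longrightarrow> hadd H v (hzero H) = v"
    and add_inverse: "v \<in> hcarrier H \<Longrightarrow> hadd H v (hscale H (- 1) v) = hzero H"
    and scale_add_right: "v \<in> hcarrier H \<Longrightarrow> w \<in> hcarrier H \<Longrightarrow>
      hscale H c (hadd H v w) = hadd H (hscale H c v) (hscale H c w)"
    and scale_add_left: "v \<in> hcarrier H \<Longrightarrow>
      hscale H (c + d) v = hadd H (hscale H c v) (hscale H d v)"
    and scale_scale: "v \<in> hcarrier H \<Longrightarrow> hscale H c (hscale H d v) = hscale H (c * d) v"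
    and scale_one: "v \<in> hcarrier H \<Longrightarrow> hscale H 1 v = v"
    and inner_add_left: "u \<in> hcarrier H \<Longrightarrow> v \<in> hcarrier H \<Longrightarrow> w \<in> hcarrier H \<Longrightarrow>
      hinner H (hadd H u v) w = hinner H u w + hinner H v w"
    and inner_scale_left: "v \<in> hcarrier H \<Longrightarrow> w \<in> hcarrier H \<Longrightarrow>
      hinner H (hscale H c v) w = c * hinner H v w"
    and inner_commute: "v \<in> hcarrier H \<Longrightarrow> w \<in> hcarrier H \<Longrightarrow>
      hinner H v w = cnj (hinner H w v)"
    and inner_pos: "v \<in> hcarrier H \<Longrightarrow> v \<noteq> hzero H \<Longrightarrow> Re (hinner H v v) > 0"
    and complete: "(\<And>n::nat. X n \<in> hcarrier H) \<Longrightarrow>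
      (\<And>e. e > 0 \<Longrightarrow> \<exists>M. \<forall>m\<ge>M. \<forall>n\<ge>M. hdist H (X m) (X n) < e) \<Longrightarrow>
      \<exists>v\<in>hcarrier H. (\<lambda>n. hdist H (X n) v) \<longlonglongrightarrow> 0"

definition closed_subspace :: "'h pre_hilbert \<Rightarrow> 'h set \<Rightarrow> bool" where
  "closed_subspace H M \<longleftrightarrow> M \<subseteq> hcarrier H \<and> hzero H \<in> M \<and>
     (\<forall>v\<in>M. \<forall>w\<in>M. hadd H v w \<in> M) \<and> (\<forall>c. \<forall>v\<in>M. hscale H c v \<in> M) \<and>
     (\<forall>X v. (\<forall>n::nat. X n \<in> M) \<and> v \<in> hcarrier H \<and> (\<lambda>n. hdist H (X n) v) \<longlonglongrightarrow> 0 \<longrightarrow> v \<in> M)"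

locale star_representation = hilbert_space H for H :: "'h pre_hilbert" +
  fixes \<pi> :: "'d::banach_star_algebra \<Rightarrow> 'h \<Rightarrow> 'h"
  assumes rep_closed: "v \<in> hcarrier H \<Longrightarrow> \<pi> a v \<in> hcarrier H"
    and rep_op_add: "v \<in> hcarrier H \<Longrightarrow> w \<in> hcarrier H \<Longrightarrow>
      \<pi> a (hadd H v w) = hadd H (\<pi> a v) (\<pi> a w)"
    and rep_op_scale: "v \<in> hcarrier H \<Longrightarrow> \<pi> a (hscale H c v) = hscale H c (\<pi> a v)"
    and rep_op_bounded: "\<exists>C. \<forall>v\<in>hcarrier H. hnorm H (\<pi> a v) \<le> C * hnorm H v"
    and rep_add: "v \<in> hcarrier H \<Longrightarrow> \<pi> (a + b) v = hadd H (\<pi> a v) (\<pi> b v)"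
    and rep_scaleC: "v \<in> hcarrier H \<Longrightarrow> \<pi> (c *\<^sub>C a) v = hscale H c (\<pi> a v)"
    and rep_mult: "v \<in> hcarrier H \<Longrightarrow> \<pi> (a * b) v = \<pi> a (\<pi> b v)"
    and rep_star: "v \<in> hcarrier H \<Longrightarrow> w \<in> hcarrier H \<Longrightarrow>
      hinner H (\<pi> (star a) v) w = hinner H v (\<pi> a w)"

definition rep_kernel :: "'h pre_hilbert \<Rightarrow> ('d \<Rightarrow> 'h \<Rightarrow> 'h) \<Rightarrow> 'd set" where
  "rep_kernel H \<pi> = {a. \<forall>v\<in>hcarrier H. \<pi> a v = hzero H}"

definition irreducible_star_representation ::
  "'h pre_hilbert \<Rightarrow> ('d::banach_star_algebra \<Rightarrow> 'h \<Rightarrow> 'h) \<Rightarrow> bool" where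
  "irreducible_star_representation H \<pi> \<longleftrightarrow> star_representation H \<pi> \<and> rep_kernel H \<pi> \<noteq> UNIV \<and>
     (\<forall>M. closed_subspace H M \<and> (\<forall>a. \<forall>v\<in>M. \<pi> a v \<in> M) \<longrightarrow> M = {hzero H} \<or> M = hcarrier H)"


section \<open>The space \<open>Prim\<^sup>*(D)\<close> and spectral synthesis\<close>

text \<open>A definition cannot quantify over all types, so the Hilbert spaces range over those whose
  carrier lies in the type \<open>'d \<Rightarrow> complex\<close>. This is no restriction: up to unitary equivalence
  every irreducible *-representation of \<open>D\<close> lives on such a space; see \<open>rep_kernel_in_prim_star\<close>.\<close>

definition prim_star :: "'d::banach_star_algebra set set" where
  "prim_star = {rep_kernel H \<pi> | (H :: ('d \<Rightarrow> complex) pre_hilbert) \<pi>.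
     irreducible_star_representation H \<pi>}"

lemma closed_subspaceD:
  assumes "closed_subspace H M"
  shows "M \<subseteq> hcarrier H" "hzero H \<in> M"
    "v \<in> M \<Longrightarrow> w \<in> M \<Longrightarrow> hadd H v w \<in> M" "v \<in> M \<Longrightarrow> hscale H c v \<in> M"
proof -
  note * = assms[unfolded closed_subspace_def]
  note ** = *[THEN conjunct2, THEN conjunct2]
  show "M \<subseteq> hcarrier H" by (rule *[THEN conjunct1])
  show "hzero H \<in> M" by (rule *[THEN conjunct2, THEN conjunct1])
  show "v \<in> M \<Longrightarrow> w \<in> M \<Longrightarrow> hadd H v w \<in> M"
    by (rule **[THEN conjunct1, rule_format])
  show "v \<in> M \<Longrightarrow> hscale H c v \<in> M"
    by (rule **[THEN conjunct2, THEN conjunct1, rule_format])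
qed

lemma closed_subspace_limit:
  fixes X :: "nat \<Rightarrow> 'h"
  assumes "closed_subspace H M" "\<And>n. X n \<in> M" "v \<in> hcarrier H"
    and "(\<lambda>n. hdist H (X n) v) \<longlonglongrightarrow> 0"
  shows "v \<in> M"
proof -
  have "\<forall>X v. (\<forall>n::nat. X n \<in> M) \<and> v \<in> hcarrier H \<and> (\<lambda>n. hdist H (X n) v) \<longlonglongrightarrow> 0 \<longrightarrow> v \<in> M"
    using assms(1) unfolding closed_subspace_def by (elim conjE)
  from this[rule_format, of X v] show ?thesis
    using assms by blast
qed

context hilbert_space
begin

lemma inner_add_right:
  assumes "u \<in> hcarrier H" "v \<in> hcarrier H" "w \<in> hcarrier H"
  shows "hinner H u (hadd H v w) = hinner H u v + hinner H u w"
  using assms inner_commute[of u "hadd H v w"] inner_commute[of u v] inner_commute[of u w]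
  by (simp add: inner_add_left add_closed)

lemma inner_scale_right:
  assumes "v \<in> hcarrier H" "w \<in> hcarrier H"
  shows "hinner H v (hscale H c w) = cnj c * hinner H v w"
  using assms inner_commute[of v "hscale H c w"] inner_commute[of v w]
  by (simp add: inner_scale_left scale_closed)

lemma inner_zero_left: "v \<in> hcarrier H \<Longrightarrow> hinner H (hzero H) v = 0"
  using inner_add_left[OF zero_closed zero_closed, of v] add_zero[OF zero_closed] by simp

lemma inner_zero_right: "v \<in> hcarrier H \<Longrightarrow> hinner H v (hzero H) = 0"
  using inner_commute[OF _ zero_closed] inner_zero_left by simp

lemma inner_self:
  assumes "v \<in> hcarrier H"
  shows "hinner H v v = complex_of_real ((hnorm H v)\<^sup>2)"
proof -
  have "Im (hinner H v v) = 0"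
    using arg_cong[OF inner_commute[OF assms assms], of Im] by simp
  moreover have "Re (hinner H v v) \<ge> 0"
    using assms inner_pos[of v] inner_zero_left[of v] by (cases "v = hzero H") auto
  ultimately show ?thesis
    by (simp add: hnorm_def complex_eq_iff)
qed

lemma hnorm_nonneg: "v \<in> hcarrier H \<Longrightarrow> hnorm H v \<ge> 0"
  using inner_self[of v] inner_pos[of v] inner_zero_left[of v]
  by (cases "v = hzero H") (auto simp: hnorm_def)

lemma hnorm_pos: "v \<in> hcarrier H \<Longrightarrow> v \<noteq> hzero H \<Longrightarrow> hnorm H v > 0"
  using inner_pos[of v] by (simp add: hnorm_def)

lemma Cauchy_Schwarz:
  assumes v: "v \<in> hcarrier H" and w: "w \<in> hcarrier H"
  shows "cmod (hinner H v w) \<le> hnorm H v * hnorm H w"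
proof (cases "w = hzero H")
  case True
  then show ?thesis using v w inner_zero_right hnorm_nonneg by simp
next
  case False
  define n where "n = (hnorm H w)\<^sup>2"
  have n: "n > 0" "hinner H w w = complex_of_real n"
    using hnorm_pos[OF w False] inner_self[OF w] by (auto simp: n_def)
  define z where "z = hinner H v w"
  have zz: "complex_of_real (cmod z) * complex_of_real (cmod z) = z * cnj z"
    using complex_norm_square[of z] by (simp add: power2_eq_square)
  have wv: "hinner H w v = cnj z"
    using inner_commute[OF w v] by (simp add: z_def)
  define c where "c = - (z / complex_of_real n)"
  define u where "u = hadd H v (hscale H c w)"
  have u: "u \<in> hcarrier H" and cw: "hscale H c w \<in> hcarrier H"
    using v w by (auto simp: u_def add_closed scale_closed)
  have "hinner H u u = hinner H v v + cnj c * z + c * cnj z + c * cnj c * hinner H w w"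
    unfolding u_def using v w cw
    by (simp add: inner_add_left inner_add_right inner_scale_left inner_scale_right add_closed
        z_def[symmetric] wv algebra_simps)
  also have "\<dots> = hinner H v v - complex_of_real ((cmod z)\<^sup>2 / n)"
    using n zz by (simp add: c_def field_simps power2_eq_square)
  finally have "complex_of_real ((hnorm H u)\<^sup>2) =
      complex_of_real ((hnorm H v)\<^sup>2 - (cmod z)\<^sup>2 / n)"
    using inner_self[OF u] inner_self[OF v] by simp
  then have "(hnorm H u)\<^sup>2 = (hnorm H v)\<^sup>2 - (cmod z)\<^sup>2 / n"
    using of_real_eq_iff by blast
  then have "(cmod z)\<^sup>2 / n \<le> (hnorm H v)\<^sup>2"
    using zero_le_power2[of "hnorm H u"] by linarith
  then have "(cmod z)\<^sup>2 \<le> (hnorm H v * hnorm H w)\<^sup>2"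
    using n by (simp add: n_def field_simps power_mult_distrib)
  then show ?thesis
    using v w by (simp add: z_def abs_le_square_iff[symmetric] hnorm_nonneg abs_mult)
qed

end

definition transport_hilbert :: "('h \<Rightarrow> 'k) \<Rightarrow> 'h pre_hilbert \<Rightarrow> 'k pre_hilbert" where
  "transport_hilbert g H =
     (let k = inv_into (hcarrier H) g in
      \<lparr>hcarrier = g ` hcarrier H, hzero = g (hzero H), hadd = (\<lambda>v w. g (hadd H (k v) (k w))),
       hscale = (\<lambda>c v. g (hscale H c (k v))), hinner = (\<lambda>v w. hinner H (k v) (k w))\<rparr>)"

definition transport_rep ::
  "('h \<Rightarrow> 'k) \<Rightarrow> 'h pre_hilbert \<Rightarrow> ('d \<Rightarrow> 'h \<Rightarrow> 'h) \<Rightarrow> 'd \<Rightarrow> 'k \<Rightarrow> 'k" where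
  "transport_rep g H \<pi> = (\<lambda>a v. g (\<pi> a (inv_into (hcarrier H) g v)))"

context
  fixes H :: "'h pre_hilbert" and g :: "'h \<Rightarrow> 'k"
  assumes inj: "inj_on g (hcarrier H)"
begin

lemma transport_simps:
  "hcarrier (transport_hilbert g H) = g ` hcarrier H"
  "hzero (transport_hilbert g H) = g (hzero H)"
  "v \<in> hcarrier H \<Longrightarrow> w \<in> hcarrier H \<Longrightarrow>
     hadd (transport_hilbert g H) (g v) (g w) = g (hadd H v w)"
  "v \<in> hcarrier H \<Longrightarrow> hscale (transport_hilbert g H) c (g v) = g (hscale H c v)"
  "v \<in> hcarrier H \<Longrightarrow> w \<in> hcarrier H \<Longrightarrow>
     hinner (transport_hilbert g H) (g v) (g w) = hinner H v w"
  "v \<in> hcarrier H \<Longrightarrow> transport_rep g H \<pi> a (g v) = g (\<pi> a v)"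
  using inj by (auto simp: transport_hilbert_def transport_rep_def Let_def)

lemma transport_hnorm: "v \<in> hcarrier H \<Longrightarrow> hnorm (transport_hilbert g H) (g v) = hnorm H v"
  by (simp add: hnorm_def transport_simps)

lemma transport_hdist:
  assumes "hilbert_space H" "v \<in> hcarrier H" "w \<in> hcarrier H"
  shows "hdist (transport_hilbert g H) (g v) (g w) = hdist H v w"
proof -
  interpret hilbert_space H by fact
  show ?thesis
    using assms(2,3) by (simp add: hdist_def transport_simps transport_hnorm add_closed scale_closed)
qed

lemma hilbert_space_transport:
  assumes "hilbert_space H"
  shows "hilbert_space (transport_hilbert g H)"
proof -
  interpret hilbert_space H by fact
  note closed = zero_closed add_closed scale_closed
  show ?thesis
  proof (unfold_locales, goal_cases)
    case (15 v)
    then obtain x where "x \<in> hcarrier H" "v = g x" "x \<noteq> hzero H"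
      by (auto simp: transport_simps)
    then show ?case by (simp add: transport_simps inner_pos)
  next
    case (16 X)
    define Y where "Y = (\<lambda>n. inv_into (hcarrier H) g (X n))"
    have Y: "Y n \<in> hcarrier H" "X n = g (Y n)" for n
      using 16(1)[of n] inj by (auto simp: Y_def transport_simps)
    have "\<exists>v\<in>hcarrier H. (\<lambda>n. hdist H (Y n) v) \<longlonglongrightarrow> 0"
      using 16(2) Y by (intro complete) (simp_all add: transport_hdist[OF assms])
    then show ?case
      using Y by (auto simp: transport_simps transport_hdist[OF assms])
  qed (auto simp: transport_simps closed add_zero add_inverse scale_add_right scale_add_left
      scale_scale scale_one inner_add_left inner_scale_left inner_pos
      intro!: arg_cong[where f = g] intro: add_assoc add_commute inner_commute)
qed

lemma star_representation_transport:
  fixes \<pi> :: "'d::banach_star_algebra \<Rightarrow> 'h \<Rightarrow> 'h"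
  assumes "star_representation H \<pi>"
  shows "star_representation (transport_hilbert g H) (transport_rep g H \<pi>)"
proof -
  interpret star_representation H \<pi> by fact
  note closed = zero_closed add_closed scale_closed rep_closed
  interpret T: hilbert_space "transport_hilbert g H"
    by (rule hilbert_space_transport) unfold_locales
  show ?thesis
  proof (unfold_locales, goal_cases)
    case (4 a)
    from rep_op_bounded[of a] show ?case
      by (auto simp: transport_simps transport_hnorm closed)
  qed (auto simp: transport_simps closed rep_op_add rep_op_scale rep_add rep_scaleC rep_mult rep_star)
qed

lemma rep_kernel_transport:
  fixes \<pi> :: "'d::banach_star_algebra \<Rightarrow> 'h \<Rightarrow> 'h"
  assumes "star_representation H \<pi>"
  shows "rep_kernel (transport_hilbert g H) (transport_rep g H \<pi>) = rep_kernel H \<pi>"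
proof -
  interpret star_representation H \<pi> by fact
  show ?thesis
    by (auto simp: rep_kernel_def transport_simps zero_closed rep_closed inj_on_eq_iff[OF inj])
qed

lemma irreducible_transport:
  fixes \<pi> :: "'d::banach_star_algebra \<Rightarrow> 'h \<Rightarrow> 'h"
  assumes "irreducible_star_representation H \<pi>"
  shows "irreducible_star_representation (transport_hilbert g H) (transport_rep g H \<pi>)"
proof -
  have rep: "star_representation H \<pi>"
    using assms by (simp add: irreducible_star_representation_def)
  interpret star_representation H \<pi> by fact
  note closed = zero_closed add_closed scale_closed rep_closed
  have hil: "hilbert_space H" by unfold_locales
  have "M = {hzero (transport_hilbert g H)} \<or> M = hcarrier (transport_hilbert g H)"
    if M: "closed_subspace (transport_hilbert g H) M"
      and invariant: "\<forall>a. \<forall>v\<in>M. transport_rep g H \<pi> a v \<in> M" for M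
  proof -
    define L where "L = {v \<in> hcarrier H. g v \<in> M}"
    have M_eq: "M = g ` L"
      using closed_subspaceD(1)[OF M] by (auto simp: L_def transport_simps(1))
    have "closed_subspace H L"
      unfolding closed_subspace_def
    proof (intro conjI allI impI ballI)
      show "L \<subseteq> hcarrier H" by (auto simp: L_def)
      show "hzero H \<in> L"
        using closed_subspaceD(2)[OF M] by (simp add: L_def transport_simps(2) closed)
      show "hadd H v w \<in> L" if "v \<in> L" "w \<in> L" for v w
      proof -
        have "hadd (transport_hilbert g H) (g v) (g w) \<in> M"
          using that by (intro closed_subspaceD(3)[OF M]) (simp_all add: L_def)
        then show ?thesis using that by (simp add: L_def transport_simps(3) closed)
      qed
      show "hscale H c v \<in> L" if "v \<in> L" for c v
      proof -
        have "hscale (transport_hilbert g H) c (g v) \<in> M"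
          using that by (intro closed_subspaceD(4)[OF M]) (simp_all add: L_def)
        then show ?thesis using that by (simp add: L_def transport_simps(4) closed)
      qed
      show "v \<in> L"
        if "(\<forall>n. X n \<in> L) \<and> v \<in> hcarrier H \<and> (\<lambda>n. hdist H (X n) v) \<longlonglongrightarrow> 0"
        for X :: "nat \<Rightarrow> 'h" and v
      proof -
        have X: "X n \<in> hcarrier H" "g (X n) \<in> M" for n using that by (auto simp: L_def)
        have v: "v \<in> hcarrier H" "(\<lambda>n. hdist H (X n) v) \<longlonglongrightarrow> 0" using that by auto
        have "g v \<in> M"
        proof (rule closed_subspace_limit[OF M])
          show "g (X n) \<in> M" for n by (rule X(2))
          show "g v \<in> hcarrier (transport_hilbert g H)"
            using v(1) by (simp add: transport_simps(1))
          show "(\<lambda>n. hdist (transport_hilbert g H) (g (X n)) (g v)) \<longlonglongrightarrow> 0"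
            using v(2) by (simp add: transport_hdist[OF hil X(1) v(1)])
        qed
        then show ?thesis using that by (simp add: L_def)
      qed
    qed
    moreover have "\<forall>a. \<forall>v\<in>L. \<pi> a v \<in> L"
    proof (intro allI ballI)
      fix a v assume v: "v \<in> L"
      then have "transport_rep g H \<pi> a (g v) \<in> M"
        using invariant by (simp add: L_def)
      then show "\<pi> a v \<in> L"
        using v by (simp add: L_def transport_simps(6) closed)
    qed
    ultimately have "L = {hzero H} \<or> L = hcarrier H"
      using assms unfolding irreducible_star_representation_def by blast
    then show ?thesis unfolding M_eq transport_simps(1,2) by auto
  qed
  moreover have "rep_kernel H \<pi> \<noteq> UNIV"
    using assms unfolding irreducible_star_representation_def by blast
  ultimately show ?thesis
    using star_representation_transport[OF rep]
    unfolding irreducible_star_representation_def rep_kernel_transport[OF rep] by blast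
qed

end

theorem rep_kernel_in_prim_star:
  fixes H :: "'h pre_hilbert" and \<pi> :: "'d::banach_star_algebra \<Rightarrow> 'h \<Rightarrow> 'h"
  assumes irr: "irreducible_star_representation H \<pi>"
  shows "rep_kernel H \<pi> \<in> prim_star"
proof -
  have rep: "star_representation H \<pi>" and ker: "rep_kernel H \<pi> \<noteq> UNIV"
    using irr by (auto simp: irreducible_star_representation_def)
  interpret star_representation H \<pi> by fact
  note closed = zero_closed add_closed scale_closed rep_closed
  obtain b \<xi> where \<xi>: "\<xi> \<in> hcarrier H" "\<pi> b \<xi> \<noteq> hzero H"
    using ker by (auto simp: rep_kernel_def)
  define M where "M = {v \<in> hcarrier H. \<forall>a. hinner H v (\<pi> a \<xi>) = 0}"
  have "closed_subspace H M"
    unfolding closed_subspace_def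
  proof (intro conjI allI impI ballI)
    fix X :: "nat \<Rightarrow> 'h" and v
    assume *: "(\<forall>n. X n \<in> M) \<and> v \<in> hcarrier H \<and> (\<lambda>n. hdist H (X n) v) \<longlonglongrightarrow> 0"
    have X: "X n \<in> hcarrier H" "hinner H (X n) (\<pi> a \<xi>) = 0" for n a
      using * by (auto simp: M_def)
    have "hinner H v (\<pi> a \<xi>) = 0" for a
    proof -
      have "cmod (hinner H v (\<pi> a \<xi>)) \<le> hdist H (X n) v * hnorm H (\<pi> a \<xi>)" for n
        using Cauchy_Schwarz[of "hadd H (X n) (hscale H (- 1) v)" "\<pi> a \<xi>"] X * \<xi>
        by (simp add: hdist_def closed inner_add_left inner_scale_left)
      moreover have "(\<lambda>n. hdist H (X n) v * hnorm H (\<pi> a \<xi>)) \<longlonglongrightarrow> 0"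
        using * by (intro tendsto_mult_left_zero) auto
      ultimately have "cmod (hinner H v (\<pi> a \<xi>)) \<le> 0"
        by (intro LIMSEQ_le_const[where X = "\<lambda>n. hdist H (X n) v * hnorm H (\<pi> a \<xi>)"]) auto
      then show ?thesis by simp
    qed
    then show "v \<in> M" using * by (simp add: M_def)
  qed (use \<xi> in \<open>auto simp: M_def closed inner_zero_left inner_add_left inner_scale_left\<close>)
  moreover have "\<pi> c v \<in> M" if "v \<in> M" for c v
  proof -
    have "hinner H (\<pi> c v) (\<pi> a \<xi>) = hinner H v (\<pi> (star c * a) \<xi>)" for a
      using that \<xi> rep_star[of v "\<pi> a \<xi>" "star c"]
      by (simp add: M_def closed rep_mult star_star)
    then show ?thesis using that by (auto simp: M_def closed)
  qed
  moreover have "hinner H (\<pi> b \<xi>) (\<pi> b \<xi>) \<noteq> 0"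
    using inner_pos[of "\<pi> b \<xi>"] \<xi> by (auto simp: closed)
  then have "\<pi> b \<xi> \<notin> M" by (auto simp: M_def)
  ultimately have M: "M = {hzero H}"
    using irr \<xi> closed by (metis irreducible_star_representation_def)
  define g where "g = (\<lambda>v a. hinner H v (\<pi> a \<xi>))"
  have inj: "inj_on g (hcarrier H)"
  proof (rule inj_onI)
    fix v w assume vw: "v \<in> hcarrier H" "w \<in> hcarrier H" "g v = g w"
    have "hadd H v (hscale H (- 1) w) \<in> M"
      using vw \<xi> by (auto simp: M_def g_def closed inner_add_left inner_scale_left fun_eq_iff)
    then have "hadd H v (hscale H (- 1) w) = hzero H" using M by simp
    then have "hadd H (hadd H v (hscale H (- 1) w)) w = w"
      using vw add_commute[OF zero_closed] add_zero by simp
    then show "v = w"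
      using vw add_assoc[of v "hscale H (- 1) w" w] add_commute[of "hscale H (- 1) w" w]
      by (simp add: closed add_inverse add_zero)
  qed
  show ?thesis
    unfolding prim_star_def
    using irreducible_transport[OF inj irr] rep_kernel_transport[OF inj rep] by blast
qed

definition hk_kernel :: "'d::banach_star_algebra set set \<Rightarrow> 'd set" where
  "hk_kernel E = \<Inter>E"

definition prim_hull :: "'d::banach_star_algebra set \<Rightarrow> 'd set set" where
  "prim_hull J = {P \<in> prim_star. J \<subseteq> P}"

definition hk_closed :: "'d::banach_star_algebra set set \<Rightarrow> bool" where
  "hk_closed E \<longleftrightarrow> E \<subseteq> prim_star \<and> prim_hull (hk_kernel E) = E"

definition spectral_set :: "'d::banach_star_algebra set set \<Rightarrow> bool" where
  "spectral_set E \<longleftrightarrow> hk_closed E \<and> {J. closed_ideal J \<and> prim_hull J = E} = {hk_kernel E}"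

definition spectral_synthesis :: "'d::banach_star_algebra itself \<Rightarrow> bool" where
  "spectral_synthesis _ \<longleftrightarrow> (\<forall>E :: 'd set set. hk_closed E \<longrightarrow> spectral_set E)"

end

theory Submission
  imports Defs "HOL-Library.Function_Algebras"
begin

text \<open>
  Let \<open>D\<close> be the tensor product of \<open>A\<close> and \<open>B\<close>.  Spectral synthesis makes every closed ideal \<open>I\<close> the
  intersection of the kernels of the irreducible representations that vanish on \<open>I\<close>
  (\<open>closed_ideal_eq_hull_kernel\<close>).  If a closed ideal \<open>J\<close> is not contained in \<open>I\<close>, some irreducible
  representation \<open>\<pi>\<close> therefore kills \<open>I\<close> but not some \<open>x \<in> J\<close>, and it suffices to find a product of
  pure states that vanishes on the kernel of \<open>\<pi>\<close> but not at \<open>x\<close> (\<open>separating_pure_states\<close>).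

  The operator space structure enters through one consequence of the formula for the norm: every
  \<open>x\<close> in \<open>D\<close> is a limit of partial sums of some \<open>\<Sum> a\<^sub>i \<otimes> b\<^sub>i\<close> in which all finite sums of the \<open>a\<^sub>i a\<^sub>i\<^sup>*\<close>
  and of the \<open>b\<^sub>i\<^sup>* b\<^sub>i\<close> are bounded (\<open>row_column_series\<close>).  For vectors \<open>\<xi>\<close>, \<open>\<eta>\<close> and elements
  \<open>c\<close>, \<open>c'\<close> of \<open>A\<close> and \<open>d\<close>, \<open>d'\<close> of \<open>B\<close> put

    \<open>v\<^sub>i = \<pi>(c \<otimes> b\<^sub>i d) \<xi>\<close>  and  \<open>w\<^sub>i = \<pi>(a\<^sub>i\<^sup>* c' \<otimes> d') \<eta>\<close>.

  Both sequences are square summable, and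
  \<open>\<Sum> \<langle>\<pi>(s \<otimes> r) v\<^sub>i, w\<^sub>i\<rangle> = \<langle>\<pi>((c'\<^sup>* \<otimes> d'\<^sup>* r) x (s c \<otimes> d)) \<xi>, \<eta>\<rangle>\<close>.  On the other hand \<open>\<Sum> \<langle>v\<^sub>i, h\<rangle> \<langle>k, w\<^sub>i\<rangle>\<close>
  is the value at \<open>x\<close> of the product of the functionals \<open>a \<mapsto> \<langle>k, \<pi>(a\<^sup>* c' \<otimes> d') \<eta>\<rangle>\<close> and
  \<open>b \<mapsto> \<langle>\<pi>(c \<otimes> b d) \<xi>, h\<rangle>\<close>.  Two facts follow.

  If \<open>\<pi>(x) = 0\<close>, then \<open>(w\<^sub>i)\<close> is orthogonal to all \<open>(\<pi>(t) v\<^sub>i)\<close>.  By Schur's lemma a closed invariant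
  subspace of a Hilbert sum of copies of \<open>\<pi>\<close> is stable under every bounded operator that acts
  diagonally, in particular under those of rank one, so that \<open>\<Sum> \<langle>v\<^sub>i, h\<rangle> \<langle>k, w\<^sub>i\<rangle> = 0\<close>
  (\<open>rank_one_density\<close>).  Thus the product functionals above vanish on the kernel of \<open>\<pi>\<close>.

  If \<open>\<pi>(x) \<noteq> 0\<close>, then \<open>\<Sum> \<langle>v\<^sub>i, w\<^sub>i\<rangle> \<noteq> 0\<close> for some choice of the vectors and elements.  This number is
  the trace of a trace class operator whose quadratic form at \<open>h\<close> is \<open>\<Sum> \<langle>v\<^sub>i, h\<rangle> \<langle>h, w\<^sub>i\<rangle>\<close>, so that
  the latter is nonzero for some \<open>h\<close> (\<open>l2_trace_zero\<close>): one of the product functionals does not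
  vanish at \<open>x\<close>.

  The factors are then replaced by pure states one at a time.  Slicing with the second functional
  maps the kernel of \<open>\<pi>\<close> into the set of those \<open>a\<close> that are annihilated by all functionals of the
  first kind.  This is the common kernel of representation-like maps, so a pure state of \<open>A\<close> that
  vanishes on it but not at the slice of \<open>x\<close> exists by the Krein-Milman argument
  (\<open>pure_state_separation\<close>).  Slicing with this pure state gives the same situation in \<open>B\<close>.

  Almost everything else provides the required part of the elementary theory of C*-algebras:
  positive elements, the C*-norm of a matrix algebra (which the norm of the tensor product refers
  to), Hilbert space projections and Schur's lemma.  Square roots are obtained from the iteration
  \<open>y \<mapsto> (h + y\<^sup>2) / 2\<close>, which replaces the continuous functional calculus throughout.\<close>

section \<open>Square roots by iteration\<close>

lemma star_zero: "star (0::'a::banach_star_algebra) = 0"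
  using star_scaleC[of 0 "0::'a"] by simp

lemma star_minus: "star (- x) = - star (x::'a::banach_star_algebra)"
  using star_add[of x "- x"] by (simp add: star_zero eq_neg_iff_add_eq_0 add.commute)

lemma star_diff: "star (x - y) = star x - star (y::'a::banach_star_algebra)"
  using star_add[of x "- y"] by (simp add: star_minus)

lemma star_scaleR: "star (r *\<^sub>R x) = r *\<^sub>R star (x::'a::banach_star_algebra)"
  by (simp add: scaleC_of_real[symmetric] star_scaleC)

lemma bounded_linear_star: "bounded_linear (star :: 'a::banach_star_algebra \<Rightarrow> 'a)"
  by (rule bounded_linear_intro[of _ 1]) (simp_all add: star_add star_scaleR norm_star)

lemma bounded_linear_scaleC: "bounded_linear ((*\<^sub>C) c :: 'a::banach_star_algebra \<Rightarrow> 'a)"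
  by (rule bounded_linear_intro[of _ "cmod c"])
    (simp_all add: scaleC_add_right scaleC_of_real[symmetric] scaleC_scaleC norm_scaleC mult.commute)

lemma star_sum: "star (\<Sum>i\<in>I. f i) = (\<Sum>i\<in>I. star (f i :: 'a::banach_star_algebra))"
  by (induction I rule: infinite_finite_induct) (auto simp: star_zero star_add)

lemma continuous_on_star: "continuous_on S (star :: 'a::banach_star_algebra \<Rightarrow> 'a)"
  by (rule bounded_linear.continuous_on[OF bounded_linear_star continuous_on_id])

lemmas scaleC_simps = complex_vector.scale_minus_left complex_vector.scale_minus_right
  complex_vector.scale_right_diff_distrib complex_vector.scale_left_diff_distrib
  scaleC_add_right scaleC_add_left scaleC_scaleC scaleC_one

lemmas star_simps = star_zero star_minus star_diff star_add star_scaleR star_scaleC star_mult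
  star_star mult_scaleC_left mult_scaleC_right scaleC_simps

lemma cstar_star_mult_eq_0: "star x * x = 0 \<Longrightarrow> x = (0::'a::cstar_algebra)"
  using cstar_identity[of x] by simp

lemma norm_square_self_adjoint:
  "star x = x \<Longrightarrow> norm (x * x) = (norm (x::'a::cstar_algebra))\<^sup>2"
  using cstar_identity[of x] by simp

lemma self_adjoint_square_eq_0: "star x = x \<Longrightarrow> x * x = 0 \<Longrightarrow> x = (0::'a::cstar_algebra)"
  using norm_square_self_adjoint[of x] by simp

text \<open>The scalar case \<open>h = 1\<close> of the iteration; its increments dominate those of the general
  case.\<close>

primrec root_majorant :: "nat \<Rightarrow> real" where
  "root_majorant 0 = 0"
| "root_majorant (Suc n) = (1 + root_majorant n * root_majorant n) / 2"

lemma root_majorant_bounds: "0 \<le> root_majorant n" "root_majorant n \<le> 1"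
proof -
  have "0 \<le> root_majorant n \<and> root_majorant n \<le> 1"
  proof (induction n)
    case (Suc n)
    then have "root_majorant n * root_majorant n \<le> 1 * 1" by (intro mult_mono) auto
    then show ?case using Suc by simp
  qed simp
  then show "0 \<le> root_majorant n" "root_majorant n \<le> 1" by auto
qed

lemma root_majorant_mono: "root_majorant n \<le> root_majorant (Suc n)"
proof -
  have "0 \<le> (1 - root_majorant n) * (1 - root_majorant n)" by simp
  then show ?thesis by (simp add: algebra_simps)
qed

declare root_majorant.simps(2) [simp del]

lemma root_majorant_convergent: "convergent root_majorant"
  by (rule Bseq_mono_convergent[OF BseqI'[of _ 1]])
    (use root_majorant_bounds lift_Suc_mono_le[of root_majorant, OF root_majorant_mono] in auto)

text \<open>The limit of \<open>y \<mapsto> (h + y\<^sup>2) / 2\<close> started at \<open>0\<close>: as \<open>(1 - y)\<^sup>2 = 1 - h\<close> formally, this is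
  the square root of \<open>1 - h\<close>, without a unit. The last clause transfers to \<open>y\<close> whatever the
  iteration preserves, for instance self-adjointness or commutation with a given element.\<close>

lemma root_iteration:
  fixes h :: "'a::{real_normed_algebra, banach}"
  assumes h: "norm h \<le> 1"
  obtains y where "y + y = h + y * y" "norm y \<le> 1"
    "\<And>S. closed S \<Longrightarrow> 0 \<in> S \<Longrightarrow> (\<And>z. z \<in> S \<Longrightarrow> (1 / 2) *\<^sub>R (h + z * z) \<in> S) \<Longrightarrow> y \<in> S"
proof -
  let ?t = root_majorant
  define Y where "Y = rec_nat 0 (\<lambda>_ z. (1 / 2) *\<^sub>R (h + z * z))"
  have Y0: "Y 0 = 0" and YS: "Y (Suc n) = (1 / 2) *\<^sub>R (h + Y n * Y n)" for n
    by (simp_all add: Y_def)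
  have Y_bound: "norm (Y n) \<le> ?t n" for n
  proof (induction n)
    case (Suc n)
    have "norm (h + Y n * Y n) \<le> 1 + ?t n * ?t n"
      using h norm_mult_ineq[of "Y n" "Y n"] mult_mono[OF Suc Suc] root_majorant_bounds[of n]
      by (intro order_trans[OF norm_triangle_ineq]) (auto intro!: add_mono)
    then show ?case by (simp add: YS root_majorant.simps(2))
  qed (simp add: Y0)
  have step: "norm (Y (Suc n) - Y n) \<le> ?t (Suc n) - ?t n" for n
  proof (induction n)
    case 0
    show ?case using h by (simp add: YS Y0 root_majorant.simps(2))
  next
    case (Suc n)
    let ?d = "Y (Suc n) - Y n" and ?e = "?t (Suc n) - ?t n"
    have "Y (Suc (Suc n)) - Y (Suc n) = (1 / 2) *\<^sub>R (Y (Suc n) * ?d + ?d * Y n)"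
      by (subst (1 2) YS) (simp add: algebra_simps)
    also have "norm \<dots> \<le> (1 / 2) * (?t (Suc n) * ?e + ?e * ?t n)"
    proof -
      have "norm (Y (Suc n) * ?d) \<le> ?t (Suc n) * ?e" "norm (?d * Y n) \<le> ?e * ?t n"
        using Suc Y_bound[of n] Y_bound[of "Suc n"] root_majorant_bounds root_majorant_mono
        by (auto intro!: order_trans[OF norm_mult_ineq] mult_mono)
      then show ?thesis
        using norm_triangle_ineq[of "Y (Suc n) * ?d" "?d * Y n"] by simp
    qed
    also have "\<dots> = ?t (Suc (Suc n)) - ?t (Suc n)"
      by (simp add: root_majorant.simps(2)[of "Suc n"] root_majorant.simps(2)[of n] algebra_simps)
    finally show ?case .
  qed
  obtain l where "?t \<longlonglongrightarrow> l"
    using root_majorant_convergent by (auto simp: convergent_def)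
  then have "summable (\<lambda>n. ?t (Suc n) - ?t n)" by (rule telescope_summable)
  then have "summable (\<lambda>n. Y (Suc n) - Y n)"
    by (rule summable_comparison_test'[where N = 0]) (rule step)
  then have "(\<lambda>n. \<Sum>i<n. Y (Suc i) - Y i) \<longlonglongrightarrow> (\<Sum>i. Y (Suc i) - Y i)"
    by (rule summable_LIMSEQ)
  then obtain y where lim: "Y \<longlonglongrightarrow> y"
    by (simp only: sum_lessThan_telescope Y0 diff_zero)
  show ?thesis
  proof (rule that)
    have "(\<lambda>n. Y (Suc n) + Y (Suc n)) \<longlonglongrightarrow> y + y"
      by (intro tendsto_add LIMSEQ_Suc lim)
    moreover have "(\<lambda>n. Y (Suc n) + Y (Suc n)) = (\<lambda>n. h + Y n * Y n)"
      by (simp add: YS scaleR_add_left[symmetric])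
    moreover have "(\<lambda>n. h + Y n * Y n) \<longlonglongrightarrow> h + y * y"
      by (intro tendsto_intros lim)
    ultimately show "y + y = h + y * y"
      using LIMSEQ_unique by metis
    have "norm (Y n) \<le> 1" for n using Y_bound[of n] root_majorant_bounds[of n] by auto
    then show "norm y \<le> 1"
      by (intro LIMSEQ_le_const2[OF tendsto_norm[OF lim]]) auto
    fix S assume S: "closed S" "0 \<in> S" "\<And>z. z \<in> S \<Longrightarrow> (1 / 2) *\<^sub>R (h + z * z) \<in> S"
    have "Y n \<in> S" for n by (induction n) (auto simp: Y0 YS S)
    then show "y \<in> S" using S(1) lim closed_sequentially by blast
  qed
qed

lemma closed_commutant: "closed {y::'a::real_normed_algebra. x * y = y * x}"
  by (intro closed_Collect_eq continuous_intros)

lemma closed_self_adjoint: "closed {y::'a::banach_star_algebra. star y = y}"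
  by (intro closed_Collect_eq continuous_intros continuous_on_star)


section \<open>Unitization\<close>

datatype 'a unitization = Unitization (alg_part: 'a) (scal_part: complex)

lemma unitization_eqI:
  "alg_part x = alg_part y \<Longrightarrow> scal_part x = scal_part y \<Longrightarrow> x = y"
  by (rule unitization.expand) simp

text \<open>Multiplication by an element of the unitization, as an operator on the ideal \<open>'a\<close>.\<close>

definition uact :: "'a::banach_star_algebra unitization \<Rightarrow> 'a \<Rightarrow> 'a" where
  "uact x b = alg_part x * b + scal_part x *\<^sub>C b"

lemma bounded_linear_uact: "bounded_linear (uact x)"
  unfolding uact_def
  by (intro bounded_linear_add bounded_linear_mult_right bounded_linear_scaleC)

text \<open>The norm is that of the direct sum of the action on the ideal and the character
  \<open>scal_part\<close>. The operator norm alone is only a seminorm if the algebra already has a unit.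
  With the maximum, unital and nonunital algebras need no distinction, and the embedding is
  isometric in both cases.\<close>

instantiation unitization :: (cstar_algebra) real_normed_algebra_1
begin

definition "0 = Unitization 0 0"
definition "1 = Unitization 0 1"
definition "x + y = Unitization (alg_part x + alg_part y) (scal_part x + scal_part y)"
definition "x - y = Unitization (alg_part x - alg_part y) (scal_part x - scal_part y)"
definition "- x = Unitization (- alg_part x) (- scal_part x)"
definition "r *\<^sub>R x = Unitization (r *\<^sub>R alg_part x) (r *\<^sub>R scal_part x)"
definition "x * y = Unitization
  (alg_part x * alg_part y + scal_part x *\<^sub>C alg_part y + scal_part y *\<^sub>C alg_part x)
  (scal_part x * scal_part y)"
definition "norm x = max (onorm (uact x)) (cmod (scal_part x))"
definition "sgn x = inverse (norm x) *\<^sub>R (x :: 'a unitization)"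
definition "dist x y = norm (x - y :: 'a unitization)"
definition "uniformity = (INF e\<in>{0<..}. principal {(x :: 'a unitization, y). dist x y < e})"
definition open_unitization :: "'a unitization set \<Rightarrow> bool" where
  "open_unitization U = (\<forall>x\<in>U. eventually (\<lambda>(x', y). x' = x \<longrightarrow> y \<in> U) uniformity)"

lemmas unitization_ops = zero_unitization_def one_unitization_def plus_unitization_def
  minus_unitization_def uminus_unitization_def scaleR_unitization_def times_unitization_def

lemma unitization_sel [simp]:
  "alg_part (0 :: 'a unitization) = 0" "scal_part (0 :: 'a unitization) = 0"
  "alg_part (1 :: 'a unitization) = 0" "scal_part (1 :: 'a unitization) = 1"
  "alg_part (x + y :: 'a unitization) = alg_part x + alg_part y"
  "scal_part (x + y :: 'a unitization) = scal_part x + scal_part y"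
  "alg_part (x - y :: 'a unitization) = alg_part x - alg_part y"
  "scal_part (x - y :: 'a unitization) = scal_part x - scal_part y"
  "alg_part (- x :: 'a unitization) = - alg_part x"
  "scal_part (- x :: 'a unitization) = - scal_part x"
  "alg_part (r *\<^sub>R x :: 'a unitization) = r *\<^sub>R alg_part x"
  "scal_part (r *\<^sub>R x :: 'a unitization) = r *\<^sub>R scal_part x"
  "alg_part (x * y :: 'a unitization) =
     alg_part x * alg_part y + scal_part x *\<^sub>C alg_part y + scal_part y *\<^sub>C alg_part x"
  "scal_part (x * y :: 'a unitization) = scal_part x * scal_part y"
  by (simp_all add: unitization_ops)

lemma uact_simps:
  "uact (x + y :: 'a unitization) = (\<lambda>b. uact x b + uact y b)"
  "uact (r *\<^sub>R x :: 'a unitization) = (\<lambda>b. r *\<^sub>R uact x b)"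
  "uact (x * y :: 'a unitization) = uact x \<circ> uact y"
  by (auto simp: fun_eq_iff uact_def star_simps algebra_simps scaleC_of_real[symmetric]
      scaleC_scaleC scaleR_conv_of_real)

lemma onorm_uact_nonneg: "0 \<le> onorm (uact x)"
  by (rule onorm_pos_le[OF bounded_linear_uact])

lemma onorm_uact_alg: "onorm (uact (Unitization a 0)) = norm (a :: 'a)"
proof (rule antisym)
  show "onorm (uact (Unitization a 0)) \<le> norm a"
    by (rule onorm_bound) (auto simp: uact_def norm_mult_ineq)
  have "norm (a * star a) \<le> onorm (uact (Unitization a 0)) * norm (star a)"
    using onorm[OF bounded_linear_uact, of "Unitization a 0" "star a"] by (simp add: uact_def)
  moreover have "norm (a * star a) = norm a * norm a"
    using cstar_identity[of "star a"] by (simp add: star_star norm_star power2_eq_square)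
  ultimately show "norm a \<le> onorm (uact (Unitization a 0))"
    by (cases "norm a = 0") (auto simp: norm_star onorm_uact_nonneg)
qed

lemma scal_part_bound: "cmod (scal_part x) \<le> norm (x :: 'a unitization)"
  by (simp add: norm_unitization_def)

lemma norm_unitization_le: "norm (x :: 'a unitization) \<le> norm (alg_part x) + cmod (scal_part x)"
proof -
  have "onorm (uact x) \<le> norm (alg_part x) + cmod (scal_part x)"
    unfolding uact_def
    by (rule onorm_bound)
      (auto simp: distrib_right norm_mult_ineq norm_scaleC intro!: norm_triangle_le add_mono)
  then show ?thesis by (simp add: norm_unitization_def)
qed

instance
proof
  fix x y z :: "'a unitization" and r s :: real
  show "x + y + z = x + (y + z)" "x + y = y + x" "0 + x = x" "- x + x = 0" "x - y = x + - y"
    by (simp_all add: unitization_eqI algebra_simps)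
  show "r *\<^sub>R (x + y) = r *\<^sub>R x + r *\<^sub>R y" "(r + s) *\<^sub>R x = r *\<^sub>R x + s *\<^sub>R x"
    "r *\<^sub>R s *\<^sub>R x = (r * s) *\<^sub>R x" "1 *\<^sub>R x = x"
    by (simp_all add: unitization_eqI algebra_simps)
  show "x * y * z = x * (y * z)" "(x + y) * z = x * z + y * z" "x * (y + z) = x * y + x * z"
    "1 * x = x" "x * 1 = x"
    by (rule unitization_eqI; simp add: algebra_simps star_simps)+
  show "r *\<^sub>R x * y = r *\<^sub>R (x * y)" "x * r *\<^sub>R y = r *\<^sub>R (x * y)"
    by (rule unitization_eqI;
        simp add: scaleC_of_real[symmetric] star_simps scaleR_conv_of_real mult_ac)+
  show "(0 :: 'a unitization) \<noteq> 1"
    by (metis unitization_sel(2,4) zero_neq_one)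
  show "dist x y = norm (x - y)" by (rule dist_unitization_def)
  show "sgn x = inverse (norm x) *\<^sub>R x" by (rule sgn_unitization_def)
  show "uniformity = (INF e\<in>{0<..}. principal {(x :: 'a unitization, y). dist x y < e})"
    by (rule uniformity_unitization_def)
  show "open U = (\<forall>x\<in>U. \<forall>\<^sub>F (x', y) in uniformity. x' = x \<longrightarrow> y \<in> U)" for U :: "'a unitization set"
    by (rule open_unitization_def)
  show "norm x = 0 \<longleftrightarrow> x = 0"
  proof
    assume 0: "norm x = 0"
    then have s: "scal_part x = 0" using scal_part_bound[of x] by simp
    then have "x = Unitization (alg_part x) 0" by (simp add: unitization_eqI)
    moreover have "onorm (uact x) = 0"
      using 0 onorm_uact_nonneg[of x] by (simp add: norm_unitization_def max_def split: if_splits)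
    ultimately have "alg_part x = 0" using onorm_uact_alg[of "alg_part x"] by simp
    then show "x = 0" using s by (simp add: unitization_eqI)
  qed (use norm_unitization_le[of x] scal_part_bound[of x] in simp)
  show "norm (x + y) \<le> norm x + norm y"
    using onorm_triangle[OF bounded_linear_uact[of x] bounded_linear_uact[of y]]
      norm_triangle_ineq[of "scal_part x" "scal_part y"]
    unfolding norm_unitization_def uact_simps by (simp add: max_def)
  show "norm (r *\<^sub>R x) = \<bar>r\<bar> * norm x"
    unfolding norm_unitization_def uact_simps
    by (simp add: onorm_scaleR[OF bounded_linear_uact] max_mult_distrib_left)
  show "norm (x * y) \<le> norm x * norm y"
  proof -
    have "onorm (uact (x * y)) \<le> onorm (uact x) * onorm (uact y)"
      unfolding uact_simps by (rule onorm_compose[OF bounded_linear_uact bounded_linear_uact])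
    also have "\<dots> \<le> norm x * norm y"
      by (intro mult_mono) (auto simp: norm_unitization_def onorm_uact_nonneg le_max_iff_disj)
    finally have "onorm (uact (x * y)) \<le> norm x * norm y" .
    moreover have "cmod (scal_part (x * y)) \<le> norm x * norm y"
      using mult_mono[OF scal_part_bound[of x] scal_part_bound[of y]] norm_ge_zero[of "scal_part x"]
        scal_part_bound[of x]
      by (simp add: norm_mult order_trans[OF norm_ge_zero[of "scal_part x"]])
    ultimately show ?thesis by (subst (1) norm_unitization_def) simp
  qed
  show "norm (1 :: 'a unitization) = 1"
  proof -
    have "onorm (uact (1 :: 'a unitization)) \<le> 1"
      by (rule onorm_bound) (auto simp: uact_def scaleC_one)
    then show ?thesis by (simp add: norm_unitization_def)
  qed
qed

end

instance unitization :: (cstar_algebra) banach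
proof
  fix X :: "nat \<Rightarrow> 'a unitization" assume X: "Cauchy X"
  have alg_le: "norm (alg_part x) \<le> 2 * norm x" for x :: "'a unitization"
  proof -
    have "Unitization (alg_part x) 0 = x - Unitization 0 (scal_part x)"
      by (simp add: unitization_eqI)
    then have "norm (Unitization (alg_part x) 0) \<le> norm x + norm (Unitization (0::'a) (scal_part x))"
      using norm_triangle_ineq4 by metis
    moreover have "norm (Unitization (0::'a) (scal_part x)) \<le> cmod (scal_part x)"
      using norm_unitization_le[of "Unitization (0::'a) (scal_part x)"] by simp
    moreover have "norm (alg_part x) \<le> norm (Unitization (alg_part x) 0)"
      by (simp add: norm_unitization_def onorm_uact_alg)
    ultimately show ?thesis using scal_part_bound[of x] by linarith
  qed
  have "Cauchy (\<lambda>n. alg_part (X n))"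
  proof (rule CauchyI)
    fix e :: real assume "e > 0"
    then obtain M where "\<forall>m\<ge>M. \<forall>n\<ge>M. norm (X m - X n) < e / 2"
      using CauchyD[OF X, of "e / 2"] by auto
    then have "norm (alg_part (X m) - alg_part (X n)) < e" if "m \<ge> M" "n \<ge> M" for m n :: nat
      using alg_le[of "X m - X n"] that by fastforce
    then show "\<exists>M. \<forall>m\<ge>M. \<forall>n\<ge>M. norm (alg_part (X m) - alg_part (X n)) < e" by blast
  qed
  moreover have "Cauchy (\<lambda>n. scal_part (X n))"
  proof (rule CauchyI)
    fix e :: real assume "e > 0"
    then obtain M where "\<forall>m\<ge>M. \<forall>n\<ge>M. norm (X m - X n) < e"
      using CauchyD[OF X, of e] by auto
    then have "norm (scal_part (X m) - scal_part (X n)) < e" if "m \<ge> M" "n \<ge> M" for m n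
      using scal_part_bound[of "X m - X n"] that
      by (auto intro: order_le_less_trans[of _ "norm (X m - X n)"])
    then show "\<exists>M. \<forall>m\<ge>M. \<forall>n\<ge>M. norm (scal_part (X m) - scal_part (X n)) < e" by blast
  qed
  ultimately obtain a l where al: "(\<lambda>n. alg_part (X n)) \<longlonglongrightarrow> a" "(\<lambda>n. scal_part (X n)) \<longlonglongrightarrow> l"
    using Cauchy_convergent convergent_def by metis
  have "(\<lambda>n. norm (X n - Unitization a l)) \<longlonglongrightarrow> 0"
  proof (rule tendsto_sandwich[OF _ _ tendsto_const])
    show "(\<lambda>n. norm (alg_part (X n) - a) + cmod (scal_part (X n) - l)) \<longlonglongrightarrow> 0"
      using tendsto_add[OF tendsto_norm_zero[OF LIM_zero[OF al(1)]] tendsto_norm_zero[OF LIM_zero[OF al(2)]]]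
      by simp
    show "\<forall>\<^sub>F n in sequentially. norm (X n - Unitization a l)
        \<le> norm (alg_part (X n) - a) + cmod (scal_part (X n) - l)"
      using norm_unitization_le[of "X _ - Unitization a l"] by (intro always_eventually allI) simp
  qed auto
  then show "convergent X"
    by (auto simp: convergent_def intro: LIM_zero_cancel tendsto_norm_zero_cancel)
qed

instantiation unitization :: (cstar_algebra) cstar_algebra
begin

definition "c *\<^sub>C x = Unitization (c *\<^sub>C alg_part x) (c * scal_part x)"
definition "star x = Unitization (star (alg_part x)) (cnj (scal_part x))"

lemma unitization_star_sel [simp]:
  "alg_part (c *\<^sub>C x :: 'a unitization) = c *\<^sub>C alg_part x"
  "scal_part (c *\<^sub>C x :: 'a unitization) = c * scal_part x"
  "alg_part (star x :: 'a unitization) = star (alg_part x)"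
  "scal_part (star x :: 'a unitization) = cnj (scal_part x)"
  by (simp_all add: scaleC_unitization_def star_unitization_def)

text \<open>The C*-identity for the operator norm is inherited from the one for \<open>x b\<close>, since
  \<open>(x b)\<^sup>* (x b) = b\<^sup>* (x\<^sup>* x) b\<close>.\<close>

lemma onorm_uact_square: "(onorm (uact x))\<^sup>2 \<le> onorm (uact (star x * x :: 'a unitization))"
proof -
  let ?q = "onorm (uact (star x * x))"
  have "norm (uact x b) \<le> sqrt ?q * norm b" for b
  proof -
    have "star (uact x b) * uact x b = star b * uact (star x * x) b"
      by (simp add: uact_def star_simps algebra_simps)
    then have "(norm (uact x b))\<^sup>2 \<le> norm (star b) * norm (uact (star x * x) b)"
      by (metis cstar_identity norm_mult_ineq)
    also have "\<dots> \<le> norm b * (?q * norm b)"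
      by (auto simp: norm_star intro!: mult_left_mono onorm[OF bounded_linear_uact])
    also have "\<dots> = (sqrt ?q * norm b)\<^sup>2"
      by (simp add: power2_eq_square onorm_uact_nonneg)
    finally show ?thesis
      by (rule power2_le_imp_le) (simp add: onorm_uact_nonneg)
  qed
  then have "onorm (uact x) \<le> sqrt ?q"
    by (intro onorm_bound) (simp_all add: onorm_uact_nonneg)
  then have "(onorm (uact x))\<^sup>2 \<le> (sqrt ?q)\<^sup>2"
    by (rule power_mono) (rule onorm_uact_nonneg)
  then show ?thesis by (simp add: onorm_uact_nonneg)
qed

lemma onorm_uact_star: "onorm (uact (star x)) = onorm (uact (x :: 'a unitization))"
proof -
  have le: "onorm (uact x) \<le> onorm (uact (star x))" for x :: "'a unitization"
  proof -
    have "(onorm (uact x))\<^sup>2 \<le> onorm (uact (star x)) * onorm (uact x)"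
      using onorm_uact_square[of x]
        onorm_compose[OF bounded_linear_uact[of "star x"] bounded_linear_uact[of x]]
      by (simp add: uact_simps)
    then show ?thesis
      using onorm_uact_nonneg[of x] onorm_uact_nonneg[of "star x"]
      by (cases "onorm (uact x) = 0") (auto simp: power2_eq_square)
  qed
  have "star (star x) = x" by (simp add: unitization_eqI star_star)
  then show ?thesis using le[of x] le[of "star x"] by simp
qed

instance
proof
  fix x y :: "'a unitization" and c d :: complex and r :: real
  show "c *\<^sub>C (x + y) = c *\<^sub>C x + c *\<^sub>C y" "(c + d) *\<^sub>C x = c *\<^sub>C x + d *\<^sub>C x"
    "c *\<^sub>C d *\<^sub>C x = (c * d) *\<^sub>C x" "1 *\<^sub>C x = x" "c *\<^sub>C x * y = c *\<^sub>C (x * y)"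
    "x * c *\<^sub>C y = c *\<^sub>C (x * y)" "star (star x) = x" "star (x + y) = star x + star y"
    "star (c *\<^sub>C x) = cnj c *\<^sub>C star x" "star (x * y) = star y * star x"
    by (simp_all add: unitization_eqI star_simps algebra_simps)
  show "complex_of_real r *\<^sub>C x = r *\<^sub>R x"
    by (rule unitization_eqI; simp add: scaleC_of_real; simp add: scaleR_conv_of_real)
  show "norm (star x) = norm x"
    by (simp add: norm_unitization_def onorm_uact_star)
  show "norm (c *\<^sub>C x) = cmod c * norm x"
  proof -
    have bound: "onorm (uact (c *\<^sub>C x)) \<le> cmod c * onorm (uact x)" for c and x :: "'a unitization"
    proof (rule onorm_bound)
      fix b
      have "uact (c *\<^sub>C x) b = c *\<^sub>C uact x b" by (simp add: uact_def star_simps)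
      then show "norm (uact (c *\<^sub>C x) b) \<le> cmod c * onorm (uact x) * norm b"
        using onorm[OF bounded_linear_uact, of x b] by (simp add: norm_scaleC mult.assoc mult_left_mono)
    qed (simp add: onorm_uact_nonneg)
    have "onorm (uact (c *\<^sub>C x)) = cmod c * onorm (uact x)"
    proof (cases "c = 0")
      case True
      then show ?thesis using bound[of c x] onorm_uact_nonneg[of "c *\<^sub>C x"] by simp
    next
      case False
      have "x = inverse c *\<^sub>C c *\<^sub>C x" using False by (simp add: unitization_eqI star_simps)
      then have "onorm (uact x) \<le> inverse (cmod c) * onorm (uact (c *\<^sub>C x))"
        using bound[of "inverse c" "c *\<^sub>C x"] by (simp add: norm_inverse)
      then show ?thesis using bound[of c x] False by (simp add: field_simps)
    qed
    then show ?thesis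
      by (simp add: norm_unitization_def norm_mult max_mult_distrib_left)
  qed
  show "norm (star x * x) = (norm x)\<^sup>2"
  proof -
    have "onorm (uact (star x * x)) \<le> onorm (uact (star x)) * onorm (uact x)"
      unfolding uact_simps by (rule onorm_compose[OF bounded_linear_uact bounded_linear_uact])
    then have "onorm (uact (star x * x)) = (onorm (uact x))\<^sup>2"
      using onorm_uact_square[of x] by (simp add: onorm_uact_star power2_eq_square)
    moreover have "max (s\<^sup>2) (t\<^sup>2) = (max s t)\<^sup>2" if "0 \<le> s" "0 \<le> t" for s t :: real
      using that power_mono[of s t 2] power_mono[of t s 2] by (auto simp: max_def)
    ultimately show ?thesis
      by (simp add: norm_unitization_def norm_mult power2_eq_square[of "cmod _", symmetric]
          onorm_uact_nonneg)
  qed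
qed

end

class unital_cstar_algebra = cstar_algebra + real_normed_algebra_1

instance unitization :: (cstar_algebra) unital_cstar_algebra ..

definition into_unitization :: "'a::cstar_algebra \<Rightarrow> 'a unitization" where
  "into_unitization a = Unitization a 0"

lemma into_unitization_sel [simp]:
  "alg_part (into_unitization a) = a" "scal_part (into_unitization a) = 0"
  by (simp_all add: into_unitization_def)

lemma norm_into_unitization [simp]: "norm (into_unitization a) = norm a"
  by (simp add: norm_unitization_def into_unitization_def onorm_uact_alg)

lemma into_unitization_eq_iff [simp]: "into_unitization a = into_unitization b \<longleftrightarrow> a = b"
  by (simp add: into_unitization_def)

lemma into_unitization_simps:
  "into_unitization 0 = 0"
  "into_unitization (a + b) = into_unitization a + into_unitization b"
  "into_unitization (a - b) = into_unitization a - into_unitization b"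
  "into_unitization (- a) = - into_unitization a"
  "into_unitization (a * b) = into_unitization a * into_unitization b"
  "into_unitization (c *\<^sub>C a) = c *\<^sub>C into_unitization a"
  "into_unitization (r *\<^sub>R a) = r *\<^sub>R into_unitization a"
  "into_unitization (star a) = star (into_unitization a)"
  by (simp_all add: unitization_eqI star_simps)

lemma into_unitization_sum: "into_unitization (\<Sum>i\<in>I. f i) = (\<Sum>i\<in>I. into_unitization (f i))"
  by (induction I rule: infinite_finite_induct) (simp_all add: into_unitization_simps)

lemma into_unitization_uact: "into_unitization (uact x a) = x * into_unitization a"
  by (simp add: unitization_eqI uact_def)

lemma into_unitization_alg_part: "scal_part x = 0 \<Longrightarrow> into_unitization (alg_part x) = x"
  by (simp add: unitization_eqI)

section \<open>Positive elements of a unital C*-algebra\<close>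

text \<open>Elements obtained from \<open>h\<close> by the iteration lie in its bicommutant, so any two of them
  commute. This is the only trace of the commutative functional calculus that is used.\<close>

definition bicommutant :: "'a::times \<Rightarrow> 'a set" where
  "bicommutant h = {x. \<forall>z. z * h = h * z \<longrightarrow> z * x = x * z}"

lemma bicommutant_self: "h \<in> bicommutant h"
  by (simp add: bicommutant_def)

lemma bicommutant_commute: "x \<in> bicommutant h \<Longrightarrow> y \<in> bicommutant h \<Longrightarrow> x * y = y * x"
  unfolding bicommutant_def mem_Collect_eq by (drule spec[of _ h]) simp

lemma bicommutant_trans: "x \<in> bicommutant h \<Longrightarrow> y \<in> bicommutant x \<Longrightarrow> y \<in> bicommutant h"
  by (simp add: bicommutant_def)

lemma bicommutant_mult:
  fixes x y h :: "'a::semigroup_mult"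
  shows "x \<in> bicommutant h \<Longrightarrow> y \<in> bicommutant h \<Longrightarrow> x * y \<in> bicommutant h"
  unfolding bicommutant_def mem_Collect_eq
proof (intro allI impI)
  fix z assume *: "\<forall>z. z * h = h * z \<longrightarrow> z * x = x * z" "\<forall>z. z * h = h * z \<longrightarrow> z * y = y * z"
    "z * h = h * z"
  then have "z * x = x * z" "z * y = y * z" by blast+
  then show "z * (x * y) = x * y * z" by (simp add: mult.assoc[symmetric]) (simp add: mult.assoc)
qed

lemma bicommutant_linear:
  fixes x y h :: "'a::real_normed_algebra_1"
  shows "x \<in> bicommutant h \<Longrightarrow> y \<in> bicommutant h \<Longrightarrow> x + y \<in> bicommutant h"
    "x \<in> bicommutant h \<Longrightarrow> y \<in> bicommutant h \<Longrightarrow> x - y \<in> bicommutant h"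
    "x \<in> bicommutant h \<Longrightarrow> r *\<^sub>R x \<in> bicommutant h" "1 \<in> bicommutant h"
    "x \<in> bicommutant h \<Longrightarrow> - x \<in> bicommutant h"
  by (simp_all add: bicommutant_def algebra_simps)

lemma closed_bicommutant: "closed (bicommutant (h::'a::real_normed_algebra))"
proof -
  have "bicommutant h = (\<Inter>z\<in>{z. z * h = h * z}. {x. z * x = x * z})"
    by (auto simp: bicommutant_def)
  then show ?thesis by (simp add: closed_INT closed_commutant)
qed

lemma star_one: "star (1::'a::unital_cstar_algebra) = 1"
  by (metis mult_1_right star_mult star_star)

lemma unital_root:
  fixes h :: "'a::unital_cstar_algebra"
  assumes "star h = h" "norm h \<le> 1"
  obtains y where "star y = y" "norm y \<le> 1" "y \<in> bicommutant h" "(1 - y) * (1 - y) = 1 - h"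
proof -
  obtain y where y: "y + y = h + y * y" "norm y \<le> 1" and
    S: "\<And>S. closed S \<Longrightarrow> 0 \<in> S \<Longrightarrow> (\<And>z. z \<in> S \<Longrightarrow> (1 / 2) *\<^sub>R (h + z * z) \<in> S) \<Longrightarrow> y \<in> S"
    using root_iteration[OF assms(2)] by metis
  show ?thesis
  proof (rule that)
    have "y \<in> {y. star y = y}"
      by (rule S[OF closed_self_adjoint]) (auto simp: star_simps assms)
    then show "star y = y" by simp
    show "y \<in> bicommutant h"
    proof (rule S[OF closed_bicommutant])
      show "0 \<in> bicommutant h" by (simp add: bicommutant_def)
    qed (intro bicommutant_linear bicommutant_mult bicommutant_self)
    have "(1 - y) * (1 - y) = 1 - (y + y) + y * y" by (simp add: algebra_simps)
    then show "(1 - y) * (1 - y) = 1 - h" by (simp add: y(1))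
  qed (rule y(2))
qed

text \<open>If \<open>s\<close> and \<open>k\<close> commute, then \<open>u = s + \<i> k\<close> has \<open>u\<^sup>* u = r\<^sup>2\<close>, and \<open>s\<close> is the real part of
  \<open>u\<close>.\<close>

lemma norm_le_of_square_sum:
  fixes s k :: "'a::unital_cstar_algebra"
  assumes "star s = s" "star k = k" "s * k = k * s" "s * s + k * k = r\<^sup>2 *\<^sub>R 1" "0 \<le> r"
  shows "norm s \<le> r"
proof -
  define u where "u = s + \<i> *\<^sub>C k"
  have su: "star u = s - \<i> *\<^sub>C k"
    using assms by (simp add: u_def star_simps)
  have "star u * u = s * s + k * k"
    unfolding su by (simp add: u_def star_simps algebra_simps assms(3))
  then have "(norm u)\<^sup>2 = r\<^sup>2" using cstar_identity[of u] assms(4) by simp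
  then have nu: "norm u = r" using assms(5) by simp
  have "2 *\<^sub>R s = u + star u" unfolding su by (simp add: u_def scaleR_2)
  then have "norm (2 *\<^sub>R s) \<le> norm u + norm (star u)" by (metis norm_triangle_ineq)
  then show ?thesis by (simp add: norm_star nu)
qed

text \<open>The bound on the norm of \<open>w\<close> is not visible in the iteration; it comes from
  \<open>w\<^sup>2 + g\<^sup>2 = 1\<close>.\<close>

lemma norm_one_minus_square:
  fixes g :: "'a::unital_cstar_algebra"
  assumes g: "star g = g" "norm g \<le> 1"
  obtains w where "star w = w" "w * w = 1 - g * g" "norm w \<le> 1" "w \<in> bicommutant g"
proof -
  have "norm (g * g) \<le> 1" using g by (simp add: norm_square_self_adjoint power_le_one)
  moreover have "star (g * g) = g * g" using g by (simp add: star_mult)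
  ultimately obtain y where y: "star y = y" "y \<in> bicommutant (g * g)" "(1 - y) * (1 - y) = 1 - g * g"
    using unital_root by metis
  have "y \<in> bicommutant g"
    by (rule bicommutant_trans[OF bicommutant_mult y(2)]) (rule bicommutant_self)+
  then have b: "1 - y \<in> bicommutant g" by (intro bicommutant_linear)
  show ?thesis
  proof (rule that)
    show "norm (1 - y) \<le> 1"
    proof (rule norm_le_of_square_sum[where k = g])
      show "(1 - y) * g = g * (1 - y)" using bicommutant_commute[OF b bicommutant_self] .
    qed (auto simp: star_diff star_one y g)
  qed (use y b in \<open>auto simp: star_diff star_one\<close>)
qed

text \<open>Squares of self-adjoint elements. That they form a cone follows from the characterisation
  of positivity of a self-adjoint \<open>h\<close> by \<open>\<parallel>r - h\<parallel> \<le> r\<close> for some (equivalently, every) \<open>r \<ge> \<parallel>h\<parallel>\<close>,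
  given by the next lemmas.\<close>

definition posit :: "'a::banach_star_algebra \<Rightarrow> bool" where
  "posit h \<longleftrightarrow> (\<exists>y. star y = y \<and> h = y * y)"

lemma posit_square: "star y = y \<Longrightarrow> posit (y * y)"
  by (auto simp: posit_def)

lemma posit_self_adjoint: "posit h \<Longrightarrow> star h = h"
  by (auto simp: posit_def star_mult)

lemma posit_zero: "posit 0"
  using posit_square[of 0] by (simp add: star_zero)

lemma posit_norm_bound:
  fixes h :: "'a::unital_cstar_algebra"
  assumes "posit h" "norm h \<le> r"
  shows "norm (r *\<^sub>R 1 - h) \<le> r"
proof (cases "r = 0")
  case False
  then have r: "r > 0" using assms(2) norm_ge_zero[of h] by linarith
  obtain y where y: "star y = y" "h = y * y" using assms(1) by (auto simp: posit_def)
  define g where "g = (1 / sqrt r) *\<^sub>R y"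
  have gg: "g * g = (1 / r) *\<^sub>R h" using r by (simp add: g_def y(2))
  have "(norm y)\<^sup>2 \<le> r" using assms(2) norm_square_self_adjoint[OF y(1)] y(2) by simp
  then have "norm y \<le> sqrt r" by (simp add: real_le_rsqrt)
  then have "norm g \<le> 1" using r by (simp add: g_def field_simps)
  moreover have "star g = g" by (simp add: g_def star_scaleR y)
  ultimately obtain w where "w * w = 1 - g * g" "norm w \<le> 1"
    using norm_one_minus_square by metis
  then have "norm (1 - (1 / r) *\<^sub>R h) \<le> 1"
    by (metis gg mult_le_one norm_ge_zero norm_mult_ineq order_trans)
  moreover have "r *\<^sub>R 1 - h = r *\<^sub>R (1 - (1 / r) *\<^sub>R h)"
    using r by (simp add: scaleR_diff_right)
  ultimately show ?thesis using r by (simp add: mult_left_le)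
qed (use assms in simp)

lemma posit_root_of_norm_bound:
  fixes h :: "'a::unital_cstar_algebra"
  assumes "star h = h" "norm (r *\<^sub>R 1 - h) \<le> r"
  obtains y where "star y = y" "y * y = h" "y \<in> bicommutant h"
    "norm (sqrt r *\<^sub>R 1 - y) \<le> sqrt r"
proof (cases "r = 0")
  case True
  then show ?thesis
    using assms that[of 0] by (auto simp: star_zero bicommutant_def)
next
  case False
  then have r: "r > 0" using assms(2) norm_ge_zero[of "r *\<^sub>R 1 - h"] by linarith
  define e where "e = 1 - (1 / r) *\<^sub>R h"
  have "r *\<^sub>R e = r *\<^sub>R 1 - h" using r by (simp add: e_def scaleR_diff_right)
  then have "norm e \<le> 1" using assms(2) r by (metis abs_of_pos mult_le_cancel_left2 norm_scaleR not_less)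
  moreover have "star e = e" by (simp add: e_def star_simps star_one assms)
  ultimately obtain y where y: "star y = y" "norm y \<le> 1" "y \<in> bicommutant e" "(1 - y) * (1 - y) = 1 - e"
    using unital_root by metis
  have "e \<in> bicommutant h" unfolding e_def by (intro bicommutant_linear bicommutant_self)
  then have b: "y \<in> bicommutant h" using y(3) bicommutant_trans by metis
  show ?thesis
  proof (rule that[of "sqrt r *\<^sub>R (1 - y)"])
    show "sqrt r *\<^sub>R (1 - y) * sqrt r *\<^sub>R (1 - y) = h"
      using r by (simp add: y(4)) (simp add: e_def)
    show "norm (sqrt r *\<^sub>R 1 - sqrt r *\<^sub>R (1 - y)) \<le> sqrt r"
      using r y(2) by (simp add: scaleR_diff_right[symmetric] mult_left_le)
  qed (auto simp: star_simps star_one y b intro!: bicommutant_linear)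
qed

lemma posit_of_norm_bound:
  "star h = h \<Longrightarrow> norm (r *\<^sub>R 1 - h) \<le> r \<Longrightarrow> posit (h :: 'a::unital_cstar_algebra)"
  by (metis posit_root_of_norm_bound posit_def)

lemma posit_sqrt:
  fixes h :: "'a::unital_cstar_algebra"
  assumes "posit h"
  obtains y where "star y = y" "y * y = h" "y \<in> bicommutant h" "posit y"
proof -
  obtain y where "star y = y" "y * y = h" "y \<in> bicommutant h"
    "norm (sqrt (norm h) *\<^sub>R 1 - y) \<le> sqrt (norm h)"
    using posit_root_of_norm_bound[OF posit_self_adjoint posit_norm_bound] assms by blast
  then show ?thesis using that posit_of_norm_bound by metis
qed

lemma posit_add:
  fixes h k :: "'a::unital_cstar_algebra"
  assumes "posit h" "posit k"
  shows "posit (h + k)"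
proof (rule posit_of_norm_bound[where r = "norm h + norm k"])
  have "(norm h + norm k) *\<^sub>R 1 - (h + k) = (norm h *\<^sub>R 1 - h) + (norm k *\<^sub>R 1 - k)"
    by (simp add: algebra_simps)
  then show "norm ((norm h + norm k) *\<^sub>R 1 - (h + k)) \<le> norm h + norm k"
    using posit_norm_bound[OF assms(1) order_refl] posit_norm_bound[OF assms(2) order_refl]
    by (metis add_mono norm_triangle_le)
qed (simp add: star_add assms posit_self_adjoint)

lemma posit_sum:
  "(\<And>i. i \<in> I \<Longrightarrow> posit (f i)) \<Longrightarrow> posit (\<Sum>i\<in>I. f i :: 'a::unital_cstar_algebra)"
  by (induction I rule: infinite_finite_induct) (auto simp: posit_zero posit_add)

lemma posit_scaleR:
  assumes "posit h" "0 \<le> r"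
  shows "posit (r *\<^sub>R h)"
proof -
  obtain y where "star y = y" "h = y * y" using assms by (auto simp: posit_def)
  then show ?thesis using assms(2) posit_square[of "sqrt r *\<^sub>R y"] by (simp add: star_scaleR)
qed

lemma closed_posit: "closed {h::'a::unital_cstar_algebra. posit h}"
proof -
  have "{h::'a. posit h} = {h. star h = h} \<inter> {h. norm (norm h *\<^sub>R 1 - h) \<le> norm h}"
    using posit_norm_bound posit_of_norm_bound posit_self_adjoint by blast
  then show ?thesis
    by (auto intro!: closed_Int closed_self_adjoint closed_Collect_le continuous_intros)
qed

text \<open>With commuting roots \<open>y\<close> of \<open>h\<close> and \<open>z\<close> of \<open>- h\<close>, the element \<open>u = y z + \<i> h\<close> satisfies
  \<open>u\<^sup>* u = y\<^sup>2 z\<^sup>2 + h\<^sup>2 = 0\<close>.\<close>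

lemma posit_antisym:
  fixes h :: "'a::unital_cstar_algebra"
  assumes "posit h" "posit (- h)"
  shows "h = 0"
proof -
  obtain y where y: "star y = y" "y * y = h" "y \<in> bicommutant h" using posit_sqrt[OF assms(1)] by metis
  obtain z where z: "star z = z" "z * z = - h" "z \<in> bicommutant (- h)"
    using posit_sqrt[OF assms(2)] by metis
  have zb: "z \<in> bicommutant h"
    by (rule bicommutant_trans[OF _ z(3)]) (intro bicommutant_linear bicommutant_self)
  have yz: "z * y = y * z" by (rule bicommutant_commute[OF zb y(3)])
  have b: "y * z \<in> bicommutant h" by (rule bicommutant_mult[OF y(3) zb])
  have sh: "star h = h" using assms(1) by (rule posit_self_adjoint)
  have h: "h * (y * z) = (y * z) * h" by (rule bicommutant_commute[OF bicommutant_self b])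
  have sq: "(y * z) * (y * z) = - (h * h)"
    by (metis (no_types, lifting) yz mult.assoc y(2) z(2) mult_minus_right)
  define u where "u = y * z + \<i> *\<^sub>C h"
  have su: "star u = y * z - \<i> *\<^sub>C h"
    by (simp add: u_def star_simps y z sh yz)
  have "star u * u = (y * z) * (y * z) + h * h"
    unfolding su
    by (simp add: u_def star_simps distrib_left distrib_right left_diff_distrib right_diff_distrib h)
  then have "u = 0" using sq cstar_star_mult_eq_0[of u] by simp
  then have "u - star u = 0" by (simp add: star_zero)
  moreover have "2 *\<^sub>R (\<i> *\<^sub>C h) = u - star u" unfolding su by (simp add: u_def scaleR_2)
  ultimately have "norm (\<i> *\<^sub>C h) = 0" by simp
  then show ?thesis by (simp add: norm_scaleC)
qed

text \<open>A root \<open>z\<close> of the modulus \<open>k\<close> is included because it makes \<open>k b\<^sup>2 = (z b)\<^sup>2\<close> a square for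
  every \<open>b\<close> commuting with \<open>z\<close>.\<close>

lemma abs_exists:
  fixes h :: "'a::unital_cstar_algebra"
  assumes "star h = h"
  obtains k z where "star k = k" "k * k = h * h" "k \<in> bicommutant h" "posit k"
    "star z = z" "z * z = k" "z \<in> bicommutant h"
proof -
  obtain k where k: "star k = k" "k * k = h * h" "k \<in> bicommutant (h * h)" "posit k"
    using posit_sqrt[OF posit_square[OF assms]] by metis
  have kb: "k \<in> bicommutant h"
    by (rule bicommutant_trans[OF bicommutant_mult k(3)]) (rule bicommutant_self)+
  obtain z where z: "star z = z" "z * z = k" "z \<in> bicommutant k"
    using posit_sqrt[OF k(4)] by metis
  show ?thesis
    by (rule that[OF k(1,2) kb k(4) z(1,2)]) (rule bicommutant_trans[OF kb z(3)])
qed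

lemma posit_if_abs_annihilates:
  fixes h k :: "'a::unital_cstar_algebra"
  assumes "star h = h" "star k = k" "posit k" "k * k = h * h" "h * k = k * h"
    and "k * (k - h) = 0"
  shows "posit h"
proof -
  have "(k - h) * (k - h) = k * (k - h) + k * (k - h)"
    using assms(4,5) by (simp add: algebra_simps)
  then have "(k - h) * (k - h) = 0" by (simp add: assms(6))
  moreover have "star (k - h) = k - h" by (simp add: star_diff assms(1,2))
  ultimately have "k - h = 0" by (rule self_adjoint_square_eq_0[rotated])
  then show ?thesis using assms(3) by simp
qed

text \<open>A number above one would make the left-hand side grow faster than linearly in the
  exponent.\<close>

lemma pow2_le_linear_imp_le_1:
  fixes c :: real
  assumes "\<And>k. c ^ (2 ^ k) \<le> 1 + 2 ^ k"
  shows "c \<le> 1"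
proof (rule ccontr)
  assume "\<not> c \<le> 1"
  then obtain d where d: "c = 1 + d" "d > 0" by (metis add.commute diff_add_cancel diff_gt_0_iff_gt not_less)
  obtain m :: nat where m: "2 / d\<^sup>2 < 2 ^ m"
    using real_arch_pow[of 2 "2 / d\<^sup>2"] by auto
  define N :: real where "N = 2 ^ m"
  have N: "N > 0" "2 < N * d\<^sup>2" using m d by (auto simp: N_def field_simps)
  have "1 + N * d \<le> c ^ (2 ^ m)"
    using Bernoulli_inequality[of d "2 ^ m"] d by (simp add: N_def)
  then have "(1 + N * d) * (1 + N * d) \<le> c ^ (2 ^ m) * c ^ (2 ^ m)"
    using N d by (intro mult_mono) auto
  also have "\<dots> = c ^ (2 ^ Suc m)" by (simp add: power_add[symmetric] mult_2)
  also have "\<dots> \<le> 1 + 2 * N" using assms[of "Suc m"] by (simp add: N_def)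
  finally have "2 * (N * d) + N * (N * d\<^sup>2) \<le> 2 * N"
    by (simp add: algebra_simps power2_eq_square)
  moreover have "N * (N * d\<^sup>2) > N * 2" using N by (intro mult_strict_left_mono) auto
  moreover have "N * d > 0" using N d by simp
  ultimately show False by linarith
qed

lemma norm_pow2_self_adjoint:
  fixes h :: "'a::unital_cstar_algebra"
  assumes "star h = h"
  shows "norm (h ^ (2 ^ k)) = norm h ^ (2 ^ k)"
proof (induction k)
  case (Suc k)
  have "star (h ^ n) = h ^ n" for n
    by (induction n) (auto simp: star_one star_mult assms power_commutes)
  then have "norm (h ^ (2 ^ k) * h ^ (2 ^ k)) = (norm (h ^ (2 ^ k)))\<^sup>2"
    by (rule norm_square_self_adjoint)
  then show ?case using Suc by (simp add: power_mult mult.commute[of 2] power2_eq_square)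
qed simp

text \<open>In a Banach algebra \<open>t t\<^sup>*\<close> and \<open>t\<^sup>* t\<close> have the same nonzero spectrum. Here this is
  replaced by a growth estimate: the \<open>n\<close>-th power of \<open>e = 1 - t\<^sup>* t\<close> has the form \<open>1 - t\<^sup>* q t\<close>
  with \<open>\<parallel>q\<parallel> \<le> n\<close>, because \<open>\<parallel>1 - t t\<^sup>*\<parallel> \<le> 1\<close>. Since \<open>\<parallel>e\<parallel>\<close> to the power \<open>2\<^sup>k\<close> is the norm of that
  power of \<open>e\<close>, linear growth forces \<open>\<parallel>e\<parallel> \<le> 1\<close>.\<close>

lemma posit_star_mult_swap_contraction:
  fixes t :: "'a::unital_cstar_algebra"
  assumes "posit (t * star t)" "norm t \<le> 1"
  shows "posit (star t * t)"
proof (rule posit_of_norm_bound[where r = 1])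
  let ?e = "1 - star t * t"
  have small: "norm (t * star t) \<le> 1"
    using assms(2) by (metis mult_le_one norm_ge_zero norm_mult_ineq norm_star order_trans)
  have c: "norm (1 - t * star t) \<le> 1"
    using posit_norm_bound[OF assms(1) small] by simp
  have q: "\<exists>q. ?e ^ n = 1 - star t * q * t \<and> norm q \<le> real n" for n
  proof (induction n)
    case 0
    show ?case by (intro exI[of _ 0]) simp
  next
    case (Suc n)
    then obtain q where q: "?e ^ n = 1 - star t * q * t" "norm q \<le> real n" by blast
    have "?e ^ Suc n = (1 - star t * q * t) * ?e" using q(1) by (simp only: power_Suc2)
    also have "\<dots> = 1 - star t * (1 + q * (1 - t * star t)) * t"
      by (simp add: algebra_simps)
    finally have "?e ^ Suc n = 1 - star t * (1 + q * (1 - t * star t)) * t" .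
    moreover have "norm (q * (1 - t * star t)) \<le> real n"
      using q(2) c by (intro order_trans[OF norm_mult_ineq]) (metis mult.right_neutral mult_mono norm_ge_zero of_nat_0_le_iff)
    then have "norm (1 + q * (1 - t * star t)) \<le> real (Suc n)"
      using norm_triangle_ineq[of 1 "q * (1 - t * star t)"] by simp
    ultimately show ?case by blast
  qed
  have "norm (?e ^ n) \<le> 1 + real n" for n
  proof -
    obtain q where q: "?e ^ n = 1 - star t * q * t" "norm q \<le> real n" using q by blast
    have "norm (star t * q * t) \<le> 1 * real n * 1"
      using assms(2) q(2)
      by (intro order_trans[OF norm_mult_ineq] mult_mono) (auto simp: norm_star)
    then show ?thesis using norm_triangle_ineq4[of 1 "star t * q * t"] q(1) by simp
  qed
  then have "norm ?e ^ (2 ^ k) \<le> 1 + 2 ^ k" for k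
    using norm_pow2_self_adjoint[of ?e k] by (simp add: star_simps star_one) (metis of_nat_numeral of_nat_power)
  then show "norm (1 *\<^sub>R 1 - star t * t) \<le> 1"
    using pow2_le_linear_imp_le_1 by simp
qed (simp add: star_simps)

lemma posit_star_mult_swap:
  fixes t :: "'a::unital_cstar_algebra"
  assumes "posit (t * star t)"
  shows "posit (star t * t)"
proof -
  define c where "c = 1 + norm t"
  have c: "c > 0" by (simp add: c_def add_pos_nonneg)
  define s where "s = (1 / c) *\<^sub>R t"
  have "norm s \<le> 1" using c by (simp add: s_def c_def)
  moreover have "posit (s * star s)"
    using posit_scaleR[OF assms, of "1 / c * (1 / c)"] c by (simp add: s_def star_scaleR)
  ultimately have "posit (star s * s)" by (rule posit_star_mult_swap_contraction[rotated])
  from posit_scaleR[OF this, of "c * c"] show ?thesis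
    using c by (simp add: s_def star_scaleR)
qed

text \<open>Kaplansky's argument. With \<open>h = x\<^sup>* x\<close>, modulus \<open>y\<close> and \<open>b = y - h\<close> (twice the negative
  part), \<open>t = x b\<close> has \<open>t\<^sup>* t = b h b = - k\<close> with \<open>k\<close> positive. Since \<open>t\<^sup>* t + t t\<^sup>*\<close> is
  positive, so is \<open>t t\<^sup>*\<close>, hence also \<open>t\<^sup>* t = - k\<close>, and \<open>k = 0\<close>, which forces \<open>h = y\<close>.\<close>

theorem posit_star_mult:
  fixes x :: "'a::unital_cstar_algebra"
  shows "posit (star x * x)"
proof -
  define h where "h = star x * x"
  have sh: "star h = h" by (simp add: h_def star_simps)
  obtain y z where y: "star y = y" "y * y = h * h" "y \<in> bicommutant h" "posit y"
    and z: "star z = z" "z * z = y" "z \<in> bicommutant h"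
    using abs_exists[OF sh] by metis
  define b where "b = y - h"
  have sb: "star b = b" by (simp add: b_def star_diff y sh)
  have bb: "b \<in> bicommutant h" unfolding b_def by (intro bicommutant_linear y bicommutant_self)
  note comm = bicommutant_commute[OF y(3) bicommutant_self] bicommutant_commute[OF z(3) bb]
  have hb: "h * b = - (y * b)" using comm(1) y(2) by (simp add: b_def algebra_simps)
  define t where "t = x * b"
  define k where "k = (z * b) * (z * b)"
  have "star (z * b) = z * b" using comm(2) by (simp add: star_mult sb z)
  then have k: "posit k" unfolding k_def by (rule posit_square)
  have "star t * t = b * (h * b)" by (simp add: t_def h_def star_mult sb mult.assoc)
  also have "\<dots> = - k"
    unfolding hb k_def z(2)[symmetric] by (simp add: mult.assoc) (metis comm(2) mult.assoc)
  finally have tt: "star t * t = - k" .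
  \<comment> \<open>Real and imaginary part of \<open>t\<close>: \<open>t\<^sup>* t + t t\<^sup>* = 2 (p\<^sup>2 + q\<^sup>2)\<close>.\<close>
  define p q where "p = (1 / 2) *\<^sub>C (t + star t)" and "q = (\<i> / 2) *\<^sub>C (star t - t)"
  have spq: "star p = p" "star q = q"
    by (simp_all add: p_def q_def star_simps add.commute)
  have t_eq: "t = p + \<i> *\<^sub>C q"
    by (simp add: p_def q_def star_simps scaleC_add_left[symmetric])
  have st: "star t = p - \<i> *\<^sub>C q"
    by (subst t_eq) (simp add: star_simps spq)
  have "star t * t + t * star t = (p * p + q * q) + (p * p + q * q)"
    unfolding st by (subst (1 2) t_eq) (simp add: star_simps algebra_simps)
  then have "posit (star t * t + t * star t)"
    using spq by (simp add: posit_add posit_square)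
  from posit_add[OF this k] have "posit (t * star t)" by (simp add: tt)
  then have "posit (- k)" using posit_star_mult_swap tt by metis
  then have "k = 0" using k posit_antisym by blast
  then have "z * b = 0"
    using \<open>star (z * b) = z * b\<close> self_adjoint_square_eq_0 unfolding k_def by blast
  then have "y * b = 0" using z(2) by (metis mult.assoc mult_zero_right)
  then have "posit h"
    using y sh comm(1) by (intro posit_if_abs_annihilates[of h y]) (auto simp: b_def)
  then show ?thesis by (simp add: h_def)
qed

lemma posit_conj:
  fixes h :: "'a::unital_cstar_algebra"
  assumes "posit h"
  shows "posit (star x * h * x)"
proof -
  obtain y where "star y = y" "h = y * y" using assms by (auto simp: posit_def)
  then show ?thesis using posit_star_mult[of "y * x"] by (simp add: star_mult mult.assoc)
qed

lemma norm_le_of_posit_diff: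
  fixes h :: "'a::unital_cstar_algebra"
  assumes "posit h" "posit (r *\<^sub>R 1 - h)" "0 \<le> r"
  shows "norm h \<le> r"
proof -
  obtain s where s: "star s = s" "s * s = h" "s \<in> bicommutant h" using posit_sqrt[OF assms(1)] by metis
  obtain k where k: "star k = k" "k * k = r *\<^sub>R 1 - h" "k \<in> bicommutant (r *\<^sub>R 1 - h)"
    using posit_sqrt[OF assms(2)] by metis
  have "k \<in> bicommutant h"
    by (rule bicommutant_trans[OF _ k(3)]) (intro bicommutant_linear bicommutant_self)
  then have "s * k = k * s" using s(3) bicommutant_commute by blast
  then have "norm s \<le> sqrt r"
    using norm_le_of_square_sum[of s k "sqrt r"] s k assms(3) by simp
  then have "(norm s)\<^sup>2 \<le> r" using assms(3) power_mono[of "norm s" "sqrt r" 2] by simp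
  then show ?thesis using norm_square_self_adjoint[OF s(1)] s(2) by simp
qed

lemma posit_norm_diff: "posit h \<Longrightarrow> norm h \<le> r \<Longrightarrow> posit (r *\<^sub>R 1 - h :: 'a::unital_cstar_algebra)"
  by (rule posit_of_norm_bound[where r = r]) (auto simp: star_simps star_one posit_self_adjoint
      dest: order_trans[OF norm_ge_zero])

text \<open>Twice the positive part of \<open>x\<close>, where \<open>k\<close> is the modulus of \<open>x\<close>. With \<open>y = k + x\<close>, its
  modulus \<open>a\<close> and \<open>c = a - y\<close>, the square of the self-adjoint \<open>y c\<close> equals \<open>- 2 k a c\<^sup>2\<close>, which
  is minus a positive element since all factors commute. So \<open>y c = 0\<close>, that is \<open>a (a - y) = 0\<close>,
  and \<open>y\<close> is its own modulus.\<close>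

lemma pos_part_posit:
  fixes x k :: "'a::unital_cstar_algebra"
  assumes x: "star x = x" and k: "star k = k" "k * k = x * x" "k \<in> bicommutant x" "posit k"
  shows "posit (k + x)"
proof -
  define y where "y = k + x"
  have sy: "star y = y" by (simp add: y_def star_add x k)
  have yb: "y \<in> bicommutant x" unfolding y_def by (intro bicommutant_linear k bicommutant_self)
  have comm: "k * x = x * k" using bicommutant_commute[OF k(3) bicommutant_self] .
  have yy: "y * y = 2 *\<^sub>R (k * y)"
    by (simp add: y_def algebra_simps k(2) comm scaleR_2)
  obtain z where z: "star z = z" "z * z = k" "z \<in> bicommutant k" using posit_sqrt[OF k(4)] by metis
  have zb: "z \<in> bicommutant x" by (rule bicommutant_trans[OF k(3) z(3)])
  obtain a s where a: "star a = a" "a * a = y * y" "a \<in> bicommutant y" "posit a"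
    and s: "star s = s" "s * s = a" "s \<in> bicommutant y"
    using abs_exists[OF sy] by metis
  have ab: "a \<in> bicommutant x" and sb: "s \<in> bicommutant x"
    using bicommutant_trans[OF yb] a s by auto
  define c where "c = a - y"
  have sc: "star c = c" by (simp add: c_def star_diff a sy)
  have cb: "c \<in> bicommutant x" unfolding c_def by (intro bicommutant_linear ab yb)
  note bc = bicommutant_commute
  have yc: "y * c = - (a * c)" using bc[OF ab yb] a(2) by (simp add: c_def algebra_simps)
  \<comment> \<open>\<open>p\<close> is a self-adjoint root of \<open>a k c\<^sup>2\<close>, as \<open>s\<^sup>2 = a\<close> and \<open>z\<^sup>2 = k\<close>.\<close>
  define p where "p = s * (z * c)"
  have zc: "z * c \<in> bicommutant x" by (rule bicommutant_mult[OF zb cb])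
  have "star (z * c) = z * c" by (simp add: star_mult sc z bc[OF zb cb])
  then have sp: "star p = p" by (simp add: p_def star_mult s bc[OF sb zc])
  have syc: "star (y * c) = y * c" by (simp add: star_mult sc sy bc[OF yb cb])
  have "(y * c) * (y * c) = (y * y) * (c * c)"
    by (metis bc[OF yb cb] mult.assoc)
  also have "\<dots> = 2 *\<^sub>R (k * (c * (y * c)))"
    unfolding yy by (simp add: mult.assoc) (metis bc[OF yb cb] mult.assoc)
  also have "c * (y * c) = - (a * (c * c))"
    unfolding yc by (simp add: mult.assoc) (metis bc[OF ab cb] mult.assoc)
  also have "k * (- (a * (c * c))) = - (p * p)"
  proof -
    have "p * p = (s * s) * ((z * c) * (z * c))"
      unfolding p_def by (metis bc[OF sb zc] mult.assoc)
    also have "(z * c) * (z * c) = (z * z) * (c * c)" by (metis bc[OF zb cb] mult.assoc)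
    finally have "p * p = a * (k * (c * c))" by (simp add: s z)
    also have "\<dots> = k * (a * (c * c))" by (metis bc[OF ab k(3)] mult.assoc)
    finally show ?thesis by simp
  qed
  finally have eq: "(y * c) * (y * c) = - (2 *\<^sub>R (p * p))" by simp
  have "posit (- ((y * c) * (y * c)))"
    unfolding eq by (simp add: posit_scaleR posit_square[OF sp])
  then have "(y * c) * (y * c) = 0" by (intro posit_antisym posit_square syc)
  then have "y * c = 0" by (rule self_adjoint_square_eq_0[OF syc])
  then have "a * (a - y) = 0" using yc by (simp add: c_def)
  then have "posit y"
    using a sy bc[OF yb ab] by (intro posit_if_abs_annihilates[of y a]) auto
  then show ?thesis by (simp add: y_def)
qed

section \<open>The C*-norm of a matrix algebra\<close>

lemma star_scaleC_mult:
  fixes x :: "'a::banach_star_algebra"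
  shows "star (c *\<^sub>C x) * (c *\<^sub>C x) = (cmod c)\<^sup>2 *\<^sub>R (star x * x)"
proof -
  have "star (c *\<^sub>C x) * (c *\<^sub>C x) = (c * cnj c) *\<^sub>C (star x * x)"
    by (simp add: star_simps mult.commute)
  then show ?thesis by (simp only: complex_norm_square[symmetric] scaleC_of_real)
qed

text \<open>Matrices over a unital C*-algebra act on columns, which form a Hilbert module with the
  algebra-valued inner square \<open>sq_sum\<close>. The C*-norm of a matrix is its operator norm in this
  action; boundedness by \<open>r\<close> is expressed as an order relation between inner squares
  (\<open>op_bound\<close>), which yields the estimate of norms by \<open>norm_le_of_posit_diff\<close>.\<close>

definition mat_vec :: "nat \<Rightarrow> (nat \<Rightarrow> nat \<Rightarrow> 'u::unital_cstar_algebra) \<Rightarrow> (nat \<Rightarrow> 'u) \<Rightarrow> nat \<Rightarrow> 'u" where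
  "mat_vec p X c i = (\<Sum>j<p. X i j * c j)"

definition sq_sum :: "nat \<Rightarrow> (nat \<Rightarrow> 'u::unital_cstar_algebra) \<Rightarrow> 'u" where
  "sq_sum p c = (\<Sum>i<p. star (c i) * c i)"

definition op_bound :: "nat \<Rightarrow> (nat \<Rightarrow> nat \<Rightarrow> 'u::unital_cstar_algebra) \<Rightarrow> real \<Rightarrow> bool" where
  "op_bound p X r \<longleftrightarrow> 0 \<le> r \<and> (\<forall>c. posit (r\<^sup>2 *\<^sub>R sq_sum p c - sq_sum p (mat_vec p X c)))"

definition module_norm :: "nat \<Rightarrow> (nat \<Rightarrow> nat \<Rightarrow> 'u::unital_cstar_algebra) \<Rightarrow> real" where
  "module_norm p X = Inf {r. op_bound p X r}"

lemma posit_sq_sum: "posit (sq_sum p c)"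
  unfolding sq_sum_def by (intro posit_sum posit_star_mult)

lemma posit_diff_trans:
  fixes x y z :: "'a::unital_cstar_algebra"
  assumes "posit (x - y)" "posit (y - z)"
  shows "posit (x - z)"
  using posit_add[OF assms] by simp

lemma op_bound_mono:
  fixes X :: "nat \<Rightarrow> nat \<Rightarrow> 'a::unital_cstar_algebra"
  assumes "op_bound p X r" "r \<le> s"
  shows "op_bound p X s"
  unfolding op_bound_def
proof (intro conjI allI)
  fix c :: "nat \<Rightarrow> 'a"
  have "0 \<le> r" using assms(1) by (simp add: op_bound_def)
  then have "posit ((s\<^sup>2 - r\<^sup>2) *\<^sub>R sq_sum p c)"
    using assms(2) by (intro posit_scaleR posit_sq_sum) (simp add: power_mono)
  then have "posit (s\<^sup>2 *\<^sub>R sq_sum p c - r\<^sup>2 *\<^sub>R sq_sum p c)" by (simp add: scaleR_diff_left)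
  moreover have "posit (r\<^sup>2 *\<^sub>R sq_sum p c - sq_sum p (mat_vec p X c))"
    using assms(1) by (simp add: op_bound_def)
  ultimately show "posit (s\<^sup>2 *\<^sub>R sq_sum p c - sq_sum p (mat_vec p X c))"
    by (rule posit_diff_trans)
qed (use assms in \<open>auto simp: op_bound_def\<close>)

lemma closed_op_bound: "closed {r. op_bound p X r}"
proof -
  have "{r. op_bound p X r} =
      {0..} \<inter> (\<Inter>c. (\<lambda>r. r\<^sup>2 *\<^sub>R sq_sum p c - sq_sum p (mat_vec p X c)) -` {h. posit h})"
    by (auto simp: op_bound_def)
  moreover have "closed ((\<lambda>r. r\<^sup>2 *\<^sub>R sq_sum p c - sq_sum p (mat_vec p X c)) -` {h. posit h})" for c
    by (intro closed_vimage closed_posit continuous_intros)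
  ultimately show ?thesis by (simp add: closed_Int closed_INT)
qed

lemma op_bound_approx:
  assumes "\<And>e. e > 0 \<Longrightarrow> op_bound p X (r + e)"
  shows "op_bound p X r"
proof -
  have "(\<lambda>n. r + inverse (real (Suc n))) \<longlonglongrightarrow> r + 0"
    by (intro tendsto_add tendsto_const LIMSEQ_inverse_real_of_nat)
  moreover have "r + inverse (real (Suc n)) \<in> {r. op_bound p X r}" for n
    using assms by simp
  ultimately have "r + 0 \<in> {r. op_bound p X r}"
    using closed_sequentially[OF closed_op_bound[of p X], of "\<lambda>n. r + inverse (real (Suc n))"] by blast
  then show ?thesis by simp
qed

lemma mat_vec_add: "mat_vec p (\<lambda>i j. X i j + Y i j) c = (\<lambda>i. mat_vec p X c i + mat_vec p Y c i)"
  by (simp add: mat_vec_def fun_eq_iff distrib_right sum.distrib)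

lemma mat_vec_mult:
  "mat_vec p (\<lambda>i k. \<Sum>j<p. X i j * Y j k) c = mat_vec p X (mat_vec p Y c)"
proof
  fix i
  have "mat_vec p (\<lambda>i k. \<Sum>j<p. X i j * Y j k) c i = (\<Sum>k<p. \<Sum>j<p. X i j * Y j k * c k)"
    by (simp add: mat_vec_def sum_distrib_right)
  also have "\<dots> = (\<Sum>j<p. \<Sum>k<p. X i j * Y j k * c k)" by (rule sum.swap)
  also have "\<dots> = mat_vec p X (mat_vec p Y c) i"
    by (simp add: mat_vec_def sum_distrib_left mult.assoc)
  finally show "mat_vec p (\<lambda>i k. \<Sum>j<p. X i j * Y j k) c i = mat_vec p X (mat_vec p Y c) i" .
qed

text \<open>The triangle inequality, from \<open>(x + y)\<^sup>* (x + y) \<le> (1 + t) x\<^sup>* x + (1 + 1 / t) y\<^sup>* y\<close>,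
  where \<open>t = s / r\<close> turns \<open>(1 + t) r\<^sup>2 + (1 + 1 / t) s\<^sup>2\<close> into \<open>(r + s)\<^sup>2\<close>.\<close>

lemma op_bound_add_pos:
  assumes X: "op_bound p X r" and Y: "op_bound p Y s" and rs: "r > 0" "s > 0"
  shows "op_bound p (\<lambda>i j. X i j + Y i j) (r + s)"
  unfolding op_bound_def
proof (intro conjI allI)
  fix c
  define a b where "a = mat_vec p X c" and "b = mat_vec p Y c"
  define t where "t = s / r"
  have t: "t > 0" using rs by (simp add: t_def)
  have split: "(1 + t) *\<^sub>R sq_sum p a + (1 + 1 / t) *\<^sub>R sq_sum p b - sq_sum p (\<lambda>i. a i + b i) =
      sq_sum p (\<lambda>i. sqrt t *\<^sub>R a i - (1 / sqrt t) *\<^sub>R b i)"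
  proof -
    have "(1 + t) *\<^sub>R (star x * x) + (1 + 1 / t) *\<^sub>R (star y * y) - star (x + y) * (x + y) =
        star (sqrt t *\<^sub>R x - (1 / sqrt t) *\<^sub>R y) * (sqrt t *\<^sub>R x - (1 / sqrt t) *\<^sub>R y)" for x y :: 'a
      using t by (simp add: star_simps algebra_simps)
    then show ?thesis
      by (simp add: sq_sum_def scaleR_sum_right sum.distrib[symmetric] sum_subtractf[symmetric])
  qed
  have "posit ((1 + t) *\<^sub>R (r\<^sup>2 *\<^sub>R sq_sum p c - sq_sum p a) +
      (1 + 1 / t) *\<^sub>R (s\<^sup>2 *\<^sub>R sq_sum p c - sq_sum p b) + sq_sum p (\<lambda>i. sqrt t *\<^sub>R a i - (1 / sqrt t) *\<^sub>R b i))"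
    using X Y t unfolding op_bound_def a_def b_def
    by (intro posit_add posit_scaleR posit_sq_sum) auto
  also have "(1 + t) *\<^sub>R (r\<^sup>2 *\<^sub>R sq_sum p c - sq_sum p a) +
      (1 + 1 / t) *\<^sub>R (s\<^sup>2 *\<^sub>R sq_sum p c - sq_sum p b) + sq_sum p (\<lambda>i. sqrt t *\<^sub>R a i - (1 / sqrt t) *\<^sub>R b i)
    = ((1 + t) * r\<^sup>2 + (1 + 1 / t) * s\<^sup>2) *\<^sub>R sq_sum p c - sq_sum p (\<lambda>i. a i + b i)"
    unfolding split[symmetric] by (simp add: scaleR_diff_right scaleR_add_left)
  also have "(1 + t) * r\<^sup>2 + (1 + 1 / t) * s\<^sup>2 = (r + s)\<^sup>2"
    using rs by (simp add: t_def field_simps power2_eq_square)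
  finally show "posit ((r + s)\<^sup>2 *\<^sub>R sq_sum p c - sq_sum p (mat_vec p (\<lambda>i j. X i j + Y i j) c))"
    by (simp add: a_def b_def mat_vec_add)
qed (use rs in simp)

lemma op_bound_add:
  assumes "op_bound p X r" "op_bound p Y s"
  shows "op_bound p (\<lambda>i j. X i j + Y i j) (r + s)"
proof (rule op_bound_approx)
  fix e :: real assume e: "e > 0"
  have "0 \<le> r" "0 \<le> s" using assms by (auto simp: op_bound_def)
  then have "op_bound p (\<lambda>i j. X i j + Y i j) ((r + e / 2) + (s + e / 2))"
    using e by (intro op_bound_add_pos op_bound_mono[OF assms(1)] op_bound_mono[OF assms(2)]) auto
  then show "op_bound p (\<lambda>i j. X i j + Y i j) (r + s + e)" by (simp add: algebra_simps)
qed

lemma op_bound_mult: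
  assumes X: "op_bound p X r" and Y: "op_bound p Y s"
  shows "op_bound p (\<lambda>i k. \<Sum>j<p. X i j * Y j k) (r * s)"
  unfolding op_bound_def
proof (intro conjI allI)
  fix c
  have "posit (r\<^sup>2 *\<^sub>R (s\<^sup>2 *\<^sub>R sq_sum p c - sq_sum p (mat_vec p Y c)))"
    using Y by (intro posit_scaleR) (auto simp: op_bound_def)
  moreover have "posit (r\<^sup>2 *\<^sub>R sq_sum p (mat_vec p Y c) - sq_sum p (mat_vec p X (mat_vec p Y c)))"
    using X by (auto simp: op_bound_def)
  ultimately show "posit ((r * s)\<^sup>2 *\<^sub>R sq_sum p c - sq_sum p (mat_vec p (\<lambda>i k. \<Sum>j<p. X i j * Y j k) c))"
    unfolding mat_vec_mult by (auto simp: scaleR_diff_right power_mult_distrib intro: posit_diff_trans)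
qed (use assms in \<open>auto simp: op_bound_def\<close>)

text \<open>The inequality behind the C*-identity. With \<open>t = X\<^sup>* X c\<close> the inner product of \<open>c\<close> and \<open>t\<close>
  is the square of \<open>X c\<close>, and \<open>r\<close> bounds the matrix \<open>X\<^sup>* X\<close>. Expanding
  \<open>(r c - t)\<^sup>* (r c - t) \<ge> 0\<close> and using \<open>t\<^sup>* t \<le> r\<^sup>2 c\<^sup>* c\<close> gives \<open>(X c)\<^sup>* (X c) \<le> r c\<^sup>* c\<close>.\<close>

lemma op_bound_root_pos:
  assumes T: "op_bound p (\<lambda>i k. \<Sum>j<p. star (X j i) * X j k) r" and r: "r > 0"
  shows "op_bound p X (sqrt r)"
  unfolding op_bound_def
proof (intro conjI allI)
  fix c
  let ?t = "mat_vec p (\<lambda>i j. star (X j i)) (mat_vec p X c)"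
  have inner: "(\<Sum>i<p. star (c i) * ?t i) = sq_sum p (mat_vec p X c)"
  proof -
    have "(\<Sum>i<p. star (c i) * ?t i) = (\<Sum>i<p. \<Sum>j<p. star (X j i * c i) * mat_vec p X c j)"
      by (simp add: mat_vec_def[of p "\<lambda>i j. star (X j i)"] sum_distrib_left star_mult mult.assoc)
    also have "\<dots> = (\<Sum>j<p. \<Sum>i<p. star (X j i * c i) * mat_vec p X c j)" by (rule sum.swap)
    also have "\<dots> = sq_sum p (mat_vec p X c)"
      by (simp add: sq_sum_def sum_distrib_right[symmetric] star_sum[symmetric] mat_vec_def[symmetric])
    finally show ?thesis .
  qed
  have "star (\<Sum>i<p. star (c i) * ?t i) = (\<Sum>i<p. star (?t i) * c i)"
    by (simp add: star_sum star_simps)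
  then have inner': "(\<Sum>i<p. star (?t i) * c i) = sq_sum p (mat_vec p X c)"
    unfolding inner posit_self_adjoint[OF posit_sq_sum] by simp
  have "sq_sum p (\<lambda>i. r *\<^sub>R c i - ?t i) =
      (\<Sum>i<p. r\<^sup>2 *\<^sub>R (star (c i) * c i) - r *\<^sub>R (star (c i) * ?t i) - r *\<^sub>R (star (?t i) * c i) + star (?t i) * ?t i)"
    by (simp add: sq_sum_def star_simps algebra_simps power2_eq_square)
  also have "\<dots> = r\<^sup>2 *\<^sub>R sq_sum p c - r *\<^sub>R (\<Sum>i<p. star (c i) * ?t i) - r *\<^sub>R (\<Sum>i<p. star (?t i) * c i) + sq_sum p ?t"
    by (simp add: sq_sum_def sum.distrib sum_subtractf scaleR_sum_right)
  finally have expand: "sq_sum p (\<lambda>i. r *\<^sub>R c i - ?t i) =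
      r\<^sup>2 *\<^sub>R sq_sum p c - r *\<^sub>R sq_sum p (mat_vec p X c) - r *\<^sub>R sq_sum p (mat_vec p X c) + sq_sum p ?t"
    by (simp add: inner inner')
  have "posit (r\<^sup>2 *\<^sub>R sq_sum p c - sq_sum p ?t)"
    using T unfolding op_bound_def mat_vec_mult by blast
  from posit_scaleR[OF posit_add[OF this posit_sq_sum[of p "\<lambda>i. r *\<^sub>R c i - ?t i"]], of "1 / (r + r)"]
  have "posit ((1 / (r + r)) *\<^sub>R (r\<^sup>2 *\<^sub>R sq_sum p c - sq_sum p ?t + sq_sum p (\<lambda>i. r *\<^sub>R c i - ?t i)))"
    using r by simp
  also have "r\<^sup>2 *\<^sub>R sq_sum p c - sq_sum p ?t + sq_sum p (\<lambda>i. r *\<^sub>R c i - ?t i) =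
      (r + r) *\<^sub>R (r *\<^sub>R sq_sum p c - sq_sum p (mat_vec p X c))"
    unfolding expand by (simp only: scaleR_add_left scaleR_diff_right power2_eq_square) simp
  also have "(1 / (r + r)) *\<^sub>R \<dots> = (sqrt r)\<^sup>2 *\<^sub>R sq_sum p c - sq_sum p (mat_vec p X c)"
    using r by simp
  finally show "posit ((sqrt r)\<^sup>2 *\<^sub>R sq_sum p c - sq_sum p (mat_vec p X c))" .
qed (use r in simp)

lemma op_bound_root:
  assumes T: "op_bound p (\<lambda>i k. \<Sum>j<p. star (X j i) * X j k) r"
  shows "op_bound p X (sqrt r)"
proof (rule op_bound_approx)
  fix e :: real assume e: "e > 0"
  have r: "0 \<le> r" using T by (simp add: op_bound_def)
  have "op_bound p (\<lambda>i k. \<Sum>j<p. star (X j i) * X j k) ((sqrt r + e)\<^sup>2)"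
  proof (rule op_bound_mono[OF T])
    have "(sqrt r)\<^sup>2 \<le> (sqrt r + e)\<^sup>2" using r e by (intro power_mono) auto
    then show "r \<le> (sqrt r + e)\<^sup>2" using r by simp
  qed
  moreover have "0 < sqrt r + e" using r e by (simp add: add_nonneg_pos)
  ultimately show "op_bound p X (sqrt r + e)"
    using op_bound_root_pos[of p X "(sqrt r + e)\<^sup>2"] by simp
qed

lemma op_bound_zero: "op_bound p (\<lambda>i j. 0) 0"
  by (simp add: op_bound_def mat_vec_def sq_sum_def star_zero posit_zero)

lemma posit_norm_conj:
  fixes x :: "'a::unital_cstar_algebra"
  shows "posit ((norm x)\<^sup>2 *\<^sub>R (star c * c) - star (x * c) * (x * c))"
proof -
  have "posit ((norm x)\<^sup>2 *\<^sub>R 1 - star x * x)"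
    by (rule posit_norm_diff[OF posit_star_mult]) (simp add: cstar_identity)
  from posit_conj[OF this, of c] show ?thesis
    by (simp add: algebra_simps star_mult)
qed

lemma op_bound_unit:
  assumes "i0 < p" "j0 < p"
  shows "op_bound p (\<lambda>i j. if i = i0 \<and> j = j0 then x else 0) (norm x)"
  unfolding op_bound_def
proof (intro conjI allI)
  fix c
  let ?X = "\<lambda>i j. if i = i0 \<and> j = j0 then x else 0"
  have vec: "mat_vec p ?X c i = (if i = i0 then x * c j0 else 0)" for i
    using assms(2) by (simp add: mat_vec_def if_distrib[where f = "\<lambda>y. y * _"] cong: if_cong)
  have "sq_sum p (mat_vec p ?X c) = star (x * c j0) * (x * c j0)"
    using assms(1) by (simp add: sq_sum_def vec if_distrib[where f = star] star_zero if_distrib[where f = "\<lambda>y. _ * y"] cong: if_cong)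
  moreover have "sq_sum p c = star (c j0) * c j0 + (\<Sum>j\<in>{..<p} - {j0}. star (c j) * c j)"
    using assms(2) by (simp add: sq_sum_def sum.remove)
  moreover have "posit (((norm x)\<^sup>2 *\<^sub>R (star (c j0) * c j0) - star (x * c j0) * (x * c j0)) +
      (norm x)\<^sup>2 *\<^sub>R (\<Sum>j\<in>{..<p} - {j0}. star (c j) * c j))"
    by (intro posit_add posit_norm_conj posit_scaleR posit_sum posit_star_mult) auto
  ultimately show "posit ((norm x)\<^sup>2 *\<^sub>R sq_sum p c - sq_sum p (mat_vec p ?X c))"
    by (simp add: algebra_simps)
qed simp

lemma op_bound_sum:
  assumes "finite S" "\<And>s. s \<in> S \<Longrightarrow> op_bound p (X s) (r s)"
  shows "op_bound p (\<lambda>i j. \<Sum>s\<in>S. X s i j) (\<Sum>s\<in>S. r s)"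
  using assms by (induction S rule: finite_induct) (auto simp: op_bound_zero intro!: op_bound_add)

lemma op_bound_cong:
  assumes "\<And>i j. i < p \<Longrightarrow> j < p \<Longrightarrow> X i j = Y i j"
  shows "op_bound p X r = op_bound p Y r"
  using assms by (simp add: op_bound_def sq_sum_def mat_vec_def)

lemma module_norm_cong:
  "(\<And>i j. i < p \<Longrightarrow> j < p \<Longrightarrow> X i j = Y i j) \<Longrightarrow> module_norm p X = module_norm p Y"
  using op_bound_cong[of p X Y] by (simp add: module_norm_def)

lemma op_bound_entries: "op_bound p X (\<Sum>(i, j)\<in>{..<p} \<times> {..<p}. norm (X i j))"
proof -
  have "op_bound p (\<lambda>i j. \<Sum>(k, l)\<in>{..<p} \<times> {..<p}. if i = k \<and> j = l then X k l else 0)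
      (\<Sum>(k, l)\<in>{..<p} \<times> {..<p}. norm (X k l))"
    unfolding case_prod_unfold by (rule op_bound_sum) (auto intro!: op_bound_unit)
  moreover have "(\<Sum>(k, l)\<in>{..<p} \<times> {..<p}. if i = k \<and> j = l then X k l else 0) = X i j"
    if "i < p" "j < p" for i j
  proof -
    have "(\<Sum>(k, l)\<in>{..<p} \<times> {..<p}. if i = k \<and> j = l then X k l else 0) =
        (\<Sum>s\<in>{..<p} \<times> {..<p}. if s = (i, j) then X i j else 0)"
      by (rule sum.cong) (auto split: if_splits)
    also have "\<dots> = X i j" using that by simp
    finally show ?thesis .
  qed
  ultimately show ?thesis by (simp cong: op_bound_cong)
qed

lemma op_bound_module_norm: "op_bound p X (module_norm p X)"
proof -
  have "module_norm p X \<in> {r. op_bound p X r}"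
    unfolding module_norm_def
  proof (rule closed_contains_Inf)
    show "{r. op_bound p X r} \<noteq> {}" using op_bound_entries by blast
    show "bdd_below {r. op_bound p X r}" by (rule bdd_belowI[of _ 0]) (simp add: op_bound_def)
  qed (rule closed_op_bound)
  then show ?thesis by simp
qed

lemma module_norm_le: "op_bound p X r \<Longrightarrow> module_norm p X \<le> r"
  unfolding module_norm_def
  by (rule cInf_lower) (auto intro!: bdd_belowI[of _ 0] simp: op_bound_def)

lemma module_norm_nonneg: "0 \<le> module_norm p X"
  using op_bound_module_norm[of p X] by (simp add: op_bound_def)

lemma posit_sum_remainder:
  fixes x :: "nat \<Rightarrow> 'a::unital_cstar_algebra"
  assumes "i < p"
  shows "posit (sq_sum p x - star (x i) * x i)"
proof -
  have "sq_sum p x = star (x i) * x i + (\<Sum>j\<in>{..<p} - {i}. star (x j) * x j)"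
    using assms by (simp add: sq_sum_def sum.remove)
  then show ?thesis by (simp add: posit_sum posit_star_mult)
qed

text \<open>Test the bound on the \<open>j\<close>-th unit column, whose image is the \<open>j\<close>-th column of \<open>X\<close>.\<close>

lemma norm_entry_le_module_norm:
  assumes "i < p" "j < p"
  shows "norm (X i j) \<le> module_norm p X"
proof -
  define c where "c = (\<lambda>k. if k = j then 1 else 0 :: 'a)"
  have c: "sq_sum p c = 1" "mat_vec p X c = (\<lambda>i. X i j)"
    using assms by (auto simp: sq_sum_def mat_vec_def c_def star_one star_zero fun_eq_iff
        if_distrib[where f = star] if_distrib[where f = "\<lambda>y. _ * y"] cong: if_cong)
  have "posit ((module_norm p X)\<^sup>2 *\<^sub>R 1 - sq_sum p (\<lambda>i. X i j))"
    using op_bound_module_norm[of p X] c unfolding op_bound_def by metis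
  from posit_diff_trans[OF this posit_sum_remainder[OF assms(1)]]
  have "norm (star (X i j) * X i j) \<le> (module_norm p X)\<^sup>2"
    by (intro norm_le_of_posit_diff posit_star_mult) auto
  then show ?thesis
    by (simp add: cstar_identity module_norm_nonneg)
qed

lemma module_norm_add:
  "module_norm p (\<lambda>i j. X i j + Y i j) \<le> module_norm p X + module_norm p Y"
  by (intro module_norm_le op_bound_add op_bound_module_norm)

lemma module_norm_mult:
  "module_norm p (\<lambda>i k. \<Sum>j<p. X i j * Y j k) \<le> module_norm p X * module_norm p Y"
  by (intro module_norm_le op_bound_mult op_bound_module_norm)

lemma module_norm_square_le:
  "(module_norm p X)\<^sup>2 \<le> module_norm p (\<lambda>i k. \<Sum>j<p. star (X j i) * X j k)"
proof -
  have "module_norm p X \<le> sqrt (module_norm p (\<lambda>i k. \<Sum>j<p. star (X j i) * X j k))"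
    by (intro module_norm_le op_bound_root op_bound_module_norm)
  from power_mono[OF this module_norm_nonneg, of 2] show ?thesis
    by (simp add: module_norm_nonneg)
qed

text \<open>From \<open>\<parallel>X\<parallel>\<^sup>2 \<le> \<parallel>X\<^sup>* X\<parallel> \<le> \<parallel>X\<^sup>*\<parallel> \<parallel>X\<parallel>\<close>, applied to \<open>X\<close> and to \<open>X\<^sup>*\<close>.\<close>

lemma module_norm_star: "module_norm p (\<lambda>i j. star (X j i)) = module_norm p X"
proof -
  have le: "module_norm p X \<le> module_norm p (\<lambda>i j. star (X j i))" for X :: "nat \<Rightarrow> nat \<Rightarrow> 'a"
  proof -
    have "(module_norm p X)\<^sup>2 \<le> module_norm p (\<lambda>i j. star (X j i)) * module_norm p X"
      using module_norm_square_le module_norm_mult by (rule order_trans)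
    then show ?thesis
      using module_norm_nonneg[of p X] module_norm_nonneg[of p "\<lambda>i j. star (X j i)"]
      by (cases "module_norm p X = 0") (auto simp: power2_eq_square)
  qed
  show ?thesis using le[of X] le[of "\<lambda>i j. star (X j i)"] by (simp add: star_star)
qed

lemma module_norm_cstar:
  "module_norm p (\<lambda>i k. \<Sum>j<p. star (X j i) * X j k) = (module_norm p X)\<^sup>2"
proof (rule antisym)
  show "module_norm p (\<lambda>i k. \<Sum>j<p. star (X j i) * X j k) \<le> (module_norm p X)\<^sup>2"
    using module_norm_mult[of p "\<lambda>i j. star (X j i)" X] by (simp add: module_norm_star power2_eq_square)
qed (rule module_norm_square_le)

lemma module_norm_scaleC: "module_norm p (\<lambda>i j. c *\<^sub>C X i j) = cmod c * module_norm p X"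
proof -
  have le: "module_norm p (\<lambda>i j. c *\<^sub>C X i j) \<le> cmod c * module_norm p X" for c and X :: "nat \<Rightarrow> nat \<Rightarrow> 'a"
  proof (intro module_norm_le, unfold op_bound_def, intro conjI allI)
    fix v
    have "sq_sum p (mat_vec p (\<lambda>i j. c *\<^sub>C X i j) v) = (cmod c)\<^sup>2 *\<^sub>R sq_sum p (mat_vec p X v)"
    proof -
      have "mat_vec p (\<lambda>i j. c *\<^sub>C X i j) v i = c *\<^sub>C mat_vec p X v i" for i
        by (simp add: mat_vec_def mult_scaleC_left complex_vector.scale_sum_right)
      then show ?thesis by (simp add: sq_sum_def scaleR_sum_right star_scaleC_mult)
    qed
    moreover have "posit ((cmod c)\<^sup>2 *\<^sub>R ((module_norm p X)\<^sup>2 *\<^sub>R sq_sum p v - sq_sum p (mat_vec p X v)))"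
      using op_bound_module_norm[of p X] by (intro posit_scaleR) (auto simp: op_bound_def)
    ultimately show "posit ((cmod c * module_norm p X)\<^sup>2 *\<^sub>R sq_sum p v - sq_sum p (mat_vec p (\<lambda>i j. c *\<^sub>C X i j) v))"
      by (simp add: scaleR_diff_right power_mult_distrib)
  qed (simp add: module_norm_nonneg)
  show ?thesis
  proof (cases "c = 0")
    case True
    then show ?thesis using le[of c X] module_norm_nonneg[of p "\<lambda>i j. c *\<^sub>C X i j"] by simp
  next
    case False
    have "module_norm p (\<lambda>i j. inverse c *\<^sub>C (c *\<^sub>C X i j)) \<le> cmod (inverse c) * module_norm p (\<lambda>i j. c *\<^sub>C X i j)"
      by (rule le)
    then have "cmod c * module_norm p X \<le> module_norm p (\<lambda>i j. c *\<^sub>C X i j)"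
      using False by (simp add: scaleC_simps norm_divide field_simps)
    with le[of c X] show ?thesis by simp
  qed
qed

definition matrix_norm :: "'a::cstar_algebra mat \<Rightarrow> real" where
  "matrix_norm x = module_norm (dim_row x) (\<lambda>i j. into_unitization (x $$ (i, j)))"

lemma mat_star_carrier: "x \<in> carrier_mat p p \<Longrightarrow> mat_star x \<in> carrier_mat p p"
  by (simp add: mat_star_def)

lemma mat_star_index: "x \<in> carrier_mat p p \<Longrightarrow> i < p \<Longrightarrow> j < p \<Longrightarrow> mat_star x $$ (i, j) = star (x $$ (j, i))"
  by (simp add: mat_star_def)

lemma mat_mult_index:
  "x \<in> carrier_mat p p \<Longrightarrow> y \<in> carrier_mat p p \<Longrightarrow> i < p \<Longrightarrow> k < p \<Longrightarrow>
    (x * y) $$ (i, k) = (\<Sum>j<p. x $$ (i, j) * y $$ (j, k))"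
  by (simp add: scalar_prod_def atLeast0LessThan)

lemma matrix_norm_eqI:
  assumes "x \<in> carrier_mat p p" "\<And>i j. i < p \<Longrightarrow> j < p \<Longrightarrow> into_unitization (x $$ (i, j)) = X i j"
  shows "matrix_norm x = module_norm p X"
proof -
  have "dim_row x = p" using assms(1) by simp
  then show ?thesis unfolding matrix_norm_def by (metis (no_types, lifting) module_norm_cong assms(2))
qed

lemma matrix_norm_cstar: "cstar_norm_on_matrices p (matrix_norm :: 'a::cstar_algebra mat \<Rightarrow> real)"
  unfolding cstar_norm_on_matrices_def
proof (intro ballI conjI allI)
  fix x y :: "'a mat" and c assume x: "x \<in> carrier_mat p p"
  let ?X = "\<lambda>i j. into_unitization (x $$ (i, j))" and ?Y = "\<lambda>i j. into_unitization (y $$ (i, j))"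
  have N: "matrix_norm x = module_norm p ?X" using x by (simp add: matrix_norm_def)
  show "0 \<le> matrix_norm x" by (simp add: matrix_norm_def module_norm_nonneg)
  show "matrix_norm x = 0 \<longleftrightarrow> x = 0\<^sub>m p p"
  proof
    assume "matrix_norm x = 0"
    then have "norm (?X i j) \<le> 0" if "i < p" "j < p" for i j
      using norm_entry_le_module_norm[OF that, of ?X] N by simp
    then show "x = 0\<^sub>m p p" using x by (intro eq_matI) auto
  next
    assume 0: "x = 0\<^sub>m p p"
    have "matrix_norm x = module_norm p (\<lambda>i j. 0 :: 'a unitization)"
      by (rule matrix_norm_eqI[OF x]) (simp add: into_unitization_simps 0)
    moreover have "module_norm p (\<lambda>i j. 0 :: 'a unitization) \<le> 0"
      by (rule module_norm_le[OF op_bound_zero])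
    ultimately show "matrix_norm x = 0"
      using module_norm_nonneg[of p "\<lambda>i j. 0 :: 'a unitization"] by simp
  qed
  have "matrix_norm (map_mat ((*\<^sub>C) c) x) = module_norm p (\<lambda>i j. c *\<^sub>C ?X i j)"
    using x by (intro matrix_norm_eqI) (auto simp: into_unitization_simps)
  then show "matrix_norm (map_mat ((*\<^sub>C) c) x) = cmod c * matrix_norm x"
    by (simp add: module_norm_scaleC N)
  have "matrix_norm (mat_star x * x) = module_norm p (\<lambda>i k. \<Sum>j<p. star (?X j i) * ?X j k)"
    using x mat_star_carrier[OF x]
    by (intro matrix_norm_eqI) (simp_all add: mat_mult_index[OF mat_star_carrier[OF x] x]
        mat_star_index[OF x] into_unitization_simps into_unitization_sum del: index_mult_mat(1))
  then show "matrix_norm (mat_star x * x) = (matrix_norm x)\<^sup>2" by (simp add: module_norm_cstar N)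
next
  fix x y :: "'a mat" assume x: "x \<in> carrier_mat p p" and y: "y \<in> carrier_mat p p"
  let ?X = "\<lambda>i j. into_unitization (x $$ (i, j))" and ?Y = "\<lambda>i j. into_unitization (y $$ (i, j))"
  have "matrix_norm (x + y) = module_norm p (\<lambda>i j. ?X i j + ?Y i j)"
    using x y by (intro matrix_norm_eqI) (auto simp: into_unitization_simps)
  then show "matrix_norm (x + y) \<le> matrix_norm x + matrix_norm y"
    using x y module_norm_add[of p ?X ?Y] by (simp add: matrix_norm_def)
  have "matrix_norm (x * y) = module_norm p (\<lambda>i k. \<Sum>j<p. ?X i j * ?Y j k)"
    using x y
    by (intro matrix_norm_eqI) (simp_all add: mat_mult_index[OF x y] into_unitization_simps
        into_unitization_sum del: index_mult_mat(1))
  then show "matrix_norm (x * y) \<le> matrix_norm x * matrix_norm y"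
    using x y module_norm_mult[of p ?X ?Y] by (simp add: matrix_norm_def)
qed

section \<open>Uniqueness of the C*-norm\<close>

text \<open>A C*-norm on the *-algebra that underlies a C*-algebra; the algebra need not be complete
  for it.\<close>

definition cstar_norm :: "('a::cstar_algebra \<Rightarrow> real) \<Rightarrow> bool" where
  "cstar_norm M \<longleftrightarrow> (\<forall>a. M a \<ge> 0 \<and> (M a = 0 \<longleftrightarrow> a = 0) \<and> (\<forall>c. M (c *\<^sub>C a) = cmod c * M a) \<and>
     M (star a * a) = (M a)\<^sup>2 \<and> (\<forall>b. M (a + b) \<le> M a + M b \<and> M (a * b) \<le> M a * M b))"

lemma uact_mult_star: "star (uact x b) * c = star b * uact (star x) (c :: 'a::cstar_algebra)"
  by (simp add: uact_def star_simps algebra_simps)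

lemma uact_mult: "uact x (uact y b) = uact (x * y) (b :: 'a::cstar_algebra)"
  by (simp add: uact_simps)

lemma uact_one: "uact 1 b = (b :: 'a::cstar_algebra)"
  by (simp add: uact_def scaleC_one)

lemma uact_scaleC: "uact (c *\<^sub>C x) b = c *\<^sub>C uact x (b :: 'a::cstar_algebra)"
  by (simp add: uact_def star_simps)

lemma uact_into_unitization: "uact (into_unitization a) b = a * b"
  by (simp add: uact_def)

context
  fixes M :: "'a::cstar_algebra \<Rightarrow> real"
  assumes M: "cstar_norm M"
begin

lemma cstar_norm_rules:
  "M a \<ge> 0" "M a = 0 \<longleftrightarrow> a = 0" "M (c *\<^sub>C a) = cmod c * M a" "M (star a * a) = (M a)\<^sup>2"
  "M (a + b) \<le> M a + M b" "M (a * b) \<le> M a * M b"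
  using M by (auto simp: cstar_norm_def)

lemma cstar_norm_isometry:
  assumes "star u * u = 1"
  shows "M (uact u b) = M b"
proof -
  have "star (uact u b) * uact u b = star b * b"
    by (simp add: uact_mult_star uact_mult assms uact_one)
  then have "(M (uact u b))\<^sup>2 = (M b)\<^sup>2" using cstar_norm_rules(4) by metis
  then show ?thesis using cstar_norm_rules(1) by (simp add: power2_eq_iff_nonneg)
qed

text \<open>A self-adjoint contraction is the mean of the unitaries \<open>g \<plusminus> \<i> w\<close> with \<open>w\<^sup>2 = 1 - g\<^sup>2\<close>,
  and unitaries preserve \<open>M\<close>.\<close>

lemma cstar_norm_self_adjoint_contraction:
  assumes "star g = g" "norm g \<le> 1"
  shows "M (uact g b) \<le> M b"
proof -
  obtain w where w: "star w = w" "w * w = 1 - g * g" "w \<in> bicommutant g"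
    using norm_one_minus_square[OF assms] by metis
  have wg: "w * g = g * w" using bicommutant_commute[OF w(3) bicommutant_self] .
  have s: "star (g + \<i> *\<^sub>C w) = g - \<i> *\<^sub>C w" "star (g - \<i> *\<^sub>C w) = g + \<i> *\<^sub>C w"
    by (simp_all add: star_simps assms w)
  have u: "star (g + \<i> *\<^sub>C w) * (g + \<i> *\<^sub>C w) = 1" "star (g - \<i> *\<^sub>C w) * (g - \<i> *\<^sub>C w) = 1"
    unfolding s by (simp_all add: star_simps algebra_simps w wg)
  have "uact g b + uact g b = uact (g + \<i> *\<^sub>C w) b + uact (g - \<i> *\<^sub>C w) b"
    by (simp add: uact_simps(1)[symmetric] fun_cong[OF uact_simps(1), symmetric])
  then have "2 *\<^sub>C uact g b = uact (g + \<i> *\<^sub>C w) b + uact (g - \<i> *\<^sub>C w) b"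
    using scaleC_add_left[of 1 1 "uact g b"] by (simp add: scaleC_one)
  then have "M (2 *\<^sub>C uact g b) \<le> M b + M b"
    using cstar_norm_rules(5) by (metis cstar_norm_isometry[OF u(1)] cstar_norm_isometry[OF u(2)])
  then show ?thesis by (simp add: cstar_norm_rules(3))
qed

lemma cstar_norm_self_adjoint_bound:
  assumes "star g = g"
  shows "M (uact g b) \<le> norm g * M b"
proof (cases "g = 0")
  case True
  then show ?thesis using cstar_norm_rules(2)[of 0] by (simp add: uact_def)
next
  case False
  define h where "h = complex_of_real (1 / norm g) *\<^sub>C g"
  have "M (uact h b) \<le> M b"
    using False assms
    by (intro cstar_norm_self_adjoint_contraction) (auto simp: h_def star_simps norm_scaleC norm_divide)
  then have "cmod (complex_of_real (1 / norm g)) * M (uact g b) \<le> M b"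
    by (simp only: h_def uact_scaleC cstar_norm_rules(3))
  then show ?thesis using False by (simp add: norm_divide field_simps)
qed

lemma cstar_norm_bound: "M (uact x b) \<le> norm x * M b"
proof -
  have "(M (uact x b))\<^sup>2 = M (star b * uact (star x * x) b)"
    by (simp add: cstar_norm_rules(4)[symmetric] uact_mult_star uact_mult)
  also have "\<dots> \<le> M (star b) * M (uact (star x * x) b)" by (rule cstar_norm_rules)
  also have "\<dots> \<le> M (star b) * (norm (star x * x) * M b)"
    by (intro mult_left_mono cstar_norm_self_adjoint_bound cstar_norm_rules) (simp add: star_simps)
  also have "M (star b) = M b"
  proof -
    have le: "M b \<le> M (star b)" for b
    proof -
      have "(M b)\<^sup>2 \<le> M (star b) * M b" using cstar_norm_rules(4,6) by metis
      then show ?thesis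
        using cstar_norm_rules(1)[of b] cstar_norm_rules(1)[of "star b"]
        by (cases "M b = 0") (auto simp: power2_eq_square)
    qed
    show ?thesis using le[of b] le[of "star b"] by (simp add: star_star)
  qed
  also have "M b * (norm (star x * x) * M b) = (norm x * M b)\<^sup>2"
    by (simp add: cstar_identity power2_eq_square)
  finally show ?thesis
    using cstar_norm_rules(1) by (intro power2_le_imp_le[of "M (uact x b)"]) auto
qed

lemma cstar_norm_le: "M a \<le> norm a"
proof (cases "a = 0")
  case True
  then show ?thesis using cstar_norm_rules(2)[of 0] by simp
next
  case False
  have "M (uact (into_unitization (star a)) a) \<le> norm a * M a"
    using cstar_norm_bound[of "into_unitization (star a)" a] by (simp add: norm_star)
  then have "(M a)\<^sup>2 \<le> norm a * M a" by (simp add: uact_into_unitization cstar_norm_rules)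
  then show ?thesis using False cstar_norm_rules(1,2)[of a] by (simp add: power2_eq_square)
qed

text \<open>A C*-norm cannot be smaller than the given norm. Let \<open>y\<close> be the positive part of \<open>h - r\<close>
  (up to a factor two); it is nonzero, and on \<open>z = y h\<close> multiplication by \<open>h\<close> agrees with
  multiplication by \<open>m = r + y / 2 \<ge> r\<close>. For large \<open>R\<close> the element \<open>R - m\<close> has norm at most
  \<open>R - r\<close>, so \<open>R M(z) \<le> M(h z) + M((R - m) z) \<le> (M(h) + R - r) M(z)\<close>, and \<open>M(z)\<close> cancels.\<close>

lemma cstar_norm_ge_positive:
  fixes a :: 'a
  assumes h: "h = star a * a" and r: "0 < r" "r < norm h"
  shows "r \<le> M h"
proof -
  define H where "H = into_unitization h"
  define k where "k = H - r *\<^sub>R 1"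
  have sH: "star H = H" by (simp add: H_def h into_unitization_simps(8)[symmetric] star_simps)
  have sk: "star k = k" by (simp add: k_def star_simps sH star_one)
  obtain K where K: "star K = K" "K * K = k * k" "K \<in> bicommutant k" "posit K"
    using abs_exists[OF sk] by metis
  have comm: "K * k = k * K" using bicommutant_commute[OF K(3) bicommutant_self] .
  define y where "y = K + k"
  have y: "posit y" unfolding y_def by (rule pos_part_posit[OF sk K])
  define m where "m = r *\<^sub>R 1 + (1 / 2) *\<^sub>R y"
  have "k * y = (1 / 2) *\<^sub>R (y * y)"
  proof -
    have "y * y = k * y + k * y" by (simp add: y_def algebra_simps K(2) comm)
    also have "\<dots> = 2 *\<^sub>R (k * y)" by (simp add: scaleR_2)
    finally show ?thesis by simp
  qed
  then have Hy: "H * y = m * y" by (simp add: k_def m_def algebra_simps)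
  define R where "R = r + norm y"
  have R0: "R > 0" using r by (simp add: R_def add_pos_nonneg)
  have R: "norm (R *\<^sub>R 1 - m) \<le> R - r"
  proof -
    have "norm (norm y *\<^sub>R 1 - (1 / 2) *\<^sub>R y) \<le> norm y"
      by (rule posit_norm_bound) (auto intro: posit_scaleR y)
    moreover have "R *\<^sub>R 1 - m = norm y *\<^sub>R 1 - (1 / 2) *\<^sub>R y"
      by (simp add: R_def m_def algebra_simps)
    ultimately show ?thesis by (simp add: R_def)
  qed
  have pH: "posit H" unfolding H_def h by (simp add: into_unitization_simps posit_star_mult)
  have y0: "y \<noteq> 0"
  proof
    assume "y = 0"
    then have "posit (r *\<^sub>R 1 - H)" using K(4) by (simp add: y_def k_def eq_neg_iff_add_eq_0[symmetric])
    then have "norm H \<le> r" using norm_le_of_posit_diff[OF pH] r by simp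
    then show False using r by (simp add: H_def)
  qed
  \<comment> \<open>Multiplying by \<open>H\<close> returns \<open>y\<close> from the unitization to the algebra, on which \<open>M\<close> is
    defined.\<close>
  define z where "z = alg_part (y * H)"
  have z: "into_unitization z = y * H"
    unfolding z_def by (rule into_unitization_alg_part) (simp add: H_def)
  \<comment> \<open>Otherwise \<open>m y = 0\<close>, which contradicts \<open>m \<ge> r > 0\<close>.\<close>
  have z0: "z \<noteq> 0"
  proof
    assume "z = 0"
    then have "y * H = 0" using z by (simp add: into_unitization_simps)
    then have "star (y * H) = 0" by (simp add: star_zero)
    then have "m * y = 0" using Hy by (simp add: star_mult sH posit_self_adjoint[OF y])
    then have "R *\<^sub>R y = (R *\<^sub>R 1 - m) * y" by (simp add: left_diff_distrib)
    then have "R * norm y \<le> norm (R *\<^sub>R 1 - m) * norm y"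
      using norm_mult_ineq[of "R *\<^sub>R 1 - m" y] R0 by (metis abs_of_pos norm_scaleR)
    also have "\<dots> \<le> (R - r) * norm y" using R by (intro mult_right_mono) auto
    finally have "r * norm y \<le> 0" by (simp add: algebra_simps)
    moreover have "r * norm y > 0" using r y0 by simp
    ultimately show False by simp
  qed
  have "into_unitization (uact m z) = H * into_unitization z"
    by (simp add: into_unitization_uact z mult.assoc[symmetric] Hy)
  then have mz: "uact m z = h * z"
    by (simp add: H_def into_unitization_simps(5)[symmetric])
  have "complex_of_real R *\<^sub>C z = uact m z + uact (R *\<^sub>R 1 - m) z"
  proof -
    have "uact m z + uact (R *\<^sub>R 1 - m) z = uact (R *\<^sub>R 1) z"
      by (simp add: fun_cong[OF uact_simps(1), symmetric])
    then show ?thesis by (simp add: fun_cong[OF uact_simps(2)] uact_one scaleC_of_real)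
  qed
  then have "M (complex_of_real R *\<^sub>C z) \<le> M (h * z) + M (uact (R *\<^sub>R 1 - m) z)"
    using cstar_norm_rules(5) mz by metis
  also have "\<dots> \<le> M h * M z + (R - r) * M z"
    using cstar_norm_bound[of "R *\<^sub>R 1 - m" z] R cstar_norm_rules(1)[of z]
    by (intro add_mono cstar_norm_rules) (meson mult_right_mono order_trans)
  also have "M (complex_of_real R *\<^sub>C z) = R * M z"
    using R0 by (simp add: cstar_norm_rules(3))
  finally have "r * M z \<le> M h * M z" by (simp add: algebra_simps)
  moreover have "M z > 0" using z0 cstar_norm_rules(1,2)[of z] by simp
  ultimately show ?thesis by simp
qed

lemma cstar_norm_unique: "M a = norm a"
proof (rule antisym[OF cstar_norm_le], rule ccontr)
  assume "\<not> norm a \<le> M a"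
  then have "(M a)\<^sup>2 < (norm a)\<^sup>2" using cstar_norm_rules(1) by (simp add: power_strict_mono)
  then obtain r where r: "(M a)\<^sup>2 < r" "r < (norm a)\<^sup>2" using dense by blast
  have "0 < r" using r(1) zero_le_power2[of "M a"] by linarith
  then have "r \<le> M (star a * a)"
    using r(2) by (intro cstar_norm_ge_positive) (auto simp: cstar_identity)
  then show False using r(1) by (simp add: cstar_norm_rules)
qed

end

definition unit_mat :: "nat \<Rightarrow> nat \<Rightarrow> nat \<Rightarrow> 'a::zero \<Rightarrow> 'a mat" where
  "unit_mat p i0 j0 a = mat p p (\<lambda>(i, j). if i = i0 \<and> j = j0 then a else 0)"

lemma unit_mat_carrier [simp]: "unit_mat p i j a \<in> carrier_mat p p"
  by (simp add: unit_mat_def)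

lemma unit_mat_index: "i < p \<Longrightarrow> j < p \<Longrightarrow> unit_mat p i0 j0 a $$ (i, j) = (if i = i0 \<and> j = j0 then a else 0)"
  by (simp add: unit_mat_def)

lemma unit_mat_mult:
  fixes x :: "'a::cstar_algebra mat"
  assumes x: "x \<in> carrier_mat p p" and ij: "i < p" "j < p"
  shows "unit_mat p k i a * x * unit_mat p j l b = unit_mat p k l (a * x $$ (i, j) * b)"
proof (rule eq_matI)
  fix s t assume "s < dim_row (unit_mat p k l (a * x $$ (i, j) * b))" "t < dim_col (unit_mat p k l (a * x $$ (i, j) * b))"
  then have st: "s < p" "t < p" by (auto simp: unit_mat_def)
  have c: "unit_mat p k i a * x \<in> carrier_mat p p" using x by (metis mult_carrier_mat unit_mat_carrier)
  have 1: "(unit_mat p k i a * x) $$ (s, n) = (if s = k then a * x $$ (i, n) else 0)" if "n < p" for n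
  proof -
    have "(unit_mat p k i a * x) $$ (s, n) = (\<Sum>m<p. (if s = k \<and> m = i then a else 0) * x $$ (m, n))"
      using st that x by (simp add: mat_mult_index[OF unit_mat_carrier x] unit_mat_index del: index_mult_mat(1))
    also have "\<dots> = (\<Sum>m<p. if m = i then (if s = k then a * x $$ (i, n) else 0) else 0)"
      by (rule sum.cong) auto
    finally show ?thesis using ij by simp
  qed
  have "(unit_mat p k i a * x * unit_mat p j l b) $$ (s, t) =
      (\<Sum>n<p. (if s = k then a * x $$ (i, n) else 0) * (if n = j \<and> t = l then b else 0))"
    using st by (simp add: mat_mult_index[OF c unit_mat_carrier] unit_mat_index 1 del: index_mult_mat(1))
  also have "\<dots> = (\<Sum>n<p. if n = j then (if s = k \<and> t = l then a * x $$ (i, j) * b else 0) else 0)"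
    by (rule sum.cong) auto
  also have "\<dots> = (if s = k \<and> t = l then a * x $$ (i, j) * b else 0)" using ij by simp
  finally show "(unit_mat p k i a * x * unit_mat p j l b) $$ (s, t) = unit_mat p k l (a * x $$ (i, j) * b) $$ (s, t)"
    using st by (simp add: unit_mat_index)
qed (use x in \<open>auto simp: unit_mat_def\<close>)

lemma unit_mat_mult2:
  fixes a b :: "'a::cstar_algebra"
  assumes "i < p"
  shows "unit_mat p k i a * unit_mat p i l b = unit_mat p k l (a * b)"
proof (rule eq_matI)
  fix s t assume "s < dim_row (unit_mat p k l (a * b))" "t < dim_col (unit_mat p k l (a * b))"
  then have st: "s < p" "t < p" by (auto simp: unit_mat_def)
  have "(unit_mat p k i a * unit_mat p i l b) $$ (s, t) =
      (\<Sum>n<p. (if s = k \<and> n = i then a else 0) * (if n = i \<and> t = l then b else 0))"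
    using st by (simp add: mat_mult_index[OF unit_mat_carrier unit_mat_carrier] unit_mat_index del: index_mult_mat(1))
  also have "\<dots> = (\<Sum>n<p. if n = i then (if s = k \<and> t = l then a * b else 0) else 0)"
    by (rule sum.cong) auto
  also have "\<dots> = (if s = k \<and> t = l then a * b else 0)" using assms by simp
  finally show "(unit_mat p k i a * unit_mat p i l b) $$ (s, t) = unit_mat p k l (a * b) $$ (s, t)"
    using st by (simp add: unit_mat_index)
qed (auto simp: unit_mat_def)

lemma mat_star_unit_mat: "mat_star (unit_mat p i j a) = unit_mat p j i (star (a :: 'a::cstar_algebra))"
  by (rule eq_matI) (auto simp: mat_star_def unit_mat_def star_zero)

context
  fixes N :: "'a::cstar_algebra mat \<Rightarrow> real" and p :: nat
  assumes N: "cstar_norm_on_matrices p N"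
begin

lemma cstar_norm_on_matrices_rules:
  assumes "x \<in> carrier_mat p p"
  shows "N x \<ge> 0" "N x = 0 \<longleftrightarrow> x = 0\<^sub>m p p" "N (map_mat (scaleC c) x) = cmod c * N x"
    "N (mat_star x * x) = (N x)\<^sup>2"
    "y \<in> carrier_mat p p \<Longrightarrow> N (x + y) \<le> N x + N y"
    "y \<in> carrier_mat p p \<Longrightarrow> N (x * y) \<le> N x * N y"
  using N assms by (auto simp: cstar_norm_on_matrices_def)

text \<open>A diagonal corner is a copy of the algebra, on which a C*-norm is unique.\<close>

lemma norm_diagonal_unit_mat:
  assumes "i < p"
  shows "N (unit_mat p i i a) = norm a"
proof (rule cstar_norm_unique)
  show "cstar_norm (\<lambda>a. N (unit_mat p i i a))"
    unfolding cstar_norm_def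
  proof (intro allI conjI)
    fix a b :: 'a and c
    note R = cstar_norm_on_matrices_rules[OF unit_mat_carrier]
    show "0 \<le> N (unit_mat p i i a)" by (rule R)
    have "unit_mat p i i a = 0\<^sub>m p p \<longleftrightarrow> a = 0"
    proof
      assume "unit_mat p i i a = 0\<^sub>m p p"
      then have "unit_mat p i i a $$ (i, i) = 0\<^sub>m p p $$ (i, i)" by simp
      then show "a = 0" using assms by (simp add: unit_mat_index)
    qed (auto simp: unit_mat_def)
    then show "N (unit_mat p i i a) = 0 \<longleftrightarrow> a = 0" by (simp add: R)
    have "unit_mat p i i (c *\<^sub>C a) = map_mat ((*\<^sub>C) c) (unit_mat p i i a)"
      by (rule eq_matI) (auto simp: unit_mat_def)
    then show "N (unit_mat p i i (c *\<^sub>C a)) = cmod c * N (unit_mat p i i a)" by (simp add: R)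
    show "N (unit_mat p i i (star a * a)) = (N (unit_mat p i i a))\<^sup>2"
      using assms by (simp add: R(4)[symmetric] mat_star_unit_mat unit_mat_mult2)
    have "unit_mat p i i (a + b) = unit_mat p i i a + unit_mat p i i b"
      by (rule eq_matI) (auto simp: unit_mat_def)
    then show "N (unit_mat p i i (a + b)) \<le> N (unit_mat p i i a) + N (unit_mat p i i b)"
      by (simp add: R)
    show "N (unit_mat p i i (a * b)) \<le> N (unit_mat p i i a) * N (unit_mat p i i b)"
      using R(6)[OF unit_mat_carrier, of i i a i i b] assms by (simp add: unit_mat_mult2)
  qed
qed

lemma norm_unit_mat:
  assumes "i < p" "j < p"
  shows "N (unit_mat p i j a) = norm a"
proof -
  have "(N (unit_mat p i j a))\<^sup>2 = (norm a)\<^sup>2"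
    using assms
    by (simp add: cstar_norm_on_matrices_rules(4)[OF unit_mat_carrier, symmetric] mat_star_unit_mat
        unit_mat_mult2 norm_diagonal_unit_mat cstar_identity)
  then show ?thesis
    using cstar_norm_on_matrices_rules(1)[OF unit_mat_carrier] by (simp add: power2_eq_iff_nonneg)
qed

lemma norm_entry_le:
  assumes x: "x \<in> carrier_mat p p" and ij: "i < p" "j < p"
  shows "norm (x $$ (i, j)) \<le> N x"
proof (cases "x $$ (i, j) = 0")
  case True
  then show ?thesis using cstar_norm_on_matrices_rules(1)[OF x] by simp
next
  case False
  define a where "a = x $$ (i, j)"
  note R = cstar_norm_on_matrices_rules
  have c: "unit_mat p i i (star a) * x \<in> carrier_mat p p" using x by (metis mult_carrier_mat unit_mat_carrier)
  have "N (unit_mat p i i (star a) * x * unit_mat p j j (star a)) \<le>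
      N (unit_mat p i i (star a) * x) * N (unit_mat p j j (star a))"
    by (rule R(6)[OF c unit_mat_carrier])
  also have "\<dots> \<le> N (unit_mat p i i (star a)) * N x * N (unit_mat p j j (star a))"
    by (intro mult_right_mono R(6)[OF unit_mat_carrier x] R(1)[OF unit_mat_carrier])
  finally have "norm (star a * a * star a) \<le> norm a * N x * norm a"
    using ij x by (simp add: unit_mat_mult norm_unit_mat a_def norm_star)
  moreover have "norm (star a * a * star a) = norm a * norm a * norm a"
  proof -
    have "(norm (star a * a * star a))\<^sup>2 = norm ((a * star a * a) * star (a * star a * a))"
      using cstar_identity[of "star (a * star a * a)"] by (simp add: star_simps mult.assoc)
    also have "(a * star a * a) * star (a * star a * a) = (a * star a * (a * star a)) * (a * star a)"
      by (simp add: star_simps mult.assoc)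
    also have "norm \<dots> = (norm a * norm a * norm a)\<^sup>2"
    proof -
      define h where "h = into_unitization (a * star a)"
      have sh: "star h = h" by (simp add: h_def into_unitization_simps(8)[symmetric] star_simps)
      have n: "norm h = (norm a)\<^sup>2"
        using cstar_identity[of "star a"] by (simp add: h_def star_star norm_star)
      have "norm h ^ 4 = norm (h * h * h * h)"
        using norm_pow2_self_adjoint[OF sh, of 2] by (simp add: power4_eq_xxxx)
      also have "\<dots> \<le> norm (h * h * h) * norm h" by (rule norm_mult_ineq)
      finally have "norm h ^ 3 \<le> norm (h * h * h)"
        using n False by (simp add: a_def eval_nat_numeral)
      moreover have "norm (h * h * h) \<le> norm h * norm h * norm h"
        by (rule order_trans[OF norm_mult_ineq mult_right_mono[OF norm_mult_ineq norm_ge_zero]])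
      ultimately have "norm (h * h * h) = norm h ^ 3" by (simp add: power3_eq_cube)
      moreover have "h * h * h = into_unitization (a * star a * (a * star a) * (a * star a))"
        by (simp add: h_def into_unitization_simps)
      ultimately have "norm (a * star a * (a * star a) * (a * star a)) = norm h ^ 3" by simp
      then show ?thesis unfolding n by (simp add: power_mult_distrib power3_eq_cube power2_eq_square)
    qed
    finally show ?thesis by (simp add: power2_eq_iff_nonneg)
  qed
  moreover have "norm a > 0" using False by (simp add: a_def)
  ultimately show ?thesis by (simp add: a_def[symmetric] mult.assoc)
qed

lemma norm_restriction_le_sum_entries:
  assumes "x \<in> carrier_mat p p" "S \<subseteq> {..<p} \<times> {..<p}"
  shows "N (mat p p (\<lambda>ij. if ij \<in> S then x $$ ij else 0)) \<le> (\<Sum>ij\<in>S. norm (x $$ ij))"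
proof -
  have "finite S" using assms(2) by (rule finite_subset) simp
  from this assms(2) show ?thesis
  proof (induction S rule: finite_induct)
    case empty
    have "mat p p (\<lambda>ij. if ij \<in> {} then x $$ ij else 0) = 0\<^sub>m p p" by (rule eq_matI) auto
    then show ?case using cstar_norm_on_matrices_rules(2)[of "0\<^sub>m p p"] by simp
  next
    case (insert s S)
    obtain i j where s: "s = (i, j)" by (cases s)
    have ij: "i < p" "j < p" using insert.prems s by auto
    let ?m = "\<lambda>S. mat p p (\<lambda>ij. if ij \<in> S then x $$ ij else 0)"
    have "?m (insert s S) = unit_mat p i j (x $$ s) + ?m S"
      using insert.hyps s by (intro eq_matI) (auto simp: unit_mat_def)
    then have "N (?m (insert s S)) \<le> N (unit_mat p i j (x $$ s)) + N (?m S)"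
      using cstar_norm_on_matrices_rules(5)[OF unit_mat_carrier] by simp
    also have "\<dots> \<le> norm (x $$ s) + (\<Sum>ij\<in>S. norm (x $$ ij))"
      using insert ij by (simp add: norm_unit_mat)
    finally show ?case using insert.hyps by simp
  qed
qed

lemma norm_le_sum_entries:
  assumes "x \<in> carrier_mat p p"
  shows "N x \<le> (\<Sum>ij\<in>{..<p} \<times> {..<p}. norm (x $$ ij))"
proof -
  have "mat p p (\<lambda>ij. if ij \<in> {..<p} \<times> {..<p} then x $$ ij else 0) = x"
    using assms by (intro eq_matI) auto
  then show ?thesis using norm_restriction_le_sum_entries[OF assms order_refl] by simp
qed

end

lemma pow2_bounded_imp_le:
  fixes a b C :: real
  assumes "\<And>k. a ^ (2 ^ k) \<le> C * b ^ (2 ^ k)" "0 \<le> a" "0 \<le> b"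
  shows "a \<le> b"
proof (rule ccontr)
  assume "\<not> a \<le> b"
  then have ab: "b < a" by simp
  show False
  proof (cases "b = 0")
    case True
    then show False using assms(1)[of 0] ab by simp
  next
    case False
    then have b: "b > 0" using assms(3) by simp
    then have q: "1 < a / b" using ab by simp
    obtain n where n: "C < (a / b) ^ n" using real_arch_pow[OF q] by blast
    have "(a / b) ^ n \<le> (a / b) ^ (2 ^ n)"
      using q by (intro power_increasing) (auto simp: less_imp_le)
    with n have "C < (a / b) ^ (2 ^ n)" by simp
    then show False using assms(1)[of n] b by (simp add: power_divide field_simps)
  qed
qed

fun iter_square :: "'a::semiring_0 mat \<Rightarrow> nat \<Rightarrow> 'a mat" where
  "iter_square x 0 = x"
| "iter_square x (Suc k) = iter_square x k * iter_square x k"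

lemma mat_star_mult:
  fixes x y :: "'a::banach_star_algebra mat"
  assumes x: "x \<in> carrier_mat p p" and y: "y \<in> carrier_mat p p"
  shows "mat_star (x * y) = mat_star y * mat_star x"
proof (rule eq_matI)
  fix i j assume "i < dim_row (mat_star y * mat_star x)" "j < dim_col (mat_star y * mat_star x)"
  then have ij: "i < p" "j < p" using assms by (auto simp: mat_star_def)
  show "mat_star (x * y) $$ (i, j) = (mat_star y * mat_star x) $$ (i, j)"
    using ij by (simp add: mat_star_index[OF mult_carrier_mat[OF x y]] mat_mult_index[OF x y]
        mat_mult_index[OF mat_star_carrier[OF y] mat_star_carrier[OF x]] mat_star_index[OF x]
        mat_star_index[OF y] star_sum star_mult del: index_mult_mat(1))
qed (use assms in \<open>auto simp: mat_star_def\<close>)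

lemma mat_star_mat_star: "x \<in> carrier_mat p p \<Longrightarrow> mat_star (mat_star x) = x"
  by (rule eq_matI) (auto simp: mat_star_def star_star)

text \<open>Any two C*-norms on matrices are equivalent, since both lie between the largest norm of an
  entry and the sum of the norms of the entries. A C*-norm of \<open>T = x\<^sup>* x\<close> to the power \<open>2\<^sup>k\<close> is
  the norm of the corresponding power of \<open>T\<close>, so the constant of the equivalence disappears as
  \<open>k\<close> grows.\<close>

lemma cstar_norm_on_matrices_le:
  fixes N N' :: "'a::cstar_algebra mat \<Rightarrow> real"
  assumes N: "cstar_norm_on_matrices p N" and N': "cstar_norm_on_matrices p N'"
    and x: "x \<in> carrier_mat p p"
  shows "N x \<le> N' x"
proof -
  let ?S = "iter_square (mat_star x * x)"
  have T: "mat_star x * x \<in> carrier_mat p p"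
    using x mat_star_carrier by (metis mult_carrier_mat)
  have S: "?S k \<in> carrier_mat p p \<and> mat_star (?S k) = ?S k" for k
  proof (induction k)
    case 0
    then show ?case
      using T x by (simp add: mat_star_mult[OF mat_star_carrier[OF x] x] mat_star_mat_star[OF x])
  next
    case (Suc k)
    then have c: "?S k \<in> carrier_mat p p" and s: "mat_star (?S k) = ?S k" by auto
    show ?case using mult_carrier_mat[OF c c] by (simp add: mat_star_mult[OF c c] s)
  qed
  have pow: "N (?S k) = N (mat_star x * x) ^ (2 ^ k)" if "cstar_norm_on_matrices p N" for N :: "'a mat \<Rightarrow> real" and k
  proof (induction k)
    case (Suc k)
    have "N (?S (Suc k)) = (N (?S k))\<^sup>2"
      using cstar_norm_on_matrices_rules(4)[OF that, of "?S k"] S[of k] by simp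
    then show ?case by (simp add: Suc power_mult[symmetric] mult.commute)
  qed simp
  have "N (mat_star x * x) ^ (2 ^ k) \<le> (\<Sum>ij\<in>{..<p} \<times> {..<p}. 1) * N' (mat_star x * x) ^ (2 ^ k)" for k
  proof -
    have "N (?S k) \<le> (\<Sum>ij\<in>{..<p} \<times> {..<p}. norm (?S k $$ ij))"
      using norm_le_sum_entries[OF N] S by blast
    also have "\<dots> \<le> (\<Sum>ij\<in>{..<p} \<times> {..<p}. N' (?S k))"
      using norm_entry_le[OF N'] S by (intro sum_mono) auto
    finally show ?thesis by (simp add: pow[OF N] pow[OF N'])
  qed
  then have "N (mat_star x * x) \<le> N' (mat_star x * x)"
    by (rule pow2_bounded_imp_le)
      (auto intro: cstar_norm_on_matrices_rules(1)[OF N T] cstar_norm_on_matrices_rules(1)[OF N' T])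
  then have "(N x)\<^sup>2 \<le> (N' x)\<^sup>2"
    by (simp add: cstar_norm_on_matrices_rules(4)[OF N x] cstar_norm_on_matrices_rules(4)[OF N' x])
  then show ?thesis by (rule power2_le_imp_le) (rule cstar_norm_on_matrices_rules(1)[OF N' x])
qed

theorem mat_norm_eq_matrix_norm:
  fixes x :: "'a::cstar_algebra mat"
  assumes x: "x \<in> carrier_mat p p"
  shows "mat_norm x = matrix_norm x"
proof -
  have p: "dim_row x = p" using x by simp
  show ?thesis
    unfolding mat_norm_def p
  proof (rule the_equality)
    show "\<exists>N. cstar_norm_on_matrices p N \<and> matrix_norm x = N x" using matrix_norm_cstar by blast
    show "r = matrix_norm x" if "\<exists>N. cstar_norm_on_matrices p N \<and> r = N x" for r
      using that cstar_norm_on_matrices_le[OF _ matrix_norm_cstar x]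
        cstar_norm_on_matrices_le[OF matrix_norm_cstar _ x] by (meson antisym)
  qed
qed

section \<open>Row-column decompositions\<close>

lemma posit_norm_mono:
  fixes x y :: "'a::unital_cstar_algebra"
  assumes "posit x" "posit (y - x)"
  shows "norm x \<le> norm y"
proof (rule norm_le_of_posit_diff[OF assms(1)])
  have "posit y" using posit_add[OF assms] by simp
  then have "posit (norm y *\<^sub>R 1 - y)" by (rule posit_norm_diff) simp
  from posit_add[OF this assms(2)] show "posit (norm y *\<^sub>R 1 - x)" by simp
qed simp

text \<open>Lagrange's identity: the difference is half the sum of the squares of all
  \<open>cnj (t j) x i - cnj (t i) x j\<close>.\<close>

lemma posit_Cauchy_Schwarz:
  fixes x :: "'i \<Rightarrow> 'a::unital_cstar_algebra" and t :: "'i \<Rightarrow> complex"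
  assumes "finite F"
  shows "posit ((\<Sum>i\<in>F. (cmod (t i))\<^sup>2) *\<^sub>R (\<Sum>i\<in>F. star (x i) * x i) -
    star (\<Sum>i\<in>F. t i *\<^sub>C x i) * (\<Sum>i\<in>F. t i *\<^sub>C x i))"
proof -
  let ?s = "\<Sum>i\<in>F. (cmod (t i))\<^sup>2" and ?X = "\<Sum>i\<in>F. star (x i) * x i"
  let ?Y = "star (\<Sum>i\<in>F. t i *\<^sub>C x i) * (\<Sum>i\<in>F. t i *\<^sub>C x i)"
  define d where "d i j = cnj (t j) *\<^sub>C x i - cnj (t i) *\<^sub>C x j" for i j
  define m where "m i j = (cnj (t i) * t j) *\<^sub>C (star (x i) * x j)" for i j
  have expand: "star (d i j) * d i j =
      (cmod (t j))\<^sup>2 *\<^sub>R (star (x i) * x i) + (cmod (t i))\<^sup>2 *\<^sub>R (star (x j) * x j) - m i j - m j i" for i j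
  proof -
    have "star (d i j) * d i j = star (cnj (t j) *\<^sub>C x i) * (cnj (t j) *\<^sub>C x i) +
        star (cnj (t i) *\<^sub>C x j) * (cnj (t i) *\<^sub>C x j) - m i j - m j i"
      by (simp add: d_def m_def star_simps algebra_simps)
    then show ?thesis by (simp only: star_scaleC_mult complex_mod_cnj)
  qed
  have "(\<Sum>i\<in>F. \<Sum>j\<in>F. (cmod (t j))\<^sup>2 *\<^sub>R (star (x i) * x i)) = ?s *\<^sub>R ?X"
    by (simp add: scaleR_sum_left[symmetric] scaleR_sum_right[symmetric])
  moreover have "(\<Sum>i\<in>F. \<Sum>j\<in>F. (cmod (t i))\<^sup>2 *\<^sub>R (star (x j) * x j)) = ?s *\<^sub>R ?X"
    by (simp add: scaleR_sum_left[symmetric] scaleR_sum_right[symmetric])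
  moreover have Y: "(\<Sum>i\<in>F. \<Sum>j\<in>F. m i j) = ?Y"
    by (simp add: m_def star_sum star_scaleC sum_product star_simps mult.commute)
  moreover have "(\<Sum>i\<in>F. \<Sum>j\<in>F. m j i) = ?Y"
    by (subst sum.swap) (rule Y)
  ultimately have "(\<Sum>i\<in>F. \<Sum>j\<in>F. star (d i j) * d i j) = (?s *\<^sub>R ?X + ?s *\<^sub>R ?X) - ?Y - ?Y"
    by (simp add: expand sum.distrib sum_subtractf)
  also have "\<dots> = 2 *\<^sub>R (?s *\<^sub>R ?X - ?Y)" by (simp add: scaleR_2)
  finally have "?s *\<^sub>R ?X - ?Y = (1 / 2) *\<^sub>R (\<Sum>i\<in>F. \<Sum>j\<in>F. star (d i j) * d i j)" by simp
  moreover have "posit ((1 / 2) *\<^sub>R (\<Sum>i\<in>F. \<Sum>j\<in>F. star (d i j) * d i j))"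
    by (intro posit_scaleR posit_sum posit_star_mult) simp
  ultimately show ?thesis by simp
qed

lemma norm_sum_scaleC_column:
  fixes b :: "'i \<Rightarrow> 'a::cstar_algebra"
  assumes "finite F"
  shows "(norm (\<Sum>i\<in>F. t i *\<^sub>C b i))\<^sup>2 \<le> (\<Sum>i\<in>F. (cmod (t i))\<^sup>2) * norm (\<Sum>i\<in>F. star (b i) * b i)"
proof -
  let ?y = "\<Sum>i\<in>F. t i *\<^sub>C b i"
  have "norm (star (into_unitization ?y) * into_unitization ?y) \<le>
      norm ((\<Sum>i\<in>F. (cmod (t i))\<^sup>2) *\<^sub>R into_unitization (\<Sum>i\<in>F. star (b i) * b i))"
    using posit_norm_mono[OF posit_star_mult posit_Cauchy_Schwarz[OF assms, of t "\<lambda>i. into_unitization (b i)"]]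
    by (simp add: into_unitization_sum into_unitization_simps)
  then show ?thesis by (simp add: cstar_identity sum_nonneg)
qed

lemma norm_sum_scaleC_row:
  fixes a :: "'i \<Rightarrow> 'a::cstar_algebra"
  assumes "finite F"
  shows "(norm (\<Sum>i\<in>F. t i *\<^sub>C a i))\<^sup>2 \<le> (\<Sum>i\<in>F. (cmod (t i))\<^sup>2) * norm (\<Sum>i\<in>F. a i * star (a i))"
proof -
  have "star (\<Sum>i\<in>F. t i *\<^sub>C a i) = (\<Sum>i\<in>F. cnj (t i) *\<^sub>C star (a i))"
    by (simp add: star_sum star_scaleC)
  then have "norm (\<Sum>i\<in>F. t i *\<^sub>C a i) = norm (\<Sum>i\<in>F. cnj (t i) *\<^sub>C star (a i))"
    by (metis norm_star)
  then show ?thesis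
    using norm_sum_scaleC_column[OF assms, of "\<lambda>i. cnj (t i)" "\<lambda>i. star (a i)"] by (simp add: star_star)
qed

text \<open>A bounded functional is completely bounded with the same norm on columns and on rows: test
  on \<open>t i = cnj (f (x i))\<close>. The hypothesis covers both cases, see the two preceding lemmas.\<close>

lemma functional_square_sum:
  fixes f :: "'a::banach_star_algebra \<Rightarrow> complex"
  assumes f: "bounded_clinear_functional f" and F: "finite F"
    and bound: "\<And>t. (norm (\<Sum>i\<in>F. t i *\<^sub>C x i))\<^sup>2 \<le> (\<Sum>i\<in>F. (cmod (t i))\<^sup>2) * c" and c: "0 \<le> c"
  shows "(\<Sum>i\<in>F. (cmod (f (x i)))\<^sup>2) \<le> (onorm f)\<^sup>2 * c"
proof -
  let ?S = "\<Sum>i\<in>F. (cmod (f (x i)))\<^sup>2" and ?y = "\<Sum>i\<in>F. cnj (f (x i)) *\<^sub>C x i"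
  have bl: "bounded_linear f" and sc: "f (c *\<^sub>C x) = c * f x" for c x
    using f by (auto simp: bounded_clinear_functional_def)
  have "f ?y = (\<Sum>i\<in>F. complex_of_real ((cmod (f (x i)))\<^sup>2))"
    by (simp only: linear_sum[OF bounded_linear.linear[OF bl]] sc complex_norm_square mult.commute)
  then have fy: "f ?y = complex_of_real ?S" by simp
  have S0: "0 \<le> ?S" by (simp add: sum_nonneg)
  have "?S = cmod (f ?y)" unfolding fy using S0 by (simp del: of_real_sum)
  also have "\<dots> \<le> onorm f * norm ?y" by (rule onorm[OF bl])
  finally have "?S\<^sup>2 \<le> (onorm f * norm ?y)\<^sup>2" using S0 by (rule power_mono)
  also have "\<dots> \<le> (onorm f)\<^sup>2 * (?S * c)"
    unfolding power_mult_distrib using bound[of "\<lambda>i. cnj (f (x i))"] by (intro mult_left_mono) auto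
  finally have "?S * ?S \<le> ?S * ((onorm f)\<^sup>2 * c)" by (simp add: power2_eq_square mult_ac)
  then show ?thesis using S0 c by (cases "?S = 0") (auto simp: mult_le_cancel_left)
qed

lemma tensor_zero_left: "0 \<otimes>\<^sub>a b = 0"
  using tensor_scaleC_left[of 0 0 b] by simp

lemma tensor_zero_right: "a \<otimes>\<^sub>a 0 = 0"
  using tensor_scaleC_right[of a 0 0] by simp

lemma tensor_sum_left: "(\<Sum>i\<in>I. f i) \<otimes>\<^sub>a b = (\<Sum>i\<in>I. f i \<otimes>\<^sub>a b)"
  by (induction I rule: infinite_finite_induct) (simp_all add: tensor_zero_left tensor_add_left)

lemma tensor_sum_right: "a \<otimes>\<^sub>a (\<Sum>i\<in>I. f i) = (\<Sum>i\<in>I. a \<otimes>\<^sub>a f i)"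
  by (induction I rule: infinite_finite_induct) (simp_all add: tensor_zero_right tensor_add_right)

text \<open>Multiplying out \<open>\<alpha> (x \<otimes> y) \<beta>\<close>, the scalar row \<open>\<alpha>\<close> is absorbed into \<open>x\<close> and the scalar
  column \<open>\<beta>\<close> into \<open>y\<close>, which leaves a single sum of elementary tensors over the row indices of
  \<open>y\<close> and the column indices of \<open>x\<close>.\<close>

definition sandwich_row :: "(nat \<times> nat \<Rightarrow> complex) \<Rightarrow> 'a::cstar_algebra mat \<Rightarrow> nat \<times> nat \<Rightarrow> 'a" where
  "sandwich_row \<alpha> x = (\<lambda>(k, j). \<Sum>i<dim_row x. \<alpha> (i, k) *\<^sub>C x $$ (i, j))"

definition sandwich_col :: "'b::cstar_algebra mat \<Rightarrow> (nat \<times> nat \<Rightarrow> complex) \<Rightarrow> nat \<times> nat \<Rightarrow> 'b" where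
  "sandwich_col y \<beta> = (\<lambda>(k, j). \<Sum>l<dim_col y. \<beta> (j, l) *\<^sub>C y $$ (k, l))"

lemma sandwich_eq_sum:
  "sandwich \<alpha> x y \<beta> = (\<Sum>s\<in>{..<dim_row y} \<times> {..<dim_col x}. sandwich_row \<alpha> x s \<otimes>\<^sub>a sandwich_col y \<beta> s)"
proof -
  have "sandwich \<alpha> x y \<beta> = (\<Sum>i<dim_row x. \<Sum>k<dim_row y. \<Sum>j<dim_col x. \<Sum>l<dim_col y.
      (\<alpha> (i, k) *\<^sub>C x $$ (i, j)) \<otimes>\<^sub>a (\<beta> (j, l) *\<^sub>C y $$ (k, l)))"
    by (simp add: sandwich_def sum.cartesian_product[symmetric] tensor_scaleC_left tensor_scaleC_right
        scaleC_scaleC mult.commute)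
  also have "\<dots> = (\<Sum>k<dim_row y. \<Sum>i<dim_row x. \<Sum>j<dim_col x. \<Sum>l<dim_col y.
      (\<alpha> (i, k) *\<^sub>C x $$ (i, j)) \<otimes>\<^sub>a (\<beta> (j, l) *\<^sub>C y $$ (k, l)))"
    by (rule sum.swap)
  also have "\<dots> = (\<Sum>k<dim_row y. \<Sum>j<dim_col x. \<Sum>i<dim_row x. \<Sum>l<dim_col y.
      (\<alpha> (i, k) *\<^sub>C x $$ (i, j)) \<otimes>\<^sub>a (\<beta> (j, l) *\<^sub>C y $$ (k, l)))"
    by (rule sum.cong[OF refl]) (rule sum.swap)
  also have "\<dots> = (\<Sum>k<dim_row y. \<Sum>j<dim_col x. sandwich_row \<alpha> x (k, j) \<otimes>\<^sub>a sandwich_col y \<beta> (k, j))"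
    by (simp only: sandwich_row_def sandwich_col_def prod.case tensor_sum_left)
      (simp only: tensor_sum_right)
  finally show ?thesis by (simp add: sum.cartesian_product case_prod_unfold)
qed

text \<open>Several linear combinations of the columns of \<open>X\<close> are images of scalar columns, whose
  inner squares are scalars.\<close>

lemma op_bound_columns:
  fixes X :: "nat \<Rightarrow> nat \<Rightarrow> 'a::unital_cstar_algebra"
  assumes X: "op_bound p X r" and v: "\<And>k j. k \<in> K \<Longrightarrow> j < p \<Longrightarrow> v k j = (\<Sum>i<p. \<gamma> k i *\<^sub>C X j i)"
  shows "norm (\<Sum>k\<in>K. sq_sum p (v k)) \<le> r\<^sup>2 * (\<Sum>k\<in>K. \<Sum>i<p. (cmod (\<gamma> k i))\<^sup>2)"
proof (rule norm_le_of_posit_diff)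
  show "posit (\<Sum>k\<in>K. sq_sum p (v k))" by (intro posit_sum posit_sq_sum)
  have "posit ((r\<^sup>2 * (\<Sum>i<p. (cmod (\<gamma> k i))\<^sup>2)) *\<^sub>R 1 - sq_sum p (v k))" if "k \<in> K" for k
  proof -
    let ?c = "\<lambda>i. \<gamma> k i *\<^sub>C (1::'a)"
    have "sq_sum p (mat_vec p X ?c) = sq_sum p (v k)"
      using that by (simp add: sq_sum_def mat_vec_def v mult_scaleC_right)
    moreover have "sq_sum p ?c = (\<Sum>i<p. (cmod (\<gamma> k i))\<^sup>2) *\<^sub>R 1"
      by (simp only: sq_sum_def star_scaleC_mult star_one mult_1_left scaleR_sum_left)
    moreover have "posit (r\<^sup>2 *\<^sub>R sq_sum p ?c - sq_sum p (mat_vec p X ?c))"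
      using X by (simp add: op_bound_def)
    ultimately show ?thesis by simp
  qed
  then have "posit (\<Sum>k\<in>K. (r\<^sup>2 * (\<Sum>i<p. (cmod (\<gamma> k i))\<^sup>2)) *\<^sub>R 1 - sq_sum p (v k))" by (rule posit_sum)
  then show "posit ((r\<^sup>2 * (\<Sum>k\<in>K. \<Sum>i<p. (cmod (\<gamma> k i))\<^sup>2)) *\<^sub>R 1 - (\<Sum>k\<in>K. sq_sum p (v k)))"
    by (simp only: sum_subtractf sum_distrib_left scaleR_sum_left)
qed (intro mult_nonneg_nonneg sum_nonneg; simp)

lemma op_bound_matrix_norm:
  "x \<in> carrier_mat p p \<Longrightarrow> op_bound p (\<lambda>i j. into_unitization (x $$ (i, j))) (matrix_norm x)"
  using op_bound_module_norm by (auto simp: matrix_norm_def)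

lemma op_bound_matrix_norm_star:
  "x \<in> carrier_mat p p \<Longrightarrow> op_bound p (\<lambda>i j. star (into_unitization (x $$ (j, i)))) (matrix_norm x)"
  using op_bound_module_norm[of p "\<lambda>i j. star (into_unitization (x $$ (j, i)))"]
  by (auto simp: matrix_norm_def module_norm_star)

lemma sandwich_row_bound:
  assumes x: "x \<in> carrier_mat p p"
  shows "norm (\<Sum>s\<in>{..<q} \<times> {..<p}. sandwich_row \<alpha> x s * star (sandwich_row \<alpha> x s)) \<le>
    (L2_set (\<lambda>r. cmod (\<alpha> r)) ({..<p} \<times> {..<q}) * matrix_norm x)\<^sup>2"
proof -
  have "norm (\<Sum>k<q. sq_sum p (\<lambda>j. star (into_unitization (sandwich_row \<alpha> x (k, j))))) \<le>
      (matrix_norm x)\<^sup>2 * (\<Sum>k<q. \<Sum>i<p. (cmod (cnj (\<alpha> (i, k))))\<^sup>2)"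
    using x by (intro op_bound_columns[OF op_bound_matrix_norm_star[OF x]])
      (simp add: sandwich_row_def into_unitization_sum into_unitization_simps star_sum star_scaleC)
  also have "(\<Sum>k<q. sq_sum p (\<lambda>j. star (into_unitization (sandwich_row \<alpha> x (k, j))))) =
      into_unitization (\<Sum>s\<in>{..<q} \<times> {..<p}. sandwich_row \<alpha> x s * star (sandwich_row \<alpha> x s))"
    by (simp add: sq_sum_def into_unitization_sum into_unitization_simps star_star sum.cartesian_product case_prod_unfold)
  also have "(\<Sum>k<q. \<Sum>i<p. (cmod (cnj (\<alpha> (i, k))))\<^sup>2) = (L2_set (\<lambda>r. cmod (\<alpha> r)) ({..<p} \<times> {..<q}))\<^sup>2"
    by (subst sum.swap) (simp add: L2_set_def sum_nonneg sum.cartesian_product case_prod_unfold)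
  finally show ?thesis by (simp add: power_mult_distrib mult.commute)
qed

lemma sandwich_col_bound:
  assumes y: "y \<in> carrier_mat q q"
  shows "norm (\<Sum>s\<in>{..<q} \<times> {..<p}. star (sandwich_col y \<beta> s) * sandwich_col y \<beta> s) \<le>
    (L2_set (\<lambda>r. cmod (\<beta> r)) ({..<p} \<times> {..<q}) * matrix_norm y)\<^sup>2"
proof -
  have "norm (\<Sum>j<p. sq_sum q (\<lambda>k. into_unitization (sandwich_col y \<beta> (k, j)))) \<le>
      (matrix_norm y)\<^sup>2 * (\<Sum>j<p. \<Sum>l<q. (cmod (\<beta> (j, l)))\<^sup>2)"
    using y by (intro op_bound_columns[OF op_bound_matrix_norm[OF y]])
      (simp add: sandwich_col_def into_unitization_sum into_unitization_simps)
  also have "(\<Sum>j<p. sq_sum q (\<lambda>k. into_unitization (sandwich_col y \<beta> (k, j)))) =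
      into_unitization (\<Sum>s\<in>{..<q} \<times> {..<p}. star (sandwich_col y \<beta> s) * sandwich_col y \<beta> s)"
    unfolding sq_sum_def
    by (subst sum.swap) (simp add: into_unitization_sum into_unitization_simps sum.cartesian_product case_prod_unfold)
  also have "(\<Sum>j<p. \<Sum>l<q. (cmod (\<beta> (j, l)))\<^sup>2) = (L2_set (\<lambda>r. cmod (\<beta> r)) ({..<p} \<times> {..<q}))\<^sup>2"
    by (simp add: L2_set_def sum_nonneg sum.cartesian_product case_prod_unfold)
  finally show ?thesis by (simp add: power_mult_distrib mult.commute)
qed

lemma alg_tensor_eq_sum: "\<exists>n a b. u = (\<Sum>i<n::nat. a i \<otimes>\<^sub>a b i)"
proof -
  have abs: "\<exists>n a b. abs_alg_tensor l = (\<Sum>i<n::nat. a i \<otimes>\<^sub>a b i)" for l :: "('a \<times> 'b) list"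
  proof (induction l)
    case Nil
    show ?case by (rule exI[of _ 0]) (simp add: zero_alg_tensor.abs_eq)
  next
    case (Cons p l)
    then obtain n a b where l: "abs_alg_tensor l = (\<Sum>i<n::nat. a i \<otimes>\<^sub>a b i)" by blast
    have "abs_alg_tensor (p # l) = fst p \<otimes>\<^sub>a snd p + abs_alg_tensor l"
      by (simp add: tensor.abs_eq plus_alg_tensor.abs_eq)
    then have "abs_alg_tensor (p # l) = (\<Sum>i<Suc n. (a(n := fst p)) i \<otimes>\<^sub>a (b(n := snd p)) i)"
      by (simp add: l add.commute)
    then show ?case by blast
  qed
  have "u = abs_alg_tensor (rep_alg_tensor u)"
    by (simp add: Quotient3_abs_rep[OF Quotient3_alg_tensor])
  then show ?thesis using abs by metis
qed

text \<open>Diagonal matrices and \<open>\<alpha>\<close>, \<open>\<beta>\<close> supported on the diagonal; one zero entry is added to make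
  the size positive.\<close>

lemma sum_eq_sandwich:
  fixes n :: nat and a :: "nat \<Rightarrow> 'a::cstar_algebra" and b :: "nat \<Rightarrow> 'b::cstar_algebra"
  obtains p x y \<alpha> \<beta> where "0 < p" "x \<in> carrier_mat p p" "y \<in> carrier_mat p p"
    "(\<Sum>i<n. a i \<otimes>\<^sub>a b i) = sandwich \<alpha> x y \<beta>"
proof -
  define m where "m = Suc n"
  define x where "x = mat m m (\<lambda>(i, j). if i = j \<and> i < n then a i else 0)"
  define y where "y = mat m m (\<lambda>(i, j). if i = j \<and> i < n then b i else 0)"
  define d where "d = (\<lambda>(i::nat, j::nat). if i = j then 1 else 0 :: complex)"
  have dims: "dim_row x = m" "dim_col x = m" "dim_row y = m" "dim_col y = m"
    by (simp_all add: x_def y_def)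
  have row: "sandwich_row d x (k, j) = x $$ (k, j)" if "k < m" for k j
  proof -
    have "sandwich_row d x (k, j) = (\<Sum>i<m. if i = k then x $$ (k, j) else 0)"
      unfolding sandwich_row_def prod.case dims by (rule sum.cong) (auto simp: d_def scaleC_one)
    then show ?thesis using that by simp
  qed
  have col: "sandwich_col y d (k, j) = y $$ (k, j)" if "j < m" for k j
  proof -
    have "sandwich_col y d (k, j) = (\<Sum>l<m. if l = j then y $$ (k, j) else 0)"
      unfolding sandwich_col_def prod.case dims by (rule sum.cong) (auto simp: d_def scaleC_one)
    then show ?thesis using that by simp
  qed
  have "sandwich d x y d = (\<Sum>k<m. \<Sum>j<m. sandwich_row d x (k, j) \<otimes>\<^sub>a sandwich_col y d (k, j))"
    unfolding sandwich_eq_sum dims by (simp add: sum.cartesian_product case_prod_unfold)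
  also have "\<dots> = (\<Sum>k<m. \<Sum>j<m. x $$ (k, j) \<otimes>\<^sub>a y $$ (k, j))"
    by (intro sum.cong refl) (simp only: row col lessThan_iff)
  also have "\<dots> = (\<Sum>k<m. \<Sum>j<m. if j = k then (if k < n then a k \<otimes>\<^sub>a b k else 0) else 0)"
    by (intro sum.cong refl) (auto simp: x_def y_def tensor_zero_left)
  also have "\<dots> = (\<Sum>k<m. if k < n then a k \<otimes>\<^sub>a b k else 0)" by simp
  also have "\<dots> = (\<Sum>k<n. a k \<otimes>\<^sub>a b k)" by (simp add: m_def)
  finally have "(\<Sum>i<n. a i \<otimes>\<^sub>a b i) = sandwich d x y d" by simp
  moreover have "0 < m" by (simp add: m_def)
  moreover have "x \<in> carrier_mat m m" "y \<in> carrier_mat m m" using dims by auto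
  ultimately show ?thesis using that by blast
qed

lemma sum_norm_le_0_imp:
  fixes a :: "'i \<Rightarrow> 'a::cstar_algebra"
  assumes F: "finite F" "i \<in> F" and "norm (\<Sum>i\<in>F. star (a i) * a i) \<le> 0"
  shows "a i = 0"
proof -
  let ?t = "\<lambda>j. if j = i then 1 else 0 :: complex"
  have "(norm (\<Sum>j\<in>F. ?t j *\<^sub>C a j))\<^sup>2 \<le> (\<Sum>j\<in>F. (cmod (?t j))\<^sup>2) * 0"
    using norm_sum_scaleC_column[OF F(1), of ?t a] assms(3) by simp
  moreover have "(\<Sum>j\<in>F. ?t j *\<^sub>C a j) = (\<Sum>j\<in>F. if j = i then a i else 0)"
    by (rule sum.cong) (auto simp: scaleC_one)
  ultimately show ?thesis using F by simp
qed

text \<open>The operator space projective norm dominates the Haagerup norm: nearly optimal \<open>\<alpha>\<close>, \<open>x\<close>,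
  \<open>y\<close>, \<open>\<beta>\<close> give a row of norm at most \<open>\<parallel>\<alpha>\<parallel> \<parallel>x\<parallel>\<close> and a column of norm at most \<open>\<parallel>y\<parallel> \<parallel>\<beta>\<parallel>\<close>. Only the
  product of these two is controlled.\<close>

lemma row_column_decomposition:
  fixes u :: "('a::cstar_algebra, 'b::cstar_algebra) alg_tensor"
  assumes e: "e > 0" and nonneg: "0 \<le> op_proj_norm u"
  obtains F :: "(nat \<times> nat) set" and a b where "finite F" "u = (\<Sum>i\<in>F. a i \<otimes>\<^sub>a b i)"
    "norm (\<Sum>i\<in>F. a i * star (a i)) \<le> op_proj_norm u + e"
    "norm (\<Sum>i\<in>F. star (b i) * b i) \<le> op_proj_norm u + e"
proof -
  let ?V = "{L2_set (\<lambda>r. cmod (\<alpha> r)) ({..<p} \<times> {..<q}) * mat_norm x * mat_norm y *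
       L2_set (\<lambda>r. cmod (\<beta> r)) ({..<p} \<times> {..<q}) | \<alpha> \<beta> x y p q.
       0 < p \<and> 0 < q \<and> x \<in> carrier_mat p p \<and> y \<in> carrier_mat q q \<and> u = sandwich \<alpha> x y \<beta>}"
  obtain n a b where "u = (\<Sum>i<n::nat. a i \<otimes>\<^sub>a b i)" using alg_tensor_eq_sum by blast
  then obtain p0 x0 y0 \<alpha>0 \<beta>0 where "0 < p0" "x0 \<in> carrier_mat p0 p0" "y0 \<in> carrier_mat p0 p0"
    "u = sandwich \<alpha>0 x0 y0 \<beta>0"
    using sum_eq_sandwich[where n = n and a = a and b = b] by metis
  then have "?V \<noteq> {}" by blast
  then have "\<exists>v\<in>?V. v < op_proj_norm u + e"
    using cInf_lessD[of ?V "op_proj_norm u + e"] e by (simp add: op_proj_norm_def)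
  then obtain \<alpha> \<beta> x y p q where x: "x \<in> carrier_mat p p" and y: "y \<in> carrier_mat q q"
    and u: "u = sandwich \<alpha> x y \<beta>"
    and v: "L2_set (\<lambda>r. cmod (\<alpha> r)) ({..<p} \<times> {..<q}) * mat_norm x * mat_norm y *
       L2_set (\<lambda>r. cmod (\<beta> r)) ({..<p} \<times> {..<q}) < op_proj_norm u + e"
    by blast
  define s where "s = L2_set (\<lambda>r. cmod (\<alpha> r)) ({..<p} \<times> {..<q}) * matrix_norm x"
  define t where "t = L2_set (\<lambda>r. cmod (\<beta> r)) ({..<p} \<times> {..<q}) * matrix_norm y"
  have st: "0 \<le> s" "0 \<le> t" "s * t \<le> op_proj_norm u + e"
    using v x y unfolding mat_norm_eq_matrix_norm[OF x] mat_norm_eq_matrix_norm[OF y]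
    by (auto simp: s_def t_def L2_set_nonneg matrix_norm_def module_norm_nonneg mult_ac)
  define F where "F = {..<q} \<times> {..<p}"
  have F: "finite F" by (simp add: F_def)
  let ?a = "sandwich_row \<alpha> x" and ?b = "sandwich_col y \<beta>"
  have u: "u = (\<Sum>i\<in>F. ?a i \<otimes>\<^sub>a ?b i)" using x y by (auto simp: u sandwich_eq_sum F_def)
  have A: "norm (\<Sum>i\<in>F. ?a i * star (?a i)) \<le> s\<^sup>2"
    unfolding F_def s_def by (rule sandwich_row_bound[OF x])
  have B: "norm (\<Sum>i\<in>F. star (?b i) * ?b i) \<le> t\<^sup>2"
    unfolding F_def t_def by (rule sandwich_col_bound[OF y])
  show ?thesis
  proof (cases "s = 0 \<or> t = 0")
    case True
    have "?a i \<otimes>\<^sub>a ?b i = 0" if i: "i \<in> F" for i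
    proof (cases "s = 0")
      case True
      then have "star (?a i) = 0"
        using A sum_norm_le_0_imp[OF F i, of "\<lambda>i. star (?a i)"] by (simp add: star_star)
      then have "?a i = 0" by (metis star_star star_zero)
      then show ?thesis by (simp add: tensor_zero_left)
    next
      case False
      then have "?b i = 0" using \<open>s = 0 \<or> t = 0\<close> B sum_norm_le_0_imp[OF F i, of ?b] by simp
      then show ?thesis by (simp add: tensor_zero_right)
    qed
    then have "u = 0" by (simp add: u)
    then show ?thesis using that[of "{}"] e nonneg by simp
  next
    case False
    then have s: "0 < s" "0 < t" using st by auto
    \<comment> \<open>Rescaling by \<open>c\<close> and \<open>1 / c\<close> turns the bounds \<open>s\<^sup>2\<close> and \<open>t\<^sup>2\<close> both into \<open>s t\<close>.\<close>
    define c where "c = sqrt (t / s)"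
    have c: "c > 0" "c\<^sup>2 = t / s" using s by (auto simp: c_def)
    show ?thesis
    proof (rule that[OF F, of "\<lambda>i. complex_of_real c *\<^sub>C ?a i" "\<lambda>i. complex_of_real (1 / c) *\<^sub>C ?b i"])
      show "u = (\<Sum>i\<in>F. (complex_of_real c *\<^sub>C ?a i) \<otimes>\<^sub>a (complex_of_real (1 / c) *\<^sub>C ?b i))"
        using c by (simp add: u tensor_scaleC_left tensor_scaleC_right scaleC_scaleC scaleC_one)
      have "(\<Sum>i\<in>F. (complex_of_real c *\<^sub>C ?a i) * star (complex_of_real c *\<^sub>C ?a i)) =
          c\<^sup>2 *\<^sub>R (\<Sum>i\<in>F. ?a i * star (?a i))"
        by (simp add: scaleC_of_real star_scaleR scaleR_sum_right power2_eq_square)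
      then have "norm (\<Sum>i\<in>F. (complex_of_real c *\<^sub>C ?a i) * star (complex_of_real c *\<^sub>C ?a i)) \<le> c\<^sup>2 * s\<^sup>2"
        using A by (simp add: mult_left_mono)
      also have "\<dots> = s * t" unfolding c(2) using s by (simp add: power2_eq_square)
      finally show "norm (\<Sum>i\<in>F. (complex_of_real c *\<^sub>C ?a i) * star (complex_of_real c *\<^sub>C ?a i)) \<le> op_proj_norm u + e"
        using st by simp
      have "(\<Sum>i\<in>F. star (complex_of_real (1 / c) *\<^sub>C ?b i) * (complex_of_real (1 / c) *\<^sub>C ?b i)) =
          (1 / c\<^sup>2) *\<^sub>R (\<Sum>i\<in>F. star (?b i) * ?b i)"
        by (simp only: scaleC_of_real star_scaleR) (simp add: scaleR_sum_right power2_eq_square)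
      then have "norm (\<Sum>i\<in>F. star (complex_of_real (1 / c) *\<^sub>C ?b i) * (complex_of_real (1 / c) *\<^sub>C ?b i)) \<le> (1 / c\<^sup>2) * t\<^sup>2"
        using B c(1) by (simp add: divide_right_mono)
      also have "\<dots> = s * t" unfolding c(2) using s by (simp add: power2_eq_square)
      finally show "norm (\<Sum>i\<in>F. star (complex_of_real (1 / c) *\<^sub>C ?b i) * (complex_of_real (1 / c) *\<^sub>C ?b i)) \<le> op_proj_norm u + e"
        using st by simp
    qed
  qed
qed

section \<open>Slice maps and products of functionals\<close>

definition cbilinear :: "('a::complex_vector \<Rightarrow> 'b::complex_vector \<Rightarrow> 'c::complex_vector) \<Rightarrow> bool" where
  "cbilinear T \<longleftrightarrow> (\<forall>a a' b. T (a + a') b = T a b + T a' b) \<and> (\<forall>a b b'. T a (b + b') = T a b + T a b') \<and>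
     (\<forall>c a b. T (c *\<^sub>C a) b = c *\<^sub>C T a b) \<and> (\<forall>c a b. T a (c *\<^sub>C b) = c *\<^sub>C T a b)"

text \<open>The universal property of the algebraic tensor product.\<close>

definition tensor_lift ::
  "('a::complex_vector \<Rightarrow> 'b::complex_vector \<Rightarrow> 'c::complex_vector) \<Rightarrow> ('a, 'b) alg_tensor \<Rightarrow> 'c" where
  "tensor_lift T u = sum_list (map (case_prod T) (rep_alg_tensor u))"

lemma tensor_eq_sum_list:
  assumes "tensor_eq s t" and T: "cbilinear T"
  shows "sum_list (map (case_prod T) s) = sum_list (map (case_prod T) t)"
  using assms(1)
proof induction
  case (tensor_eq_zero b)
  have "T (0 *\<^sub>C 0) b = 0 *\<^sub>C T 0 b" using T unfolding cbilinear_def by blast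
  then show ?case by simp
qed (use T in \<open>auto simp: cbilinear_def add.commute\<close>)

context
  fixes T :: "'a::complex_vector \<Rightarrow> 'b::complex_vector \<Rightarrow> 'c::complex_vector"
  assumes T: "cbilinear T"
begin

lemma tensor_lift_abs: "tensor_lift T (abs_alg_tensor s) = sum_list (map (case_prod T) s)"
proof -
  have "tensor_eq (rep_alg_tensor (abs_alg_tensor s)) s"
    by (rule rep_abs_rsp_left[OF Quotient3_alg_tensor]) (rule tensor_eq_refl)
  then show ?thesis unfolding tensor_lift_def by (rule tensor_eq_sum_list[OF _ T])
qed

lemma tensor_lift_tensor: "tensor_lift T (a \<otimes>\<^sub>a b) = T a b"
  by (simp add: tensor.abs_eq tensor_lift_abs)

lemma alg_tensor_abs_cases: obtains s where "(u :: ('x::complex_vector, 'y::complex_vector) alg_tensor) = abs_alg_tensor s"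
  by (metis Quotient3_abs_rep[OF Quotient3_alg_tensor])

lemma tensor_lift_add: "tensor_lift T (u + v) = tensor_lift T u + tensor_lift T v"
  by (cases u rule: alg_tensor_abs_cases; cases v rule: alg_tensor_abs_cases)
    (simp add: plus_alg_tensor.abs_eq tensor_lift_abs)

lemma tensor_lift_scaleC: "tensor_lift T (c *\<^sub>C u) = c *\<^sub>C tensor_lift T u"
proof (cases u rule: alg_tensor_abs_cases)
  case (1 s)
  have "T (c *\<^sub>C a) b = c *\<^sub>C T a b" for a b using T unfolding cbilinear_def by blast
  then have "sum_list (map (case_prod T) (map (\<lambda>(a, b). (c *\<^sub>C a, b)) s)) = c *\<^sub>C sum_list (map (case_prod T) s)"
    by (induction s) (auto simp: scaleC_add_right)
  then show ?thesis by (simp add: 1 scaleC_alg_tensor.abs_eq tensor_lift_abs)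
qed

lemma tensor_lift_zero: "tensor_lift T 0 = 0"
  using tensor_lift_scaleC[of 0 0] by simp

lemma tensor_lift_sum: "tensor_lift T (\<Sum>i\<in>I. f i) = (\<Sum>i\<in>I. tensor_lift T (f i))"
  by (induction I rule: infinite_finite_induct) (auto simp: tensor_lift_zero tensor_lift_add)

end

lemma bounded_clinear_functionalD:
  assumes "bounded_clinear_functional f"
  shows "bounded_linear f" "f (c *\<^sub>C x) = c * f x" "f (x + y) = f x + f y"
    "cmod (f x) \<le> onorm f * norm x"
proof -
  show bl: "bounded_linear f" and "f (c *\<^sub>C x) = c * f x"
    using assms by (auto simp: bounded_clinear_functional_def)
  show "f (x + y) = f x + f y" by (rule linear_add[OF bounded_linear.linear[OF bl]])
  show "cmod (f x) \<le> onorm f * norm x" by (rule onorm[OF bl])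
qed

lemma cbilinear_slices:
  assumes "bounded_clinear_functional f"
  shows "cbilinear (\<lambda>a b. f b *\<^sub>C a)" "cbilinear (\<lambda>a b. f a *\<^sub>C b)"
  by (auto simp: cbilinear_def bounded_clinear_functionalD[OF assms] scaleC_simps mult.commute)

context op_proj_tensor_product
begin

lemma op_proj_norm_nonneg: "0 \<le> op_proj_norm (u :: ('a, 'b) alg_tensor)"
  using norm_emb[of u] by (metis norm_ge_zero)

lemma emb_zero: "emb 0 = 0"
  using emb_scaleC[of 0 0] by simp

lemma emb_minus: "emb (- u) = - emb u"
  using emb_add[of u "- u"] by (simp add: emb_zero eq_neg_iff_add_eq_0 add.commute)

lemma emb_diff: "emb (u - v) = emb u - emb v"
  using emb_add[of u "- v"] by (simp add: emb_minus)

lemma emb_sum: "emb (\<Sum>i\<in>I. f i) = (\<Sum>i\<in>I. emb (f i))"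
  by (induction I rule: infinite_finite_induct) (auto simp: emb_zero emb_add)

lemma emb_approx: "e > 0 \<Longrightarrow> \<exists>u. norm (emb u - x) < e"
  using dense_range_emb closure_approachable[of x "range emb"] by (auto simp: dist_norm)

text \<open>By the row-column decomposition \<open>\<Sum> f(b\<^sub>i) a\<^sub>i\<close> is estimated by the Cauchy-Schwarz
  inequality for the row \<open>(a\<^sub>i)\<close>.\<close>

lemma slice_right_bound:
  assumes f: "bounded_clinear_functional f"
  shows "norm (tensor_lift (\<lambda>a b. f b *\<^sub>C a) u) \<le> onorm f * op_proj_norm (u :: ('a, 'b) alg_tensor)"
proof (rule field_le_epsilon)
  fix e :: real assume e: "e > 0"
  define e' where "e' = e / (onorm f + 1)"
  have K: "0 \<le> onorm f" by (rule onorm_pos_le[OF bounded_clinear_functionalD(1)[OF f]])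
  then have e': "e' > 0" "onorm f * e' \<le> e" using e by (auto simp: e'_def field_simps)
  obtain F :: "(nat \<times> nat) set" and a b where F: "finite F" and u: "u = (\<Sum>i\<in>F. a i \<otimes>\<^sub>a b i)"
    and A: "norm (\<Sum>i\<in>F. a i * star (a i)) \<le> op_proj_norm u + e'"
    and B: "norm (\<Sum>i\<in>F. star (b i) * b i) \<le> op_proj_norm u + e'"
    using row_column_decomposition[OF e'(1) op_proj_norm_nonneg] by blast
  let ?Q = "op_proj_norm u + e'"
  have Q: "0 \<le> ?Q" using op_proj_norm_nonneg[of u] e' by simp
  have "tensor_lift (\<lambda>a b. f b *\<^sub>C a) u = (\<Sum>i\<in>F. f (b i) *\<^sub>C a i)"
    unfolding u by (simp add: tensor_lift_sum[OF cbilinear_slices(1)[OF f]] tensor_lift_tensor[OF cbilinear_slices(1)[OF f]])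
  then have "(norm (tensor_lift (\<lambda>a b. f b *\<^sub>C a) u))\<^sup>2 \<le>
      (\<Sum>i\<in>F. (cmod (f (b i)))\<^sup>2) * norm (\<Sum>i\<in>F. a i * star (a i))"
    using norm_sum_scaleC_row[OF F, of "\<lambda>i. f (b i)" a] by simp
  also have "\<dots> \<le> ((onorm f)\<^sup>2 * norm (\<Sum>i\<in>F. star (b i) * b i)) * norm (\<Sum>i\<in>F. a i * star (a i))"
    by (intro mult_right_mono functional_square_sum[OF f F] norm_sum_scaleC_column F) auto
  also have "\<dots> \<le> ((onorm f)\<^sup>2 * ?Q) * ?Q"
    using A B Q by (intro mult_mono mult_left_mono) auto
  also have "\<dots> = (onorm f * ?Q)\<^sup>2" by (simp add: power2_eq_square)
  finally have "norm (tensor_lift (\<lambda>a b. f b *\<^sub>C a) u) \<le> onorm f * ?Q"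
    using K Q by (intro power2_le_imp_le[of "norm _"]) auto
  then show "norm (tensor_lift (\<lambda>a b. f b *\<^sub>C a) u) \<le> onorm f * op_proj_norm u + e"
    using e'(2) by (simp add: distrib_left)
qed

lemma slice_left_bound:
  assumes f: "bounded_clinear_functional f"
  shows "norm (tensor_lift (\<lambda>a b. f a *\<^sub>C b) u) \<le> onorm f * op_proj_norm (u :: ('a, 'b) alg_tensor)"
proof (rule field_le_epsilon)
  fix e :: real assume e: "e > 0"
  define e' where "e' = e / (onorm f + 1)"
  have K: "0 \<le> onorm f" by (rule onorm_pos_le[OF bounded_clinear_functionalD(1)[OF f]])
  then have e': "e' > 0" "onorm f * e' \<le> e" using e by (auto simp: e'_def field_simps)
  obtain F :: "(nat \<times> nat) set" and a b where F: "finite F" and u: "u = (\<Sum>i\<in>F. a i \<otimes>\<^sub>a b i)"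
    and A: "norm (\<Sum>i\<in>F. a i * star (a i)) \<le> op_proj_norm u + e'"
    and B: "norm (\<Sum>i\<in>F. star (b i) * b i) \<le> op_proj_norm u + e'"
    using row_column_decomposition[OF e'(1) op_proj_norm_nonneg] by blast
  let ?Q = "op_proj_norm u + e'"
  have Q: "0 \<le> ?Q" using op_proj_norm_nonneg[of u] e' by simp
  have "tensor_lift (\<lambda>a b. f a *\<^sub>C b) u = (\<Sum>i\<in>F. f (a i) *\<^sub>C b i)"
    unfolding u by (simp add: tensor_lift_sum[OF cbilinear_slices(2)[OF f]] tensor_lift_tensor[OF cbilinear_slices(2)[OF f]])
  then have "(norm (tensor_lift (\<lambda>a b. f a *\<^sub>C b) u))\<^sup>2 \<le>
      (\<Sum>i\<in>F. (cmod (f (a i)))\<^sup>2) * norm (\<Sum>i\<in>F. star (b i) * b i)"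
    using norm_sum_scaleC_column[OF F, of "\<lambda>i. f (a i)" b] by simp
  also have "\<dots> \<le> ((onorm f)\<^sup>2 * norm (\<Sum>i\<in>F. a i * star (a i))) * norm (\<Sum>i\<in>F. star (b i) * b i)"
    by (intro mult_right_mono functional_square_sum[OF f F] norm_sum_scaleC_row F) auto
  also have "\<dots> \<le> ((onorm f)\<^sup>2 * ?Q) * ?Q"
    using A B Q by (intro mult_mono mult_left_mono) auto
  also have "\<dots> = (onorm f * ?Q)\<^sup>2" by (simp add: power2_eq_square)
  finally have "norm (tensor_lift (\<lambda>a b. f a *\<^sub>C b) u) \<le> onorm f * ?Q"
    using K Q by (intro power2_le_imp_le[of "norm _"]) auto
  then show "norm (tensor_lift (\<lambda>a b. f a *\<^sub>C b) u) \<le> onorm f * op_proj_norm u + e"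
    using e'(2) by (simp add: distrib_left)
qed

lemma extend_from_alg_tensor:
  fixes g :: "('a, 'b) alg_tensor \<Rightarrow> 'c::banach_star_algebra"
  assumes add: "\<And>u v. g (u + v) = g u + g v" and sc: "\<And>c u. g (c *\<^sub>C u) = c *\<^sub>C g u"
    and bound: "\<And>u. norm (g u) \<le> K * op_proj_norm u"
  obtains f where "bounded_linear f" "\<And>c x. f (c *\<^sub>C x) = c *\<^sub>C f x" "\<And>u. f (emb u) = g u"
proof -
  have g0: "g 0 = 0" using sc[of 0 0] by simp
  have gm: "g (- u) = - g u" for u
    using add[of u "- u"] by (simp add: g0 eq_neg_iff_add_eq_0 add.commute)
  have gd: "g (u - v) = g u - g v" for u v
    using add[of u "- v"] by (simp add: gm)
  define U where "U x n = (SOME u. norm (emb u - x) < inverse (real (Suc n)))" for x n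
  have U_less: "norm (emb (U x n) - x) < inverse (real (Suc n))" for x n
    unfolding U_def by (rule someI_ex[OF emb_approx]) simp
  have U: "(\<lambda>n. emb (U x n)) \<longlonglongrightarrow> x" for x
  proof (rule LIM_zero_cancel, rule Lim_null_comparison[OF _ LIMSEQ_inverse_real_of_nat])
    show "\<forall>\<^sub>F n in sequentially. norm (emb (U x n) - x) \<le> inverse (real (Suc n))"
      by (simp add: less_imp_le[OF U_less] del: of_nat_Suc)
  qed
  have K: "norm (g u - g v) \<le> \<bar>K\<bar> * norm (emb u - emb v)" for u v
    using bound[of "u - v"] norm_emb[of "u - v"] op_proj_norm_nonneg[of "u - v"]
    by (simp add: gd emb_diff) (meson abs_ge_self mult_right_mono order_trans)
  have cauchy: "Cauchy (\<lambda>n. g (w n))" if "(\<lambda>n. emb (w n)) \<longlonglongrightarrow> x" for w x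
  proof (rule CauchyI)
    fix e :: real assume e: "e > 0"
    have "Cauchy (\<lambda>n. emb (w n))" using that by (rule LIMSEQ_imp_Cauchy)
    then obtain M where M: "\<forall>m\<ge>M. \<forall>n\<ge>M. norm (emb (w m) - emb (w n)) < e / (\<bar>K\<bar> + 1)"
      using CauchyD[of "\<lambda>n. emb (w n)" "e / (\<bar>K\<bar> + 1)"] e by (auto simp: add_nonneg_pos)
    have "norm (g (w m) - g (w n)) < e" if "m \<ge> M" "n \<ge> M" for m n
    proof -
      have "norm (emb (w m) - emb (w n)) < e / (\<bar>K\<bar> + 1)" using M that by blast
      then have "(\<bar>K\<bar> + 1) * norm (emb (w m) - emb (w n)) < e"
        by (simp add: pos_less_divide_eq add_nonneg_pos mult.commute)
      moreover have "\<bar>K\<bar> * norm (emb (w m) - emb (w n)) \<le> (\<bar>K\<bar> + 1) * norm (emb (w m) - emb (w n))"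
        by (intro mult_right_mono) auto
      ultimately show ?thesis using K[of "w m" "w n"] by linarith
    qed
    then show "\<exists>M. \<forall>m\<ge>M. \<forall>n\<ge>M. norm (g (w m) - g (w n)) < e" by blast
  qed
  define f where "f x = lim (\<lambda>n. g (U x n))" for x
  have fU: "(\<lambda>n. g (U x n)) \<longlonglongrightarrow> f x" for x
    unfolding f_def using cauchy[OF U] Cauchy_convergent_iff convergent_LIMSEQ_iff by blast
  have flim: "(\<lambda>n. g (w n)) \<longlonglongrightarrow> f x" if w: "(\<lambda>n. emb (w n)) \<longlonglongrightarrow> x" for w x
  proof -
    have "(\<lambda>n. \<bar>K\<bar> * norm (emb (w n) - emb (U x n))) \<longlonglongrightarrow> \<bar>K\<bar> * norm (x - x)"
      by (intro tendsto_intros w U)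
    then have lim0: "(\<lambda>n. \<bar>K\<bar> * norm (emb (w n) - emb (U x n))) \<longlonglongrightarrow> 0" by simp
    have "(\<lambda>n. g (w n) - g (U x n)) \<longlonglongrightarrow> 0"
      by (rule Lim_null_comparison[OF _ lim0]) (simp add: K)
    from tendsto_add[OF this fU[of x]] show ?thesis by simp
  qed
  show ?thesis
  proof (rule that)
    show femb: "f (emb u) = g u" for u
      using flim[of "\<lambda>_. u" "emb u"] LIMSEQ_unique tendsto_const by blast
    show fsc: "f (c *\<^sub>C x) = c *\<^sub>C f x" for c x
    proof -
      have "(\<lambda>n. emb (c *\<^sub>C U x n)) \<longlonglongrightarrow> c *\<^sub>C x"
        unfolding emb_scaleC by (rule bounded_linear.tendsto[OF bounded_linear_scaleC U])
      from flim[OF this] have "(\<lambda>n. c *\<^sub>C g (U x n)) \<longlonglongrightarrow> f (c *\<^sub>C x)" by (simp add: sc)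
      moreover have "(\<lambda>n. c *\<^sub>C g (U x n)) \<longlonglongrightarrow> c *\<^sub>C f x"
        by (rule bounded_linear.tendsto[OF bounded_linear_scaleC fU])
      ultimately show ?thesis using LIMSEQ_unique by blast
    qed
    show "bounded_linear f"
    proof (rule bounded_linear_intro[of _ "\<bar>K\<bar>"])
      fix x y
      have "(\<lambda>n. emb (U x n + U y n)) \<longlonglongrightarrow> x + y"
        unfolding emb_add by (intro tendsto_add U)
      from flim[OF this] have "(\<lambda>n. g (U x n) + g (U y n)) \<longlonglongrightarrow> f (x + y)" by (simp add: add)
      moreover have "(\<lambda>n. g (U x n) + g (U y n)) \<longlonglongrightarrow> f x + f y" by (intro tendsto_add fU)
      ultimately show "f (x + y) = f x + f y" using LIMSEQ_unique by blast
      show "f (r *\<^sub>R x) = r *\<^sub>R f x" for r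
        using fsc[of "complex_of_real r" x] by (simp add: scaleC_of_real)
      show "norm (f x) \<le> norm x * \<bar>K\<bar>"
      proof (rule LIMSEQ_le)
        show "(\<lambda>n. norm (g (U x n))) \<longlonglongrightarrow> norm (f x)" by (intro tendsto_norm fU)
        show "(\<lambda>n. norm (emb (U x n)) * \<bar>K\<bar>) \<longlonglongrightarrow> norm x * \<bar>K\<bar>" by (intro tendsto_intros U)
        show "\<exists>N. \<forall>n\<ge>N. norm (g (U x n)) \<le> norm (emb (U x n)) * \<bar>K\<bar>"
          using K[of "U x _" 0] by (auto simp: g0 emb_zero mult.commute)
      qed
    qed
  qed
qed

text \<open>A product of two bounded functionals is one of them composed with the slice by the other.\<close>

lemma slice_maps:
  assumes f: "bounded_clinear_functional f"
  shows "\<exists>R. bounded_linear R \<and> (\<forall>c x. R (c *\<^sub>C x) = c *\<^sub>C R x) \<and> (\<forall>a b. R (emb (a \<otimes>\<^sub>a b)) = f b *\<^sub>C (a::'a))"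
    and "bounded_clinear_functional h \<Longrightarrow>
      \<exists>L. bounded_linear L \<and> (\<forall>c x. L (c *\<^sub>C x) = c *\<^sub>C L x) \<and> (\<forall>a b. L (emb (a \<otimes>\<^sub>a b)) = h a *\<^sub>C (b::'b))"
proof -
  note s = cbilinear_slices(1)[OF f]
  obtain R where "bounded_linear R" "\<And>c x. R (c *\<^sub>C x) = c *\<^sub>C R x"
    "\<And>u. R (emb u) = tensor_lift (\<lambda>a b. f b *\<^sub>C a) u"
    using extend_from_alg_tensor[where g = "tensor_lift (\<lambda>a b. f b *\<^sub>C a)",
        OF tensor_lift_add[OF s] tensor_lift_scaleC[OF s] slice_right_bound[OF f]] by blast
  then show "\<exists>R. bounded_linear R \<and> (\<forall>c x. R (c *\<^sub>C x) = c *\<^sub>C R x) \<and> (\<forall>a b. R (emb (a \<otimes>\<^sub>a b)) = f b *\<^sub>C (a::'a))"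
    by (intro exI[of _ R]) (simp add: tensor_lift_tensor[OF s])
next
  assume h: "bounded_clinear_functional h"
  note s = cbilinear_slices(2)[OF h]
  obtain L where "bounded_linear L" "\<And>c x. L (c *\<^sub>C x) = c *\<^sub>C L x"
    "\<And>u. L (emb u) = tensor_lift (\<lambda>a b. h a *\<^sub>C b) u"
    using extend_from_alg_tensor[where g = "tensor_lift (\<lambda>a b. h a *\<^sub>C b)",
        OF tensor_lift_add[OF s] tensor_lift_scaleC[OF s] slice_left_bound[OF h]] by blast
  then show "\<exists>L. bounded_linear L \<and> (\<forall>c x. L (c *\<^sub>C x) = c *\<^sub>C L x) \<and> (\<forall>a b. L (emb (a \<otimes>\<^sub>a b)) = h a *\<^sub>C (b::'b))"
    by (intro exI[of _ L]) (simp add: tensor_lift_tensor[OF s])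
qed

lemma bounded_linear_eq_on_tensors:
  fixes f g :: "'d \<Rightarrow> 'c::real_normed_vector"
  assumes f: "bounded_linear f" and g: "bounded_linear g"
    and eq: "\<And>a b. f (emb (a \<otimes>\<^sub>a b)) = g (emb (a \<otimes>\<^sub>a b))"
  shows "f x = g x"
proof -
  have "f (emb u) = g (emb u)" for u
  proof -
    obtain n a b where "u = (\<Sum>i<n::nat. a i \<otimes>\<^sub>a b i)" using alg_tensor_eq_sum by blast
    then show ?thesis
      by (simp add: emb_sum linear_sum[OF bounded_linear.linear[OF f]] linear_sum[OF bounded_linear.linear[OF g]] eq)
  qed
  then have sub: "range emb \<subseteq> {x. f x = g x}" by auto
  have "closed {x. f x = g x}"
    by (intro closed_Collect_eq bounded_linear.continuous_on[OF f] bounded_linear.continuous_on[OF g] continuous_on_id)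
  then have "closure (range emb) \<subseteq> {x. f x = g x}" by (rule closure_minimal[OF sub])
  then show ?thesis using dense_range_emb by auto
qed

text \<open>Write \<open>x\<close> as a telescoping series of \<open>w\<^sub>m\<close> in the algebraic tensor product with \<open>\<parallel>w\<^sub>m\<parallel>\<close> of
  order \<open>2\<^sup>-\<^sup>m\<close>, and decompose each \<open>w\<^sub>m\<close> into a row and a column. The norms of \<open>\<Sum> a a\<^sup>*\<close> and
  \<open>\<Sum> b\<^sup>* b\<close> add up over \<open>m\<close>; since they increase with the set of indices, the bound holds for
  all finite sets. Convergence is only claimed along the sets \<open>F n\<close>, which collect whole blocks.\<close>

lemma row_column_series:
  fixes x :: 'd
  obtains F :: "nat \<Rightarrow> (nat \<times> nat \<times> nat) set" and a :: "nat \<times> nat \<times> nat \<Rightarrow> 'a"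
    and b :: "nat \<times> nat \<times> nat \<Rightarrow> 'b" and C
  where "\<And>n. finite (F n)" "\<And>n. F n \<subseteq> F (Suc n)" "\<And>i. i \<notin> (\<Union>n. F n) \<Longrightarrow> a i = 0 \<and> b i = 0"
    "\<And>G. finite G \<Longrightarrow> norm (\<Sum>i\<in>G. a i * star (a i)) \<le> C"
    "\<And>G. finite G \<Longrightarrow> norm (\<Sum>i\<in>G. star (b i) * b i) \<le> C"
    "(\<lambda>n. \<Sum>i\<in>F n. emb (a i \<otimes>\<^sub>a b i)) \<longlonglongrightarrow> x"
proof -
  have "\<forall>n. \<exists>u. norm (emb u - x) < (1 / 2) ^ n" by (intro allI emb_approx) simp
  then obtain v where v: "\<And>n. norm (emb (v n) - x) < (1 / 2) ^ n" by metis
  define s where "s n = (case n of 0 \<Rightarrow> 0 | Suc m \<Rightarrow> v m)" for n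
  define w where "w m = s (Suc m) - s m" for m
  define B where "B = norm (emb (w 0)) + 4"
  have w_bound: "op_proj_norm (w m) + (1 / 2) ^ m \<le> B * (1 / 2) ^ m" for m
  proof (cases m)
    case 0
    then show ?thesis by (simp add: B_def norm_emb)
  next
    case (Suc k)
    have "norm (emb (w m)) = norm ((emb (v m) - x) - (emb (v k) - x))"
      by (simp add: w_def s_def Suc emb_diff)
    also have "\<dots> \<le> (1 / 2) ^ m + (1 / 2) ^ k"
      using v[of m] v[of k] by (intro order_trans[OF norm_triangle_ineq4]) simp
    finally have "op_proj_norm (w m) \<le> 3 * (1 / 2) ^ m" by (simp add: norm_emb Suc)
    moreover have "4 * (1 / 2) ^ m \<le> B * (1 / 2) ^ m" by (intro mult_right_mono) (auto simp: B_def)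
    ultimately show ?thesis by linarith
  qed
  define Q where "Q m F a b \<longleftrightarrow> finite F \<and> w m = (\<Sum>i\<in>F. a i \<otimes>\<^sub>a b i) \<and>
      norm (\<Sum>i\<in>F. a i * star (a i)) \<le> B * (1 / 2) ^ m \<and>
      norm (\<Sum>i\<in>F. star (b i) * b i) \<le> B * (1 / 2) ^ m"
    for m and F :: "(nat \<times> nat) set" and a b
  have "\<exists>F a b. Q m F a b" for m
  proof -
    obtain F :: "(nat \<times> nat) set" and a b where "finite F" "w m = (\<Sum>i\<in>F. a i \<otimes>\<^sub>a b i)"
      "norm (\<Sum>i\<in>F. a i * star (a i)) \<le> op_proj_norm (w m) + (1 / 2) ^ m"
      "norm (\<Sum>i\<in>F. star (b i) * b i) \<le> op_proj_norm (w m) + (1 / 2) ^ m"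
      using row_column_decomposition[OF _ op_proj_norm_nonneg, of "(1 / 2) ^ m" "w m"] by auto
    then have "Q m F a b" using w_bound[of m] unfolding Q_def by linarith
    then show ?thesis by blast
  qed
  then obtain E a b where "\<And>m. Q m (E m) (a m) (b m)" by metis
  then have E: "\<And>m. finite (E m)"
    and w_eq: "\<And>m. w m = (\<Sum>i\<in>E m. a m i \<otimes>\<^sub>a b m i)"
    and A: "\<And>m. norm (\<Sum>i\<in>E m. a m i * star (a m i)) \<le> B * (1 / 2) ^ m"
    and Bb: "\<And>m. norm (\<Sum>i\<in>E m. star (b m i) * b m i) \<le> B * (1 / 2) ^ m"
    unfolding Q_def by blast+
  define F where "F n = (SIGMA m:{..<n}. E m)" for n
  define a' b' where "a' = (\<lambda>(m, i). if i \<in> E m then a m i else 0)"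
    and "b' = (\<lambda>(m, i). if i \<in> E m then b m i else 0)"
  have finF: "finite (F n)" for n by (simp add: F_def E)
  have geom: "(\<Sum>m<n. B * (1 / 2) ^ m) \<le> B * 2" for n :: nat
  proof -
    have "(\<Sum>m<n. (1 / 2 :: real) ^ m) \<le> (\<Sum>m. (1 / 2) ^ m)"
      by (rule sum_le_suminf) auto
    then have "(\<Sum>m<n. (1 / 2 :: real) ^ m) \<le> 2" by (simp add: suminf_geometric)
    then show ?thesis unfolding sum_distrib_left[symmetric] by (intro mult_left_mono) (auto simp: B_def)
  qed
  have total: "norm (\<Sum>i\<in>G. star (t i) * t i) \<le> B * 2"
    if G: "finite G" and zero: "\<And>m i. i \<notin> E m \<Longrightarrow> t (m, i) = 0"
      and bound: "\<And>m. norm (\<Sum>i\<in>E m. star (t (m, i)) * t (m, i)) \<le> B * (1 / 2) ^ m"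
    for G and t :: "nat \<times> nat \<times> nat \<Rightarrow> 'z::cstar_algebra"
  proof -
    obtain n where n: "fst ` G \<subseteq> {..<n}" using G finite_nat_iff_bounded by blast
    define G' where "G' = G \<inter> F n"
    let ?u = "\<lambda>i. star (into_unitization (t i)) * into_unitization (t i)"
    have "(\<Sum>i\<in>G. star (t i) * t i) = (\<Sum>i\<in>G'. star (t i) * t i)"
      unfolding G'_def using G n
      by (intro sum.mono_neutral_right) (auto simp: F_def, metis mult_zero_right zero)
    moreover have "norm (\<Sum>i\<in>G'. ?u i) \<le> norm (\<Sum>i\<in>F n. ?u i)"
    proof (rule posit_norm_mono)
      have "(\<Sum>i\<in>F n. ?u i) - (\<Sum>i\<in>G'. ?u i) = (\<Sum>i\<in>F n - G'. ?u i)"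
        using finF by (simp add: sum_diff G'_def)
      then show "posit ((\<Sum>i\<in>F n. ?u i) - (\<Sum>i\<in>G'. ?u i))"
        by (simp only:) (intro posit_sum posit_star_mult)
    qed (intro posit_sum posit_star_mult)
    ultimately have "norm (\<Sum>i\<in>G. star (t i) * t i) \<le> norm (\<Sum>i\<in>F n. star (t i) * t i)"
      by (simp add: into_unitization_simps(5,8)[symmetric] into_unitization_sum[symmetric])
    also have "(\<Sum>i\<in>F n. star (t i) * t i) = (\<Sum>m<n. \<Sum>i\<in>E m. star (t (m, i)) * t (m, i))"
      unfolding F_def by (subst sum.Sigma) (auto simp: E case_prod_unfold)
    also have "norm \<dots> \<le> (\<Sum>m<n. B * (1 / 2) ^ m)" by (intro sum_norm_le bound)
    also have "\<dots> \<le> B * 2" by (rule geom)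
    finally show ?thesis .
  qed
  show ?thesis
  proof (rule that[of F a' b' "B * 2"])
    show "finite (F n)" "F n \<subseteq> F (Suc n)" for n by (auto simp: F_def E)
    show "a' i = 0 \<and> b' i = 0" if "i \<notin> (\<Union>n. F n)" for i
    proof -
      obtain m k where i: "i = (m, k)" by (cases i)
      have "i \<notin> F (Suc m)" using that by blast
      then have "k \<notin> E m" by (auto simp: F_def i)
      then show ?thesis by (simp add: i a'_def b'_def)
    qed
    show "norm (\<Sum>i\<in>G. a' i * star (a' i)) \<le> B * 2" if "finite G" for G
      using total[OF that, of "\<lambda>i. star (a' i)"] A by (simp add: a'_def star_zero star_star cong: sum.cong)
    show "norm (\<Sum>i\<in>G. star (b' i) * b' i) \<le> B * 2" if "finite G" for G
      using total[OF that, of b'] Bb by (simp add: b'_def cong: sum.cong)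
    have "(\<Sum>i\<in>F n. emb (a' i \<otimes>\<^sub>a b' i)) = emb (s n)" for n
    proof -
      have "(\<Sum>i\<in>F n. emb (a' i \<otimes>\<^sub>a b' i)) = (\<Sum>m<n. \<Sum>i\<in>E m. emb (a' (m, i) \<otimes>\<^sub>a b' (m, i)))"
        unfolding F_def by (subst sum.Sigma) (auto simp: E case_prod_unfold)
      also have "\<dots> = (\<Sum>m<n. emb (w m))"
        by (simp add: a'_def b'_def w_eq emb_sum cong: sum.cong)
      also have "\<dots> = emb (\<Sum>m<n. w m)" by (simp add: emb_sum)
      also have "(\<Sum>m<n. w m) = s n"
        unfolding w_def by (simp add: sum_lessThan_telescope) (simp add: s_def)
      finally show ?thesis .
    qed
    moreover have "(\<lambda>n. emb (s n)) \<longlonglongrightarrow> x"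
    proof (rule LIMSEQ_imp_Suc)
      have "(\<lambda>n. emb (v n) - x) \<longlonglongrightarrow> 0"
        by (rule Lim_null_comparison[OF _ LIMSEQ_realpow_zero[of "1 / 2"]])
          (simp_all add: less_imp_le[OF v])
      then show "(\<lambda>n. emb (s (Suc n))) \<longlonglongrightarrow> x" by (simp add: s_def LIM_zero_iff)
    qed
    ultimately show "(\<lambda>n. \<Sum>i\<in>F n. emb (a' i \<otimes>\<^sub>a b' i)) \<longlonglongrightarrow> x" by simp
  qed
qed

end

section \<open>Hilbert spaces with pointwise operations\<close>

instantiation "fun" :: (type, complex_vector) complex_vector
begin

definition "c *\<^sub>C f = (\<lambda>x. c *\<^sub>C f x)"

instance
  by standard (simp_all add: fun_eq_iff scaleC_fun_def scaleC_simps)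

end

instantiation complex :: complex_vector
begin

definition "c *\<^sub>C (z::complex) = c * z"

instance
  by standard (simp_all add: scaleC_complex_def algebra_simps)

end

text \<open>Hilbert spaces whose operations are those of an ambient complex vector space, so that the
  vectors can be treated with the usual algebraic simplification. Every irreducible
  representation can be transported to such a space, see \<open>vector_representation_exists\<close>.\<close>

locale vector_hilbert = hilbert_space H for H :: "'v::complex_vector pre_hilbert" +
  assumes hadd_eq: "v \<in> hcarrier H \<Longrightarrow> w \<in> hcarrier H \<Longrightarrow> hadd H v w = v + w"
    and hscale_eq: "v \<in> hcarrier H \<Longrightarrow> hscale H c v = c *\<^sub>C v"
    and hzero_eq: "hzero H = 0"
begin

abbreviation "V \<equiv> hcarrier H"
abbreviation "ip \<equiv> hinner H"
abbreviation "nm \<equiv> hnorm H"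

lemma V_zero: "0 \<in> V"
  using zero_closed hzero_eq by simp

lemma V_add: "v \<in> V \<Longrightarrow> w \<in> V \<Longrightarrow> v + w \<in> V"
  using add_closed hadd_eq by metis

lemma V_scale: "v \<in> V \<Longrightarrow> c *\<^sub>C v \<in> V"
  using scale_closed hscale_eq by metis

lemma V_minus: "v \<in> V \<Longrightarrow> - v \<in> V"
  using V_scale[of v "- 1"] by (simp add: scaleC_simps)

lemma V_diff: "v \<in> V \<Longrightarrow> w \<in> V \<Longrightarrow> v - w \<in> V"
  using V_add[of v "- w"] V_minus[of w] by simp

lemma V_sum: "(\<And>i. i \<in> I \<Longrightarrow> f i \<in> V) \<Longrightarrow> (\<Sum>i\<in>I. f i) \<in> V"
  by (induction I rule: infinite_finite_induct) (auto simp: V_zero V_add)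

lemmas V_closed = V_zero V_add V_scale V_minus V_diff V_sum

lemma ip_add: "u \<in> V \<Longrightarrow> v \<in> V \<Longrightarrow> w \<in> V \<Longrightarrow> ip (u + v) w = ip u w + ip v w"
  "u \<in> V \<Longrightarrow> v \<in> V \<Longrightarrow> w \<in> V \<Longrightarrow> ip w (u + v) = ip w u + ip w v"
  using inner_add_left[of u v w] inner_add_right[of w u v] by (simp_all add: hadd_eq)

lemma ip_scale: "v \<in> V \<Longrightarrow> w \<in> V \<Longrightarrow> ip (c *\<^sub>C v) w = c * ip v w"
  "v \<in> V \<Longrightarrow> w \<in> V \<Longrightarrow> ip w (c *\<^sub>C v) = cnj c * ip w v"
  using inner_scale_left[of v w c] inner_scale_right[of w v c] by (simp_all add: hscale_eq)

lemma ip_zero: "v \<in> V \<Longrightarrow> ip 0 v = 0" "v \<in> V \<Longrightarrow> ip v 0 = 0"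
  using inner_zero_left[of v] inner_zero_right[of v] by (simp_all add: hzero_eq)

lemma ip_minus: "v \<in> V \<Longrightarrow> w \<in> V \<Longrightarrow> ip (- v) w = - ip v w" "v \<in> V \<Longrightarrow> w \<in> V \<Longrightarrow> ip w (- v) = - ip w v"
  using ip_scale[of v w "- 1"] by (simp_all add: scaleC_simps)

lemma ip_diff: "u \<in> V \<Longrightarrow> v \<in> V \<Longrightarrow> w \<in> V \<Longrightarrow> ip (u - v) w = ip u w - ip v w"
  "u \<in> V \<Longrightarrow> v \<in> V \<Longrightarrow> w \<in> V \<Longrightarrow> ip w (u - v) = ip w u - ip w v"
  using ip_add[of u "- v" w] ip_minus[of v w] V_minus[of v] by simp_all

lemmas ip_simps = ip_add ip_scale ip_zero ip_minus ip_diff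

lemma ip_sum: "(\<And>i. i \<in> I \<Longrightarrow> f i \<in> V) \<Longrightarrow> w \<in> V \<Longrightarrow> ip (\<Sum>i\<in>I. f i) w = (\<Sum>i\<in>I. ip (f i) w)"
  "(\<And>i. i \<in> I \<Longrightarrow> f i \<in> V) \<Longrightarrow> w \<in> V \<Longrightarrow> ip w (\<Sum>i\<in>I. f i) = (\<Sum>i\<in>I. ip w (f i))"
  by (induction I rule: infinite_finite_induct) (auto simp: ip_simps V_closed)

lemma ip_cnj: "v \<in> V \<Longrightarrow> w \<in> V \<Longrightarrow> cnj (ip v w) = ip w v"
  using inner_commute[of w v] by simp

lemma ip_self: "v \<in> V \<Longrightarrow> ip v v = complex_of_real ((nm v)\<^sup>2)"
  by (rule inner_self)

lemma nm_nonneg: "v \<in> V \<Longrightarrow> 0 \<le> nm v"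
  by (rule hnorm_nonneg)

lemma nm_square: "v \<in> V \<Longrightarrow> (nm v)\<^sup>2 = Re (ip v v)"
  by (simp add: ip_self)

lemma nm_eq_0: "v \<in> V \<Longrightarrow> nm v = 0 \<longleftrightarrow> v = 0"
  using hnorm_pos[of v] ip_zero(1)[OF V_zero] by (cases "v = 0") (auto simp: hzero_eq hnorm_def)

lemma nm_zero: "nm 0 = 0"
  using nm_eq_0[OF V_zero] by simp

lemma ip_self_eq_0: "v \<in> V \<Longrightarrow> ip v v = 0 \<Longrightarrow> v = 0"
  using nm_eq_0[of v] by (simp add: ip_self)

lemma nm_scale: "v \<in> V \<Longrightarrow> nm (c *\<^sub>C v) = cmod c * nm v"
proof -
  assume v: "v \<in> V"
  have "ip (c *\<^sub>C v) (c *\<^sub>C v) = complex_of_real ((cmod c)\<^sup>2) * complex_of_real ((nm v)\<^sup>2)"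
    using v by (simp only: ip_scale V_scale ip_self[symmetric] complex_norm_square) (simp add: mult_ac)
  then have "(nm (c *\<^sub>C v))\<^sup>2 = (cmod c * nm v)\<^sup>2"
    using v by (simp add: nm_square V_scale power_mult_distrib)
  then show ?thesis using v by (simp add: power2_eq_iff_nonneg nm_nonneg V_scale)
qed

lemma nm_minus: "v \<in> V \<Longrightarrow> nm (- v) = nm v"
  using nm_scale[of v "- 1"] by (simp add: scaleC_simps)

lemma nm_diff_commute: "v \<in> V \<Longrightarrow> w \<in> V \<Longrightarrow> nm (v - w) = nm (w - v)"
  using nm_minus[of "w - v"] V_diff[of w v] by simp

lemma CS: "v \<in> V \<Longrightarrow> w \<in> V \<Longrightarrow> cmod (ip v w) \<le> nm v * nm w"
  by (rule Cauchy_Schwarz)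

lemma nm_add_square: "v \<in> V \<Longrightarrow> w \<in> V \<Longrightarrow> (nm (v + w))\<^sup>2 = (nm v)\<^sup>2 + (nm w)\<^sup>2 + 2 * Re (ip v w)"
  using ip_cnj[of v w] by (simp add: nm_square V_closed ip_simps) (metis cnj.simps(1))

lemma nm_diff_square: "v \<in> V \<Longrightarrow> w \<in> V \<Longrightarrow> (nm (v - w))\<^sup>2 = (nm v)\<^sup>2 + (nm w)\<^sup>2 - 2 * Re (ip v w)"
  using nm_add_square[of v "- w"] by (simp add: V_closed ip_simps nm_minus)

lemma nm_triangle: "v \<in> V \<Longrightarrow> w \<in> V \<Longrightarrow> nm (v + w) \<le> nm v + nm w"
proof -
  assume v: "v \<in> V" "w \<in> V"
  have "Re (ip v w) \<le> nm v * nm w" using CS[OF v] complex_Re_le_cmod[of "ip v w"] by linarith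
  then have "(nm (v + w))\<^sup>2 \<le> (nm v + nm w)\<^sup>2"
    using v by (simp add: nm_add_square power2_sum)
  then show ?thesis by (rule power2_le_imp_le) (use v nm_nonneg in auto)
qed

lemma nm_triangle_diff: "v \<in> V \<Longrightarrow> w \<in> V \<Longrightarrow> nm (v - w) \<le> nm v + nm w"
  using nm_triangle[of v "- w"] by (simp add: V_closed nm_minus)

lemma nm_triangle3: "u \<in> V \<Longrightarrow> v \<in> V \<Longrightarrow> w \<in> V \<Longrightarrow> nm (u - w) \<le> nm (u - v) + nm (v - w)"
  using nm_triangle[of "u - v" "v - w"] by (simp add: V_closed)

lemma parallelogram: "v \<in> V \<Longrightarrow> w \<in> V \<Longrightarrow> (nm (v + w))\<^sup>2 + (nm (v - w))\<^sup>2 = 2 * (nm v)\<^sup>2 + 2 * (nm w)\<^sup>2"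
  by (simp add: nm_add_square nm_diff_square)

lemma hdist_eq: "v \<in> V \<Longrightarrow> w \<in> V \<Longrightarrow> hdist H v w = nm (v - w)"
  by (simp add: hdist_def hscale_eq hadd_eq V_scale scaleC_simps V_minus)

lemma V_eqI: "v \<in> V \<Longrightarrow> w \<in> V \<Longrightarrow> (\<And>u. u \<in> V \<Longrightarrow> ip v u = ip w u) \<Longrightarrow> v = w"
  using ip_self_eq_0[of "v - w"] by (simp add: V_closed ip_simps)

lemma V_complete:
  assumes "\<And>n::nat. X n \<in> V" "\<And>e. e > 0 \<Longrightarrow> \<exists>M. \<forall>m\<ge>M. \<forall>n\<ge>M. nm (X m - X n) < e"
  obtains v where "v \<in> V" "(\<lambda>n. nm (X n - v)) \<longlonglongrightarrow> 0"
  using complete[of X] assms by (auto simp: hdist_eq)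

lemma limit_unique:
  assumes "\<And>n::nat. X n \<in> V" "v \<in> V" "w \<in> V" "(\<lambda>n. nm (X n - v)) \<longlonglongrightarrow> 0" "(\<lambda>n. nm (X n - w)) \<longlonglongrightarrow> 0"
  shows "v = w"
proof -
  have "(\<lambda>n. nm (X n - v) + nm (X n - w)) \<longlonglongrightarrow> 0 + 0" by (intro tendsto_add assms)
  moreover have "nm (v - w) \<le> nm (X n - v) + nm (X n - w)" for n
    using nm_triangle3[of v "X n" w] nm_diff_commute[of v "X n"] assms by simp
  ultimately have "nm (v - w) \<le> 0"
    by (intro LIMSEQ_le_const[of "\<lambda>n. nm (X n - v) + nm (X n - w)"]) auto
  then show ?thesis using nm_eq_0[of "v - w"] nm_nonneg[of "v - w"] assms by (simp add: V_closed)
qed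

lemma ip_limit:
  assumes "\<And>n::nat. X n \<in> V" "v \<in> V" "w \<in> V" "(\<lambda>n. nm (X n - v)) \<longlonglongrightarrow> 0"
  shows "(\<lambda>n. ip (X n) w) \<longlonglongrightarrow> ip v w"
proof -
  have lim: "(\<lambda>n. nm (X n - v) * nm w) \<longlonglongrightarrow> 0"
    using tendsto_mult_left_zero[OF assms(4)] by simp
  have "(\<lambda>n. ip (X n) w - ip v w) \<longlonglongrightarrow> 0"
    by (rule Lim_null_comparison[OF _ lim])
      (use assms CS[of "X _ - v" w] in \<open>simp add: V_closed ip_simps\<close>)
  then show ?thesis by (simp add: LIM_zero_iff)
qed

lemma nm_limit_le:
  assumes "\<And>n::nat. X n \<in> V" "v \<in> V" "(\<lambda>n. nm (X n - v)) \<longlonglongrightarrow> 0" "\<And>n. nm (X n) \<le> c n" "c \<longlonglongrightarrow> C"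
  shows "nm v \<le> C"
proof -
  have "(\<lambda>n. c n + nm (X n - v)) \<longlonglongrightarrow> C + 0" by (intro tendsto_add assms)
  moreover have "nm v \<le> c n + nm (X n - v)" for n
    using nm_triangle_diff[of "X n" "X n - v"] assms(1,2) assms(4)[of n] by (simp add: V_closed)
  ultimately show ?thesis by (intro LIMSEQ_le_const[of "\<lambda>n. c n + nm (X n - v)"]) auto
qed

text \<open>The form that \<open>closed_subspace\<close> takes for pointwise operations.\<close>

definition clsub :: "'v set \<Rightarrow> bool" where
  "clsub M \<longleftrightarrow> M \<subseteq> V \<and> 0 \<in> M \<and> (\<forall>v\<in>M. \<forall>w\<in>M. v + w \<in> M) \<and> (\<forall>c. \<forall>v\<in>M. c *\<^sub>C v \<in> M) \<and>
     (\<forall>X v. (\<forall>n::nat. X n \<in> M) \<and> v \<in> V \<and> (\<lambda>n. nm (X n - v)) \<longlonglongrightarrow> 0 \<longrightarrow> v \<in> M)"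

lemma clsubD:
  assumes "clsub M"
  shows "v \<in> M \<Longrightarrow> v \<in> V" "0 \<in> M" "v \<in> M \<Longrightarrow> w \<in> M \<Longrightarrow> v + w \<in> M" "v \<in> M \<Longrightarrow> c *\<^sub>C v \<in> M"
    "v \<in> M \<Longrightarrow> w \<in> M \<Longrightarrow> v - w \<in> M"
    "(\<And>n::nat. X n \<in> M) \<Longrightarrow> v \<in> V \<Longrightarrow> (\<lambda>n. nm (X n - v)) \<longlonglongrightarrow> 0 \<Longrightarrow> v \<in> M"
proof -
  show "v \<in> M \<Longrightarrow> v \<in> V" "0 \<in> M" and a: "\<And>v w. v \<in> M \<Longrightarrow> w \<in> M \<Longrightarrow> v + w \<in> M"
    and s: "\<And>c v. v \<in> M \<Longrightarrow> c *\<^sub>C v \<in> M"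
    and "(\<And>n::nat. X n \<in> M) \<Longrightarrow> v \<in> V \<Longrightarrow> (\<lambda>n. nm (X n - v)) \<longlonglongrightarrow> 0 \<Longrightarrow> v \<in> M"
    using assms unfolding clsub_def by blast+
  show "v \<in> M \<Longrightarrow> w \<in> M \<Longrightarrow> v - w \<in> M"
    using a[of v "(- 1) *\<^sub>C w"] s[of w "- 1"] by (simp add: scaleC_simps)
qed

lemma clsub_closed_subspace:
  assumes M: "clsub M"
  shows "closed_subspace H M"
  unfolding closed_subspace_def
proof (intro conjI allI ballI impI)
  note D = clsubD[OF M]
  show "M \<subseteq> hcarrier H" using D(1) by blast
  show "hzero H \<in> M" using D(2) by (simp add: hzero_eq)
  show "hadd H v w \<in> M" if "v \<in> M" "w \<in> M" for v w
    using D(3)[OF that] D(1)[OF that(1)] D(1)[OF that(2)] by (simp add: hadd_eq)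
  show "hscale H c v \<in> M" if "v \<in> M" for c v
    using D(4)[OF that] D(1)[OF that] by (simp add: hscale_eq)
  fix X :: "nat \<Rightarrow> 'v" and v
  assume *: "(\<forall>n. X n \<in> M) \<and> v \<in> hcarrier H \<and> (\<lambda>n. hdist H (X n) v) \<longlonglongrightarrow> 0"
  then have "hdist H (X n) v = nm (X n - v)" for n
    by (intro hdist_eq[OF D(1)]) auto
  then have "(\<lambda>n. nm (X n - v)) \<longlonglongrightarrow> 0" using * by simp
  then show "v \<in> M" using * D(6)[of X v] by blast
qed

text \<open>Test on the multiple \<open>c z\<close> that is the projection of \<open>v\<close> onto the line through \<open>z\<close>.\<close>

lemma orthogonal_if_nearest:
  assumes v: "v \<in> V" "z \<in> V" and min: "\<And>c. nm v \<le> nm (v - c *\<^sub>C z)"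
  shows "ip v z = 0"
proof (cases "nm z = 0")
  case True
  then show ?thesis using v nm_eq_0 ip_zero by simp
next
  case False
  define n where "n = (nm z)\<^sup>2"
  have n: "n > 0" using False by (simp add: n_def)
  define c where "c = ip v z / complex_of_real n"
  have "Re (ip v (c *\<^sub>C z)) = (cmod (ip v z))\<^sup>2 / n"
  proof -
    have "ip v (c *\<^sub>C z) = ip v z * cnj (ip v z) / complex_of_real n"
      using v by (simp add: ip_simps c_def)
    also have "\<dots> = complex_of_real ((cmod (ip v z))\<^sup>2 / n)"
      by (simp only: complex_norm_square[symmetric] of_real_divide)
    finally show ?thesis by simp
  qed
  moreover have "(nm (c *\<^sub>C z))\<^sup>2 = (cmod (ip v z))\<^sup>2 / n"
    using v n by (simp add: nm_scale c_def norm_divide power_mult_distrib power_divide)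
      (simp add: n_def power2_eq_square)
  moreover have "(nm v)\<^sup>2 \<le> (nm (v - c *\<^sub>C z))\<^sup>2"
    using min v by (intro power_mono nm_nonneg) auto
  ultimately have "(cmod (ip v z))\<^sup>2 / n \<le> 0"
    using v by (simp add: nm_diff_square V_closed)
  then show ?thesis using n by (simp add: divide_le_0_iff)
qed

text \<open>A minimising sequence is Cauchy by the parallelogram law, and its limit is nearest to \<open>v\<close>.\<close>

theorem projection_exists:
  assumes M: "clsub M" and v: "v \<in> V"
  obtains m where "m \<in> M" "\<And>z. z \<in> M \<Longrightarrow> ip (v - m) z = 0"
proof -
  note D = clsubD[OF M]
  define d where "d = Inf ((\<lambda>z. (nm (v - z))\<^sup>2) ` M)"
  have bdd: "bdd_below ((\<lambda>z. (nm (v - z))\<^sup>2) ` M)" by (rule bdd_belowI[of _ 0]) auto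
  have d_le: "d \<le> (nm (v - z))\<^sup>2" if "z \<in> M" for z
    unfolding d_def using that bdd by (intro cINF_lower)
  have "\<exists>z\<in>M. (nm (v - z))\<^sup>2 < d + inverse (real (Suc n))" for n
    using cInf_lessD[of "(\<lambda>z. (nm (v - z))\<^sup>2) ` M" "d + inverse (real (Suc n))"] D(2)
    by (auto simp: d_def)
  then obtain X where X: "\<And>n. X n \<in> M" "\<And>n. (nm (v - X n))\<^sup>2 < d + inverse (real (Suc n))"
    by metis
  have XV: "X n \<in> V" for n by (rule D(1)[OF X(1)])
  have close: "(nm (X m - X n))\<^sup>2 \<le> 2 * inverse (real (Suc m)) + 2 * inverse (real (Suc n))" for m n
  proof -
    let ?a = "v - X m" and ?b = "v - X n"
    have ab: "?a \<in> V" "?b \<in> V" using v XV by (auto intro: V_closed)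
    have "?a + ?b = 2 *\<^sub>C (v - (1 / 2) *\<^sub>C (X m + X n))"
      using scaleC_add_left[of 1 1 v] by (simp add: scaleC_simps algebra_simps)
    moreover have mid: "(1 / 2) *\<^sub>C (X m + X n) \<in> M" by (intro D(4) D(3) X(1))
    ultimately have "(nm (?a + ?b))\<^sup>2 = 4 * (nm (v - (1 / 2) *\<^sub>C (X m + X n)))\<^sup>2"
      using v XV by (simp add: nm_scale V_closed power_mult_distrib)
    then have "4 * d \<le> (nm (?a + ?b))\<^sup>2" using d_le[OF mid] by simp
    moreover have "nm (X m - X n) = nm (?a - ?b)"
      using nm_diff_commute[OF XV XV, of m n] by simp
    ultimately show ?thesis using parallelogram[OF ab] X(2)[of m] X(2)[of n] by simp
  qed
  have "\<exists>M. \<forall>m\<ge>M. \<forall>n\<ge>M. nm (X m - X n) < e" if e: "e > 0" for e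
  proof -
    obtain N where N: "inverse (real (Suc N)) < e\<^sup>2 / 4"
      using reals_Archimedean[of "e\<^sup>2 / 4"] e by auto
    have "nm (X m - X n) < e" if "m \<ge> N" "n \<ge> N" for m n
    proof -
      have "inverse (real (Suc m)) \<le> inverse (real (Suc N))" "inverse (real (Suc n)) \<le> inverse (real (Suc N))"
        using that by (simp_all add: field_simps)
      then have "(nm (X m - X n))\<^sup>2 < e\<^sup>2" using close[of m n] N by linarith
      then show ?thesis using e by (simp add: power2_less_imp_less)
    qed
    then show ?thesis by blast
  qed
  then obtain m where m: "m \<in> V" "(\<lambda>n. nm (X n - m)) \<longlonglongrightarrow> 0" using V_complete[of X] XV by metis
  have mM: "m \<in> M" by (rule D(6)[OF X(1) m])
  have le: "nm (v - m) \<le> nm (v - z)" if z: "z \<in> M" for z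
  proof (rule nm_limit_le[where X = "\<lambda>n. v - X n" and c = "\<lambda>n. sqrt ((nm (v - z))\<^sup>2 + inverse (real (Suc n)))"])
    have "nm ((v - X n) - (v - m)) = nm (X n - m)" for n
      using nm_diff_commute[of "X n" m] XV m by simp
    then show "(\<lambda>n. nm ((v - X n) - (v - m))) \<longlonglongrightarrow> 0" using m by simp
    show "nm (v - X n) \<le> sqrt ((nm (v - z))\<^sup>2 + inverse (real (Suc n)))" for n
      using X(2)[of n] d_le[OF z] by (intro real_le_rsqrt) linarith
    have "(\<lambda>n. sqrt ((nm (v - z))\<^sup>2 + inverse (real (Suc n)))) \<longlonglongrightarrow> sqrt ((nm (v - z))\<^sup>2 + 0)"
      by (intro tendsto_intros LIMSEQ_inverse_real_of_nat)
    then show "(\<lambda>n. sqrt ((nm (v - z))\<^sup>2 + inverse (real (Suc n)))) \<longlonglongrightarrow> nm (v - z)"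
      using nm_nonneg[of "v - z"] v z D(1)[of z] by (simp add: V_closed)
  qed (use v XV m in \<open>auto intro: V_closed\<close>)
  have "ip (v - m) z = 0" if z: "z \<in> M" for z
  proof (rule orthogonal_if_nearest)
    fix c
    show "nm (v - m) \<le> nm (v - m - c *\<^sub>C z)" using le[OF D(3)[OF mM D(4)[OF z]], of c] by (simp add: diff_diff_eq)
  qed (rule V_diff[OF v m(1)], rule D(1)[OF z])
  then show ?thesis using that mM by blast
qed

text \<open>Gram-Schmidt: an orthonormal basis of the span of \<open>S\<close>.\<close>

lemma finite_rank_projection:
  assumes "finite S" "S \<subseteq> V"
  obtains E where "finite E" "E \<subseteq> V" "\<And>e. e \<in> E \<Longrightarrow> ip e e = 1"
    "\<And>e e'. e \<in> E \<Longrightarrow> e' \<in> E \<Longrightarrow> e \<noteq> e' \<Longrightarrow> ip e e' = 0"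
    "\<And>v. v \<in> S \<Longrightarrow> v = (\<Sum>e\<in>E. ip v e *\<^sub>C e)"
proof -
  define on where "on E \<longleftrightarrow> finite E \<and> E \<subseteq> V \<and> (\<forall>e\<in>E. ip e e = 1) \<and>
    (\<forall>e\<in>E. \<forall>e'\<in>E. e \<noteq> e' \<longrightarrow> ip e e' = 0)" for E
  have "\<exists>E. on E \<and> (\<forall>v\<in>S. v = (\<Sum>e\<in>E. ip v e *\<^sub>C e))"
    using assms
  proof (induction S rule: finite_induct)
    case empty
    then show ?case by (intro exI[of _ "{}"]) (auto simp: on_def)
  next
    case (insert s S)
    then obtain E where E: "on E" "\<And>v. v \<in> S \<Longrightarrow> v = (\<Sum>e\<in>E. ip v e *\<^sub>C e)" by auto
    have EV: "e \<in> V" if "e \<in> E" for e using E(1) that by (auto simp: on_def)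
    have fE: "finite E" using E(1) by (simp add: on_def)
    have s: "s \<in> V" using insert.prems by auto
    define r where "r = s - (\<Sum>e\<in>E. ip s e *\<^sub>C e)"
    have rV: "r \<in> V" unfolding r_def using s EV by (intro V_closed) auto
    have re: "ip r e = 0" if e: "e \<in> E" for e
    proof -
      have "ip (\<Sum>e'\<in>E. ip s e' *\<^sub>C e') e = (\<Sum>e'\<in>E. ip s e' * ip e' e)"
        using EV e by (subst ip_sum) (auto simp: ip_simps V_closed)
      also have "\<dots> = (\<Sum>e'\<in>E. if e' = e then ip s e else 0)"
        using E(1) e by (intro sum.cong) (auto simp: on_def)
      also have "\<dots> = ip s e" using fE e by simp
      finally show ?thesis using s EV e by (simp add: r_def ip_simps V_closed)
    qed
    show ?case
    proof (cases "r = 0")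
      case True
      then show ?thesis using E by (intro exI[of _ E]) (auto simp: r_def)
    next
      case False
      define f where "f = complex_of_real (1 / nm r) *\<^sub>C r"
      have nr: "nm r > 0" using False rV nm_nonneg[OF rV] nm_eq_0[OF rV] by simp
      have fV: "f \<in> V" unfolding f_def using rV by (rule V_scale)
      have "ip f f = complex_of_real (1 / nm r) * (complex_of_real (1 / nm r) * ip r r)"
        using rV by (simp add: f_def ip_scale V_scale)
      then have ff: "ip f f = 1" using nr rV by (simp add: ip_self power2_eq_square)
      have fe: "ip f e = 0" "ip e f = 0" if "e \<in> E" for e
        using re[OF that] ip_cnj[OF rV EV[OF that]] rV EV[OF that] by (simp_all add: f_def ip_simps)
      have fn: "f \<notin> E" using fe ff by fastforce
      have on: "on (insert f E)" using E(1) fV ff fe by (auto simp: on_def)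
      have "ip v f = 0" if "v \<in> S" for v
      proof -
        have "ip v f = ip (\<Sum>e\<in>E. ip v e *\<^sub>C e) f" using E(2)[OF that] by simp
        also have "\<dots> = (\<Sum>e\<in>E. ip v e * ip e f)"
          using EV fV by (subst ip_sum) (auto simp: ip_simps V_closed)
        finally show ?thesis using fe by simp
      qed
      then have 1: "v = (\<Sum>e\<in>insert f E. ip v e *\<^sub>C e)" if "v \<in> S" for v
        using E(2)[OF that] that fE fn by simp
      have "ip s f = complex_of_real (nm r)"
      proof -
        have "ip (\<Sum>e\<in>E. ip s e *\<^sub>C e) f = 0"
          using EV fV fe by (subst ip_sum) (auto simp: ip_simps V_closed)
        moreover have "s = r + (\<Sum>e\<in>E. ip s e *\<^sub>C e)" by (simp add: r_def)
        ultimately have "ip s f = ip r f"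
          using rV fV EV by (metis (no_types, lifting) V_scale V_sum add.right_neutral ip_add(1))
        also have "\<dots> = complex_of_real (nm r)"
          using rV nr by (simp add: f_def ip_simps ip_self power2_eq_square)
        finally show ?thesis .
      qed
      then have "ip s f *\<^sub>C f = r" using nr by (simp add: f_def scaleC_simps)
      then have 2: "s = (\<Sum>e\<in>insert f E. ip s e *\<^sub>C e)"
        using fE fn by (simp add: r_def)
      show ?thesis using on 1 2 by (intro exI[of _ "insert f E"]) auto
    qed
  qed
  then obtain E where E: "on E" "\<And>v. v \<in> S \<Longrightarrow> v = (\<Sum>e\<in>E. ip v e *\<^sub>C e)" by blast
  show ?thesis
    by (rule that[of E]) (use E in \<open>auto simp: on_def\<close>)
qed

end

section \<open>Representations and Schur's lemma\<close>

locale vector_representation = vector_hilbert H + star_representation H \<pi>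
  for H :: "'v::complex_vector pre_hilbert" and \<pi> :: "'d::banach_star_algebra \<Rightarrow> 'v \<Rightarrow> 'v"
begin

lemma rep_V: "v \<in> V \<Longrightarrow> \<pi> a v \<in> V"
  by (rule rep_closed)

lemma rep_vector_add: "v \<in> V \<Longrightarrow> w \<in> V \<Longrightarrow> \<pi> a (v + w) = \<pi> a v + \<pi> a w"
  using rep_op_add[of v w a] by (simp add: hadd_eq rep_V)

lemma rep_vector_scale: "v \<in> V \<Longrightarrow> \<pi> a (c *\<^sub>C v) = c *\<^sub>C \<pi> a v"
  using rep_op_scale[of v a c] by (simp add: hscale_eq rep_V)

lemma rep_vector_zero: "\<pi> a 0 = 0"
  using rep_vector_scale[OF V_zero, of a 0] by simp

lemma rep_vector_minus: "v \<in> V \<Longrightarrow> \<pi> a (- v) = - \<pi> a v"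
  using rep_vector_scale[of v a "- 1"] by (simp add: scaleC_simps)

lemma rep_vector_diff: "v \<in> V \<Longrightarrow> w \<in> V \<Longrightarrow> \<pi> a (v - w) = \<pi> a v - \<pi> a w"
  using rep_vector_add[of v "- w" a] by (simp add: rep_vector_minus V_minus)

lemma rep_alg_add: "v \<in> V \<Longrightarrow> \<pi> (a + b) v = \<pi> a v + \<pi> b v"
  using rep_add[of v a b] by (simp add: hadd_eq rep_V)

lemma rep_alg_scale: "v \<in> V \<Longrightarrow> \<pi> (c *\<^sub>C a) v = c *\<^sub>C \<pi> a v"
  using rep_scaleC[of v c a] by (simp add: hscale_eq rep_V)

lemma rep_alg_zero: "v \<in> V \<Longrightarrow> \<pi> 0 v = 0"
  using rep_alg_scale[of v 0 0] by simp

lemma rep_adjoint: "v \<in> V \<Longrightarrow> w \<in> V \<Longrightarrow> ip (\<pi> a v) w = ip v (\<pi> (star a) w)"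
  using rep_star[of v w "star a"] by (simp add: star_star)

lemma rep_kernel_iff: "a \<in> rep_kernel H \<pi> \<longleftrightarrow> (\<forall>v\<in>V. \<pi> a v = 0)"
  by (simp add: rep_kernel_def hzero_eq)

text \<open>If \<open>h\<close> is self-adjoint of norm at most one, then formally \<open>1 - h = (1 - y)\<^sup>2\<close> for a
  self-adjoint \<open>y\<close>, and hence \<open>\<langle>v, v\<rangle> - \<langle>\<pi>(h) v, v\<rangle> = \<parallel>v - \<pi>(y) v\<parallel>\<^sup>2 \<ge> 0\<close>.\<close>

lemma rep_self_adjoint_bound:
  assumes h: "star h = h" "norm h \<le> 1" and v: "v \<in> V"
  shows "Re (ip (\<pi> h v) v) \<le> (nm v)\<^sup>2"
proof -
  obtain y where y: "y + y = h + y * y" and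
    S: "\<And>S. closed S \<Longrightarrow> 0 \<in> S \<Longrightarrow> (\<And>z. z \<in> S \<Longrightarrow> (1 / 2) *\<^sub>R (h + z * z) \<in> S) \<Longrightarrow> y \<in> S"
    using root_iteration[OF h(2)] by metis
  have "y \<in> {y. star y = y}"
    by (rule S[OF closed_self_adjoint]) (auto simp: star_simps h)
  then have sy: "star y = y" by simp
  let ?y = "\<pi> y v"
  have yV: "?y \<in> V" by (rule rep_V[OF v])
  have "\<pi> (y + y) v = \<pi> (h + y * y) v" by (simp add: y)
  then have "?y + ?y = \<pi> h v + \<pi> y ?y" using v by (simp add: rep_alg_add rep_mult)
  then have "\<pi> h v = ?y + ?y - \<pi> y ?y" by (simp add: algebra_simps)
  then have "ip (\<pi> h v) v = ip ?y v + ip ?y v - ip (\<pi> y ?y) v"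
    using v yV by (simp add: ip_simps V_closed rep_V)
  also have "ip (\<pi> y ?y) v = ip ?y ?y" using rep_adjoint[OF yV v, of y] by (simp add: sy)
  finally have "Re (ip (\<pi> h v) v) = 2 * Re (ip ?y v) - (nm ?y)\<^sup>2"
    using yV by (simp add: nm_square)
  moreover have "Re (ip ?y v) = Re (ip v ?y)" using ip_cnj[OF v yV] by (metis cnj.simps(1))
  moreover have "0 \<le> (nm (v - ?y))\<^sup>2" by simp
  ultimately show ?thesis using nm_diff_square[OF v yV] by simp
qed

text \<open>Automatic continuity: a multiple of \<open>x\<^sup>* x\<close> is a self-adjoint contraction, to which the
  preceding bound applies.\<close>

theorem rep_contractive:
  assumes v: "v \<in> V"
  shows "nm (\<pi> x v) \<le> norm x * nm v"
proof (cases "x = 0")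
  case True
  then show ?thesis using v by (simp add: rep_alg_zero nm_zero)
next
  case False
  define z where "z = complex_of_real (1 / norm x) *\<^sub>C x"
  have nz: "norm z = 1" using False by (simp add: z_def norm_scaleC norm_divide)
  have "norm (star z * z) \<le> norm (star z) * norm z" by (rule norm_mult_ineq)
  then have "norm (star z * z) \<le> 1" by (simp add: norm_star nz)
  moreover have "star (star z * z) = star z * z" by (simp add: star_simps)
  ultimately have "Re (ip (\<pi> (star z * z) v) v) \<le> (nm v)\<^sup>2" using rep_self_adjoint_bound v by blast
  moreover have "ip (\<pi> (star z * z) v) v = ip (\<pi> z v) (\<pi> z v)"
    using v by (simp add: rep_mult rep_adjoint rep_V star_star)
  ultimately have "(nm (\<pi> z v))\<^sup>2 \<le> (nm v)\<^sup>2" using v by (simp add: nm_square rep_V)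
  then have "nm (\<pi> z v) \<le> nm v" by (rule power2_le_imp_le) (rule nm_nonneg[OF v])
  then have "cmod (complex_of_real (1 / norm x)) * nm (\<pi> x v) \<le> nm v"
    using v by (simp only: z_def rep_alg_scale nm_scale rep_V)
  then show ?thesis using False by (simp add: norm_divide field_simps)
qed

lemma rep_functional_bounded:
  assumes "v \<in> V" "w \<in> V"
  shows "bounded_linear (\<lambda>x. ip (\<pi> x v) w)"
proof (rule bounded_linear_intro[of _ "nm v * nm w"])
  show "ip (\<pi> (x + y) v) w = ip (\<pi> x v) w + ip (\<pi> y v) w" for x y
    using assms by (simp add: rep_alg_add ip_simps rep_V)
  show "ip (\<pi> (r *\<^sub>R x) v) w = r *\<^sub>R ip (\<pi> x v) w" for r x
    using assms by (simp add: scaleC_of_real[symmetric] rep_alg_scale ip_simps rep_V scaleR_conv_of_real)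
  show "norm (ip (\<pi> x v) w) \<le> norm x * (nm v * nm w)" for x
  proof -
    have "cmod (ip (\<pi> x v) w) \<le> nm (\<pi> x v) * nm w" using assms by (intro CS rep_V)
    also have "\<dots> \<le> (norm x * nm v) * nm w"
      using assms by (intro mult_right_mono rep_contractive nm_nonneg)
    finally show ?thesis by (simp add: mult.assoc)
  qed
qed

definition intertwiner :: "('v \<Rightarrow> 'v) \<Rightarrow> real \<Rightarrow> bool" where
  "intertwiner T C \<longleftrightarrow> 0 \<le> C \<and> (\<forall>v\<in>V. T v \<in> V) \<and> (\<forall>v\<in>V. \<forall>w\<in>V. T (v + w) = T v + T w) \<and>
     (\<forall>c. \<forall>v\<in>V. T (c *\<^sub>C v) = c *\<^sub>C T v) \<and> (\<forall>v\<in>V. nm (T v) \<le> C * nm v) \<and>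
     (\<forall>a. \<forall>v\<in>V. T (\<pi> a v) = \<pi> a (T v))"

lemma intertwinerD:
  assumes "intertwiner T C"
  shows "0 \<le> C" "v \<in> V \<Longrightarrow> T v \<in> V" "v \<in> V \<Longrightarrow> w \<in> V \<Longrightarrow> T (v + w) = T v + T w"
    "v \<in> V \<Longrightarrow> T (c *\<^sub>C v) = c *\<^sub>C T v" "v \<in> V \<Longrightarrow> nm (T v) \<le> C * nm v"
    "v \<in> V \<Longrightarrow> T (\<pi> a v) = \<pi> a (T v)" "v \<in> V \<Longrightarrow> w \<in> V \<Longrightarrow> T (v - w) = T v - T w"
proof -
  show *: "0 \<le> C" "v \<in> V \<Longrightarrow> T v \<in> V" "\<And>v w. v \<in> V \<Longrightarrow> w \<in> V \<Longrightarrow> T (v + w) = T v + T w"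
    "\<And>c v. v \<in> V \<Longrightarrow> T (c *\<^sub>C v) = c *\<^sub>C T v" "v \<in> V \<Longrightarrow> nm (T v) \<le> C * nm v"
    "v \<in> V \<Longrightarrow> T (\<pi> a v) = \<pi> a (T v)" for v a
    using assms by (auto simp: intertwiner_def)
  show "v \<in> V \<Longrightarrow> w \<in> V \<Longrightarrow> T (v - w) = T v - T w"
    using *(3)[of v "- w"] *(4)[of w "- 1"] by (simp add: scaleC_simps V_minus)
qed

lemma intertwiner_add:
  assumes S: "intertwiner S C" and T: "intertwiner T D"
  shows "intertwiner (\<lambda>v. S v + T v) (C + D)"
proof -
  note s = intertwinerD[OF S] and t = intertwinerD[OF T]
  have "nm (S v + T v) \<le> (C + D) * nm v" if "v \<in> V" for v
    using nm_triangle[OF s(2)[OF that] t(2)[OF that]] s(5)[OF that] t(5)[OF that]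
    by (simp add: distrib_right)
  then show ?thesis
    unfolding intertwiner_def using s t by (auto simp: V_add scaleC_simps rep_vector_add)
qed

lemma intertwiner_scale:
  assumes S: "intertwiner S C"
  shows "intertwiner (\<lambda>v. c *\<^sub>C S v) (cmod c * C)"
proof -
  note s = intertwinerD[OF S]
  have "nm (c *\<^sub>C S v) \<le> cmod c * C * nm v" if "v \<in> V" for v
    using that by (simp add: nm_scale s mult.assoc mult_left_mono)
  then show ?thesis
    unfolding intertwiner_def using s
    by (auto simp: V_scale scaleC_simps rep_vector_scale mult.commute)
qed

lemma intertwiner_id: "intertwiner (\<lambda>v. v) 1"
  by (simp add: intertwiner_def)

lemma intertwiner_compose:
  assumes S: "intertwiner S C" and T: "intertwiner T D"
  shows "intertwiner (\<lambda>v. S (T v)) (C * D)"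
proof -
  note s = intertwinerD[OF S] and t = intertwinerD[OF T]
  have "nm (S (T v)) \<le> C * D * nm v" if "v \<in> V" for v
    using s(5)[OF t(2)[OF that]] mult_left_mono[OF t(5)[OF that] s(1)] by (simp add: mult.assoc)
  then show ?thesis unfolding intertwiner_def using s t by auto
qed

lemma intertwiner_mono:
  assumes "intertwiner T C" "C \<le> D"
  shows "intertwiner T D"
proof -
  have "nm (T v) \<le> D * nm v" if "v \<in> V" for v
    using intertwinerD(5)[OF assms(1) that] mult_right_mono[OF assms(2) nm_nonneg[OF that]] by simp
  then show ?thesis using assms unfolding intertwiner_def by auto
qed

lemma intertwiner_kernel:
  assumes "intertwiner T C"
  shows "clsub {v \<in> V. T v = 0}" "v \<in> {v \<in> V. T v = 0} \<Longrightarrow> \<pi> a v \<in> {v \<in> V. T v = 0}"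
proof -
  note t = intertwinerD[OF assms]
  show "clsub {v \<in> V. T v = 0}"
    unfolding clsub_def
  proof (intro conjI allI ballI impI)
    show "0 \<in> {v \<in> V. T v = 0}" using t(4)[OF V_zero, of 0] by (simp add: V_zero)
    fix X :: "nat \<Rightarrow> 'v" and v
    assume *: "(\<forall>n. X n \<in> {v \<in> V. T v = 0}) \<and> v \<in> V \<and> (\<lambda>n. nm (X n - v)) \<longlonglongrightarrow> 0"
    have "nm (T v) \<le> C * nm (X n - v)" for n
    proof -
      have X: "X n \<in> V" "T (X n) = 0" using * by auto
      have "T (X n - v) = - T v" using * X t(7)[of "X n" v] by simp
      then show ?thesis using t(5)[of "X n - v"] X * nm_minus[OF t(2)[of v]] by (simp add: V_diff)
    qed
    moreover have "(\<lambda>n. C * nm (X n - v)) \<longlonglongrightarrow> 0" using * tendsto_mult_right_zero by blast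
    ultimately have "nm (T v) \<le> 0" by (intro LIMSEQ_le_const) auto
    then have "T v = 0" using * t(2)[of v] nm_eq_0[of "T v"] nm_nonneg[of "T v"] by simp
    then show "v \<in> {v \<in> V. T v = 0}" using * by simp
  qed (auto simp: V_closed t)
  show "v \<in> {v \<in> V. T v = 0} \<Longrightarrow> \<pi> a v \<in> {v \<in> V. T v = 0}"
    by (auto simp: t rep_V rep_vector_zero)
qed

end

locale irreducible_vector_representation = vector_representation H \<pi>
  for H :: "'v::complex_vector pre_hilbert" and \<pi> :: "'d::banach_star_algebra \<Rightarrow> 'v \<Rightarrow> 'v" +
  assumes irreducible: "irreducible_star_representation H \<pi>"
begin

lemma invariant_subspace_trivial:
  assumes "clsub M" "\<And>a v. v \<in> M \<Longrightarrow> \<pi> a v \<in> M"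
  shows "M = {0} \<or> M = V"
  using irreducible clsub_closed_subspace[OF assms(1)] assms(2)
  unfolding irreducible_star_representation_def hzero_eq by blast

text \<open>The common null space of all \<open>\<pi> a\<close> is invariant and not the whole space, as \<open>\<pi> \<noteq> 0\<close>.\<close>

lemma nondegenerate:
  assumes v: "v \<in> V" "\<And>a. \<pi> a v = 0"
  shows "v = 0"
proof -
  define M where "M = {v \<in> V. \<forall>a. \<pi> a v = 0}"
  have "clsub M"
    unfolding clsub_def
  proof (intro conjI allI ballI impI)
    fix X :: "nat \<Rightarrow> 'v" and v
    assume *: "(\<forall>n. X n \<in> M) \<and> v \<in> V \<and> (\<lambda>n. nm (X n - v)) \<longlonglongrightarrow> 0"
    have "\<pi> a v = 0" for a
    proof -
      have "nm (\<pi> a v) \<le> norm a * nm (X n - v)" for n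
      proof -
        have X: "X n \<in> V" "\<pi> a (X n) = 0" using * by (auto simp: M_def)
        have "\<pi> a (X n - v) = - \<pi> a v" using * X by (simp add: rep_vector_diff)
        then show ?thesis using rep_contractive[of "X n - v" a] X * nm_minus[OF rep_V[of v a]] by (simp add: V_diff)
      qed
      moreover have "(\<lambda>n. norm a * nm (X n - v)) \<longlonglongrightarrow> 0" using * tendsto_mult_right_zero by blast
      ultimately have "nm (\<pi> a v) \<le> 0" by (intro LIMSEQ_le_const) auto
      then show ?thesis using * rep_V[of v a] nm_eq_0[of "\<pi> a v"] nm_nonneg[of "\<pi> a v"] by simp
    qed
    then show "v \<in> M" using * by (simp add: M_def)
  qed (auto simp: M_def V_closed rep_vector_zero rep_vector_add rep_vector_scale)
  moreover have "\<pi> a v \<in> M" if "v \<in> M" for a v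
    using that by (auto simp: M_def rep_V V_zero rep_vector_zero)
  ultimately have "M = {0} \<or> M = V" by (rule invariant_subspace_trivial)
  moreover have "M \<noteq> V"
  proof
    assume "M = V"
    then have "\<forall>v\<in>V. \<forall>a. \<pi> a v = 0" by (auto simp: M_def)
    then have "rep_kernel H \<pi> = UNIV" using rep_kernel_iff by blast
    then show False using irreducible by (simp add: irreducible_star_representation_def)
  qed
  ultimately show ?thesis using v by (auto simp: M_def)
qed

text \<open>The modulus of a self-adjoint intertwiner \<open>T\<close> of norm at most one is \<open>1 - Y\<close>, where \<open>Y\<close> is
  the limit of the iteration of \<open>root_iteration\<close> for \<open>h = 1 - T\<^sup>2\<close>. The limit is taken at each
  vector separately.\<close>

lemma intertwiner_modulus:
  assumes T: "intertwiner T 1" and sa: "\<And>v w. v \<in> V \<Longrightarrow> w \<in> V \<Longrightarrow> ip (T v) w = ip v (T w)"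
  obtains Y where "intertwiner Y 1" "\<And>v. v \<in> V \<Longrightarrow> Y (T v) = T (Y v)"
    "\<And>v. v \<in> V \<Longrightarrow> Y v + Y v = v - T (T v) + Y (Y v)"
proof -
  note t = intertwinerD[OF T]
  define G where "G v = v - T (T v)" for v
  define Z where "Z = rec_nat (\<lambda>_. 0) (\<lambda>_ S v. (1 / 2) *\<^sub>C (G v + S (S v)))"
  have Z0: "Z 0 v = 0" and ZS: "Z (Suc n) v = (1 / 2) *\<^sub>C (G v + Z n (Z n v))" for n v
    by (simp_all add: Z_def)
  have GV: "G v \<in> V" if "v \<in> V" for v using that by (simp add: G_def V_diff t)
  have G: "intertwiner G 1"
    unfolding intertwiner_def
  proof (intro conjI allI ballI)
    fix v assume v: "v \<in> V"
    have "(nm (G v))\<^sup>2 = (nm v)\<^sup>2 + (nm (T (T v)))\<^sup>2 - 2 * (nm (T v))\<^sup>2"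
      using v by (simp add: G_def nm_diff_square t sa[symmetric] nm_square[of "T v"])
    moreover have "(nm (T (T v)))\<^sup>2 \<le> (nm (T v))\<^sup>2"
      using t(5)[OF t(2)[OF v]] v by (intro power_mono nm_nonneg t) auto
    ultimately have "(nm (G v))\<^sup>2 \<le> (nm v)\<^sup>2" using zero_le_power2[of "nm (T v)"] by linarith
    from power2_le_imp_le[OF this nm_nonneg[OF v]] show "nm (G v) \<le> 1 * nm v" by simp
  qed (auto simp: GV, auto simp: G_def t scaleC_simps rep_vector_diff rep_V)
  note g = intertwinerD[OF G]
  have Z: "intertwiner (Z n) (root_majorant n) \<and> (\<forall>v\<in>V. Z n (T v) = T (Z n v))" for n
  proof (induction n)
    case 0
    show ?case using t(4)[OF V_zero, of 0] by (auto simp: intertwiner_def Z0 V_zero rep_vector_zero nm_zero)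
  next
    case (Suc n)
    then have I: "intertwiner (Z n) (root_majorant n)" by simp
    have "intertwiner (\<lambda>v. (1 / 2) *\<^sub>C (G v + Z n (Z n v))) (cmod (1 / 2) * (1 + root_majorant n * root_majorant n))"
      by (intro intertwiner_scale intertwiner_add G intertwiner_compose I)
    moreover have "(\<lambda>v. (1 / 2) *\<^sub>C (G v + Z n (Z n v))) = Z (Suc n)" by (simp add: ZS fun_eq_iff)
    moreover have "cmod (1 / 2) * (1 + root_majorant n * root_majorant n) = root_majorant (Suc n)"
      by (simp add: root_majorant.simps(2) norm_divide)
    moreover have "Z (Suc n) (T v) = T (Z (Suc n) v)" if v: "v \<in> V" for v
    proof -
      have "Z n (Z n (T v)) = T (Z n (Z n v))" using Suc v intertwinerD(2)[OF I] by simp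
      moreover have "G (T v) = T (G v)" using v by (simp add: G_def t)
      ultimately show ?thesis using v intertwinerD(2)[OF I] by (simp add: ZS t GV V_add)
    qed
    ultimately show ?case by simp
  qed
  have ZI: "intertwiner (Z n) (root_majorant n)" and ZT: "v \<in> V \<Longrightarrow> Z n (T v) = T (Z n v)" for n v
    using Z by auto
  note z = intertwinerD[OF ZI]
  have step: "nm (Z (Suc n) v - Z n v) \<le> (root_majorant (Suc n) - root_majorant n) * nm v" if v: "v \<in> V" for n v
    using v
  proof (induction n arbitrary: v)
    case 0
    have "nm (Z (Suc 0) v) \<le> root_majorant (Suc 0) * nm v" using z(5) 0 by blast
    then show ?case by (simp add: Z0)
  next
    case (Suc n)
    let ?d = "Z (Suc n) v - Z n v" and ?w = "Z n v" and ?e = "root_majorant (Suc n) - root_majorant n"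
    note v = Suc.prems
    have w: "?w \<in> V" and d: "?d \<in> V" using v by (auto simp: z V_diff)
    have "Z (Suc (Suc n)) v - Z (Suc n) v =
        (1 / 2) *\<^sub>C (Z (Suc n) ?d + (Z (Suc n) ?w - Z n ?w))"
    proof -
      have "Z (Suc n) ?d = Z (Suc n) (Z (Suc n) v) - Z (Suc n) ?w" using v by (simp add: z)
      then show ?thesis
        by (subst ZS) (subst (2) ZS, simp add: scaleC_simps)
    qed
    also have "nm \<dots> = (1 / 2) * nm (Z (Suc n) ?d + (Z (Suc n) ?w - Z n ?w))"
      using w d by (subst nm_scale) (auto simp: z V_closed norm_divide)
    also have "nm (Z (Suc n) ?d + (Z (Suc n) ?w - Z n ?w)) \<le> root_majorant (Suc n) * (?e * nm v) + ?e * (root_majorant n * nm v)"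
    proof -
      have "nm (Z (Suc n) ?d) \<le> root_majorant (Suc n) * (?e * nm v)"
        by (rule order_trans[OF z(5)[OF d]]) (intro mult_left_mono Suc.IH v root_majorant_bounds)
      moreover have "nm (Z (Suc n) ?w - Z n ?w) \<le> ?e * (root_majorant n * nm v)"
        using root_majorant_mono[of n]
        by (intro order_trans[OF Suc.IH[OF w]] mult_left_mono z(5) v) auto
      ultimately show ?thesis
        using nm_triangle[of "Z (Suc n) ?d" "Z (Suc n) ?w - Z n ?w"] w d by (simp add: z V_closed)
    qed
    also have "(1 / 2) * (root_majorant (Suc n) * (?e * nm v) + ?e * (root_majorant n * nm v)) =
        (root_majorant (Suc (Suc n)) - root_majorant (Suc n)) * nm v"
      by (simp add: root_majorant.simps(2)[of "Suc n"] root_majorant.simps(2)[of n] field_simps)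
    finally show ?case by simp
  qed
  have gap: "nm (Z (n + k) v - Z n v) \<le> (root_majorant (n + k) - root_majorant n) * nm v" if v: "v \<in> V" for n k v
  proof (induction k)
    case (Suc k)
    have "nm (Z (n + Suc k) v - Z n v) \<le> nm (Z (n + Suc k) v - Z (n + k) v) + nm (Z (n + k) v - Z n v)"
      using v by (intro nm_triangle3) (auto simp: z)
    also have "\<dots> \<le> (root_majorant (Suc (n + k)) - root_majorant (n + k)) * nm v +
        (root_majorant (n + k) - root_majorant n) * nm v"
      using step[OF v, of "n + k"] Suc by simp
    finally show ?case by (simp add: algebra_simps)
  qed (simp add: nm_zero)
  have "\<exists>y\<in>V. (\<lambda>n. nm (Z n v - y)) \<longlonglongrightarrow> 0" if v: "v \<in> V" for v
  proof -
    have "\<exists>M. \<forall>m\<ge>M. \<forall>n\<ge>M. nm (Z m v - Z n v) < e" if e: "e > 0" for e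
    proof -
      have "Cauchy root_majorant" using root_majorant_convergent by (rule convergent_Cauchy)
      then obtain M where M: "\<And>m n. m \<ge> M \<Longrightarrow> n \<ge> M \<Longrightarrow> \<bar>root_majorant m - root_majorant n\<bar> < e / (nm v + 1)"
        using CauchyD[of root_majorant "e / (nm v + 1)"] e nm_nonneg[OF v] by (auto simp: add_nonneg_pos)
      have le: "nm (Z m v - Z n v) < e" if "n \<ge> M" "m \<ge> n" for m n
      proof -
        from that(2) obtain k where k: "m = n + k" using le_Suc_ex by blast
        have "root_majorant m - root_majorant n \<le> e / (nm v + 1)" using M[of m n] that by auto
        then have "(root_majorant m - root_majorant n) * nm v \<le> e / (nm v + 1) * nm v"
          using nm_nonneg[OF v] by (rule mult_right_mono)
        also have "\<dots> < e" using e nm_nonneg[OF v] by (simp add: field_simps)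
        finally show ?thesis using gap[OF v, of n k] by (simp add: k)
      qed
      have "nm (Z m v - Z n v) < e" if "m \<ge> M" "n \<ge> M" for m n
        using le[of n m] le[of m n] that nm_diff_commute[OF z(2)[OF v] z(2)[OF v], of m n]
        by (cases "m \<ge> n") auto
      then show ?thesis by blast
    qed
    then show ?thesis using V_complete[of "\<lambda>n. Z n v"] z(2)[OF v] by metis
  qed
  then obtain Y where YV: "\<And>v. v \<in> V \<Longrightarrow> Y v \<in> V" and lim: "\<And>v. v \<in> V \<Longrightarrow> (\<lambda>n. nm (Z n v - Y v)) \<longlonglongrightarrow> 0"
    by metis
  have uniq: "Y v = w" if "v \<in> V" "w \<in> V" "(\<lambda>n. nm (Z n v - w)) \<longlonglongrightarrow> 0" for v w
    by (rule limit_unique[where X = "\<lambda>n. Z n v"]) (use that z YV lim in auto)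
  have squeeze: "f \<longlonglongrightarrow> 0" if "g \<longlonglongrightarrow> 0" "\<And>n. 0 \<le> f n" "\<And>n. f n \<le> g n" for f g :: "nat \<Rightarrow> real"
    by (rule tendsto_sandwich[OF _ _ tendsto_const that(1)]) (use that in auto)
  show ?thesis
  proof (rule that)
    show "intertwiner Y 1"
      unfolding intertwiner_def
    proof (intro conjI allI ballI)
      fix v w assume v: "v \<in> V" and w: "w \<in> V"
      have "(\<lambda>n. nm (Z n v - Y v) + nm (Z n w - Y w)) \<longlonglongrightarrow> 0 + 0" by (intro tendsto_add lim v w)
      then have "(\<lambda>n. nm (Z n v - Y v) + nm (Z n w - Y w)) \<longlonglongrightarrow> 0" by simp
      then have "(\<lambda>n. nm (Z n (v + w) - (Y v + Y w))) \<longlonglongrightarrow> 0"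
      proof (rule squeeze)
        fix n
        show "nm (Z n (v + w) - (Y v + Y w)) \<le> nm (Z n v - Y v) + nm (Z n w - Y w)"
          using nm_triangle[of "Z n v - Y v" "Z n w - Y w"] v w by (simp add: z YV V_diff add_diff_add)
        show "0 \<le> nm (Z n (v + w) - (Y v + Y w))" using v w by (intro nm_nonneg V_diff V_add z YV)
      qed
      then show "Y (v + w) = Y v + Y w" using v w by (intro uniq V_add YV)
    next
      fix c v assume v: "v \<in> V"
      have "(\<lambda>n. cmod c * nm (Z n v - Y v)) \<longlonglongrightarrow> 0" using lim[OF v] by (rule tendsto_mult_right_zero)
      moreover have "nm (Z n (c *\<^sub>C v) - c *\<^sub>C Y v) = cmod c * nm (Z n v - Y v)" for n
        using v nm_scale[of "Z n v - Y v" c] by (simp add: z YV V_diff scaleC_simps)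
      ultimately show "Y (c *\<^sub>C v) = c *\<^sub>C Y v" using v by (intro uniq V_scale YV) auto
    next
      fix v assume v: "v \<in> V"
      show "nm (Y v) \<le> 1 * nm v"
      proof (rule nm_limit_le[OF z(2)[OF v] YV[OF v] lim[OF v] _ tendsto_const])
        show "nm (Z n v) \<le> 1 * nm v" for n
          using z(5)[OF v, of n] mult_right_mono[OF root_majorant_bounds(2)[of n] nm_nonneg[OF v]] by linarith
      qed
    next
      fix a :: 'd and v assume v: "v \<in> V"
      have "(\<lambda>n. norm a * nm (Z n v - Y v)) \<longlonglongrightarrow> 0" using lim[OF v] by (rule tendsto_mult_right_zero)
      then have "(\<lambda>n. nm (Z n (\<pi> a v) - \<pi> a (Y v))) \<longlonglongrightarrow> 0"
      proof (rule squeeze)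
        fix n
        show "nm (Z n (\<pi> a v) - \<pi> a (Y v)) \<le> norm a * nm (Z n v - Y v)"
          using rep_contractive[of "Z n v - Y v" a] v by (simp add: z YV V_diff rep_vector_diff)
        show "0 \<le> nm (Z n (\<pi> a v) - \<pi> a (Y v))" using v by (intro nm_nonneg V_diff z YV rep_V)
      qed
      then show "Y (\<pi> a v) = \<pi> a (Y v)" using v by (intro uniq rep_V YV)
    qed (use YV in auto)
    fix v assume v: "v \<in> V"
    have "(\<lambda>n. nm (Z n (T v) - T (Y v))) \<longlonglongrightarrow> 0"
    proof (rule squeeze[OF lim[OF v]])
      fix n
      show "nm (Z n (T v) - T (Y v)) \<le> nm (Z n v - Y v)"
        using t(5)[of "Z n v - Y v"] v by (simp add: ZT t z YV V_diff)
      show "0 \<le> nm (Z n (T v) - T (Y v))" using v by (intro nm_nonneg V_diff z YV t)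
    qed
    then show "Y (T v) = T (Y v)" using v by (intro uniq t YV)
    have sq: "(\<lambda>n. nm (Z n (Z n v) - Y (Y v))) \<longlonglongrightarrow> 0"
    proof (rule squeeze)
      fix n
      have "nm (Z n (Z n v) - Y (Y v)) \<le> nm (Z n (Z n v) - Z n (Y v)) + nm (Z n (Y v) - Y (Y v))"
        using v by (intro nm_triangle3 z YV)
      moreover have "nm (Z n (Z n v) - Z n (Y v)) \<le> nm (Z n v - Y v)"
      proof -
        have "nm (Z n (Z n v - Y v)) \<le> root_majorant n * nm (Z n v - Y v)"
          using v by (intro z V_diff YV)
        also have "\<dots> \<le> 1 * nm (Z n v - Y v)"
          using v by (intro mult_right_mono root_majorant_bounds nm_nonneg V_diff z YV)
        finally show ?thesis using v by (simp add: z YV)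
      qed
      ultimately show "nm (Z n (Z n v) - Y (Y v)) \<le> nm (Z n v - Y v) + nm (Z n (Y v) - Y (Y v))" by simp
      show "0 \<le> nm (Z n (Z n v) - Y (Y v))" using v by (intro nm_nonneg V_diff z YV)
    next
      have "(\<lambda>n. nm (Z n v - Y v) + nm (Z n (Y v) - Y (Y v))) \<longlonglongrightarrow> 0 + 0"
        by (intro tendsto_add lim v YV)
      then show "(\<lambda>n. nm (Z n v - Y v) + nm (Z n (Y v) - Y (Y v))) \<longlonglongrightarrow> 0" by simp
    qed
    have "Y v = (1 / 2) *\<^sub>C (G v + Y (Y v))"
    proof (rule limit_unique[where X = "\<lambda>n. Z (Suc n) v"])
      show "(\<lambda>n. nm (Z (Suc n) v - Y v)) \<longlonglongrightarrow> 0" using lim[OF v] by (rule LIMSEQ_Suc)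
      have half: "nm (Z (Suc n) v - (1 / 2) *\<^sub>C (G v + Y (Y v))) = (1 / 2) * nm (Z n (Z n v) - Y (Y v))" for n
      proof -
        have "Z (Suc n) v - (1 / 2) *\<^sub>C (G v + Y (Y v)) = (1 / 2) *\<^sub>C (Z n (Z n v) - Y (Y v))"
          by (simp add: ZS scaleC_simps)
        then show ?thesis using v by (simp add: nm_scale V_diff z YV norm_divide)
      qed
      show "(\<lambda>n. nm (Z (Suc n) v - (1 / 2) *\<^sub>C (G v + Y (Y v)))) \<longlonglongrightarrow> 0"
        unfolding half by (rule tendsto_mult_right_zero[OF sq])
    qed (intro V_scale V_add GV YV z(2) v)+
    then have "Y v + Y v = (1 / 2 + 1 / 2) *\<^sub>C (G v + Y (Y v))"
      by (metis scaleC_add_left)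
    then show "Y v + Y v = v - T (T v) + Y (Y v)" by (simp add: G_def scaleC_one)
  qed
qed

text \<open>Let \<open>A = \<bar>T\<bar>\<close>, so that \<open>(A + T) (A - T) = 0\<close>. The null space of \<open>A + T\<close> is invariant: if
  it is zero, \<open>T = A \<ge> 0\<close>; if it is everything, \<open>T = - A \<le> 0\<close>.\<close>

lemma self_adjoint_contraction_sign:
  assumes T: "intertwiner T 1" and sa: "\<And>v w. v \<in> V \<Longrightarrow> w \<in> V \<Longrightarrow> ip (T v) w = ip v (T w)"
  shows "(\<forall>v\<in>V. 0 \<le> Re (ip (T v) v)) \<or> (\<forall>v\<in>V. Re (ip (T v) v) \<le> 0)"
proof -
  note t = intertwinerD[OF T]
  obtain Y where Y: "intertwiner Y 1" and YT: "\<And>v. v \<in> V \<Longrightarrow> Y (T v) = T (Y v)"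
    and eq: "\<And>v. v \<in> V \<Longrightarrow> Y v + Y v = v - T (T v) + Y (Y v)"
    using intertwiner_modulus[OF T sa] by metis
  note y = intertwinerD[OF Y]
  define A where "A v = v - Y v" for v
  have AV: "A v \<in> V" if "v \<in> V" for v using that by (simp add: A_def V_diff y)
  have pos: "0 \<le> Re (ip (A v) v)" if v: "v \<in> V" for v
  proof -
    have "cmod (ip (Y v) v) \<le> nm v * nm v"
      using CS[OF y(2)[OF v] v] y(5)[OF v] nm_nonneg[OF v] by (smt (verit, ccfv_SIG) mult_right_mono)
    then have "Re (ip (Y v) v) \<le> (nm v)\<^sup>2"
      using complex_Re_le_cmod[of "ip (Y v) v"] by (simp add: power2_eq_square)
    then show ?thesis using v by (simp add: A_def ip_simps y nm_square)
  qed
  have AA: "A (A v) = T (T v)" if v: "v \<in> V" for v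
  proof -
    have "A (A v) = v - (Y v + Y v) + Y (Y v)" using v by (simp add: A_def y)
    then show ?thesis using eq[OF v] by simp
  qed
  have AT: "A (T v) = T (A v)" if v: "v \<in> V" for v using v by (simp add: A_def YT t y)
  have Aadd: "A (v - w) = A v - A w" if "v \<in> V" "w \<in> V" for v w using that by (simp add: A_def y)
  have S: "intertwiner (\<lambda>v. (v + (- 1) *\<^sub>C Y v) + T v) ((1 + cmod (- 1) * 1) + 1)"
    by (intro intertwiner_add intertwiner_id intertwiner_scale Y T)
  have S_eq: "(v + (- 1) *\<^sub>C Y v) + T v = A v + T v" for v by (simp add: A_def scaleC_simps)
  define M where "M = {v \<in> V. A v + T v = 0}"
  have "M = {0} \<or> M = V"
    using invariant_subspace_trivial[of M] intertwiner_kernel[OF S] unfolding S_eq M_def by blast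
  then show ?thesis
  proof
    assume M: "M = {0}"
    have "T v = A v" if v: "v \<in> V" for v
    proof -
      have "A (A v - T v) + T (A v - T v) = 0"
        using v by (simp add: Aadd AV t AA AT)
      then have "A v - T v \<in> M" using v by (simp add: M_def AV t V_diff)
      then show ?thesis using M by simp
    qed
    then show ?thesis using pos by simp
  next
    assume M: "M = V"
    have "Re (ip (T v) v) \<le> 0" if v: "v \<in> V" for v
    proof -
      have "v \<in> M" using M v by simp
      then have "T v = - A v" by (simp add: M_def eq_neg_iff_add_eq_0 add.commute)
      then show ?thesis using pos[OF v] v AV[OF v] by (simp add: ip_simps)
    qed
    then show ?thesis by blast
  qed
qed

lemma self_adjoint_sign:
  assumes T: "intertwiner T C" and sa: "\<And>v w. v \<in> V \<Longrightarrow> w \<in> V \<Longrightarrow> ip (T v) w = ip v (T w)"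
  shows "(\<forall>v\<in>V. 0 \<le> Re (ip (T v) v)) \<or> (\<forall>v\<in>V. Re (ip (T v) v) \<le> 0)"
proof -
  note t = intertwinerD[OF T]
  define s where "s = 1 / (C + 1)"
  have s: "s > 0" "s * C \<le> 1" using t(1) by (auto simp: s_def field_simps)
  have "intertwiner (\<lambda>v. complex_of_real s *\<^sub>C T v) 1"
    by (rule intertwiner_mono[OF intertwiner_scale[OF T]]) (use s in simp)
  moreover have "ip (complex_of_real s *\<^sub>C T v) w = ip v (complex_of_real s *\<^sub>C T w)" if "v \<in> V" "w \<in> V" for v w
    using that sa by (simp add: ip_simps t)
  ultimately have "(\<forall>v\<in>V. 0 \<le> Re (ip (complex_of_real s *\<^sub>C T v) v)) \<or>
      (\<forall>v\<in>V. Re (ip (complex_of_real s *\<^sub>C T v) v) \<le> 0)"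
    by (rule self_adjoint_contraction_sign)
  moreover have "Re (ip (complex_of_real s *\<^sub>C T v) v) = s * Re (ip (T v) v)" if "v \<in> V" for v
    using that by (simp add: ip_simps t)
  ultimately show ?thesis using s by (auto simp: zero_le_mult_iff mult_le_0_iff)
qed

text \<open>For each real \<open>r\<close> the operator \<open>T - r\<close> has a sign. Hence all values of the quadratic form
  of \<open>T\<close> on unit vectors agree, for otherwise \<open>r\<close> could be chosen strictly between two of them.\<close>

lemma schur_self_adjoint:
  assumes T: "intertwiner T C" and sa: "\<And>v w. v \<in> V \<Longrightarrow> w \<in> V \<Longrightarrow> ip (T v) w = ip v (T w)"
  shows "\<exists>c. \<forall>v\<in>V. T v = c *\<^sub>C v"
proof -
  note t = intertwinerD[OF T]
  define S where "S r v = T v + (- complex_of_real r) *\<^sub>C v" for r v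
  have S: "intertwiner (S r) (C + cmod (- complex_of_real r) * 1)" for r
    unfolding S_def by (intro intertwiner_add T intertwiner_scale intertwiner_id)
  have Ssa: "ip (S r v) w = ip v (S r w)" if "v \<in> V" "w \<in> V" for r v w
    using that by (simp add: S_def ip_simps t V_closed sa)
  have SRe: "Re (ip (S r v) v) = Re (ip (T v) v) - r * (nm v)\<^sup>2" if "v \<in> V" for r v
    using that by (simp add: S_def ip_simps t V_closed nm_square)
  have key: "\<exists>r. \<forall>v\<in>V. Re (ip (T v) v) = r * (nm v)\<^sup>2"
  proof (cases "V = {0}")
    case True
    then show ?thesis using t(2)[OF V_zero] by (auto simp: ip_zero V_zero nm_zero)
  next
    case False
    then obtain u where u: "u \<in> V" "u \<noteq> 0" using V_zero by blast
    then have nu: "nm u > 0" using nm_eq_0 nm_nonneg by (metis less_eq_real_def)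
    define r where "r = Re (ip (T u) u) / (nm u)\<^sup>2"
    have "Re (ip (T v) v) = r * (nm v)\<^sup>2" if v: "v \<in> V" for v
    proof (cases "v = 0")
      case True
      then show ?thesis using t(2)[OF V_zero] by (simp add: ip_zero nm_zero)
    next
      case False
      then have nv: "nm v > 0" using v nm_eq_0 nm_nonneg by (metis less_eq_real_def)
      define q where "q = Re (ip (T v) v) / (nm v)\<^sup>2"
      have "q = r"
      proof (rule ccontr)
        assume "q \<noteq> r"
        define m where "m = (q + r) / 2"
        have "Re (ip (S m u) u) = (r - m) * (nm u)\<^sup>2" "Re (ip (S m v) v) = (q - m) * (nm v)\<^sup>2"
          using u v nu nv by (simp_all add: SRe r_def q_def field_simps)
        moreover have "(r - m) * (q - m) < 0"
        proof -
          have "(r - m) * (q - m) = - ((q - r)\<^sup>2 / 4)"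
            by (simp add: m_def field_simps power2_eq_square)
          then show ?thesis using \<open>q \<noteq> r\<close> by simp
        qed
        moreover have "0 \<le> Re (ip (S m u) u) \<and> 0 \<le> Re (ip (S m v) v) \<or> Re (ip (S m u) u) \<le> 0 \<and> Re (ip (S m v) v) \<le> 0"
          using self_adjoint_sign[OF S Ssa, of m] u v by blast
        ultimately show False using nu nv by (auto simp: zero_le_mult_iff mult_le_0_iff mult_less_0_iff)
      qed
      then show ?thesis using nv by (simp add: q_def field_simps)
    qed
    then show ?thesis by blast
  qed
  then obtain r where r: "\<And>v. v \<in> V \<Longrightarrow> Re (ip (S r v) v) = 0" using SRe by auto
  have "T v = complex_of_real r *\<^sub>C v" if v: "v \<in> V" for v
  proof -
    note s = intertwinerD[OF S[of r]]
    have w: "S r v \<in> V" by (rule s(2)[OF v])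
    have "Re (ip (S r (v + S r v)) (v + S r v)) = 0" using v w by (intro r V_add)
    then have "Re (ip (S r v) (S r v)) + Re (ip (S r (S r v)) v) = 0"
      using r[OF v] r[OF w] v w by (simp add: s ip_simps V_closed)
    moreover have "ip (S r (S r v)) v = ip (S r v) (S r v)" using v w by (rule Ssa[rotated])
    ultimately have "(nm (S r v))\<^sup>2 = 0" using w by (simp add: nm_square)
    then have "S r v = 0" using w nm_eq_0 by simp
    then show ?thesis by (simp add: S_def scaleC_simps)
  qed
  then show ?thesis by blast
qed

text \<open>The adjoint \<open>T'\<close> is given as a second intertwiner, so that the self-adjoint case applies
  to the real and the imaginary part.\<close>

theorem schur:
  assumes T: "intertwiner T C" and T': "intertwiner T' C'"
    and adj: "\<And>v w. v \<in> V \<Longrightarrow> w \<in> V \<Longrightarrow> ip (T v) w = ip v (T' w)"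
  shows "\<exists>c. \<forall>v\<in>V. T v = c *\<^sub>C v"
proof -
  note t = intertwinerD[OF T] and t' = intertwinerD[OF T']
  have adj': "ip (T' v) w = ip v (T w)" if "v \<in> V" "w \<in> V" for v w
    using adj[OF that(2,1)] ip_cnj that t t' by metis
  have "\<exists>c. \<forall>v\<in>V. T v + T' v = c *\<^sub>C v"
    using intertwiner_add[OF T T'] by (rule schur_self_adjoint) (simp add: ip_simps t t' adj adj' add.commute)
  then obtain c where c: "\<And>v. v \<in> V \<Longrightarrow> T v + T' v = c *\<^sub>C v" by blast
  have "\<exists>d. \<forall>v\<in>V. \<i> *\<^sub>C T v + (- \<i>) *\<^sub>C T' v = d *\<^sub>C v"
    using intertwiner_add[OF intertwiner_scale[OF T] intertwiner_scale[OF T']]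
    by (rule schur_self_adjoint) (simp add: ip_simps scaleC_simps V_closed t t' adj adj')
  then obtain d where d: "\<And>v. v \<in> V \<Longrightarrow> \<i> *\<^sub>C T v + (- \<i>) *\<^sub>C T' v = d *\<^sub>C v" by blast
  have "T v = ((c - \<i> * d) / 2) *\<^sub>C v" if v: "v \<in> V" for v
  proof -
    have "(- \<i>) *\<^sub>C (\<i> *\<^sub>C T v + (- \<i>) *\<^sub>C T' v) = (- \<i> * d) *\<^sub>C v"
      unfolding d[OF v] by (simp add: scaleC_scaleC)
    then have "T v - T' v = (- \<i> * d) *\<^sub>C v" by (simp add: scaleC_simps)
    then have "T v + T v = (c - \<i> * d) *\<^sub>C v"
      using c[OF v] by (simp add: scaleC_simps algebra_simps)
    then have "(1 / 2) *\<^sub>C (T v + T v) = (1 / 2) *\<^sub>C ((c - \<i> * d) *\<^sub>C v)" by simp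
    then show ?thesis by (simp add: scaleC_scaleC scaleC_add_right scaleC_add_left[symmetric] scaleC_one)
  qed
  then show ?thesis by blast
qed

end

section \<open>Hilbert sums and density\<close>

context vector_hilbert
begin

definition l2_carrier :: "('i \<Rightarrow> 'v) set" where
  "l2_carrier = {z. (\<forall>i. z i \<in> V) \<and> (\<lambda>i. (nm (z i))\<^sup>2) summable_on UNIV}"

definition l2_ip :: "('i \<Rightarrow> 'v) \<Rightarrow> ('i \<Rightarrow> 'v) \<Rightarrow> complex" where
  "l2_ip z w = (\<Sum>\<^sub>\<infinity>i. ip (z i) (w i))"

definition l2_hilbert :: "('i \<Rightarrow> 'v) pre_hilbert" where
  "l2_hilbert = \<lparr>hcarrier = l2_carrier, hzero = 0, hadd = (+), hscale = scaleC, hinner = l2_ip\<rparr>"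

lemma l2_V: "z \<in> l2_carrier \<Longrightarrow> z i \<in> V"
  by (simp add: l2_carrier_def)

lemma l2_summable: "z \<in> l2_carrier \<Longrightarrow> (\<lambda>i. (nm (z i))\<^sup>2) summable_on UNIV"
  by (simp add: l2_carrier_def)

lemma l2_memI:
  assumes "\<And>i. z i \<in> V" "\<And>F. finite F \<Longrightarrow> (\<Sum>i\<in>F. (nm (z i))\<^sup>2) \<le> C"
  shows "z \<in> l2_carrier"
  unfolding l2_carrier_def
  using assms by (auto intro!: nonneg_bdd_above_summable_on bdd_aboveI[of _ C])

lemma l2_finite_sum_le:
  "z \<in> l2_carrier \<Longrightarrow> finite F \<Longrightarrow> (\<Sum>i\<in>F. (nm (z i))\<^sup>2) \<le> (\<Sum>\<^sub>\<infinity>i. (nm (z i))\<^sup>2)"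
  by (intro finite_sum_le_infsum l2_summable) auto

lemma l2_abs_summable:
  assumes z: "z \<in> l2_carrier" and w: "w \<in> l2_carrier"
  shows "(\<lambda>i. cmod (ip (z i) (w i))) summable_on UNIV"
proof (rule Infinite_Sum.abs_summable_on_comparison_test')
  show "(\<lambda>i. (nm (z i))\<^sup>2 + (nm (w i))\<^sup>2) summable_on UNIV"
    by (intro summable_on_add l2_summable z w)
  show "cmod (ip (z i) (w i)) \<le> (nm (z i))\<^sup>2 + (nm (w i))\<^sup>2" for i
  proof -
    have "cmod (ip (z i) (w i)) \<le> nm (z i) * nm (w i)" by (intro CS l2_V z w)
    moreover have "2 * (nm (z i) * nm (w i)) \<le> (nm (z i))\<^sup>2 + (nm (w i))\<^sup>2"
      using sum_squares_bound[of "nm (z i)" "nm (w i)"] by simp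
    moreover have "0 \<le> nm (z i) * nm (w i)" by (intro mult_nonneg_nonneg nm_nonneg l2_V z w)
    ultimately show ?thesis by linarith
  qed
qed

lemma l2_ip_summable: "z \<in> l2_carrier \<Longrightarrow> w \<in> l2_carrier \<Longrightarrow> (\<lambda>i. ip (z i) (w i)) summable_on UNIV"
  by (rule abs_summable_summable[OF l2_abs_summable])

lemma l2_add:
  fixes z w :: "'i \<Rightarrow> 'v"
  shows "z \<in> l2_carrier \<Longrightarrow> w \<in> l2_carrier \<Longrightarrow> z + w \<in> l2_carrier"
proof (rule l2_memI[where C = "2 * (\<Sum>\<^sub>\<infinity>i. (nm (z i))\<^sup>2) + 2 * (\<Sum>\<^sub>\<infinity>i. (nm (w i))\<^sup>2)"])
  assume z: "z \<in> l2_carrier" and w: "w \<in> l2_carrier"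
  show "(z + w) i \<in> V" for i using l2_V[OF z] l2_V[OF w] by (simp add: V_add)
  fix F :: "'i set" assume F: "finite F"
  have "(nm ((z + w) i))\<^sup>2 \<le> 2 * (nm (z i))\<^sup>2 + 2 * (nm (w i))\<^sup>2" for i
    using parallelogram[OF l2_V[OF z] l2_V[OF w], of i i] zero_le_power2[of "nm (z i - w i)"]
    unfolding plus_fun_apply by linarith
  then have "(\<Sum>i\<in>F. (nm ((z + w) i))\<^sup>2) \<le> (\<Sum>i\<in>F. 2 * (nm (z i))\<^sup>2 + 2 * (nm (w i))\<^sup>2)"
    by (rule sum_mono)
  also have "\<dots> = 2 * (\<Sum>i\<in>F. (nm (z i))\<^sup>2) + 2 * (\<Sum>i\<in>F. (nm (w i))\<^sup>2)"
    by (simp add: sum.distrib sum_distrib_left)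
  also have "\<dots> \<le> 2 * (\<Sum>\<^sub>\<infinity>i. (nm (z i))\<^sup>2) + 2 * (\<Sum>\<^sub>\<infinity>i. (nm (w i))\<^sup>2)"
    using l2_finite_sum_le[OF z F] l2_finite_sum_le[OF w F] by simp
  finally show "(\<Sum>i\<in>F. (nm ((z + w) i))\<^sup>2) \<le> 2 * (\<Sum>\<^sub>\<infinity>i. (nm (z i))\<^sup>2) + 2 * (\<Sum>\<^sub>\<infinity>i. (nm (w i))\<^sup>2)" .
qed

lemma l2_scale: "z \<in> l2_carrier \<Longrightarrow> c *\<^sub>C z \<in> l2_carrier"
  unfolding l2_carrier_def
  by (auto simp: scaleC_fun_def V_scale nm_scale power_mult_distrib intro: summable_on_cmult_right)

lemma l2_zero: "0 \<in> l2_carrier"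
  by (rule l2_memI[of _ 0]) (auto simp: V_zero nm_zero)

lemma l2_ip_self: "z \<in> l2_carrier \<Longrightarrow> l2_ip z z = complex_of_real (\<Sum>\<^sub>\<infinity>i. (nm (z i))\<^sup>2)"
  using has_sum_of_real[OF has_sum_infsum[OF l2_summable], of z, where ?'a = complex]
  by (simp add: l2_ip_def ip_self[OF l2_V] infsumI)

lemma l2_hnorm: "z \<in> l2_carrier \<Longrightarrow> hnorm l2_hilbert z = sqrt (\<Sum>\<^sub>\<infinity>i. (nm (z i))\<^sup>2)"
  by (simp add: hnorm_def l2_hilbert_def l2_ip_self)

lemma l2_hnorm_square: "z \<in> l2_carrier \<Longrightarrow> (hnorm l2_hilbert z)\<^sup>2 = (\<Sum>\<^sub>\<infinity>i. (nm (z i))\<^sup>2)"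
  by (simp add: l2_hnorm infsum_nonneg)

lemma l2_diff: "z \<in> l2_carrier \<Longrightarrow> w \<in> l2_carrier \<Longrightarrow> z - w \<in> l2_carrier"
  using l2_add[of z "(- 1) *\<^sub>C w"] l2_scale[of w "- 1"] by (simp add: scaleC_simps)

lemma l2_entry_le: "z \<in> l2_carrier \<Longrightarrow> nm (z i) \<le> hnorm l2_hilbert z"
proof -
  assume z: "z \<in> l2_carrier"
  have "(nm (z i))\<^sup>2 \<le> (hnorm l2_hilbert z)\<^sup>2"
    using l2_finite_sum_le[OF z, of "{i}"] by (simp add: l2_hnorm_square z)
  then show ?thesis by (rule power2_le_imp_le) (simp add: l2_hnorm z infsum_nonneg)
qed

lemma l2_complete:
  fixes X :: "nat \<Rightarrow> 'i \<Rightarrow> 'v"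
  assumes X: "\<And>n. X n \<in> l2_carrier"
    and cauchy: "\<And>e. e > 0 \<Longrightarrow> \<exists>M. \<forall>m\<ge>M. \<forall>n\<ge>M. hnorm l2_hilbert (X m - X n) < e"
  shows "\<exists>z\<in>l2_carrier. (\<lambda>n. hnorm l2_hilbert (X n - z)) \<longlonglongrightarrow> 0"
proof -
  have "\<exists>v\<in>V. (\<lambda>n. nm (X n i - v)) \<longlonglongrightarrow> 0" for i
  proof -
    have "\<exists>M. \<forall>m\<ge>M. \<forall>n\<ge>M. nm (X m i - X n i) < e" if "e > 0" for e
    proof -
      from cauchy[OF that] obtain M where M: "\<forall>m\<ge>M. \<forall>n\<ge>M. hnorm l2_hilbert (X m - X n) < e"
        by blast
      have "nm (X m i - X n i) < e" if "m \<ge> M" "n \<ge> M" for m n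
        using l2_entry_le[OF l2_diff[OF X X], of m n i] M that by fastforce
      then show ?thesis by blast
    qed
    then show ?thesis using V_complete[of "\<lambda>n. X n i"] l2_V[OF X] by metis
  qed
  then obtain z where zV: "\<And>i. z i \<in> V" and lim: "\<And>i. (\<lambda>n. nm (X n i - z i)) \<longlonglongrightarrow> 0" by metis
  have key: "X m - z \<in> l2_carrier \<and> hnorm l2_hilbert (X m - z) \<le> e"
    if e: "e > 0" and M: "\<forall>n\<ge>M. hnorm l2_hilbert (X m - X n) < e" for e M m
  proof -
    have bound: "(\<Sum>i\<in>F. (nm ((X m - z) i))\<^sup>2) \<le> e\<^sup>2" if F: "finite F" for F
    proof (rule LIMSEQ_le_const2)
      have "(\<lambda>n. nm (X m i - X n i)) \<longlonglongrightarrow> nm (X m i - z i)" for i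
      proof (rule LIM_zero_cancel, rule Lim_null_comparison[OF _ lim[of i]], rule always_eventually, rule allI)
        fix n
        have V: "X m i \<in> V" "X n i \<in> V" "z i \<in> V" using l2_V[OF X] zV by auto
        have "nm (X m i - X n i) \<le> nm (X m i - z i) + nm (z i - X n i)"
          "nm (X m i - z i) \<le> nm (X m i - X n i) + nm (X n i - z i)"
          using V by (auto intro: nm_triangle3)
        then show "norm (nm (X m i - X n i) - nm (X m i - z i)) \<le> nm (X n i - z i)"
          using nm_diff_commute[OF V(2,3)] by simp
      qed
      then show "(\<lambda>n. \<Sum>i\<in>F. (nm (X m i - X n i))\<^sup>2) \<longlonglongrightarrow> (\<Sum>i\<in>F. (nm ((X m - z) i))\<^sup>2)"
        by (auto intro!: tendsto_sum tendsto_power)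
      have "(\<Sum>i\<in>F. (nm (X m i - X n i))\<^sup>2) \<le> e\<^sup>2" if "n \<ge> M" for n
      proof -
        have d: "X m - X n \<in> l2_carrier" by (intro l2_diff X)
        have "(\<Sum>i\<in>F. (nm (X m i - X n i))\<^sup>2) \<le> (hnorm l2_hilbert (X m - X n))\<^sup>2"
          using l2_finite_sum_le[OF d F] by (simp add: l2_hnorm_square d)
        also have "\<dots> \<le> e\<^sup>2"
        proof (rule power_mono)
          show "hnorm l2_hilbert (X m - X n) \<le> e" using M that by (simp add: less_imp_le)
        qed (simp add: l2_hnorm d infsum_nonneg)
        finally show ?thesis .
      qed
      then show "\<exists>N. \<forall>n\<ge>N. (\<Sum>i\<in>F. (nm (X m i - X n i))\<^sup>2) \<le> e\<^sup>2" by blast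
    qed
    have mem: "X m - z \<in> l2_carrier"
      by (rule l2_memI[OF _ bound]) (auto intro: V_diff l2_V[OF X] zV)
    have "(\<Sum>\<^sub>\<infinity>i. (nm ((X m - z) i))\<^sup>2) \<le> e\<^sup>2"
      by (rule infsum_le_finite_sums[OF l2_summable[OF mem]]) (use bound in auto)
    then have "hnorm l2_hilbert (X m - z) \<le> e"
      using e by (simp add: l2_hnorm[OF mem] real_le_lsqrt infsum_nonneg)
    then show ?thesis using mem by blast
  qed
  obtain M0 where "\<forall>n\<ge>M0. hnorm l2_hilbert (X M0 - X n) < 1" using cauchy[of 1] by auto
  then have "X M0 - z \<in> l2_carrier" using key[of 1 M0 M0] by simp
  from l2_diff[OF X this, of M0] have z: "z \<in> l2_carrier" by (simp add: fun_eq_iff fun_diff_def)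
  have "(\<lambda>n. hnorm l2_hilbert (X n - z)) \<longlonglongrightarrow> 0"
  proof (rule LIMSEQ_I)
    fix e :: real assume e: "0 < e"
    then obtain M where M: "\<forall>m\<ge>M. \<forall>n\<ge>M. hnorm l2_hilbert (X m - X n) < e / 2"
      using cauchy[of "e / 2"] by auto
    have "norm (hnorm l2_hilbert (X m - z) - 0) < e" if "m \<ge> M" for m
    proof -
      have "\<forall>n\<ge>M. hnorm l2_hilbert (X m - X n) < e / 2" using M that by blast
      then have "hnorm l2_hilbert (X m - z) \<le> e / 2" using key[of "e / 2" M m] e by simp
      moreover have "0 \<le> hnorm l2_hilbert (X m - z)" using l2_diff[OF X z] by (simp add: l2_hnorm infsum_nonneg)
      ultimately show ?thesis using e by simp
    qed
    then show "\<exists>no. \<forall>n\<ge>no. norm (hnorm l2_hilbert (X n - z) - 0) < e" by blast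
  qed
  then show ?thesis using z by blast
qed

lemma vector_hilbert_l2: "vector_hilbert (l2_hilbert :: ('i \<Rightarrow> 'v) pre_hilbert)"
proof -
  have sel: "hcarrier l2_hilbert = (l2_carrier :: ('i \<Rightarrow> 'v) set)" "hzero l2_hilbert = (0 :: 'i \<Rightarrow> 'v)"
    "hadd l2_hilbert = ((+) :: ('i \<Rightarrow> 'v) \<Rightarrow> _)" "hscale l2_hilbert = (scaleC :: _ \<Rightarrow> ('i \<Rightarrow> 'v) \<Rightarrow> _)"
    "hinner l2_hilbert = (l2_ip :: ('i \<Rightarrow> 'v) \<Rightarrow> _)"
    by (simp_all add: l2_hilbert_def)
  have dist: "hdist l2_hilbert v w = hnorm l2_hilbert (v - w)" for v w :: "'i \<Rightarrow> 'v"
    by (simp add: hdist_def sel scaleC_simps)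
  show ?thesis
  proof (unfold_locales, unfold sel dist, goal_cases)
    case (12 u v w)
    have "l2_ip (u + v) w = (\<Sum>\<^sub>\<infinity>i. ip (u i) (w i) + ip (v i) (w i))"
      unfolding l2_ip_def using 12 by (simp add: ip_add l2_V)
    then show ?case using 12 by (simp add: l2_ip_def infsum_add l2_ip_summable)
  next
    case (13 v w c)
    have "l2_ip (c *\<^sub>C v) w = (\<Sum>\<^sub>\<infinity>i. c * ip (v i) (w i))"
      unfolding l2_ip_def using 13 by (simp add: ip_scale l2_V scaleC_fun_def)
    then show ?case using 13 by (simp add: l2_ip_def infsum_cmult_right l2_ip_summable)
  next
    case (14 v w)
    then show ?case
      unfolding l2_ip_def infsum_cnj[symmetric] by (simp add: ip_cnj l2_V)
  next
    case (15 v)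
    then obtain i where i: "v i \<noteq> 0" by (auto simp: fun_eq_iff)
    have "0 < (nm (v i))\<^sup>2" using i nm_eq_0[OF l2_V[OF 15(1)], of i] by simp
    also have "\<dots> \<le> (\<Sum>\<^sub>\<infinity>i. (nm (v i))\<^sup>2)" using l2_finite_sum_le[of v "{i}"] 15 by simp
    finally show ?case using 15 by (simp add: l2_ip_self)
  next
    case (16 X)
    then show ?case using l2_complete[of X] by blast
  qed (auto simp: l2_zero l2_add l2_scale scaleC_simps add.assoc add.commute)
qed

end

context irreducible_vector_representation
begin

definition rep_l2 :: "'d \<Rightarrow> ('i \<Rightarrow> 'v) \<Rightarrow> 'i \<Rightarrow> 'v" where
  "rep_l2 t z = (\<lambda>i. \<pi> t (z i))"

lemma rep_l2_closed:
  fixes z :: "'i \<Rightarrow> 'v"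
  assumes z: "z \<in> l2_carrier"
  shows "rep_l2 t z \<in> l2_carrier"
proof (rule l2_memI[where C = "(norm t)\<^sup>2 * (\<Sum>\<^sub>\<infinity>i. (nm (z i))\<^sup>2)"])
  show "rep_l2 t z i \<in> V" for i by (simp add: rep_l2_def rep_V l2_V z)
  fix F :: "'i set" assume F: "finite F"
  have "(nm (rep_l2 t z i))\<^sup>2 \<le> (norm t)\<^sup>2 * (nm (z i))\<^sup>2" for i
    using power_mono[OF rep_contractive[OF l2_V[OF z], of t i] nm_nonneg[OF rep_V[OF l2_V[OF z]]], of 2]
    by (simp add: rep_l2_def power_mult_distrib)
  then have "(\<Sum>i\<in>F. (nm (rep_l2 t z i))\<^sup>2) \<le> (norm t)\<^sup>2 * (\<Sum>i\<in>F. (nm (z i))\<^sup>2)"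
    unfolding sum_distrib_left by (rule sum_mono)
  also have "\<dots> \<le> (norm t)\<^sup>2 * (\<Sum>\<^sub>\<infinity>i. (nm (z i))\<^sup>2)"
    by (intro mult_left_mono l2_finite_sum_le z F) auto
  finally show "(\<Sum>i\<in>F. (nm (rep_l2 t z i))\<^sup>2) \<le> (norm t)\<^sup>2 * (\<Sum>\<^sub>\<infinity>i. (nm (z i))\<^sup>2)" .
qed

lemma rep_l2_adjoint:
  "z \<in> l2_carrier \<Longrightarrow> w \<in> l2_carrier \<Longrightarrow> l2_ip (rep_l2 t z) w = l2_ip z (rep_l2 (star t) w)"
  by (simp add: l2_ip_def rep_l2_def rep_adjoint l2_V)

text \<open>The families \<open>z\<close> for which \<open>w\<close> is orthogonal to \<open>z\<close> and to all \<open>\<pi>(t) z\<close> form a closed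
  invariant subspace \<open>K\<close> of the Hilbert sum, and \<open>v\<close> lies in it. The projection \<open>q\<close> onto \<open>K\<close>
  commutes with the representation, so by Schur's lemma its matrix entries are scalars \<open>\<gamma> i j\<close>.
  Therefore \<open>q\<close> also commutes with every operator applied in each coordinate, in particular with
  \<open>y \<mapsto> \<langle>y, h\<rangle> k\<close>: with \<open>v\<close> also \<open>(\<langle>v\<^sub>i, h\<rangle> k)\<close> lies in \<open>K\<close> and is orthogonal to \<open>w\<close>.\<close>

theorem rank_one_density:
  fixes v w :: "'i \<Rightarrow> 'v"
  assumes v: "v \<in> l2_carrier" and w: "w \<in> l2_carrier"
    and orth0: "l2_ip v w = 0" and orth: "\<And>t. l2_ip (rep_l2 t v) w = 0"
    and h: "h \<in> V" and k: "k \<in> V"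
  shows "(\<Sum>\<^sub>\<infinity>i. ip (v i) h * ip k (w i)) = 0"
proof -
  interpret L: vector_hilbert "l2_hilbert :: ('i \<Rightarrow> 'v) pre_hilbert" by (rule vector_hilbert_l2)
  have sel [simp]: "hcarrier l2_hilbert = (l2_carrier :: ('i \<Rightarrow> 'v) set)"
    "hinner l2_hilbert = (l2_ip :: ('i \<Rightarrow> 'v) \<Rightarrow> _)"
    by (simp_all add: l2_hilbert_def)
  note LV = L.V_closed[unfolded sel] and Lip = L.ip_simps[unfolded sel]
  define K where "K = {z \<in> l2_carrier. l2_ip z w = 0 \<and> (\<forall>t. l2_ip (rep_l2 t z) w = 0)}"
  have K: "L.clsub K"
    unfolding L.clsub_def sel
  proof (intro conjI allI ballI impI)
    show "0 \<in> K" by (auto simp: K_def LV Lip w rep_l2_adjoint rep_l2_closed)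
    fix x y assume "x \<in> K" "y \<in> K"
    then show "x + y \<in> K" by (auto simp: K_def LV Lip w rep_l2_adjoint rep_l2_closed)
  next
    fix c x assume "x \<in> K"
    then show "c *\<^sub>C x \<in> K" by (auto simp: K_def LV Lip w rep_l2_adjoint rep_l2_closed)
  next
    fix X :: "nat \<Rightarrow> 'i \<Rightarrow> 'v" and x
    assume *: "(\<forall>n. X n \<in> K) \<and> x \<in> l2_carrier \<and> (\<lambda>n. L.nm (X n - x)) \<longlonglongrightarrow> 0"
    have X: "X n \<in> l2_carrier" for n using * by (auto simp: K_def)
    have lim: "(\<lambda>n. l2_ip (X n) u) \<longlonglongrightarrow> l2_ip x u" if "u \<in> l2_carrier" for u
      using L.ip_limit[of X x u] X * that by simp
    have "l2_ip x u = 0" if u: "u \<in> l2_carrier" "\<And>n. l2_ip (X n) u = 0" for u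
      using lim[OF u(1)] u(2) by (simp add: LIMSEQ_const_iff)
    then show "x \<in> K"
      using * w X by (auto simp: K_def rep_l2_adjoint rep_l2_closed)
  qed (auto simp: K_def)
  have KL: "z \<in> l2_carrier" if "z \<in> K" for z using that by (simp add: K_def)
  have Kinv: "rep_l2 t z \<in> K" if "z \<in> K" for t z
  proof -
    have "rep_l2 s (rep_l2 t z) = rep_l2 (s * t) z" for s
      using KL[OF that] by (simp add: rep_l2_def rep_mult l2_V)
    then show ?thesis using that by (auto simp: K_def rep_l2_closed)
  qed
  have "\<exists>m. m \<in> K \<and> (\<forall>x\<in>K. l2_ip (z - m) x = 0)" if "z \<in> l2_carrier" for z
    by (rule L.projection_exists[OF K, of z]) (use that in auto)
  then obtain q where q: "\<And>z. z \<in> l2_carrier \<Longrightarrow> q z \<in> K"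
    and qo: "\<And>z x. z \<in> l2_carrier \<Longrightarrow> x \<in> K \<Longrightarrow> l2_ip (z - q z) x = 0" by metis
  have qL: "q z \<in> l2_carrier" if "z \<in> l2_carrier" for z using KL q that by blast
  have q_uniq: "q z = m" if z: "z \<in> l2_carrier" and m: "m \<in> K" "\<And>x. x \<in> K \<Longrightarrow> l2_ip (z - m) x = 0" for z m
  proof -
    have d: "q z - m \<in> K" using L.clsubD(5)[OF K q[OF z] m(1)] .
    have "l2_ip (q z - m) (q z - m) = l2_ip (z - m) (q z - m) - l2_ip (z - q z) (q z - m)"
      using z m(1) KL qL d by (simp add: Lip LV)
    then have "l2_ip (q z - m) (q z - m) = 0" using m(2)[OF d] qo[OF z d] by simp
    then have "q z - m = 0" using L.ip_self_eq_0[of "q z - m"] KL[OF d] by simp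
    then show ?thesis by simp
  qed
  have q_add: "q (x + y) = q x + q y" if x: "x \<in> l2_carrier" and y: "y \<in> l2_carrier" for x y
  proof (rule q_uniq[OF LV(2)[OF x y] L.clsubD(3)[OF K q[OF x] q[OF y]]])
    fix u assume u: "u \<in> K"
    have "x + y - (q x + q y) = (x - q x) + (y - q y)" by simp
    then show "l2_ip (x + y - (q x + q y)) u = 0"
      using qo[OF x u] qo[OF y u] x y KL[OF u] by (simp only: Lip LV qL) simp
  qed
  have q_scale: "q (c *\<^sub>C x) = c *\<^sub>C q x" if x: "x \<in> l2_carrier" for c x
  proof (rule q_uniq[OF LV(3)[OF x] L.clsubD(4)[OF K q[OF x]]])
    fix u assume u: "u \<in> K"
    have "c *\<^sub>C x - c *\<^sub>C q x = c *\<^sub>C (x - q x)" by (simp add: scaleC_simps)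
    then show "l2_ip (c *\<^sub>C x - c *\<^sub>C q x) u = 0"
      using qo[OF x u] x KL[OF u] by (simp only: Lip LV qL) simp
  qed
  have q_rep: "q (rep_l2 t x) = rep_l2 t (q x)" if x: "x \<in> l2_carrier" for t x
  proof (rule q_uniq[OF rep_l2_closed[OF x] Kinv[OF q[OF x]]])
    fix u assume u: "u \<in> K"
    have "rep_l2 t x - rep_l2 t (q x) = rep_l2 t (x - q x)"
      using x qL[OF x] by (simp add: rep_l2_def fun_eq_iff rep_vector_diff l2_V)
    then have "l2_ip (rep_l2 t x - rep_l2 t (q x)) u = l2_ip (x - q x) (rep_l2 (star t) u)"
      using x qL[OF x] KL[OF u] by (simp add: rep_l2_adjoint LV)
    then show "l2_ip (rep_l2 t x - rep_l2 t (q x)) u = 0" using qo[OF x Kinv[OF u]] by simp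
  qed
  have q_sa: "l2_ip (q x) y = l2_ip x (q y)" if x: "x \<in> l2_carrier" and y: "y \<in> l2_carrier" for x y
  proof -
    have "l2_ip (x - q x) (q y) = 0" by (rule qo[OF x q[OF y]])
    then have 1: "l2_ip x (q y) = l2_ip (q x) (q y)" using x y by (simp add: Lip qL)
    have "l2_ip (y - q y) (q x) = 0" by (rule qo[OF y q[OF x]])
    then have "cnj (l2_ip (q x) (y - q y)) = 0" using L.ip_cnj[of "q x" "y - q y"] x y by (simp add: qL LV)
    then have 2: "l2_ip (q x) y = l2_ip (q x) (q y)" using x y by (simp add: Lip qL)
    show ?thesis using 1 2 by simp
  qed
  have q_fix: "q z = z" if z: "z \<in> K" for z
    by (rule q_uniq[OF KL[OF z] z]) (use KL in \<open>simp add: Lip\<close>)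
  have q_contr: "L.nm (q x) \<le> L.nm x" if x: "x \<in> l2_carrier" for x
  proof -
    have "(L.nm (q x))\<^sup>2 = Re (l2_ip (q x) (q x))" using L.nm_square[of "q x"] qL[OF x] by simp
    also have "l2_ip (q x) (q x) = l2_ip x (q x)" using q_sa[OF x qL[OF x]] q_fix[OF q[OF x]] by simp
    also have "Re (l2_ip x (q x)) \<le> L.nm x * L.nm (q x)"
      using L.CS[of x "q x"] complex_Re_le_cmod[of "l2_ip x (q x)"] x qL[OF x] by simp
    finally have "L.nm (q x) * L.nm (q x) \<le> L.nm x * L.nm (q x)" by (simp add: power2_eq_square)
    then show ?thesis
      using L.nm_nonneg[of "q x"] L.nm_nonneg[of x] qL[OF x] x by (cases "L.nm (q x) = 0") auto
  qed
  \<comment> \<open>\<open>e i x\<close> is the vector \<open>x\<close> placed in coordinate \<open>i\<close>, and \<open>T i j\<close> is a matrix entry of \<open>q\<close>.\<close>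
  define e where "e i x = (\<lambda>j. if j = i then x else (0 :: 'v))" for i :: 'i and x
  have e_sum: "(\<Sum>j\<in>F. (nm (e i x j))\<^sup>2) \<le> (nm x)\<^sup>2" if "finite F" for F i x
  proof -
    have "(\<Sum>j\<in>F. (nm (e i x j))\<^sup>2) = (\<Sum>j\<in>F. if j = i then (nm x)\<^sup>2 else 0)"
      by (rule sum.cong) (auto simp: e_def nm_zero)
    then show ?thesis using that by simp
  qed
  have eL: "e i x \<in> l2_carrier" if "x \<in> V" for i x
    by (rule l2_memI[OF _ e_sum]) (auto simp: e_def that V_zero)
  have e_ip: "l2_ip z (e i x) = ip (z i) x" if z: "z \<in> l2_carrier" and "x \<in> V" for z i x
  proof -
    have "l2_ip z (e i x) = (\<Sum>\<^sub>\<infinity>j\<in>{i}. ip (z j) (e i x j))"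
      unfolding l2_ip_def by (rule infsum_cong_neutral) (auto simp: e_def ip_zero l2_V[OF z])
    then show ?thesis by (simp add: e_def)
  qed
  have e_nm: "L.nm (e i x) \<le> nm x" if x: "x \<in> V" for i x
  proof -
    have "(L.nm (e i x))\<^sup>2 \<le> (nm x)\<^sup>2"
      unfolding l2_hnorm_square[OF eL[OF x]]
      by (rule infsum_le_finite_sums[OF l2_summable[OF eL[OF x]]]) (use e_sum in auto)
    then show ?thesis by (rule power2_le_imp_le) (rule nm_nonneg[OF x])
  qed
  define T where "T i j x = q (e i x) j" for i j x
  have T: "intertwiner (T i j) 1" for i j
    unfolding intertwiner_def
  proof (intro conjI allI ballI)
    fix x y assume x: "x \<in> V" and y: "y \<in> V"
    have "e i (x + y) = e i x + e i y" by (auto simp: e_def fun_eq_iff)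
    then show "T i j (x + y) = T i j x + T i j y" by (simp add: T_def q_add eL x y)
  next
    fix c x assume x: "x \<in> V"
    have "e i (c *\<^sub>C x) = c *\<^sub>C e i x" by (auto simp: e_def fun_eq_iff scaleC_fun_def)
    then have "q (e i (c *\<^sub>C x)) = c *\<^sub>C q (e i x)" by (simp only: q_scale eL x)
    then show "T i j (c *\<^sub>C x) = c *\<^sub>C T i j x" by (simp add: T_def scaleC_fun_def)
  next
    fix x assume x: "x \<in> V"
    show "nm (T i j x) \<le> 1 * nm x"
      using l2_entry_le[OF qL[OF eL[OF x]], of i j] q_contr[OF eL[OF x], of i] e_nm[OF x, of i]
      by (simp add: T_def)
  next
    fix a :: 'd and x assume x: "x \<in> V"
    have "e i (\<pi> a x) = rep_l2 a (e i x)" by (auto simp: e_def rep_l2_def fun_eq_iff rep_vector_zero)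
    then show "T i j (\<pi> a x) = \<pi> a (T i j x)"
      by (simp add: T_def q_rep eL x) (simp add: rep_l2_def)
  qed (auto simp: T_def l2_V qL eL)
  have Tadj: "ip (T i j x) y = ip x (T j i y)" if x: "x \<in> V" and y: "y \<in> V" for i j x y
  proof -
    have "ip (T i j x) y = l2_ip (q (e i x)) (e j y)" by (simp add: T_def e_ip qL eL x y)
    also have "\<dots> = l2_ip (e i x) (q (e j y))" by (rule q_sa[OF eL[OF x] eL[OF y]])
    also have "\<dots> = cnj (l2_ip (q (e j y)) (e i x))"
      using L.ip_cnj[of "q (e j y)" "e i x"] by (simp add: qL eL x y)
    also have "\<dots> = ip x (T j i y)"
      using x y l2_V[OF qL[OF eL[OF y]]] by (simp add: e_ip qL eL ip_cnj T_def)
    finally show ?thesis .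
  qed
  have "\<exists>c. \<forall>x\<in>V. T i j x = c *\<^sub>C x" for i j by (rule schur[OF T T Tadj])
  then obtain \<gamma> where \<gamma>: "\<And>i j x. x \<in> V \<Longrightarrow> T i j x = \<gamma> i j *\<^sub>C x" by metis
  have q_e: "q (e i x) = (\<lambda>j. \<gamma> i j *\<^sub>C x)" if "x \<in> V" for i x
    using \<gamma>[OF that, of i] by (simp add: T_def fun_eq_iff)
  have vK: "v \<in> K" using v orth0 orth by (simp add: K_def)
  \<comment> \<open>The identity \<open>q v = v\<close>, paired with \<open>h\<close> in each coordinate.\<close>
  have b_eq: "ip (v j) h = (\<Sum>\<^sub>\<infinity>i. cnj (\<gamma> j i) * ip (v i) h)" for j
  proof -
    have "ip (v j) h = l2_ip (q v) (e j h)" by (simp add: q_fix[OF vK] e_ip v h)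
    also have "\<dots> = l2_ip v (q (e j h))" by (rule q_sa[OF v eL[OF h]])
    also have "\<dots> = (\<Sum>\<^sub>\<infinity>i. cnj (\<gamma> j i) * ip (v i) h)"
      unfolding q_e[OF h] by (simp add: l2_ip_def ip_scale l2_V[OF v] h)
    finally show ?thesis .
  qed
  define z where "z = (\<lambda>i. ip (v i) h *\<^sub>C k)"
  have zL: "z \<in> l2_carrier"
  proof (rule l2_memI[where C = "((nm h)\<^sup>2 * (nm k)\<^sup>2) * (\<Sum>\<^sub>\<infinity>i. (nm (v i))\<^sup>2)"])
    show "z i \<in> V" for i by (simp add: z_def V_scale k)
    fix F :: "'i set" assume F: "finite F"
    have "(nm (z i))\<^sup>2 \<le> ((nm h)\<^sup>2 * (nm k)\<^sup>2) * (nm (v i))\<^sup>2" for i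
    proof -
      have "nm (z i) \<le> (nm (v i) * nm h) * nm k"
        unfolding z_def nm_scale[OF k] by (intro mult_right_mono CS l2_V v h nm_nonneg k)
      from power_mono[OF this, of 2] show ?thesis
        using k by (simp add: z_def nm_nonneg V_scale power_mult_distrib mult_ac)
    qed
    then have "(\<Sum>i\<in>F. (nm (z i))\<^sup>2) \<le> ((nm h)\<^sup>2 * (nm k)\<^sup>2) * (\<Sum>i\<in>F. (nm (v i))\<^sup>2)"
      unfolding sum_distrib_left by (rule sum_mono)
    also have "\<dots> \<le> ((nm h)\<^sup>2 * (nm k)\<^sup>2) * (\<Sum>\<^sub>\<infinity>i. (nm (v i))\<^sup>2)"
      by (intro mult_left_mono l2_finite_sum_le v F) auto
    finally show "(\<Sum>i\<in>F. (nm (z i))\<^sup>2) \<le> ((nm h)\<^sup>2 * (nm k)\<^sup>2) * (\<Sum>\<^sub>\<infinity>i. (nm (v i))\<^sup>2)" .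
  qed
  have "q z j = z j" for j
  proof (rule V_eqI)
    fix u assume u: "u \<in> V"
    have "ip (q z j) u = l2_ip z (q (e j u))" by (simp add: e_ip[symmetric] qL zL u q_sa eL)
    also have "\<dots> = (\<Sum>\<^sub>\<infinity>i. (cnj (\<gamma> j i) * ip (v i) h) * ip k u)"
      unfolding q_e[OF u] by (simp add: l2_ip_def z_def ip_scale V_scale k u mult_ac)
    also have "\<dots> = ip (v j) h * ip k u"
      unfolding infsum_cmult_left' b_eq[symmetric] ..
    finally show "ip (q z j) u = ip (z j) u" by (simp add: z_def ip_scale k u)
  qed (auto simp: l2_V qL zL)
  then have "q z = z" by (simp add: fun_eq_iff)
  then have "z \<in> K" using q[OF zL] by simp
  then have "l2_ip z w = 0" by (simp add: K_def)
  then show ?thesis by (simp add: l2_ip_def z_def ip_scale k l2_V[OF w])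
qed

end

section \<open>Pure states\<close>

text \<open>The roots of the positive and the negative part are computed in the unitization; they lie
  in the algebra because their squares have scalar part zero.\<close>

lemma self_adjoint_Jordan:
  fixes x :: "'a::cstar_algebra"
  assumes x: "star x = x"
  obtains s s' where "star s = s" "star s' = s'" "x = s * s - s' * s'"
    "(s * s + s' * s') * (s * s + s' * s') = x * x"
proof -
  define X where "X = into_unitization x"
  have sX: "star X = X" by (simp add: X_def into_unitization_simps(8)[symmetric] x)
  obtain K where K: "star K = K" "K * K = X * X" "K \<in> bicommutant X" "posit K"
    using abs_exists[OF sX] by metis
  have "bicommutant (- X) = bicommutant X" by (simp add: bicommutant_def)
  then have "posit (K + X)" "posit (K + - X)"
    using pos_part_posit[OF sX K] pos_part_posit[of "- X" K] K sX by (auto simp: star_minus)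
  then have "posit ((1 / 2) *\<^sub>R (K + X))" "posit ((1 / 2) *\<^sub>R (K + - X))"
    by (auto intro: posit_scaleR)
  then obtain S S' where S: "star S = S" "S * S = (1 / 2) *\<^sub>R (K + X)"
    and S': "star S' = S'" "S' * S' = (1 / 2) *\<^sub>R (K + - X)"
    unfolding posit_def by metis
  have "scal_part (K * K) = 0" by (simp add: K X_def del: unitization_sel(13,14)) (simp add: X_def)
  then have K0: "scal_part K = 0" by simp
  have "scal_part (S * S) = 0" "scal_part (S' * S') = 0"
    unfolding S S' by (simp_all add: K0 X_def)
  then have S0: "scal_part S = 0" "scal_part S' = 0" by simp_all
  define s s' where "s = alg_part S" and "s' = alg_part S'"
  have i: "into_unitization s = S" "into_unitization s' = S'"
    by (simp_all add: s_def s'_def into_unitization_alg_part S0)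
  have sum: "S * S + S' * S' = K" "S * S - S' * S' = X"
    unfolding S S' by (simp_all add: scaleR_add_right[symmetric] scaleR_diff_right[symmetric])
  show ?thesis
  proof (rule that[of s s'])
    show "star s = s" "star s' = s'" using S S' by (simp_all add: s_def s'_def unitization_star_sel(3)[symmetric] del: unitization_star_sel)
    have "into_unitization (s * s - s' * s') = into_unitization x"
      by (simp add: into_unitization_simps i sum X_def)
    then show "x = s * s - s' * s'" by simp
    have "into_unitization ((s * s + s' * s') * (s * s + s' * s')) = into_unitization (x * x)"
      unfolding into_unitization_simps i sum K(2) X_def ..
    then show "(s * s + s' * s') * (s * s + s' * s') = x * x" by simp
  qed
qed

lemma compact_pointwise_bounded:
  fixes r :: "'a \<Rightarrow> real"
  shows "compact {f :: 'a \<Rightarrow> complex. \<forall>x. cmod (f x) \<le> r x}"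
proof -
  have "compactin (product_topology (\<lambda>_. euclidean) UNIV) (PiE UNIV (\<lambda>x. cball (0::complex) (r x)))"
    unfolding compactin_PiE by simp
  then have "compact (PiE UNIV (\<lambda>x. cball (0::complex) (r x)))"
    by (simp add: euclidean_product_topology)
  moreover have "PiE UNIV (\<lambda>x. cball (0::complex) (r x)) = {f. \<forall>x. cmod (f x) \<le> r x}"
    by (auto simp: PiE_def Pi_def)
  ultimately show ?thesis by simp
qed

lemma continuous_on_evaluation: "continuous_on S (\<lambda>f :: 'a \<Rightarrow> complex. f x)"
  by (rule continuous_on_subset[OF continuous_on_product_coordinates]) simp

text \<open>Closed faces of \<open>S\<close> for pointwise convergence of functions; they contain every segment in
  \<open>S\<close> one of whose inner points they contain.\<close>

definition face :: "('a \<Rightarrow> complex) set \<Rightarrow> ('a \<Rightarrow> complex) set \<Rightarrow> bool" where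
  "face S F \<longleftrightarrow> F \<subseteq> S \<and> closed F \<and> F \<noteq> {} \<and>
     (\<forall>f\<in>F. \<forall>f1\<in>S. \<forall>f2\<in>S. \<forall>t. 0 < t \<and> t < 1 \<and>
        (\<forall>x. f x = complex_of_real t * f1 x + complex_of_real (1 - t) * f2 x) \<longrightarrow> f1 \<in> F \<and> f2 \<in> F)"

lemma faceD:
  assumes "face S F"
  shows "F \<subseteq> S" "closed F" "F \<noteq> {}"
    "\<lbrakk>f \<in> F; f1 \<in> S; f2 \<in> S; 0 < t; t < 1;
      \<And>x. f x = complex_of_real t * f1 x + complex_of_real (1 - t) * f2 x\<rbrakk> \<Longrightarrow> f1 \<in> F \<and> f2 \<in> F"
proof -
  note * = assms[unfolded face_def]
  show "F \<subseteq> S" "closed F" "F \<noteq> {}" using * by auto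
  assume "f \<in> F" "f1 \<in> S" "f2 \<in> S" "0 < t" "t < 1"
    "\<And>x. f x = complex_of_real t * f1 x + complex_of_real (1 - t) * f2 x"
  with *[THEN conjunct2, THEN conjunct2, THEN conjunct2, rule_format, of f f1 f2 t]
  show "f1 \<in> F \<and> f2 \<in> F" by blast
qed

text \<open>If a maximiser is a proper convex combination of two functions in \<open>F\<close>, neither value at
  \<open>x\<close> can be smaller, as neither is larger.\<close>

lemma face_maximizers:
  assumes S: "compact S" and F: "face S F"
  shows "face S {f \<in> F. \<forall>g\<in>F. Re (c * g x) \<le> Re (c * f x)}" (is "face S ?F")
proof -
  have FS: "F \<subseteq> S" and clF: "closed F" and ne: "F \<noteq> {}" using F by (auto simp: face_def)
  have "S \<inter> F = F" using FS by blast
  then have "compact F" using compact_Int_closed[OF S clF] by simp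
  have cont: "continuous_on T (\<lambda>f :: 'a \<Rightarrow> complex. Re (c * f x))" for T
    by (intro continuous_intros continuous_on_evaluation)
  obtain m where "m \<in> F" "\<forall>g\<in>F. Re (c * g x) \<le> Re (c * m x)"
    using continuous_attains_sup[OF \<open>compact F\<close> ne cont] by blast
  then have "?F \<noteq> {}" by blast
  moreover have "closed ?F"
  proof -
    have "?F = F \<inter> (\<Inter>g\<in>F. {f. Re (c * g x) \<le> Re (c * f x)})" by auto
    moreover have "closed {f. Re (c * g x) \<le> Re (c * f x)}" for g
      by (intro closed_Collect_le continuous_on_const cont)
    ultimately show ?thesis using clF by (simp add: closed_Int closed_INT)
  qed
  moreover have "f1 \<in> ?F \<and> f2 \<in> ?F"
    if f: "f \<in> ?F" and f12: "f1 \<in> S" "f2 \<in> S" and t: "0 < t" "t < 1"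
      and eq: "\<forall>x. f x = complex_of_real t * f1 x + complex_of_real (1 - t) * f2 x" for f f1 f2 t
  proof -
    have mem: "f1 \<in> F" "f2 \<in> F" using F f f12 t eq unfolding face_def by blast+
    then have le: "Re (c * f1 x) \<le> Re (c * f x)" "Re (c * f2 x) \<le> Re (c * f x)" using f by auto
    have "c * f x = complex_of_real t * (c * f1 x) + complex_of_real (1 - t) * (c * f2 x)"
      by (subst eq[rule_format, of x]) (simp add: algebra_simps)
    then have conv: "Re (c * f x) = t * Re (c * f1 x) + (1 - t) * Re (c * f2 x)" by simp
    have "t * (Re (c * f x) - Re (c * f1 x)) + (1 - t) * (Re (c * f x) - Re (c * f2 x)) = 0"
      using conv by (simp add: algebra_simps)
    moreover have "0 \<le> t * (Re (c * f x) - Re (c * f1 x))" "0 \<le> (1 - t) * (Re (c * f x) - Re (c * f2 x))"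
      using t le by auto
    ultimately have "t * (Re (c * f x) - Re (c * f1 x)) = 0" "(1 - t) * (Re (c * f x) - Re (c * f2 x)) = 0"
      by linarith+
    then have "Re (c * f1 x) = Re (c * f x)" "Re (c * f2 x) = Re (c * f x)" using t by auto
    then show ?thesis using mem f by auto
  qed
  ultimately show ?thesis using FS unfolding face_def by blast
qed

text \<open>The Krein-Milman argument, started with the face where \<open>f \<mapsto> Re (cnj (f0 a) * f a)\<close> is
  maximal so that the extreme point does not vanish at \<open>a\<close>. A minimal face is a single point,
  because evaluations separate points.\<close>

theorem extreme_point_exists:
  fixes S :: "('a \<Rightarrow> complex) set"
  assumes S: "compact S" and clS: "closed S" and f0: "f0 \<in> S" "f0 a \<noteq> 0"
  obtains e where "e \<in> S" "e a \<noteq> 0"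
    "\<And>f1 f2 t. f1 \<in> S \<Longrightarrow> f2 \<in> S \<Longrightarrow> 0 < t \<Longrightarrow> t < 1 \<Longrightarrow>
      (\<And>x. e x = complex_of_real t * f1 x + complex_of_real (1 - t) * f2 x) \<Longrightarrow> f1 = e \<and> f2 = e"
proof -
  define c where "c = cnj (f0 a)"
  define F0 where "F0 = {f \<in> S. \<forall>g\<in>S. Re (c * g a) \<le> Re (c * f a)}"
  have "face S S" using clS f0 by (auto simp: face_def)
  then have F0: "face S F0" unfolding F0_def by (rule face_maximizers[OF S])
  have F0_nz: "f a \<noteq> 0" if "f \<in> F0" for f
  proof -
    have "Re (c * f0 a) \<le> Re (c * f a)" using that f0 by (auto simp: F0_def)
    moreover have "Re (c * f0 a) = (cmod (f0 a))\<^sup>2"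
      unfolding c_def by (metis complex_norm_square mult.commute Re_complex_of_real)
    ultimately show ?thesis using f0 by auto
  qed
  \<comment> \<open>Complements turn minimal faces into maximal elements, as required by the lemma of Zorn.\<close>
  define \<A> where "\<A> = {- F | F. face S F \<and> F \<subseteq> F0}"
  have "\<exists>M\<in>\<A>. \<forall>X\<in>\<A>. M \<subseteq> X \<longrightarrow> X = M"
  proof (rule subset_Zorn_nonempty)
    show "\<A> \<noteq> {}" using F0 by (auto simp: \<A>_def)
    fix \<C> assume ne: "\<C> \<noteq> {}" and chain: "subset.chain \<A> \<C>"
    define \<F> where "\<F> = uminus ` \<C>"
    have faces: "face S F \<and> F \<subseteq> F0" if F: "F \<in> \<F>" for F
    proof -
      have "- F \<in> \<A>" using F chain by (auto simp: \<F>_def subset.chain_def)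
      then show ?thesis by (auto simp: \<A>_def)
    qed
    have comparable: "F \<subseteq> G \<or> G \<subseteq> F" if "F \<in> \<F>" "G \<in> \<F>" for F G
      using that chain unfolding \<F>_def subset.chain_def by auto
    have neF: "\<F> \<noteq> {}" using ne by (simp add: \<F>_def)
    have fin: "\<exists>T\<in>\<F>. T \<subseteq> \<Inter>\<G>" if "finite \<G>" "\<G> \<subseteq> \<F>" for \<G>
      using that
    proof (induction \<G> rule: finite_induct)
      case empty
      then show ?case using neF by auto
    next
      case (insert F \<G>)
      then obtain T where T: "T \<in> \<F>" "T \<subseteq> \<Inter>\<G>" by auto
      show ?case
        using comparable[of F T] insert.prems T by (metis Inter_insert Int_greatest insert_subset order_refl order_trans)
    qed
    have "S \<inter> \<Inter>\<F> \<noteq> {}"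
    proof (rule compact_imp_fip[OF S])
      show "closed F" if "F \<in> \<F>" for F using faces[OF that] by (simp add: face_def)
      fix \<G> assume "finite \<G>" "\<G> \<subseteq> \<F>"
      then obtain T where T: "T \<in> \<F>" "T \<subseteq> \<Inter>\<G>" using fin by blast
      then have "T \<noteq> {}" "T \<subseteq> S" using faces by (auto simp: face_def)
      then show "S \<inter> \<Inter>\<G> \<noteq> {}" using T by blast
    qed
    then have "face S (\<Inter>\<F>)"
      using faces neF unfolding face_def by (intro conjI closed_Inter) (blast+)
    moreover have "\<Inter>\<F> \<subseteq> F0" using faces neF by blast
    moreover have "\<Union>\<C> = - \<Inter>\<F>" by (auto simp: \<F>_def)
    ultimately show "\<Union>\<C> \<in> \<A>" by (auto simp: \<A>_def)
  qed
  then obtain M where M: "face S M" "M \<subseteq> F0" and max: "\<And>X. X \<in> \<A> \<Longrightarrow> - M \<subseteq> X \<Longrightarrow> X = - M"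
    by (auto simp: \<A>_def)
  have min: "G = M" if "face S G" "G \<subseteq> M" for G
  proof -
    have "- G \<in> \<A>" "- M \<subseteq> - G" using that M by (auto simp: \<A>_def)
    then have "- G = - M" by (rule max)
    then show ?thesis by simp
  qed
  obtain e where e: "e \<in> M" using faceD(3)[OF M(1)] by blast
  have single: "g = e" if g: "g \<in> M" for g
  proof (rule ccontr)
    assume "g \<noteq> e"
    then obtain x where x: "g x \<noteq> e x" by (auto simp: fun_eq_iff)
    define d where "d = cnj (g x - e x)"
    have "{f \<in> M. \<forall>g\<in>M. Re (d * g x) \<le> Re (d * f x)} = M"
      by (rule min[OF face_maximizers[OF S M(1)]]) blast
    then have "Re (d * g x) \<le> Re (d * e x)" using g e by blast
    then have "Re (d * (g x - e x)) \<le> 0" by (simp add: right_diff_distrib)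
    moreover have "Re (d * (g x - e x)) = (cmod (g x - e x))\<^sup>2"
      unfolding d_def by (metis complex_norm_square mult.commute Re_complex_of_real)
    ultimately have "(cmod (g x - e x))\<^sup>2 \<le> 0" by (simp only:)
    then show False using x by simp
  qed
  show ?thesis
  proof (rule that)
    show "e \<in> S" by (rule subsetD[OF faceD(1)[OF M(1)] e])
    show "e a \<noteq> 0" by (rule F0_nz[OF subsetD[OF M(2) e]])
    fix f1 f2 t assume "f1 \<in> S" "f2 \<in> S" "0 < t" "t < 1"
      "\<And>x. e x = complex_of_real t * f1 x + complex_of_real (1 - t) * f2 x"
    then have "f1 \<in> M \<and> f2 \<in> M" by (rule faceD(4)[OF M(1) e])
    then show "f1 = e \<and> f2 = e" using single by blast
  qed
qed

text \<open>Apply the preceding theorem to the contractive positive functionals that vanish on \<open>K\<close>. An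
  extreme point \<open>e\<close> that is nonzero at \<open>a\<close> has norm one, since otherwise it would be an inner
  point of the segment from \<open>0\<close> to \<open>e / \<parallel>e\<parallel>\<close>. It is extreme among all states because two states
  of which a proper convex combination vanishes on \<open>K\<close> both vanish on \<open>K\<close>: this holds at
  positive elements of \<open>K\<close>, and these span \<open>K\<close> by the closure conditions.\<close>

theorem pure_state_separation:
  fixes K :: "'a::cstar_algebra set"
  assumes K_add: "\<And>x y. x \<in> K \<Longrightarrow> y \<in> K \<Longrightarrow> x + y \<in> K"
    and K_scale: "\<And>c x. x \<in> K \<Longrightarrow> c *\<^sub>C x \<in> K"
    and K_star: "\<And>x. x \<in> K \<Longrightarrow> star x \<in> K"
    and K_square: "\<And>x. star x * x \<in> K \<longleftrightarrow> x \<in> K"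
    and f: "bounded_clinear_functional f" "\<And>x. f (star x * x) \<in> nonneg_Reals" "\<And>x. x \<in> K \<Longrightarrow> f x = 0"
    and a: "f a \<noteq> 0"
  shows "\<exists>\<phi>. pure_state \<phi> \<and> (\<forall>x\<in>K. \<phi> x = 0) \<and> \<phi> a \<noteq> 0"
proof -
  define S where "S = {g :: 'a \<Rightarrow> complex. (\<forall>x. cmod (g x) \<le> norm x) \<and> (\<forall>x y. g (x + y) = g x + g y) \<and>
    (\<forall>c x. g (c *\<^sub>C x) = c * g x) \<and> (\<forall>x. g (star x * x) \<in> nonneg_Reals) \<and> (\<forall>x\<in>K. g x = 0)}"
  have S_mem: "bounded_clinear_functional g \<and> onorm g \<le> 1" if g: "g \<in> S" for g
  proof -
    have "bounded_linear g"
    proof (rule bounded_linear_intro[of _ 1])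
      show "g (r *\<^sub>R x) = r *\<^sub>R g x" for r x
        using g by (simp add: S_def scaleC_of_real[symmetric] scaleR_conv_of_real)
    qed (use g in \<open>auto simp: S_def\<close>)
    moreover have "onorm g \<le> 1" by (rule onorm_bound) (use g in \<open>auto simp: S_def\<close>)
    ultimately show ?thesis using g by (auto simp: bounded_clinear_functional_def S_def)
  qed
  have mem_S: "g \<in> S" if g: "bounded_clinear_functional g" "onorm g \<le> 1" "\<And>x. g (star x * x) \<in> nonneg_Reals"
    "\<And>x. x \<in> K \<Longrightarrow> g x = 0" for g
  proof -
    note D = bounded_clinear_functionalD[OF g(1)]
    have "cmod (g x) \<le> norm x" for x
      using D(4)[of x] mult_right_mono[OF g(2) norm_ge_zero[of x]] by simp
    then show ?thesis using D g by (auto simp: S_def)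
  qed
  have clS: "closed S"
  proof -
    have "S = (\<Inter>x. {g. cmod (g x) \<le> norm x}) \<inter> (\<Inter>x. \<Inter>y. {g. g (x + y) = g x + g y}) \<inter>
      (\<Inter>c. \<Inter>x. {g. g (c *\<^sub>C x) = c * g x}) \<inter> (\<Inter>x. (\<lambda>g. g (star x * x)) -` nonneg_Reals) \<inter>
      (\<Inter>x\<in>K. {g. g x = 0})"
      by (auto simp: S_def)
    also have "closed \<dots>"
      by (intro closed_Int closed_INT ballI closed_Collect_le closed_Collect_eq continuous_intros
          continuous_on_evaluation closed_vimage closed_nonneg_Reals_complex)
    finally show ?thesis .
  qed
  have "S = {g. \<forall>x. cmod (g x) \<le> norm x} \<inter> S" by (auto simp: S_def)
  then have compS: "compact S" using compact_Int_closed[OF compact_pointwise_bounded clS] by metis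
  note fD = bounded_clinear_functionalD[OF f(1)]
  define r where "r = 1 / (onorm f + 1)"
  have on: "0 \<le> onorm f" by (rule onorm_pos_le[OF fD(1)])
  then have r: "0 < r" "r * onorm f \<le> 1" by (auto simp: r_def field_simps)
  define f0 where "f0 x = complex_of_real r * f x" for x
  have f0S: "f0 \<in> S"
  proof (rule mem_S)
    have bl: "bounded_linear f0" unfolding f0_def by (intro bounded_linear_mult_right[THEN bounded_linear_compose] fD)
    then show "bounded_clinear_functional f0"
      by (auto simp: bounded_clinear_functional_def f0_def fD)
    show "onorm f0 \<le> 1"
    proof (rule onorm_bound)
      fix x
      have "cmod (f0 x) \<le> r * (onorm f * norm x)"
        using r fD(4)[of x] by (simp add: f0_def norm_mult mult_left_mono)
      also have "\<dots> \<le> 1 * norm x" unfolding mult.assoc[symmetric] using r by (intro mult_right_mono) auto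
      finally show "norm (f0 x) \<le> 1 * norm x" .
    qed simp
    show "f0 (star x * x) \<in> nonneg_Reals" for x
      using f(2)[of x] r by (auto simp: f0_def complex_nonneg_Reals_iff)
  qed (simp add: f0_def f)
  have "f0 a \<noteq> 0" using a r by (simp add: f0_def)
  from extreme_point_exists[OF compS clS f0S this] obtain e where eS: "e \<in> S" and ea: "e a \<noteq> 0"
    and ext: "\<And>f1 f2 t. f1 \<in> S \<Longrightarrow> f2 \<in> S \<Longrightarrow> 0 < t \<Longrightarrow> t < 1 \<Longrightarrow>
      (\<And>x. e x = complex_of_real t * f1 x + complex_of_real (1 - t) * f2 x) \<Longrightarrow> f1 = e \<and> f2 = e"
    by blast
  have e: "bounded_clinear_functional e" "onorm e \<le> 1" and e_pos: "e (star x * x) \<in> nonneg_Reals"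
    and eK: "x \<in> K \<Longrightarrow> e x = 0" for x
    using S_mem[OF eS] eS by (auto simp: S_def)
  note eD = bounded_clinear_functionalD[OF e(1)]
  have e1: "onorm e = 1"
  proof (rule ccontr)
    assume "onorm e \<noteq> 1"
    define n where "n = onorm e"
    have n1: "n < 1" using e(2) \<open>onorm e \<noteq> 1\<close> by (simp add: n_def)
    have "n \<noteq> 0" using eD(4)[of a] ea by (auto simp: n_def)
    then have n0: "0 < n" using onorm_pos_le[OF eD(1)] by (simp add: n_def)
    define e' where "e' x = complex_of_real (1 / n) * e x" for x
    have e'S: "e' \<in> S"
    proof (rule mem_S)
      have "bounded_linear e'" unfolding e'_def by (intro bounded_linear_mult_right[THEN bounded_linear_compose] eD)
      then show "bounded_clinear_functional e'" by (auto simp: bounded_clinear_functional_def e'_def eD)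
      show "onorm e' \<le> 1"
      proof (rule onorm_bound)
        show "norm (e' x) \<le> 1 * norm x" for x
          using n0 eD(4)[of x] by (simp add: e'_def norm_mult norm_divide field_simps n_def)
      qed simp
      show "e' (star x * x) \<in> nonneg_Reals" for x
        using e_pos[of x] n0 by (auto simp: e'_def complex_nonneg_Reals_iff)
    qed (simp add: e'_def eK)
    have "(\<lambda>x. 0) \<in> S" by (auto simp: S_def)
    moreover have "e x = complex_of_real n * e' x + complex_of_real (1 - n) * 0" for x
      using n0 by (simp add: e'_def)
    ultimately have "(\<lambda>x. 0) = e" using ext[OF e'S _ n0 n1, of "\<lambda>x. 0"] by blast
    then show False using ea by (metis)
  qed
  have st: "state e" using e e1 e_pos by (simp add: state_def)
  have vanish: "\<phi>1 x = 0 \<and> \<phi>2 x = 0"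
    if s: "state \<phi>1" "state \<phi>2" and t: "0 < t" "t < 1"
      and eq: "\<forall>a. e a = complex_of_real t * \<phi>1 a + complex_of_real (1 - t) * \<phi>2 a" and x: "x \<in> K"
    for \<phi>1 \<phi>2 t x
  proof -
    have b: "bounded_clinear_functional \<phi>1" "bounded_clinear_functional \<phi>2"
      and p: "\<And>y. \<phi>1 (star y * y) \<in> nonneg_Reals" "\<And>y. \<phi>2 (star y * y) \<in> nonneg_Reals"
      using s by (auto simp: state_def)
    note D1 = bounded_clinear_functionalD[OF b(1)] and D2 = bounded_clinear_functionalD[OF b(2)]
    have sq: "\<phi>1 (y * y) = 0 \<and> \<phi>2 (y * y) = 0" if y: "star y = y" "y * y \<in> K" for y
    proof -
      have "complex_of_real t * \<phi>1 (y * y) + complex_of_real (1 - t) * \<phi>2 (y * y) = 0"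
        using eq eK[OF y(2)] by metis
      moreover have "\<phi>1 (y * y) \<in> nonneg_Reals" "\<phi>2 (y * y) \<in> nonneg_Reals" using p[of y] y by simp_all
      then obtain u v where uv: "\<phi>1 (y * y) = complex_of_real u" "\<phi>2 (y * y) = complex_of_real v" "0 \<le> u" "0 \<le> v"
        by (auto elim!: nonneg_Reals_cases)
      ultimately have "complex_of_real (t * u + (1 - t) * v) = 0" by simp
      then have z: "t * u + (1 - t) * v = 0" by (simp only: of_real_eq_0_iff)
      moreover have "0 \<le> t * u" "0 \<le> (1 - t) * v" using t uv by auto
      ultimately have "t * u = 0" "(1 - t) * v = 0" by linarith+
      then show ?thesis using t uv by simp
    qed
    have sa: "\<phi>1 y = 0 \<and> \<phi>2 y = 0" if y: "star y = y" "y \<in> K" for y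
    proof -
      obtain u v where uv: "star u = u" "star v = v" "y = u * u - v * v"
        "(u * u + v * v) * (u * u + v * v) = y * y"
        using self_adjoint_Jordan[OF y(1)] by metis
      define m where "m = u * u + v * v"
      \<comment> \<open>The modulus \<open>m\<close> of \<open>y\<close> lies in \<open>K\<close>, because \<open>m\<^sup>* m = y\<^sup>* y\<close>; hence so do the positive
        and the negative part.\<close>
      have "star m = m" by (simp add: m_def star_simps uv)
      moreover have "m * m \<in> K" using uv(4) K_square[of y] y by (simp add: m_def)
      ultimately have mK: "m \<in> K" using K_square[of m] by simp
      have my: "m + y = u * u + u * u" "m + (- 1) *\<^sub>C y = v * v + v * v"
        using uv(3) by (simp_all add: m_def scaleC_simps)
      have "(1 / 2) *\<^sub>C (m + y) \<in> K" "(1 / 2) *\<^sub>C (m + (- 1) *\<^sub>C y) \<in> K"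
        by (intro K_scale K_add mK y)+
      then have "u * u \<in> K" "v * v \<in> K"
        unfolding my by (simp_all add: scaleC_add_right scaleC_add_left[symmetric] scaleC_one)
      then have "\<phi>1 (u * u) = 0 \<and> \<phi>2 (u * u) = 0" "\<phi>1 (v * v) = 0 \<and> \<phi>2 (v * v) = 0"
        using sq uv by blast+
      moreover have "y = u * u + (- 1) *\<^sub>C (v * v)" using uv(3) by (simp add: scaleC_simps)
      ultimately show ?thesis by (simp only: D1 D2) simp
    qed
    define p q where "p = (1 / 2) *\<^sub>C (x + star x)" and "q = (\<i> / 2) *\<^sub>C (star x + (- 1) *\<^sub>C x)"
    have "star p = p" "star q = q" by (simp_all add: p_def q_def star_simps add.commute)
    moreover have "p \<in> K" "q \<in> K" unfolding p_def q_def by (intro K_scale K_add K_star x)+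
    moreover have "x = p + \<i> *\<^sub>C q"
      by (simp add: p_def q_def star_simps scaleC_add_left[symmetric])
    ultimately show ?thesis using sa[of p] sa[of q] by (simp only: D1 D2) simp
  qed
  have "pure_state e"
    unfolding pure_state_def
  proof (intro conjI st allI impI)
    fix \<phi>1 \<phi>2 t
    assume *: "state \<phi>1 \<and> state \<phi>2 \<and> 0 < t \<and> t < 1 \<and>
      (\<forall>a. e a = complex_of_real t * \<phi>1 a + complex_of_real (1 - t) * \<phi>2 a)"
    then have "\<phi>1 \<in> S" "\<phi>2 \<in> S"
      using vanish[of \<phi>1 \<phi>2 t] by (auto intro!: mem_S simp: state_def)
    then have "\<phi>1 = e \<and> \<phi>2 = e" using ext[of \<phi>1 \<phi>2 t] * by blast
    then show "\<phi>1 = e" "\<phi>2 = e" by auto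
  qed
  then show ?thesis using eK ea by blast
qed

section \<open>Module maps into a Hilbert space\<close>

context vector_hilbert
begin

text \<open>Maps of the form \<open>a \<mapsto> \<pi>(a \<otimes> d) \<xi>\<close>. They behave like the orbit map of a vector under a
  representation of \<open>a\<close>, although \<open>\<pi>\<close> need not come from representations of the two factors:
  there is no unit to put in the place of \<open>d\<close>.\<close>

definition module_map :: "('a::cstar_algebra \<Rightarrow> 'v) \<Rightarrow> bool" where
  "module_map \<rho> \<longleftrightarrow> (\<forall>a. \<rho> a \<in> V) \<and> (\<forall>a b. \<rho> (a + b) = \<rho> a + \<rho> b) \<and> (\<forall>c a. \<rho> (c *\<^sub>C a) = c *\<^sub>C \<rho> a) \<and>
     (\<forall>a c c'. ip (\<rho> (a * c)) (\<rho> c') = ip (\<rho> c) (\<rho> (star a * c')))"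

text \<open>The kernel of the representation that the module map generates.\<close>

definition module_kernel :: "('a::cstar_algebra \<Rightarrow> 'v) \<Rightarrow> 'a set" where
  "module_kernel \<rho> = {a. \<forall>c. \<rho> (a * c) = 0}"

context
  fixes \<rho> :: "'a::cstar_algebra \<Rightarrow> 'v"
  assumes \<rho>: "module_map \<rho>"
begin

lemma module_map_rules:
  "\<rho> a \<in> V" "\<rho> (a + b) = \<rho> a + \<rho> b" "\<rho> (c *\<^sub>C a) = c *\<^sub>C \<rho> a"
  "ip (\<rho> (a * b)) (\<rho> b') = ip (\<rho> b) (\<rho> (star a * b'))"
  using \<rho> by (auto simp: module_map_def)

lemma module_map_zero: "\<rho> 0 = 0"
  using module_map_rules(3)[of 0 0] by simp

lemma module_map_diff: "\<rho> (a - b) = \<rho> a - \<rho> b"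
  using module_map_rules(2)[of "a - b" b] by (simp add: algebra_simps)

lemma module_map_sum: "\<rho> (\<Sum>i\<in>I. f i) = (\<Sum>i\<in>I. \<rho> (f i))"
  by (induction I rule: infinite_finite_induct) (auto simp: module_map_zero module_map_rules)

lemma module_map_uact: "ip (\<rho> (uact g c)) (\<rho> c') = ip (\<rho> c) (\<rho> (uact (star g) c'))"
proof -
  have "ip (\<rho> (uact g c)) (\<rho> c') = ip (\<rho> (alg_part g * c)) (\<rho> c') + scal_part g * ip (\<rho> c) (\<rho> c')"
    by (simp add: uact_def module_map_rules(1-3) ip_simps V_closed)
  also have "\<dots> = ip (\<rho> c) (\<rho> (uact (star g) c'))"
    by (simp add: uact_def module_map_rules ip_simps V_closed)
  finally show ?thesis .
qed

text \<open>With \<open>g\<^sup>2 = \<parallel>s\<parallel> - s\<close> and \<open>s = \<Sum> a\<^sub>i\<^sup>* a\<^sub>i\<close>, the difference of the two sides is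
  \<open>\<parallel>\<rho>(g c)\<parallel>\<^sup>2\<close>.\<close>

lemma module_map_square_sum:
  assumes G: "finite G"
  shows "(\<Sum>i\<in>G. (nm (\<rho> (a i * c)))\<^sup>2) \<le> norm (\<Sum>i\<in>G. star (a i) * a i) * (nm (\<rho> c))\<^sup>2"
proof -
  let ?s = "\<Sum>i\<in>G. star (a i) * a i"
  have "into_unitization ?s = (\<Sum>i\<in>G. star (into_unitization (a i)) * into_unitization (a i))"
    by (simp add: into_unitization_sum into_unitization_simps)
  then have "posit (into_unitization ?s)" by (simp add: posit_sum posit_star_mult)
  then have "posit (norm ?s *\<^sub>R 1 - into_unitization ?s)" by (rule posit_norm_diff) simp
  then obtain g where g: "star g = g" "norm ?s *\<^sub>R 1 - into_unitization ?s = g * g"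
    unfolding posit_def by blast
  have parts: "alg_part (norm ?s *\<^sub>R 1 - into_unitization ?s) = - ?s"
    "scal_part (norm ?s *\<^sub>R 1 - into_unitization ?s) = complex_of_real (norm ?s)"
    by (simp_all del: of_real_1 flip: scaleR_conv_of_real) (simp_all add: scaleR_conv_of_real)
  have "uact (g * g) c = complex_of_real (norm ?s) *\<^sub>C c - ?s * c"
    unfolding g(2)[symmetric] uact_def parts by simp
  also have "?s * c = (\<Sum>i\<in>G. star (a i) * (a i * c))"
    by (simp add: sum_distrib_right mult.assoc)
  finally have gg: "uact (g * g) c =
    complex_of_real (norm ?s) *\<^sub>C c - (\<Sum>i\<in>G. star (a i) * (a i * c))" .
  have "(nm (\<rho> (uact g c)))\<^sup>2 = Re (ip (\<rho> c) (\<rho> (uact (g * g) c)))"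
    by (simp add: nm_square module_map_rules(1) module_map_uact g(1) uact_mult)
  also have "ip (\<rho> c) (\<rho> (uact (g * g) c)) =
      complex_of_real (norm ?s) * ip (\<rho> c) (\<rho> c) - (\<Sum>i\<in>G. ip (\<rho> c) (\<rho> (star (a i) * (a i * c))))"
    unfolding gg module_map_diff module_map_sum by (simp add: module_map_rules(1,3) ip_simps V_closed ip_sum V_sum)
  also have "(\<Sum>i\<in>G. ip (\<rho> c) (\<rho> (star (a i) * (a i * c)))) = (\<Sum>i\<in>G. ip (\<rho> (a i * c)) (\<rho> (a i * c)))"
    by (simp add: module_map_rules(4))
  finally have "(nm (\<rho> (uact g c)))\<^sup>2 = norm ?s * (nm (\<rho> c))\<^sup>2 - (\<Sum>i\<in>G. (nm (\<rho> (a i * c)))\<^sup>2)"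
    by (simp add: nm_square module_map_rules(1))
  then show ?thesis using zero_le_power2[of "nm (\<rho> (uact g c))"] by linarith
qed

lemma module_map_bound: "nm (\<rho> (a * c)) \<le> norm a * nm (\<rho> c)"
proof (rule power2_le_imp_le)
  show "(nm (\<rho> (a * c)))\<^sup>2 \<le> (norm a * nm (\<rho> c))\<^sup>2"
    using module_map_square_sum[of "{()}" "\<lambda>_. a" c] by (simp add: cstar_identity power_mult_distrib)
qed (intro mult_nonneg_nonneg nm_nonneg module_map_rules norm_ge_zero)

lemma module_functional_left:
  assumes h: "h \<in> V"
  shows "bounded_clinear_functional (\<lambda>a. ip (\<rho> (a * c)) h)"
  unfolding bounded_clinear_functional_def
proof (intro conjI allI)
  show sc: "ip (\<rho> (t *\<^sub>C a * c)) h = t * ip (\<rho> (a * c)) h" for t a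
    by (simp add: mult_scaleC_left module_map_rules(1,3) ip_simps h)
  show "bounded_linear (\<lambda>a. ip (\<rho> (a * c)) h)"
  proof (rule bounded_linear_intro[of _ "nm (\<rho> c) * nm h"])
    show "ip (\<rho> ((a + b) * c)) h = ip (\<rho> (a * c)) h + ip (\<rho> (b * c)) h" for a b
      by (simp add: distrib_right module_map_rules(1,2) ip_simps h)
    show "ip (\<rho> (r *\<^sub>R a * c)) h = r *\<^sub>R ip (\<rho> (a * c)) h" for r a
      using sc[of "complex_of_real r" a] by (simp add: scaleC_of_real scaleR_conv_of_real)
    show "norm (ip (\<rho> (a * c)) h) \<le> norm a * (nm (\<rho> c) * nm h)" for a
      using CS[OF module_map_rules(1) h, of "a * c"] mult_right_mono[OF module_map_bound nm_nonneg[OF h], of a c]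
      by (simp add: mult.assoc)
  qed
qed

lemma module_functional_right:
  assumes k: "k \<in> V"
  shows "bounded_clinear_functional (\<lambda>a. ip k (\<rho> (star a * c)))"
  unfolding bounded_clinear_functional_def
proof (intro conjI allI)
  show sc: "ip k (\<rho> (star (t *\<^sub>C a) * c)) = t * ip k (\<rho> (star a * c))" for t a
    by (simp add: star_simps module_map_rules(1,3) ip_simps k)
  show "bounded_linear (\<lambda>a. ip k (\<rho> (star a * c)))"
  proof (rule bounded_linear_intro[of _ "nm (\<rho> c) * nm k"])
    show "ip k (\<rho> (star (a + b) * c)) = ip k (\<rho> (star a * c)) + ip k (\<rho> (star b * c))" for a b
      by (simp add: star_add distrib_right module_map_rules(1,2) ip_simps k)
    show "ip k (\<rho> (star (r *\<^sub>R a) * c)) = r *\<^sub>R ip k (\<rho> (star a * c))" for r a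
      using sc[of "complex_of_real r" a] by (simp add: scaleC_of_real scaleR_conv_of_real)
    show "norm (ip k (\<rho> (star a * c))) \<le> norm a * (nm (\<rho> c) * nm k)" for a
    proof -
      have "nm (\<rho> (star a * c)) \<le> norm a * nm (\<rho> c)" using module_map_bound[of "star a" c] by (simp add: norm_star)
      then have "nm k * nm (\<rho> (star a * c)) \<le> nm k * (norm a * nm (\<rho> c))"
        by (rule mult_left_mono) (rule nm_nonneg[OF k])
      then show ?thesis using CS[OF k module_map_rules(1), of "star a * c"] by (simp add: mult_ac)
    qed
  qed
qed

lemma module_kernel_add: "x \<in> module_kernel \<rho> \<Longrightarrow> y \<in> module_kernel \<rho> \<Longrightarrow> x + y \<in> module_kernel \<rho>"
  by (simp add: module_kernel_def distrib_right module_map_rules)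

lemma module_kernel_scale: "x \<in> module_kernel \<rho> \<Longrightarrow> c *\<^sub>C x \<in> module_kernel \<rho>"
  by (simp add: module_kernel_def mult_scaleC_left module_map_rules)

lemma module_kernel_star:
  assumes "x \<in> module_kernel \<rho>"
  shows "star x \<in> module_kernel \<rho>"
proof -
  have "ip (\<rho> (star x * c)) (\<rho> (star x * c)) = 0" for c
    using module_map_rules(4)[of "star x" c "star x * c"] assms
    by (simp add: star_star module_kernel_def ip_zero module_map_rules(1))
  then show ?thesis using ip_self_eq_0 module_map_rules(1) by (simp add: module_kernel_def)
qed

lemma module_kernel_square: "star x * x \<in> module_kernel \<rho> \<longleftrightarrow> x \<in> module_kernel \<rho>"
proof
  assume "star x * x \<in> module_kernel \<rho>"
  then have "ip (\<rho> (x * c)) (\<rho> (x * c)) = 0" for c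
    using module_map_rules(4)[of x c "x * c"]
    by (simp add: module_kernel_def mult.assoc[symmetric] ip_zero module_map_rules(1))
  then show "x \<in> module_kernel \<rho>" using ip_self_eq_0 module_map_rules(1) by (simp add: module_kernel_def)
next
  assume "x \<in> module_kernel \<rho>"
  then show "star x * x \<in> module_kernel \<rho>"
    using module_kernel_star by (simp add: module_kernel_def mult.assoc)
qed

text \<open>By polarisation, the vanishing of all these values would give \<open>\<rho> (a * c) = 0\<close> for all \<open>c\<close>.\<close>

lemma module_kernel_functional:
  assumes a: "a \<notin> module_kernel \<rho>"
  obtains c where "ip (\<rho> (a * c)) (\<rho> c) \<noteq> 0"
proof (rule ccontr)
  assume "\<not> thesis"
  then have 0: "ip (\<rho> (a * c)) (\<rho> c) = 0" for c using that by blast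
  define s where "s c d = ip (\<rho> (a * c)) (\<rho> d)" for c d
  have s_add: "s (c + c') d = s c d + s c' d" "s c (d + d') = s c d + s c d'" for c c' d d'
    by (simp_all add: s_def distrib_left module_map_rules(1,2) ip_simps)
  have s_sc: "s (t *\<^sub>C c) d = t * s c d" "s c (t *\<^sub>C d) = cnj t * s c d" for t c d
    by (simp_all add: s_def mult_scaleC_right module_map_rules(1,3) ip_simps)
  have s0: "s c c = 0" for c by (simp add: s_def 0)
  have "s c d = 0" for c d
  proof -
    have sum0: "s c e + s e c = 0" for e
    proof -
      have "s c c + s e c + (s c e + s e e) = 0" using s0[of "c + e"] unfolding s_add .
      then show ?thesis unfolding s0 by (simp add: add.commute)
    qed
    have "\<i> * (s d c - s c d) = 0" using sum0[of "\<i> *\<^sub>C d"] by (simp add: s_sc algebra_simps)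
    then have "s d c = s c d" by simp
    then have "2 * s c d = 0" using sum0[of d] unfolding mult_2 by simp
    then show ?thesis by simp
  qed
  then have "ip (\<rho> (a * c)) (\<rho> (a * c)) = 0" for c by (simp add: s_def)
  then have "a \<in> module_kernel \<rho>" using ip_self_eq_0 module_map_rules(1) by (simp add: module_kernel_def)
  then show False using a by simp
qed

end

text \<open>A positive functional \<open>a \<mapsto> \<langle>\<rho>(a c), \<rho>(c)\<rangle>\<close> vanishes on the kernels and not at \<open>a\<close>; it can
  be replaced by a pure state.\<close>

theorem pure_state_kills_module_kernels:
  fixes R :: "('a::cstar_algebra \<Rightarrow> 'v) set"
  assumes R: "\<And>\<rho>. \<rho> \<in> R \<Longrightarrow> module_map \<rho>" and a: "a \<notin> (\<Inter>\<rho>\<in>R. module_kernel \<rho>)"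
  shows "\<exists>\<phi>. pure_state \<phi> \<and> (\<forall>x\<in>(\<Inter>\<rho>\<in>R. module_kernel \<rho>). \<phi> x = 0) \<and> \<phi> a \<noteq> 0"
proof -
  obtain \<rho> where \<rho>: "\<rho> \<in> R" "a \<notin> module_kernel \<rho>" using a by blast
  note m = R[OF \<rho>(1)]
  obtain c where c: "ip (\<rho> (a * c)) (\<rho> c) \<noteq> 0" using module_kernel_functional[OF m \<rho>(2)] .
  show ?thesis
  proof (rule pure_state_separation[where f = "\<lambda>x. ip (\<rho> (x * c)) (\<rho> c)"])
    show "bounded_clinear_functional (\<lambda>x. ip (\<rho> (x * c)) (\<rho> c))"
      by (rule module_functional_left[OF m module_map_rules(1)[OF m]])
    show "ip (\<rho> (star x * x * c)) (\<rho> c) \<in> nonneg_Reals" for x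
    proof -
      have "ip (\<rho> (star x * x * c)) (\<rho> c) = complex_of_real ((nm (\<rho> (x * c)))\<^sup>2)"
        using module_map_rules(4)[OF m, of "star x" "x * c" c]
        by (simp add: mult.assoc star_star ip_self[OF module_map_rules(1)[OF m]])
      then show ?thesis by (simp only: nonneg_Reals_of_real_iff zero_le_power2)
    qed
    show "ip (\<rho> (x * c)) (\<rho> c) = 0" if "x \<in> (\<Inter>\<rho>\<in>R. module_kernel \<rho>)" for x
      using that \<rho>(1) by (auto simp: module_kernel_def ip_zero module_map_rules(1)[OF m])
    show "ip (\<rho> (a * c)) (\<rho> c) \<noteq> 0" by (rule c)
    show "star x * x \<in> (\<Inter>\<rho>\<in>R. module_kernel \<rho>) \<longleftrightarrow> x \<in> (\<Inter>\<rho>\<in>R. module_kernel \<rho>)" for x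
      using module_kernel_square[OF R] by auto
  qed (use R in \<open>auto intro: module_kernel_add module_kernel_scale module_kernel_star\<close>)
qed

text \<open>\<open>y \<mapsto> \<Sum> \<langle>y, w\<^sub>i\<rangle> v\<^sub>i\<close> is a trace class operator with vanishing quadratic form, so its trace
  vanishes. To avoid trace class operators, let \<open>Q\<close> be the projection onto the span of finitely
  many \<open>v\<^sub>i\<close> such that \<open>\<Sum> \<parallel>v\<^sub>i\<parallel> \<parallel>w\<^sub>i\<parallel>\<close> over the remaining \<open>i\<close> is small. The trace over the range
  of \<open>Q\<close> is zero, and the rest is small.\<close>

lemma l2_trace_zero:
  fixes v w :: "'i \<Rightarrow> 'v"
  assumes v: "v \<in> l2_carrier" and w: "w \<in> l2_carrier"
    and zero: "\<And>h. h \<in> V \<Longrightarrow> (\<Sum>\<^sub>\<infinity>i. ip (v i) h * ip h (w i)) = 0"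
    and summable: "\<And>h. h \<in> V \<Longrightarrow> (\<lambda>i. ip (v i) h * ip h (w i)) summable_on UNIV"
  shows "l2_ip v w = 0"
proof (rule ccontr)
  assume ne: "l2_ip v w \<noteq> 0"
  define g where "g i = nm (v i) * nm (w i)" for i
  have vV: "v i \<in> V" and wV: "w i \<in> V" for i by (rule l2_V[OF v], rule l2_V[OF w])
  have g0: "0 \<le> g i" for i by (simp add: g_def nm_nonneg vV wV)
  have gs: "g summable_on UNIV"
  proof (rule summable_on_comparison_test)
    show "(\<lambda>i. (nm (v i))\<^sup>2 + (nm (w i))\<^sup>2) summable_on UNIV" by (intro summable_on_add l2_summable v w)
    show "g i \<le> (nm (v i))\<^sup>2 + (nm (w i))\<^sup>2" for i
      using sum_squares_bound[of "nm (v i)" "nm (w i)"] g0[of i] unfolding g_def by linarith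
  qed (rule g0)
  define e where "e = cmod (l2_ip v w)"
  have e: "e > 0" using ne by (simp add: e_def)
  have "\<exists>F. finite F \<and> infsum g UNIV - e < sum g F"
  proof (rule ccontr)
    assume "\<not> (\<exists>F. finite F \<and> infsum g UNIV - e < sum g F)"
    then have "sum g F \<le> infsum g UNIV - e" if "finite F" for F using that by (meson not_less)
    then have "infsum g UNIV \<le> infsum g UNIV - e" by (intro infsum_le_finite_sums gs) auto
    then show False using e by simp
  qed
  then obtain F where F: "finite F" "infsum g UNIV - e < sum g F" by blast
  have gsF: "g summable_on - F" by (rule summable_on_subset_banach[OF gs]) simp
  have "infsum g (F \<union> - F) = infsum g F + infsum g (- F)"
    using F(1) gsF by (intro infsum_Un_disjoint) auto
  then have tail: "infsum g (- F) < e" using F by simp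
  obtain E where E: "finite E" "E \<subseteq> V" "\<And>x. x \<in> E \<Longrightarrow> ip x x = 1"
    "\<And>x y. x \<in> E \<Longrightarrow> y \<in> E \<Longrightarrow> x \<noteq> y \<Longrightarrow> ip x y = 0"
    "\<And>x. x \<in> v ` F \<Longrightarrow> x = (\<Sum>y\<in>E. ip x y *\<^sub>C y)"
    using finite_rank_projection[of "v ` F"] F(1) vV by blast
  define Q where "Q x = (\<Sum>y\<in>E. ip x y *\<^sub>C y)" for x
  have EV: "y \<in> V" if "y \<in> E" for y using that E(2) by blast
  have QV: "Q x \<in> V" for x unfolding Q_def by (intro V_sum V_scale EV)
  have Qy: "ip (Q x) y = ip x y" if y: "y \<in> E" for x y
  proof -
    have "ip (Q x) y = (\<Sum>z\<in>E. ip x z * ip z y)"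
      unfolding Q_def using EV y by (subst ip_sum) (auto simp: ip_simps V_closed)
    also have "\<dots> = (\<Sum>z\<in>E. if z = y then ip x y else 0)"
      using E y by (intro sum.cong) auto
    finally show ?thesis using E(1) y by simp
  qed
  have contr: "nm (x - Q x) \<le> nm x" if x: "x \<in> V" for x
  proof -
    have "ip (x - Q x) (Q x) = (\<Sum>y\<in>E. cnj (ip x y) * ip (x - Q x) y)"
      by (subst (2) Q_def) (use x EV QV in \<open>simp add: ip_sum ip_scale V_closed\<close>)
    also have "\<dots> = 0" using Qy x EV QV by (simp add: ip_diff)
    finally have "(nm ((x - Q x) + Q x))\<^sup>2 = (nm (x - Q x))\<^sup>2 + (nm (Q x))\<^sup>2"
      using x QV by (subst nm_add_square) (auto simp: V_diff)
    then have "(nm (x - Q x))\<^sup>2 \<le> (nm x)\<^sup>2" by simp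
    then show ?thesis by (rule power2_le_imp_le) (rule nm_nonneg[OF x])
  qed
  define d where "d i = ip (v i - Q (v i)) (w i)" for i
  have d_eq: "d i = ip (v i) (w i) - (\<Sum>y\<in>E. ip (v i) y * ip y (w i))" for i
    using vV wV EV QV by (simp add: d_def ip_diff) (simp add: Q_def ip_sum ip_scale V_closed)
  have trace: "((\<lambda>i. ip (v i) y * ip y (w i)) has_sum 0) UNIV" if "y \<in> V" for y
    using has_sum_infsum[OF summable[OF that]] zero[OF that] by simp
  have "((\<lambda>i. \<Sum>y\<in>E'. ip (v i) y * ip y (w i)) has_sum 0) UNIV" if "finite E'" "E' \<subseteq> V" for E'
    using that
  proof induction
    case (insert y E')
    then show ?case using has_sum_add[OF trace[of y], of _ 0] by simp
  qed (simp add: has_sum_0)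
  then have "((\<lambda>i. \<Sum>y\<in>E. ip (v i) y * ip y (w i)) has_sum 0) UNIV" using E(1,2) by blast
  then have "((\<lambda>i. ip (v i) (w i) + - (\<Sum>y\<in>E. ip (v i) y * ip y (w i))) has_sum (l2_ip v w + - 0)) UNIV"
    unfolding l2_ip_def by (intro has_sum_add has_sum_uminusI has_sum_infsum l2_ip_summable v w)
  then have "(d has_sum l2_ip v w) UNIV" by (simp add: d_eq[abs_def])
  then have ds: "infsum d UNIV = l2_ip v w" by (rule infsumI)
  have d0: "d i = 0" if "i \<in> F" for i
  proof -
    have "Q (v i) = v i" unfolding Q_def using E(5)[of "v i"] that by simp
    then show ?thesis using ip_zero wV by (simp add: d_def)
  qed
  have dg: "cmod (d i) \<le> g i" for i
  proof -
    have "cmod (d i) \<le> nm (v i - Q (v i)) * nm (w i)"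
      unfolding d_def by (intro CS V_diff vV wV QV)
    also have "\<dots> \<le> g i" unfolding g_def by (intro mult_right_mono contr vV nm_nonneg wV)
    finally show ?thesis .
  qed
  have "infsum d UNIV = infsum d (- F)" by (rule infsum_cong_neutral) (auto simp: d0)
  moreover have "cmod (infsum d (- F)) \<le> infsum g (- F)"
  proof (rule norm_infsum_le)
    have "(\<lambda>i. cmod (d i)) summable_on - F"
      by (rule summable_on_comparison_test[OF gsF]) (auto simp: dg)
    then show "(d has_sum infsum d (- F)) (- F)" by (rule has_sum_infsum[OF abs_summable_summable])
    show "(g has_sum infsum g (- F)) (- F)" by (intro has_sum_infsum gsF)
  qed (rule dg)
  ultimately show False using tail ds by (simp add: e_def)
qed

end

section \<open>Product functionals on the tensor product\<close>

context irreducible_vector_representation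
begin

lemma rep_l2_norm:
  assumes z: "z \<in> l2_carrier"
  shows "hnorm l2_hilbert (rep_l2 t z) \<le> norm t * hnorm l2_hilbert z"
proof -
  have "(\<Sum>i\<in>F. (nm (rep_l2 t z i))\<^sup>2) \<le> (norm t)\<^sup>2 * (\<Sum>\<^sub>\<infinity>i. (nm (z i))\<^sup>2)" if F: "finite F" for F
  proof -
    have "(nm (rep_l2 t z i))\<^sup>2 \<le> (norm t)\<^sup>2 * (nm (z i))\<^sup>2" for i
      using power_mono[OF rep_contractive[OF l2_V[OF z], of t i] nm_nonneg[OF rep_V[OF l2_V[OF z]]], of 2]
      by (simp add: rep_l2_def power_mult_distrib)
    then have "(\<Sum>i\<in>F. (nm (rep_l2 t z i))\<^sup>2) \<le> (norm t)\<^sup>2 * (\<Sum>i\<in>F. (nm (z i))\<^sup>2)"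
      unfolding sum_distrib_left by (rule sum_mono)
    also have "\<dots> \<le> (norm t)\<^sup>2 * (\<Sum>\<^sub>\<infinity>i. (nm (z i))\<^sup>2)"
      by (intro mult_left_mono l2_finite_sum_le z F) auto
    finally show ?thesis .
  qed
  then have "(hnorm l2_hilbert (rep_l2 t z))\<^sup>2 \<le> (norm t * hnorm l2_hilbert z)\<^sup>2"
    unfolding power_mult_distrib l2_hnorm_square[OF rep_l2_closed[OF z]] l2_hnorm_square[OF z]
    by (intro infsum_le_finite_sums l2_summable rep_l2_closed z) auto
  then show ?thesis
    by (rule power2_le_imp_le) (simp add: l2_hnorm z infsum_nonneg)
qed

lemma rep_l2_functional_bounded:
  fixes v w :: "'i \<Rightarrow> 'v"
  assumes v: "v \<in> l2_carrier" and w: "w \<in> l2_carrier"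
  shows "bounded_linear (\<lambda>t. l2_ip (rep_l2 t v) w)"
proof -
  interpret L: vector_hilbert "l2_hilbert :: ('i \<Rightarrow> 'v) pre_hilbert" by (rule vector_hilbert_l2)
  have sel [simp]: "hcarrier l2_hilbert = (l2_carrier :: ('i \<Rightarrow> 'v) set)"
    "hinner l2_hilbert = (l2_ip :: ('i \<Rightarrow> 'v) \<Rightarrow> _)"
    by (simp_all add: l2_hilbert_def)
  note Lip = L.ip_simps[unfolded sel]
  show ?thesis
  proof (rule bounded_linear_intro[of _ "L.nm v * L.nm w"])
    fix t s and r :: real
    have "rep_l2 (t + s) v = rep_l2 t v + rep_l2 s v"
      by (simp add: rep_l2_def fun_eq_iff rep_alg_add l2_V v)
    then show "l2_ip (rep_l2 (t + s) v) w = l2_ip (rep_l2 t v) w + l2_ip (rep_l2 s v) w"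
      by (simp add: Lip rep_l2_closed v w)
    have "rep_l2 (r *\<^sub>R t) v = complex_of_real r *\<^sub>C rep_l2 t v"
      by (simp add: rep_l2_def fun_eq_iff scaleC_fun_def scaleC_of_real[symmetric] rep_alg_scale l2_V v)
    then show "l2_ip (rep_l2 (r *\<^sub>R t) v) w = r *\<^sub>R l2_ip (rep_l2 t v) w"
      by (simp add: Lip rep_l2_closed v w scaleR_conv_of_real)
    have "cmod (l2_ip (rep_l2 t v) w) \<le> L.nm (rep_l2 t v) * L.nm w"
      using L.CS[of "rep_l2 t v" w] by (simp add: rep_l2_closed v w)
    also have "\<dots> \<le> (norm t * L.nm v) * L.nm w"
      using L.nm_nonneg[of w] w by (intro mult_right_mono rep_l2_norm v) auto
    finally show "norm (l2_ip (rep_l2 t v) w) \<le> norm t * (L.nm v * L.nm w)" by (simp add: mult.assoc)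
  qed
qed

end

text \<open>Connects convergence along \<open>F n\<close>, which holds for the row-column series itself, with the
  unconditional summability of its images.\<close>

lemma exhausting_sums_tendsto:
  fixes f :: "'i \<Rightarrow> complex"
  assumes F: "\<And>n::nat. finite (F n)" "\<And>n. F n \<subseteq> F (Suc n)" and zero: "\<And>i. i \<notin> (\<Union>n. F n) \<Longrightarrow> f i = 0"
    and summable: "f summable_on UNIV"
  shows "(\<lambda>n. sum f (F n)) \<longlonglongrightarrow> infsum f UNIV"
proof -
  let ?I = "\<Union>n. F n"
  have mono: "F m \<subseteq> F n" if "m \<le> n" for m n using F(2) that by (rule lift_Suc_mono_le)
  have "f summable_on ?I" by (rule summable_on_subset_banach[OF summable]) simp
  then have "(f has_sum infsum f ?I) ?I" by (rule has_sum_infsum)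
  then have lim: "(sum f \<longlongrightarrow> infsum f ?I) (finite_subsets_at_top ?I)" by (simp add: has_sum_def)
  have "filterlim F (finite_subsets_at_top ?I) sequentially"
    unfolding filterlim_finite_subsets_at_top
  proof (intro allI impI)
    fix X assume X: "finite X \<and> X \<subseteq> ?I"
    then have "\<forall>x\<in>X. \<exists>n. x \<in> F n" by blast
    then obtain n where n: "\<And>x. x \<in> X \<Longrightarrow> x \<in> F (n x)" by metis
    define N where "N = (if X = {} then 0 else Max (n ` X))"
    have "X \<subseteq> F N"
    proof
      fix x assume x: "x \<in> X"
      then have "n x \<le> N" using X by (auto simp: N_def)
      then show "x \<in> F N" using n[OF x] mono by blast
    qed
    then have "finite (F m) \<and> X \<subseteq> F m \<and> F m \<subseteq> ?I" if "m \<ge> N" for m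
      using mono[OF that] F(1) by blast
    then show "\<forall>\<^sub>F m in sequentially. finite (F m) \<and> X \<subseteq> F m \<and> F m \<subseteq> ?I"
      using eventually_sequentially by blast
  qed
  then have "(\<lambda>n. sum f (F n)) \<longlonglongrightarrow> infsum f ?I" by (rule filterlim_compose[OF lim])
  moreover have "infsum f ?I = infsum f UNIV" by (rule infsum_cong_neutral) (auto simp: zero)
  ultimately show ?thesis by simp
qed

locale tensor_representation =
  op_proj_tensor_product emb + irreducible_vector_representation H \<pi>
  for emb :: "('a::cstar_algebra, 'b::cstar_algebra) alg_tensor \<Rightarrow> 'd::banach_star_algebra"
    and H :: "'v::complex_vector pre_hilbert" and \<pi> :: "'d \<Rightarrow> 'v \<Rightarrow> 'v"
begin

definition left_map :: "'b \<Rightarrow> 'v \<Rightarrow> 'a \<Rightarrow> 'v" where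
  "left_map d \<xi> a = \<pi> (emb (a \<otimes>\<^sub>a d)) \<xi>"

definition right_map :: "'a \<Rightarrow> 'v \<Rightarrow> 'b \<Rightarrow> 'v" where
  "right_map c \<xi> b = \<pi> (emb (c \<otimes>\<^sub>a b)) \<xi>"

lemma ip_emb:
  assumes "\<xi> \<in> V" "\<eta> \<in> V"
  shows "ip (\<pi> (emb (c \<otimes>\<^sub>a d)) \<xi>) (\<pi> (emb (c' \<otimes>\<^sub>a d')) \<eta>) = ip (\<pi> (emb ((star c' * c) \<otimes>\<^sub>a (star d' * d))) \<xi>) \<eta>"
  using assms rep_star[of "\<pi> (emb (c \<otimes>\<^sub>a d)) \<xi>" \<eta> "emb (c' \<otimes>\<^sub>a d')"]
  by (simp add: rep_V emb_star rep_mult[symmetric] emb_mult)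

lemma module_map_left: "\<xi> \<in> V \<Longrightarrow> module_map (left_map d \<xi>)"
  unfolding module_map_def left_map_def
  by (simp add: rep_V tensor_add_left tensor_scaleC_left emb_add emb_scaleC rep_alg_add rep_alg_scale ip_emb
      star_simps mult.assoc)

lemma module_map_right: "\<xi> \<in> V \<Longrightarrow> module_map (right_map c \<xi>)"
  unfolding module_map_def right_map_def
  by (simp add: rep_V tensor_add_right tensor_scaleC_right emb_add emb_scaleC rep_alg_add rep_alg_scale ip_emb
      star_simps mult.assoc)

text \<open>The elements \<open>a\<close> with \<open>\<pi>(a c \<otimes> d) = 0\<close> for all \<open>c\<close> and \<open>d\<close>.\<close>

definition left_kernel :: "'a set" where
  "left_kernel = (\<Inter>\<rho>\<in>{left_map d \<xi> | d \<xi>. \<xi> \<in> V}. module_kernel \<rho>)"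

text \<open>The elements \<open>b\<close> with \<open>\<pi>(c \<otimes> b d) = 0\<close> for all \<open>c\<close> and \<open>d\<close>.\<close>

definition right_kernel :: "'b set" where
  "right_kernel = (\<Inter>\<rho>\<in>{right_map c \<xi> | c \<xi>. \<xi> \<in> V}. module_kernel \<rho>)"

text \<open>The star makes the functional linear, although \<open>a\<close> stands in the second argument of the
  inner product.\<close>

definition left_functional :: "'v \<Rightarrow> 'a \<Rightarrow> 'b \<Rightarrow> 'v \<Rightarrow> 'a \<Rightarrow> complex" where
  "left_functional k c' d' \<eta> a = ip k (left_map d' \<eta> (star a * c'))"

definition right_functional :: "'a \<Rightarrow> 'b \<Rightarrow> 'v \<Rightarrow> 'v \<Rightarrow> 'b \<Rightarrow> complex" where
  "right_functional c d \<xi> h b = ip (right_map c \<xi> (b * d)) h"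

lemma left_functional_bounded:
  "k \<in> V \<Longrightarrow> \<eta> \<in> V \<Longrightarrow> bounded_clinear_functional (left_functional k c' d' \<eta>)"
  unfolding left_functional_def by (intro module_functional_right module_map_left)

lemma right_functional_bounded:
  "h \<in> V \<Longrightarrow> \<xi> \<in> V \<Longrightarrow> bounded_clinear_functional (right_functional c d \<xi> h)"
  unfolding right_functional_def by (intro module_functional_left module_map_right)

lemma left_kernelI:
  assumes "\<And>k c' d' \<eta>. k \<in> V \<Longrightarrow> \<eta> \<in> V \<Longrightarrow> left_functional k c' d' \<eta> a = 0"
  shows "a \<in> left_kernel"
proof -
  have "left_map d \<xi> (star a * c) = 0" if "\<xi> \<in> V" for d \<xi> c
    using assms[OF module_map_rules(1)[OF module_map_left[OF that]] that, of d "star a * c" c d]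
      ip_self_eq_0[OF module_map_rules(1)[OF module_map_left[OF that]]]
    by (simp add: left_functional_def)
  then have "star a \<in> module_kernel (left_map d \<xi>)" if "\<xi> \<in> V" for d \<xi>
    using that by (simp add: module_kernel_def)
  then show ?thesis
    using module_kernel_star[OF module_map_left] by (fastforce simp: left_kernel_def star_star)
qed

lemma left_kernelD:
  assumes "a \<in> left_kernel" "k \<in> V" "\<eta> \<in> V"
  shows "left_functional k c' d' \<eta> a = 0"
proof -
  have "a \<in> module_kernel (left_map d' \<eta>)" using assms by (auto simp: left_kernel_def)
  then have "star a \<in> module_kernel (left_map d' \<eta>)" by (rule module_kernel_star[OF module_map_left[OF assms(3)]])
  then show ?thesis using assms by (simp add: left_functional_def module_kernel_def ip_zero)
qed

lemma right_kernelI: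
  assumes "\<And>c d \<xi> h. h \<in> V \<Longrightarrow> \<xi> \<in> V \<Longrightarrow> right_functional c d \<xi> h b = 0"
  shows "b \<in> right_kernel"
proof -
  have "right_map c \<xi> (b * d) = 0" if "\<xi> \<in> V" for c \<xi> d
    using assms[OF module_map_rules(1)[OF module_map_right[OF that]] that, of c d c "b * d"]
      ip_self_eq_0[OF module_map_rules(1)[OF module_map_right[OF that]]]
    by (simp add: right_functional_def)
  then show ?thesis by (auto simp: right_kernel_def module_kernel_def)
qed

lemma right_kernelD:
  assumes "b \<in> right_kernel" "h \<in> V" "\<xi> \<in> V"
  shows "right_functional c d \<xi> h b = 0"
proof -
  have "b \<in> module_kernel (right_map c \<xi>)" using assms by (auto simp: right_kernel_def)
  then show ?thesis using assms by (simp add: right_functional_def module_kernel_def ip_zero)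
qed

text \<open>The families \<open>v\<^sub>i = \<pi>(c \<otimes> b\<^sub>i d) \<xi>\<close> and \<open>w\<^sub>i = \<pi>(a\<^sub>i\<^sup>* c' \<otimes> d') \<eta>\<close> of a row-column series
  of \<open>x\<close> encode both the matrix coefficients of \<open>x\<close> and its values under product functionals.
  Their square sums are finite by \<open>module_map_square_sum\<close>.\<close>

lemma trace_identities:
  assumes V: "\<xi> \<in> V" "\<eta> \<in> V"
  obtains v w :: "nat \<times> nat \<times> nat \<Rightarrow> 'v"
  where "v \<in> l2_carrier" "w \<in> l2_carrier"
    "l2_ip v w = ip (\<pi> (emb (star c' \<otimes>\<^sub>a star d') * x * emb (c \<otimes>\<^sub>a d)) \<xi>) \<eta>"
    "\<And>s r. l2_ip (rep_l2 (emb (s \<otimes>\<^sub>a r)) v) w =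
      ip (\<pi> (emb (star c' \<otimes>\<^sub>a (star d' * r)) * x * emb ((s * c) \<otimes>\<^sub>a d)) \<xi>) \<eta>"
    "\<And>h k f. h \<in> V \<Longrightarrow> k \<in> V \<Longrightarrow>
      product_functional emb (left_functional k c' d' \<eta>) (right_functional c d \<xi> h) f \<Longrightarrow>
      (\<lambda>i. ip (v i) h * ip k (w i)) summable_on UNIV \<and> (\<Sum>\<^sub>\<infinity>i. ip (v i) h * ip k (w i)) = f x"
proof -
  obtain F :: "nat \<Rightarrow> (nat \<times> nat \<times> nat) set" and a :: "nat \<times> nat \<times> nat \<Rightarrow> 'a"
    and b :: "nat \<times> nat \<times> nat \<Rightarrow> 'b" and C
    where F: "\<And>n. finite (F n)" "\<And>n. F n \<subseteq> F (Suc n)"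
      and zero: "\<And>i. i \<notin> (\<Union>n. F n) \<Longrightarrow> a i = 0 \<and> b i = 0"
      and A: "\<And>G. finite G \<Longrightarrow> norm (\<Sum>i\<in>G. a i * star (a i)) \<le> C"
      and B: "\<And>G. finite G \<Longrightarrow> norm (\<Sum>i\<in>G. star (b i) * b i) \<le> C"
      and lim: "(\<lambda>n. \<Sum>i\<in>F n. emb (a i \<otimes>\<^sub>a b i)) \<longlonglongrightarrow> x"
    using row_column_series[of x] by blast
  have series: "infsum (\<lambda>i. g (emb (a i \<otimes>\<^sub>a b i))) UNIV = g x"
    if g: "bounded_linear g" and s: "(\<lambda>i. g (emb (a i \<otimes>\<^sub>a b i))) summable_on UNIV" for g :: "'d \<Rightarrow> complex"
  proof (rule LIMSEQ_unique)
    have g0: "g (emb (a i \<otimes>\<^sub>a b i)) = 0" if "i \<notin> (\<Union>n. F n)" for i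
      using zero[OF that] linear_0[OF bounded_linear.linear[OF g]] by (simp add: tensor_zero_left emb_zero)
    show "(\<lambda>n. \<Sum>i\<in>F n. g (emb (a i \<otimes>\<^sub>a b i))) \<longlonglongrightarrow> infsum (\<lambda>i. g (emb (a i \<otimes>\<^sub>a b i))) UNIV"
      by (rule exhausting_sums_tendsto) (use F g0 s in auto)
    show "(\<lambda>n. \<Sum>i\<in>F n. g (emb (a i \<otimes>\<^sub>a b i))) \<longlonglongrightarrow> g x"
      using bounded_linear.tendsto[OF g lim] by (simp add: linear_sum[OF bounded_linear.linear[OF g]])
  qed
  define v where "v i = right_map c \<xi> (b i * d)" for i
  define w where "w i = left_map d' \<eta> (star (a i) * c')" for i
  note mr = module_map_right[OF V(1), of c] and ml = module_map_left[OF V(2), of d']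
  have v: "v \<in> l2_carrier"
  proof (rule l2_memI[where C = "C * (nm (right_map c \<xi> d))\<^sup>2"])
    show "v i \<in> V" for i unfolding v_def by (rule module_map_rules(1)[OF mr])
    fix G :: "(nat \<times> nat \<times> nat) set" assume G: "finite G"
    have "(\<Sum>i\<in>G. (nm (v i))\<^sup>2) \<le> norm (\<Sum>i\<in>G. star (b i) * b i) * (nm (right_map c \<xi> d))\<^sup>2"
      unfolding v_def by (rule module_map_square_sum[OF mr G])
    also have "\<dots> \<le> C * (nm (right_map c \<xi> d))\<^sup>2" by (intro mult_right_mono B G) simp
    finally show "(\<Sum>i\<in>G. (nm (v i))\<^sup>2) \<le> C * (nm (right_map c \<xi> d))\<^sup>2" .
  qed
  have w: "w \<in> l2_carrier"
  proof (rule l2_memI[where C = "C * (nm (left_map d' \<eta> c'))\<^sup>2"])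
    show "w i \<in> V" for i unfolding w_def by (rule module_map_rules(1)[OF ml])
    fix G :: "(nat \<times> nat \<times> nat) set" assume G: "finite G"
    have "(\<Sum>i\<in>G. (nm (w i))\<^sup>2) \<le> norm (\<Sum>i\<in>G. star (star (a i)) * star (a i)) * (nm (left_map d' \<eta> c'))\<^sup>2"
      unfolding w_def by (rule module_map_square_sum[OF ml G])
    also have "\<dots> \<le> C * (nm (left_map d' \<eta> c'))\<^sup>2"
      unfolding star_star by (intro mult_right_mono A G) simp
    finally show "(\<Sum>i\<in>G. (nm (w i))\<^sup>2) \<le> C * (nm (left_map d' \<eta> c'))\<^sup>2" .
  qed
  have sandwich_bl: "bounded_linear (\<lambda>t. ip (\<pi> (Y * t * Z) \<xi>) \<eta>)" for Y Z
    using bounded_linear_compose[OF rep_functional_bounded[OF V]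
        bounded_linear_compose[OF bounded_linear_mult_left bounded_linear_mult_right], of Y Z]
    by (simp add: o_def)
  have 1: "ip (v i) (w i) = ip (\<pi> (emb (star c' \<otimes>\<^sub>a star d') * emb (a i \<otimes>\<^sub>a b i) * emb (c \<otimes>\<^sub>a d)) \<xi>) \<eta>" for i
    by (simp add: v_def w_def right_map_def left_map_def ip_emb V emb_mult star_simps mult.assoc)
  have 2: "ip (rep_l2 (emb (s \<otimes>\<^sub>a r)) v i) (w i) =
      ip (\<pi> (emb (star c' \<otimes>\<^sub>a (star d' * r)) * emb (a i \<otimes>\<^sub>a b i) * emb ((s * c) \<otimes>\<^sub>a d)) \<xi>) \<eta>" for s r i
    by (simp add: rep_l2_def v_def w_def right_map_def left_map_def rep_mult[symmetric] ip_emb V emb_mult star_simps mult.assoc)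
  show ?thesis
  proof (rule that[OF v w])
    show "l2_ip v w = ip (\<pi> (emb (star c' \<otimes>\<^sub>a star d') * x * emb (c \<otimes>\<^sub>a d)) \<xi>) \<eta>"
      using series[OF sandwich_bl] l2_ip_summable[OF v w] unfolding l2_ip_def 1 by blast
    show "l2_ip (rep_l2 (emb (s \<otimes>\<^sub>a r)) v) w =
      ip (\<pi> (emb (star c' \<otimes>\<^sub>a (star d' * r)) * x * emb ((s * c) \<otimes>\<^sub>a d)) \<xi>) \<eta>" for s r
      using series[OF sandwich_bl] l2_ip_summable[OF rep_l2_closed[OF v] w, of "emb (s \<otimes>\<^sub>a r)"]
      unfolding l2_ip_def 2 by blast
    fix h k f
    assume hk: "h \<in> V" "k \<in> V"
      and f: "product_functional emb (left_functional k c' d' \<eta>) (right_functional c d \<xi> h) f"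
    have fi: "f (emb (a i \<otimes>\<^sub>a b i)) = ip (v i) h * ip k (w i)" for i
      using f by (simp add: product_functional_def left_functional_def right_functional_def v_def w_def)
    have "(\<lambda>i. ip (v i) h * ip k (w i)) summable_on UNIV"
    proof (rule abs_summable_summable, rule Infinite_Sum.abs_summable_on_comparison_test')
      show "(\<lambda>i. (nm h * nm k) * ((nm (v i))\<^sup>2 + (nm (w i))\<^sup>2)) summable_on UNIV"
        by (intro summable_on_cmult_right summable_on_add l2_summable v w)
      fix i
      have "cmod (ip (v i) h * ip k (w i)) \<le> (nm (v i) * nm h) * (nm k * nm (w i))"
        unfolding norm_mult
        by (intro mult_mono CS l2_V v w hk mult_nonneg_nonneg nm_nonneg norm_ge_zero)
      also have "\<dots> = (nm h * nm k) * (nm (v i) * nm (w i))" by simp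
      also have "\<dots> \<le> (nm h * nm k) * ((nm (v i))\<^sup>2 + (nm (w i))\<^sup>2)"
      proof (rule mult_left_mono)
        have "0 \<le> nm (v i) * nm (w i)" by (intro mult_nonneg_nonneg nm_nonneg l2_V v w)
        then show "nm (v i) * nm (w i) \<le> (nm (v i))\<^sup>2 + (nm (w i))\<^sup>2"
          using sum_squares_bound[of "nm (v i)" "nm (w i)"] by linarith
      qed (intro mult_nonneg_nonneg nm_nonneg hk)
      finally show "cmod (ip (v i) h * ip k (w i)) \<le> (nm h * nm k) * ((nm (v i))\<^sup>2 + (nm (w i))\<^sup>2)" .
    qed
    then show "(\<lambda>i. ip (v i) h * ip k (w i)) summable_on UNIV \<and> (\<Sum>\<^sub>\<infinity>i. ip (v i) h * ip k (w i)) = f x"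
      using series[of f] f unfolding fi product_functional_def bounded_clinear_functional_def by blast
  qed
qed

text \<open>The matrix coefficients in \<open>trace_identities\<close> are zero, so \<open>rank_one_density\<close> applies.\<close>

lemma product_functional_zero_on_kernel:
  assumes x: "x \<in> rep_kernel H \<pi>" and V: "\<xi> \<in> V" "\<eta> \<in> V" "h \<in> V" "k \<in> V"
    and f: "product_functional emb (left_functional k c' d' \<eta>) (right_functional c d \<xi> h) f"
  shows "f x = 0"
proof -
  obtain v w :: "nat \<times> nat \<times> nat \<Rightarrow> 'v" where vw: "v \<in> l2_carrier" "w \<in> l2_carrier"
    and 1: "l2_ip v w = ip (\<pi> (emb (star c' \<otimes>\<^sub>a star d') * x * emb (c \<otimes>\<^sub>a d)) \<xi>) \<eta>"
    and 2: "\<And>s r. l2_ip (rep_l2 (emb (s \<otimes>\<^sub>a r)) v) w =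
      ip (\<pi> (emb (star c' \<otimes>\<^sub>a (star d' * r)) * x * emb ((s * c) \<otimes>\<^sub>a d)) \<xi>) \<eta>"
    and 3: "\<And>h k f. h \<in> V \<Longrightarrow> k \<in> V \<Longrightarrow>
      product_functional emb (left_functional k c' d' \<eta>) (right_functional c d \<xi> h) f \<Longrightarrow>
      (\<lambda>i. ip (v i) h * ip k (w i)) summable_on UNIV \<and> (\<Sum>\<^sub>\<infinity>i. ip (v i) h * ip k (w i)) = f x"
    using trace_identities[OF V(1,2), of c' d' x c d] by blast
  have 0: "\<pi> (Y * x * Z) \<xi> = 0" for Y Z
    using x V(1) by (simp add: rep_mult rep_V rep_kernel_iff rep_vector_zero)
  have "l2_ip v w = 0" by (simp add: 1 0 ip_zero V)
  moreover have "l2_ip (rep_l2 t v) w = 0" for t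
    using bounded_linear_eq_on_tensors[OF rep_l2_functional_bounded[OF vw] bounded_linear_zero, of t]
    by (simp add: 2 0 ip_zero V)
  ultimately have "(\<Sum>\<^sub>\<infinity>i. ip (v i) h * ip k (w i)) = 0" by (intro rank_one_density vw V)
  then show ?thesis using 3[OF V(3,4) f] by simp
qed

text \<open>If all these coefficients vanish, then \<open>t x s\<close> acts as zero for all \<open>s\<close> and \<open>t\<close> by density
  of the elementary tensors, and \<open>\<pi>\<close> is nondegenerate.\<close>

lemma nonzero_matrix_coefficient:
  assumes x: "x \<notin> rep_kernel H \<pi>"
  obtains c d c' d' \<xi> \<eta> where "\<xi> \<in> V" "\<eta> \<in> V"
    "ip (\<pi> (emb (star c' \<otimes>\<^sub>a star d') * x * emb (c \<otimes>\<^sub>a d)) \<xi>) \<eta> \<noteq> 0"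
proof (rule ccontr)
  assume "\<not> thesis"
  then have star0: "\<forall>\<xi>\<in>V. \<forall>\<eta>\<in>V. \<forall>c' d' c d. ip (\<pi> (emb (star c' \<otimes>\<^sub>a star d') * x * emb (c \<otimes>\<^sub>a d)) \<xi>) \<eta> = 0"
    using that by blast
  have 0: "ip (\<pi> (emb (c' \<otimes>\<^sub>a d') * x * emb (c \<otimes>\<^sub>a d)) \<xi>) \<eta> = 0" if "\<xi> \<in> V" "\<eta> \<in> V" for c d c' d' \<xi> \<eta>
    using star0[rule_format, OF that, of "star c'" "star d'" c d] by (simp add: star_star)
  have bl1: "bounded_linear (\<lambda>t. ip (\<pi> (t * Z) \<xi>) \<eta>)" and bl2: "bounded_linear (\<lambda>t. ip (\<pi> (Z * t) \<xi>) \<eta>)"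
    if "\<xi> \<in> V" "\<eta> \<in> V" for Z \<xi> \<eta>
    using bounded_linear_compose[OF rep_functional_bounded[OF that] bounded_linear_mult_left, of Z]
      bounded_linear_compose[OF rep_functional_bounded[OF that] bounded_linear_mult_right, of Z]
    by (simp_all add: o_def)
  have 1: "ip (\<pi> (t * (x * emb (c \<otimes>\<^sub>a d))) \<xi>) \<eta> = 0" if "\<xi> \<in> V" "\<eta> \<in> V" for t c d \<xi> \<eta>
    using bounded_linear_eq_on_tensors[OF bl1[OF that] bounded_linear_zero, of "x * emb (c \<otimes>\<^sub>a d)" t] 0[OF that]
    by (simp add: mult.assoc)
  have 2: "ip (\<pi> (t * x * s) \<xi>) \<eta> = 0" if "\<xi> \<in> V" "\<eta> \<in> V" for t s \<xi> \<eta>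
    using bounded_linear_eq_on_tensors[OF bl2[OF that] bounded_linear_zero, of "t * x" s] 1[OF that]
    by (simp add: mult.assoc)
  have 3: "\<pi> (x * s) \<xi> = 0" if "\<xi> \<in> V" for s \<xi>
  proof (rule nondegenerate)
    fix t
    have "ip (\<pi> t (\<pi> (x * s) \<xi>)) (\<pi> t (\<pi> (x * s) \<xi>)) = 0"
      using 2[OF that rep_V[OF rep_V[OF that]], of t s t "x * s"] that by (simp add: rep_mult rep_V mult.assoc)
    then show "\<pi> t (\<pi> (x * s) \<xi>) = 0" using that by (intro ip_self_eq_0 rep_V) auto
  qed (rule rep_V[OF that])
  have "\<pi> (star x) \<xi> = 0" if \<xi>: "\<xi> \<in> V" for \<xi>
  proof (rule nondegenerate)
    fix t
    show "\<pi> t (\<pi> (star x) \<xi>) = 0"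
    proof (rule V_eqI)
      fix u assume u: "u \<in> V"
      have "ip (\<pi> t (\<pi> (star x) \<xi>)) u = ip \<xi> (\<pi> (x * star t) u)"
        using \<xi> u by (simp add: rep_adjoint rep_V star_star rep_mult)
      then show "ip (\<pi> t (\<pi> (star x) \<xi>)) u = ip 0 u" using 3[OF u] \<xi> u by (simp add: ip_zero)
    qed (auto intro: rep_V \<xi> V_zero)
  qed (rule rep_V[OF \<xi>])
  then have "\<pi> x \<xi> = 0" if "\<xi> \<in> V" for \<xi>
    using rep_adjoint[OF that rep_V[OF that], of x x] that ip_self_eq_0[OF rep_V[OF that], of x]
    by (simp add: rep_V ip_zero)
  then show False using x by (simp add: rep_kernel_iff)
qed

text \<open>Start from a product of vector functionals that vanishes on the kernel but not at \<open>x\<close>, and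
  replace the factors by pure states in turn, using the slices \<open>R\<close> and \<open>L\<close>.\<close>

theorem separating_pure_states:
  assumes x: "x \<notin> rep_kernel H \<pi>"
  shows "\<exists>\<phi> \<psi> f. pure_state \<phi> \<and> pure_state \<psi> \<and> product_functional emb \<phi> \<psi> f \<and>
    (\<forall>y\<in>rep_kernel H \<pi>. f y = 0) \<and> f x \<noteq> 0"
proof -
  obtain c d c' d' \<xi> \<eta> where V: "\<xi> \<in> V" "\<eta> \<in> V"
    and ne: "ip (\<pi> (emb (star c' \<otimes>\<^sub>a star d') * x * emb (c \<otimes>\<^sub>a d)) \<xi>) \<eta> \<noteq> 0"
    using nonzero_matrix_coefficient[OF x] .
  have compose: "product_functional emb \<phi> \<psi> (\<lambda>t. \<phi> (R t))"
    if "bounded_clinear_functional \<phi>" "bounded_linear R" "\<And>c t. R (c *\<^sub>C t) = c *\<^sub>C R t"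
      "\<And>a b. R (emb (a \<otimes>\<^sub>a b)) = \<psi> b *\<^sub>C a" for \<phi> :: "'a \<Rightarrow> complex" and \<psi> and R
    unfolding product_functional_def bounded_clinear_functional_def
    using bounded_linear_compose[OF bounded_clinear_functionalD(1)[OF that(1)] that(2)] that
    by (simp add: bounded_clinear_functionalD(2)[OF that(1)] mult.commute o_def)
  \<comment> \<open>If the product functionals with \<open>h = k\<close> all vanished at \<open>x\<close>, so would the trace, which is
    the chosen matrix coefficient.\<close>
  have "\<exists>h\<in>V. \<forall>f. product_functional emb (left_functional h c' d' \<eta>) (right_functional c d \<xi> h) f \<longrightarrow> f x \<noteq> 0"
  proof (rule ccontr)
    assume "\<not> ?thesis"
    then have bad: "\<And>h. h \<in> V \<Longrightarrow> \<exists>f. product_functional emb (left_functional h c' d' \<eta>) (right_functional c d \<xi> h) f \<and> f x = 0"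
      by blast
    obtain v w :: "nat \<times> nat \<times> nat \<Rightarrow> 'v" where vw: "v \<in> l2_carrier" "w \<in> l2_carrier"
      and 1: "l2_ip v w = ip (\<pi> (emb (star c' \<otimes>\<^sub>a star d') * x * emb (c \<otimes>\<^sub>a d)) \<xi>) \<eta>"
      and "\<And>s r. l2_ip (rep_l2 (emb (s \<otimes>\<^sub>a r)) v) w =
        ip (\<pi> (emb (star c' \<otimes>\<^sub>a (star d' * r)) * x * emb ((s * c) \<otimes>\<^sub>a d)) \<xi>) \<eta>"
      and 3: "\<And>h k f. h \<in> V \<Longrightarrow> k \<in> V \<Longrightarrow>
        product_functional emb (left_functional k c' d' \<eta>) (right_functional c d \<xi> h) f \<Longrightarrow>
        (\<lambda>i. ip (v i) h * ip k (w i)) summable_on UNIV \<and> (\<Sum>\<^sub>\<infinity>i. ip (v i) h * ip k (w i)) = f x"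
      using trace_identities[OF V, of c' d' x c d] by blast
    have "(\<lambda>i. ip (v i) h * ip h (w i)) summable_on UNIV \<and> (\<Sum>\<^sub>\<infinity>i. ip (v i) h * ip h (w i)) = 0"
      if h: "h \<in> V" for h
    proof -
      obtain f where f: "product_functional emb (left_functional h c' d' \<eta>) (right_functional c d \<xi> h) f" "f x = 0"
        using bad[OF h] by blast
      show ?thesis using 3[OF h h f(1)] unfolding f(2) .
    qed
    then have "l2_ip v w = 0" by (intro l2_trace_zero vw) auto
    then show False using ne 1 by simp
  qed
  then obtain h where h: "h \<in> V"
    and fx: "\<And>f. product_functional emb (left_functional h c' d' \<eta>) (right_functional c d \<xi> h) f \<Longrightarrow> f x \<noteq> 0"
    by blast
  let ?\<psi> = "right_functional c d \<xi> h"
  note \<psi> = right_functional_bounded[OF h V(1), of c d]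
  obtain R :: "'d \<Rightarrow> 'a" where R: "bounded_linear R" "\<And>c t. R (c *\<^sub>C t) = c *\<^sub>C R t"
    "\<And>a b. R (emb (a \<otimes>\<^sub>a b)) = ?\<psi> b *\<^sub>C a"
    using slice_maps(1)[OF \<psi>] by blast
  have prodR: "product_functional emb (left_functional k c1 d1 \<zeta>) ?\<psi> (\<lambda>t. left_functional k c1 d1 \<zeta> (R t))"
    if "k \<in> V" "\<zeta> \<in> V" for k c1 d1 \<zeta>
    by (rule compose[OF left_functional_bounded[OF that] R])
  have RK: "R y \<in> left_kernel" if y: "y \<in> rep_kernel H \<pi>" for y
    by (rule left_kernelI)
      (use product_functional_zero_on_kernel[OF y V(1) _ h _ prodR] in blast)
  have "R x \<notin> left_kernel"
    using fx[OF prodR[OF h V(2)]] left_kernelD[OF _ h V(2)] by blast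
  then obtain \<phi> where \<phi>: "pure_state \<phi>" "\<And>a. a \<in> left_kernel \<Longrightarrow> \<phi> a = 0" "\<phi> (R x) \<noteq> 0"
    using pure_state_kills_module_kernels[of "{left_map d \<xi> | d \<xi>. \<xi> \<in> V}" "R x"] module_map_left
    unfolding left_kernel_def by blast
  have \<phi>b: "bounded_clinear_functional \<phi>" using \<phi>(1) by (simp add: pure_state_def state_def)
  obtain L :: "'d \<Rightarrow> 'b" where L: "bounded_linear L" "\<And>c t. L (c *\<^sub>C t) = c *\<^sub>C L t"
    "\<And>a b. L (emb (a \<otimes>\<^sub>a b)) = \<phi> a *\<^sub>C b"
    using slice_maps(2)[OF \<psi> \<phi>b] by blast
  \<comment> \<open>Slicing in either order gives the value of the product functional.\<close>
  have swap: "right_functional c1 d1 \<zeta> k (L t) = \<phi> (R' t)"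
    if k: "k \<in> V" "\<zeta> \<in> V" and R': "bounded_linear R'" "\<And>a b. R' (emb (a \<otimes>\<^sub>a b)) = right_functional c1 d1 \<zeta> k b *\<^sub>C a"
    for k c1 d1 \<zeta> t and R' :: "'d \<Rightarrow> 'a"
  proof (rule bounded_linear_eq_on_tensors)
    note \<psi>' = right_functional_bounded[OF k, of c1 d1]
    show "bounded_linear (\<lambda>t. right_functional c1 d1 \<zeta> k (L t))"
      using bounded_linear_compose[OF bounded_clinear_functionalD(1)[OF \<psi>'] L(1)] by (simp add: o_def)
    show "bounded_linear (\<lambda>t. \<phi> (R' t))"
      using bounded_linear_compose[OF bounded_clinear_functionalD(1)[OF \<phi>b] R'(1)] by (simp add: o_def)
    show "right_functional c1 d1 \<zeta> k (L (emb (a \<otimes>\<^sub>a b))) = \<phi> (R' (emb (a \<otimes>\<^sub>a b)))" for a b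
      by (simp add: L(3) R'(2) bounded_clinear_functionalD(2)[OF \<psi>'] bounded_clinear_functionalD(2)[OF \<phi>b])
  qed
  have LK: "L y \<in> right_kernel" if y: "y \<in> rep_kernel H \<pi>" for y
  proof (rule right_kernelI)
    fix c1 d1 \<zeta> k assume k: "k \<in> V" "\<zeta> \<in> V"
    obtain R' :: "'d \<Rightarrow> 'a" where R': "bounded_linear R'" "\<And>c t. R' (c *\<^sub>C t) = c *\<^sub>C R' t"
      "\<And>a b. R' (emb (a \<otimes>\<^sub>a b)) = right_functional c1 d1 \<zeta> k b *\<^sub>C a"
      using slice_maps(1)[OF right_functional_bounded[OF k, of c1 d1]] by blast
    have "R' y \<in> left_kernel"
    proof (rule left_kernelI)
      fix k' c2 d2 \<eta>' assume k': "k' \<in> V" "\<eta>' \<in> V"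
      show "left_functional k' c2 d2 \<eta>' (R' y) = 0"
        by (rule product_functional_zero_on_kernel[OF y k(2) k'(2) k(1) k'(1) compose[OF left_functional_bounded[OF k'] R']])
    qed
    then show "right_functional c1 d1 \<zeta> k (L y) = 0"
      using swap[OF k R'(1,3)] \<phi>(2) by simp
  qed
  have "?\<psi> (L x) = \<phi> (R x)" by (rule swap[OF h V(1) R(1,3)])
  then have "L x \<notin> right_kernel" using \<phi>(3) right_kernelD[OF _ h V(1)] by fastforce
  then obtain \<psi>' where \<psi>': "pure_state \<psi>'" "\<And>b. b \<in> right_kernel \<Longrightarrow> \<psi>' b = 0" "\<psi>' (L x) \<noteq> 0"
    using pure_state_kills_module_kernels[of "{right_map c \<xi> | c \<xi>. \<xi> \<in> V}" "L x"] module_map_right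
    unfolding right_kernel_def by blast
  have \<psi>'b: "bounded_clinear_functional \<psi>'" using \<psi>'(1) by (simp add: pure_state_def state_def)
  have "product_functional emb \<phi> \<psi>' (\<lambda>t. \<psi>' (L t))"
    unfolding product_functional_def bounded_clinear_functional_def
    using bounded_linear_compose[OF bounded_clinear_functionalD(1)[OF \<psi>'b] L(1)]
    by (simp add: L bounded_clinear_functionalD(2)[OF \<psi>'b] o_def)
  then show ?thesis using \<phi>(1) \<psi>' LK by blast
qed

end

section \<open>Spectral synthesis implies property (F)\<close>

text \<open>The linear embedding \<open>v \<mapsto> \<langle>v, _\<rangle>\<close> into the functions on the Hilbert space carries its
  operations to pointwise ones.\<close>

lemma vector_representation_exists:
  fixes H :: "'h pre_hilbert" and \<pi> :: "'d::banach_star_algebra \<Rightarrow> 'h \<Rightarrow> 'h"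
  assumes irr: "irreducible_star_representation H \<pi>"
  obtains H' :: "('h \<Rightarrow> complex) pre_hilbert" and \<pi>' where
    "irreducible_vector_representation H' \<pi>'" "rep_kernel H' \<pi>' = rep_kernel H \<pi>"
proof -
  have rep: "star_representation H \<pi>" using irr by (simp add: irreducible_star_representation_def)
  interpret star_representation H \<pi> by fact
  note closed = zero_closed add_closed scale_closed
  define g where "g v = (\<lambda>w. if w \<in> hcarrier H then hinner H v w else 0)" for v
  have inj: "inj_on g (hcarrier H)"
  proof (rule inj_onI)
    fix v w assume vw: "v \<in> hcarrier H" "w \<in> hcarrier H" "g v = g w"
    define u where "u = hadd H v (hscale H (- 1) w)"
    have u: "u \<in> hcarrier H" using vw by (simp add: u_def closed)
    have "hinner H v u = hinner H w u" using fun_cong[OF vw(3), of u] u by (simp add: g_def)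
    then have "hinner H u u = 0"
      by (subst (1) u_def) (use vw u in \<open>simp add: inner_add_left inner_scale_left closed\<close>)
    then have "u = hzero H" using inner_pos[OF u] by auto
    then have "hadd H (hadd H v (hscale H (- 1) w)) w = w"
      using vw add_commute[OF zero_closed] add_zero by (simp add: u_def)
    then show "v = w"
      using vw add_assoc[of v "hscale H (- 1) w" w] add_commute[of "hscale H (- 1) w" w]
      by (simp add: closed add_inverse add_zero)
  qed
  let ?H = "transport_hilbert g H" and ?\<pi> = "transport_rep g H \<pi>"
  have irr': "irreducible_star_representation ?H ?\<pi>" by (rule irreducible_transport[OF inj irr])
  then interpret T: star_representation ?H ?\<pi> by (simp add: irreducible_star_representation_def)
  have "irreducible_vector_representation ?H ?\<pi>"
  proof (unfold_locales, goal_cases)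
    case (1 v w)
    then show ?case
      by (auto simp: transport_simps[OF inj]) (auto simp: g_def fun_eq_iff inner_add_left)
  next
    case (2 v c)
    then show ?case
      by (auto simp: transport_simps[OF inj]) (auto simp: g_def fun_eq_iff inner_scale_left scaleC_fun_def scaleC_complex_def)
  next
    case 3
    show ?case by (auto simp: transport_simps[OF inj] g_def fun_eq_iff inner_zero_left)
  next
    case 4
    show ?case by (rule irr')
  qed
  then show ?thesis using that rep_kernel_transport[OF inj rep] by blast
qed

lemma prim_star_separation:
  fixes emb :: "('a::cstar_algebra, 'b::cstar_algebra) alg_tensor \<Rightarrow> 'd::banach_star_algebra"
  assumes emb: "op_proj_tensor_product emb" and P: "P \<in> prim_star" and x: "x \<notin> P"
  shows "\<exists>\<phi> \<psi> f. pure_state \<phi> \<and> pure_state \<psi> \<and> product_functional emb \<phi> \<psi> f \<and> (\<forall>y\<in>P. f y = 0) \<and> f x \<noteq> 0"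
proof -
  obtain H :: "('d \<Rightarrow> complex) pre_hilbert" and \<pi> where irr: "irreducible_star_representation H \<pi>"
    and P: "P = rep_kernel H \<pi>"
    using P by (auto simp: prim_star_def)
  obtain H' :: "(('d \<Rightarrow> complex) \<Rightarrow> complex) pre_hilbert" and \<pi>' where
    irr': "irreducible_vector_representation H' \<pi>'" and ker: "rep_kernel H' \<pi>' = rep_kernel H \<pi>"
    using vector_representation_exists[OF irr] .
  interpret op_proj_tensor_product emb by fact
  interpret irreducible_vector_representation H' \<pi>' by fact
  interpret tensor_representation emb H' \<pi>' by unfold_locales
  show ?thesis using separating_pure_states[of x] x unfolding P ker by blast
qed

text \<open>The hull of \<open>I\<close> is closed and therefore spectral, and \<open>I\<close> is a closed ideal with this
  hull.\<close>

lemma closed_ideal_eq_hull_kernel: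
  fixes I :: "'d::banach_star_algebra set"
  assumes syn: "spectral_synthesis TYPE('d)" and I: "closed_ideal I"
  shows "I = \<Inter>(prim_hull I)"
proof -
  have "hk_closed (prim_hull I)"
    by (auto simp: hk_closed_def prim_hull_def hk_kernel_def)
  then have "spectral_set (prim_hull I)" using syn by (simp add: spectral_synthesis_def)
  then have "I \<in> {hk_kernel (prim_hull I)}"
    using I unfolding spectral_set_def by blast
  then show ?thesis by (simp add: hk_kernel_def)
qed

theorem theorem4p3:
  fixes emb :: "('a::cstar_algebra, 'b::cstar_algebra) alg_tensor \<Rightarrow> 'd::banach_star_algebra"
  assumes "op_proj_tensor_product emb"
    and "spectral_synthesis TYPE('d)"
  shows "property_F emb"
  unfolding property_F_def
proof (intro allI impI)
  fix I J :: "'d set"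
  assume *: "closed_ideal I \<and> closed_ideal J \<and> I \<noteq> J"
  have separate: "\<exists>\<phi> \<psi> f. pure_state \<phi> \<and> pure_state \<psi> \<and> product_functional emb \<phi> \<psi> f \<and>
      (\<forall>y\<in>I. f y = 0) \<and> \<not> (\<forall>y\<in>J. f y = 0)" if ideal: "closed_ideal I" and sub: "\<not> J \<subseteq> I" for I J :: "'d set"
  proof -
    obtain x where x: "x \<in> J" "x \<notin> I" using sub by blast
    then obtain P where P: "P \<in> prim_star" "I \<subseteq> P" "x \<notin> P"
      using closed_ideal_eq_hull_kernel[OF assms(2) ideal] by (auto simp: prim_hull_def)
    show ?thesis using prim_star_separation[OF assms(1) P(1,3)] P(2) x(1) by blast
  qed
  have "\<not> J \<subseteq> I \<or> \<not> I \<subseteq> J" using * by blast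
  then show "\<exists>\<phi> \<psi> f. pure_state \<phi> \<and> pure_state \<psi> \<and> product_functional emb \<phi> \<psi> f \<and>
           ((\<forall>x\<in>I. f x = 0) \<and> \<not> (\<forall>x\<in>J. f x = 0) \<or>
            \<not> (\<forall>x\<in>I. f x = 0) \<and> (\<forall>x\<in>J. f x = 0))"
    using separate[of I J] separate[of J I] * by blast
qed

end
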